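(* Let $r,n\in\mathbb{Z}_{>0}$. Let $t_a\in\mathbb{C}^*$, $n_a\in\mathbb{Z}$ ($a=1,\ldots,2n+4$), $\epsilon\in\{0,1\}$, and $p,q\in\mathbb{C}$ satisfy $|p|,|q|,|t_a|<1$ and the balancing condition $$\prod_{a=1}^{2n+4}t_a=pq,\qquad \sum_{a=1}^{2n+4}n_a+(n+2)\epsilon=0 .$$ Denote $$\kappa_n^{(r)}=\frac{(p^r;p^r)_\infty^n(q^r;q^r)_\infty^n}{(4\pi \mathrm{i})^n\,n!}$$ and $$\Delta_{I,\epsilon}(z_j,m_j;t_a,n_a)=\prod_{1\le j<k\le n}\frac{1}{\Gamma^{(r)}\big(z_j^{\pm1}z_k^{\pm1},\pm(m_j+\tfrac{\epsilon}{2})\pm(m_k+\tfrac{\epsilon}{2})\big)}\prod_{j=1}^n\frac{\prod_{a=1}^{2n+4}\Gamma^{(r)}(t_az_j,n_a+m_j+\epsilon)\,\Gamma^{(r)}(t_az_j^{-1},n_a-m_j)}{\Gamma^{(r)}(z_j^{\pm2},\pm(2m_j+\epsilon))}.$$ Then $$\kappa_n^{(r)}\sum_{m_1,\ldots,m_n=0}^{r-1}\int_{\mathbb{T}^n}\Delta_{I,\epsilon}(z_j,m_j;t_a,n_a)\prod_{j=1}^n\frac{dz_j}{z_j}=\prod_{1\le a<b\le 2n+4}\Gamma^{(r)}(t_at_b,n_a+n_b+\epsilon),$$ where $\mathbb{T}$ is the positively oriented unit circle.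
   Context: Notation: $(z;p)_\infty=\prod_{j\ge0}(1-zp^j)$ for $|p|<1$. The elliptic gamma function is $\Gamma(z;p,q)=\prod_{j,k=0}^\infty\frac{1-z^{-1}p^{j+1}q^{k+1}}{1-zp^jq^k}$ for $|p|,|q|<1$, $z\in\mathbb{C}^*$. For $r\in\mathbb{Z}_{>0}$, $m\in\mathbb{Z}$, nonzero $p,q$ with $|p|,|q|<1$, the rarefied elliptic gamma function is the meromorphic function of $z\in\mathbb{C}^*$ $$\Gamma^{(r)}(z,m)=\Gamma^{(r)}(z,m;p,q)=(-z)^{\frac{m(m-1)}{2}}p^{\frac{m(m-1)(m-2)}{6}}q^{-\frac{m(m^2-1)}{6}}\;\Gamma(zp^m;p^r,pq)\,\Gamma(zq^{r-m};q^r,pq)$$ (the elementary prefactor equals $\left(-\frac{z}{\sqrt{pq}}\right)^{m(m-1)/2}\left(\frac pq\right)^{m(m-1)(2m-1)/12}$; all exponents written above are integers). Products and quotients of these functions are understood as meromorphic functions. Sign conventions: $\Gamma^{(r)}(z^{\pm2},\pm M)=\Gamma^{(r)}(z^2,M)\Gamma^{(r)}(z^{-2},-M)$, and $\Gamma^{(r)}(z^{\pm1}w^{\pm1},\pm a\pm b)$ is the product of the four factors $\Gamma^{(r)}(z^{\sigma}w^{\sigma'},\sigma a+\sigma' b)$ over $\sigma,\sigma'\in\{+1,-1\}$ (signs of the exponents and of the discrete arguments are matched). For $a=m_j+\epsilon/2$, $b=m_k+\epsilon/2$ the discrete arguments $\sigma a+\sigma'b$ are integers. *)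

theory Defs
  imports "HOL-Complex_Analysis.Complex_Analysis"
begin

definition qpoch_inf :: "complex \<Rightarrow> complex \<Rightarrow> complex" where
  "qpoch_inf z p = prodinf (\<lambda>j. 1 - z * p ^ j)"

text \<open>For \<open>\<bar>p\<bar>, \<bar>q\<bar> < 1\<close> the double product converges absolutely, so it may be iterated.
  At the poles a denominator vanishes and the value is 0.\<close>

definition ell_gamma :: "complex \<Rightarrow> complex \<Rightarrow> complex \<Rightarrow> complex" where
  "ell_gamma z p q =
     prodinf (\<lambda>j. prodinf (\<lambda>k.
       (1 - inverse z * p ^ (j + 1) * q ^ (k + 1)) / (1 - z * p ^ j * q ^ k)))"

text \<open>The divisions in the exponents are exact. Poles of one elliptic gamma factor may cancel
  against zeros of the other, even inside the unit disc; a pointwise product would be 0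
  there. Hence the product is taken as a meromorphic function of \<open>z\<close>: \<^const>\<open>remove_sings\<close>
  inserts the limit at removable singularities (and 0 at poles).\<close>

definition rar_gamma :: "nat \<Rightarrow> complex \<Rightarrow> complex \<Rightarrow> complex \<Rightarrow> int \<Rightarrow> complex" where
  "rar_gamma r p q z m =
     remove_sings (\<lambda>w.
       (- w) powi (m * (m - 1) div 2)
       * p powi (m * (m - 1) * (m - 2) div 6)
       * q powi (- (m * (m\<^sup>2 - 1) div 6))
       * ell_gamma (w * p powi m) (p ^ r) (p * q)
       * ell_gamma (w * q powi (int r - m)) (q ^ r) (p * q)) z"

text \<open>\<open>rar_gamma_pm2 r p q z M\<close> is \<open>\<Gamma>(z\<^sup>\<plusminus>\<^sup>2, \<plusminus>M)\<close>.\<close>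

definition rar_gamma_pm2 :: "nat \<Rightarrow> complex \<Rightarrow> complex \<Rightarrow> complex \<Rightarrow> int \<Rightarrow> complex" where
  "rar_gamma_pm2 r p q z M =
     (\<Prod>\<sigma>\<in>{1, -1::int}. rar_gamma r p q (z powi (2 * \<sigma>)) (\<sigma> * M))"

text \<open>\<open>rar_gamma_pm4 r p q z w A B\<close> is \<open>\<Gamma>(z\<^sup>\<plusminus>\<^sup>1 w\<^sup>\<plusminus>\<^sup>1, \<plusminus>A/2 \<plusminus> B/2)\<close> for integers
  \<open>A\<close>, \<open>B\<close> of equal parity, so that the halving is exact.\<close>

definition rar_gamma_pm4 ::
  "nat \<Rightarrow> complex \<Rightarrow> complex \<Rightarrow> complex \<Rightarrow> complex \<Rightarrow> int \<Rightarrow> int \<Rightarrow> complex" where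
  "rar_gamma_pm4 r p q z w A B =
     (\<Prod>\<sigma>\<in>{1, -1::int}. \<Prod>\<tau>\<in>{1, -1::int}.
        rar_gamma r p q (z powi \<sigma> * w powi \<tau>) ((\<sigma> * A + \<tau> * B) div 2))"

definition kappa :: "nat \<Rightarrow> nat \<Rightarrow> complex \<Rightarrow> complex \<Rightarrow> complex" where
  "kappa r n p q =
     qpoch_inf (p ^ r) (p ^ r) ^ n * qpoch_inf (q ^ r) (q ^ r) ^ n
     / ((4 * of_real pi * \<i>) ^ n * fact n)"

text \<open>This product of functions of \<open>z\<close> is formed pointwise. It agrees with the product of
  meromorphic functions off the zero and pole divisors of the factors, hence almost everywhere
  on the torus, so the integrals below are the same.\<close>

definition Delta_I ::
  "nat \<Rightarrow> nat \<Rightarrow> complex \<Rightarrow> complex \<Rightarrow> int \<Rightarrow> (nat \<Rightarrow> complex) \<Rightarrow> (nat \<Rightarrow> int)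
    \<Rightarrow> (nat \<Rightarrow> complex) \<Rightarrow> (nat \<Rightarrow> int) \<Rightarrow> complex" where
  "Delta_I r n p q \<epsilon> t \<nu> z m =
     (\<Prod>j\<in>{1..n}. \<Prod>k\<in>{j<..n}.
        1 / rar_gamma_pm4 r p q (z j) (z k) (2 * m j + \<epsilon>) (2 * m k + \<epsilon>))
     * (\<Prod>j\<in>{1..n}.
        (\<Prod>a\<in>{1..2*n+4}.
           rar_gamma r p q (t a * z j) (\<nu> a + m j + \<epsilon>)
           * rar_gamma r p q (t a * inverse (z j)) (\<nu> a - m j))
        / rar_gamma_pm2 r p q (z j) (2 * m j + \<epsilon>))"

text \<open>The integral of \<open>f(z\<^sub>1,\<dots>,z\<^sub>n) dz\<^sub>1 \<cdots> dz\<^sub>n\<close> over the \<open>n\<close>-fold product of the positively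
  oriented unit circle, each circle parametrised by \<open>circlepath 0 1\<close> on \<open>[0,1]\<close>
  (the \<open>n\<close>-dimensional analogue of \<^const>\<open>contour_integral\<close>).\<close>

definition torus_integral :: "nat \<Rightarrow> ((nat \<Rightarrow> complex) \<Rightarrow> complex) \<Rightarrow> complex" where
  "torus_integral n f =
     (LINT x:({1..n} \<rightarrow>\<^sub>E {0..1})|(\<Pi>\<^sub>M j\<in>{1..n}. lborel).
        f (\<lambda>j. circlepath 0 1 (x j))
        * (\<Prod>j\<in>{1..n}. vector_derivative (circlepath 0 1) (at (x j))))"

end

theory Submission
  imports Defs "Jordan_Normal_Form.Determinant"
begin

text \<open>By Andreief's identity the integral is a determinant of one-dimensional pairings between even theta
  functions of nomes \<open>p\<^sup>r\<close> and \<open>q\<^sup>r\<close>. A one-variable telescoping identity for the integrand gives a linear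
  relation between the rows of this determinant, and hence the invariance of the quotient of the two sides
  under \<open>(t\<^sub>i, n\<^sub>i; t\<^sub>j, n\<^sub>j) \<mapsto> (q t\<^sub>i, n\<^sub>i + 1; t\<^sub>j/q, n\<^sub>j - 1)\<close>. The quotient is holomorphic and periodic in the
  discrete variables, so by the maximum principle it is constant where a parameter is small, and by analytic
  continuation everywhere. Letting two parameters tend to \<open>-\<i>\<close> and \<open>\<i>\<close> pinches the contour; a Poisson kernel
  argument evaluates the limit of the determinant and reduces \<open>n\<close> variables to \<open>n - 1\<close>.\<close>

text \<open>The q-shift alone forces constancy. It moves a discrete variable along with its
  parameter, so the quotient of the two sides becomes a family indexed by the integers. Periodicity
  modulo \<open>r\<close> makes this family finite, and a finite dilation-invariant family on a wide
  annulus attains its maximum modulus. The annulus is wide enough only if the product of the two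
  moved parameters is below |q| in modulus; hence small parameters precede analytic continuation.
  The two shifted systems compared at each step come from one system whose parameters multiply to p
  instead of pq. In a basis built from the theta variables of the two parameters, raising one of
  them or the other selects the last or the first N of the same N + 1 rows. The contour is pinched
  at -i and i because these points are not fixed by z -> 1/z, whereas at 1 and -1 the theta
  functions of the squared variable can vanish. In a basis where all elements but one vanish at the
  pinch point, the determinant splits into a divergent corner and a minor, which is the problem with
  one variable less.\<close>

text \<open>The only analytic input on infinite products: dilation products of an entire function
  with value 1 at the origin.\<close>

lemma dilation_bound:
 fixes g :: "complex => complex"
 assumes hol: "g holomorphic_on UNIV" and g0: "g 0=1"
 obtains C where "C \<ge> 0" "\<And>w. norm w\<le>R==>norm(g w-1)\<le>C * norm w"
proof -
 have "compact(deriv g ` cball 0 R)"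
  using hol by(intro compact_continuous_image holomorphic_on_imp_continuous_on
   holomorphic_on_subset[OF holomorphic_deriv[OF hol open_UNIV]]) auto
 then obtain C where C: "\<And>w. w\<in>cball 0 R==>norm(deriv g w)\<le>C"
  by(metis compact_imp_bounded bounded_iff imageI)
 have "norm(g w-1)\<le>max C 0 * norm w" if "norm w\<le>R" for w
 proof -
  have "norm(g w-g 0)\<le>max C 0 * norm(w-0)"
  proof(rule field_differentiable_bound[of "cball 0 R" g "deriv g"])
   show "(g has_field_derivative deriv g z)(at z within cball 0 R)" if "z\<in>cball 0 R" for z
    using hol by(meson UNIV_I has_field_derivative_at_within holomorphic_derivI open_UNIV)
   have "0\<le>R" using that norm_ge_zero order_trans by blast
   then show "0\<in>cball 0 R" by simp
  qed(use C that in \<open>auto simp: le_max_iff_disj\<close>)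
  then show ?thesis using g0 by simp
 qed
 then show ?thesis by(intro that[of "max C 0"]) auto
qed

context
 fixes g :: "complex => complex" and p :: complex
 assumes hol: "g holomorphic_on UNIV" and g0: "g 0=1" and p: "norm p<1"
begin

lemma dilation_uniform: "uniformly_convergent_on(cball 0 R)(%N z. \<Prod>n<N. g(z * p^n))"
proof(rule uniformly_convergent_on_prod')
 show "continuous_on(cball 0 R)(%z. g(z * p^n))" for n
  by(intro continuous_on_compose2[OF holomorphic_on_imp_continuous_on[OF hol]] continuous_intros) auto
 obtain C where C: "C \<ge> 0" "\<And>w. norm w\<le>R==>norm(g w-1)\<le>C * norm w"
  using dilation_bound[OF hol g0] by blast
 have bd: "norm(g(z * p^n)-1)\<le>C * R * norm p^n" if "z\<in>cball 0 R" for z n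
 proof -
  have "norm(z * p^n)\<le>R * norm p^n"
   using that by(auto simp: norm_mult norm_power intro!: mult_right_mono)
  moreover have "R \<ge> 0" using that norm_ge_zero[of z] by(auto simp del: norm_ge_zero)
  moreover have "R * norm p^n\<le>R * 1" using p \<open>R \<ge> 0\<close> by(intro mult_left_mono power_le_one) auto
  ultimately have "norm(g(z * p^n)-1)\<le>C * norm(z * p^n)"
   by(intro C) auto
  also have "\<dots>\<le>C *(R * norm p^n)" by(intro mult_left_mono)(use C \<open>norm(z * p^n)\<le>R * norm p^n\<close> in auto)
  finally show ?thesis by(simp add: mult_ac)
 qed
 show "uniformly_convergent_on(cball 0 R)(%N x. \<Sum>n<N. norm(g(x * p^n)-1))"
  by(rule Weierstrass_m_test'[where M = "%n. C * R * norm p^n"])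
    (use bd p in \<open>auto intro!: summable_mult summable_geometric\<close>)
qed auto

lemma dilation_convergent: "convergent_prod(%j. g(z * p^j))"
proof -
 obtain C where C: "C \<ge> 0" "\<And>w. norm w\<le>norm z==>norm(g w-1)\<le>C * norm w"
  using dilation_bound[OF hol g0] by blast
 have "norm(g(z * p^n)-1)\<le>C * norm z * norm p^n" for n
 proof -
  have "norm z * norm p^n\<le>norm z * 1" using p by(intro mult_left_mono power_le_one) auto
  then show ?thesis using C(2)[of "z * p^n"] by(simp add: norm_mult norm_power mult_ac)
 qed
 then have bd: "norm(norm(g(z * p^n)-1))\<le>C * norm z * norm p^n" for n by simp
 have "summable(%n. norm(g(z * p^n)-1))"
  by(rule summable_comparison_test'[of "%n. C * norm z * norm p^n" 0])(use p bd in \<open>auto intro!: summable_mult summable_geometric\<close>)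
 then show ?thesis
  by(intro abs_convergent_prod_imp_convergent_prod)
    (auto simp: abs_convergent_prod_conv_summable)
qed

lemma dilation_holomorphic: "(%z. \<Prod>j. g(z * p^j)) holomorphic_on UNIV"
proof(rule holomorphic_uniform_sequence[where f = "%N z. \<Prod>n<N. g(z * p^n)"])
 show "(%z. \<Prod>n<N. g(z * p^n)) holomorphic_on UNIV" for N
  by(intro holomorphic_on_prod holomorphic_on_compose_gen[OF _ hol, unfolded o_def] holomorphic_intros) auto
 show "\<exists>d>0. cball x d \<subseteq> UNIV \<and>
   uniform_limit(cball x d)(%N z. \<Prod>n<N. g(z * p^n))(%z. \<Prod>j. g(z * p^j)) sequentially" for x
 proof(intro exI conjI)
  let ?R = "norm x+1"
  have "uniform_limit(cball 0 ?R)(%N z. \<Prod>n<N. g(z * p^n))(%z. lim(%N. \<Prod>n<N. g(z * p^n))) sequentially"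
   using dilation_uniform[of ?R] uniformly_convergent_uniform_limit_iff by blast
  moreover have "lim(%N. \<Prod>n<N. g(z * p^n))=(\<Prod>j. g(z * p^j))" for z
   using dilation_convergent[of z] by(intro limI)(use convergent_prod_LIMSEQ LIMSEQ_lessThan_iff_atMost in metis)
  ultimately have "uniform_limit(cball 0 ?R)(%N z. \<Prod>n<N. g(z * p^n))(%z. \<Prod>j. g(z * p^j)) sequentially"
   by simp
  then show "uniform_limit(cball x 1)(%N z. \<Prod>n<N. g(z * p^n))(%z. \<Prod>j. g(z * p^j)) sequentially"
  proof(rule uniform_limit_on_subset)
   show "cball x 1 \<subseteq> cball 0 ?R" 
    by(auto simp: dist_norm)(smt(verit) norm_minus_commute norm_triangle_ineq2)
  qed
 qed auto
qed auto

lemma dilation_eq_0_iff: "(\<Prod>j. g(z * p^j))=0 \<longleftrightarrow> (\<exists>j. g(z * p^j)=0)"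
proof
 show "\<exists>j. g(z * p^j)=0" if "(\<Prod>j. g(z * p^j))=0"
  using prodinf_nonzero[OF dilation_convergent[of z]] that by blast
 assume "\<exists>j. g(z * p^j)=0"
 then obtain j where "g(z * p^j)=0" ..
 then show "(\<Prod>j. g(z * p^j))=0"
  using has_prod_eq_0_iff[OF convergent_prod_has_prod[OF dilation_convergent[of z]]] by auto
qed

lemma dilation_split: "(\<Prod>j. g(z * p^j))=g z *(\<Prod>j. g(z * p * p^j))"
 using has_prod_unique[OF has_prod_ignore_initial_segment'[OF dilation_convergent[of z], of 1]]
 by(simp add: mult_ac)

end

section \<open>Single and double q-products, and the elliptic gamma function as their
  quotient\<close>

lemma holomorphic_linear_factor: "(%z::complex. 1-z) holomorphic_on UNIV"
 by(intro holomorphic_intros)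

lemma qpoch_inf_altdef: "qpoch_inf z p=(\<Prod>j. (%w. 1-w)(z * p^j))"
 by(simp add: qpoch_inf_def)

lemma qpoch_inf_holomorphic: "norm p<1==>(%z. qpoch_inf z p) holomorphic_on UNIV"
 using dilation_holomorphic[OF holomorphic_linear_factor] by(simp add: qpoch_inf_def)

lemma qpoch_inf_split: "norm p<1==>qpoch_inf z p=(1-z)* qpoch_inf(z * p) p"
 unfolding qpoch_inf_def by(rule dilation_split[OF holomorphic_linear_factor]) simp_all

lemma qpoch_inf_eq_0_iff: "norm p<1==>qpoch_inf z p=0 \<longleftrightarrow> (\<exists>j. z * p^j=1)"
 using dilation_eq_0_iff[OF holomorphic_linear_factor] by(simp add: qpoch_inf_def)

lemma qpoch_inf_0 [simp]: "qpoch_inf 0 p=1"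
 by(simp add: qpoch_inf_def)

text \<open>The product of all 1 - z p^j q^k, arranged as a dilation product of an entire function
  so that the lemmas above apply to it a second time.\<close>

definition dpoch :: "complex => complex => complex => complex" where
 "dpoch z p q=(\<Prod>j. qpoch_inf(z * p^j) q)"

context
 fixes p q :: complex
 assumes p: "norm p<1" and q: "norm q<1"
begin

lemma dpoch_holomorphic: "(%z. dpoch z p q) holomorphic_on UNIV"
 unfolding dpoch_def by(rule dilation_holomorphic[OF qpoch_inf_holomorphic[OF q] _ p]) simp

lemma dpoch_convergent: "convergent_prod(%j. qpoch_inf(z * p^j) q)"
 by(rule dilation_convergent[OF qpoch_inf_holomorphic[OF q] _ p]) simp

lemma dpoch_eq_0_iff: "dpoch z p q=0 \<longleftrightarrow> (\<exists>j k. z * p^j * q^k=1)"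
 unfolding dpoch_def
 by(subst dilation_eq_0_iff[OF qpoch_inf_holomorphic[OF q] _ p])(auto simp: qpoch_inf_eq_0_iff[OF q])

lemma dpoch_split_p: "dpoch z p q=qpoch_inf z q * dpoch(z * p) p q"
 unfolding dpoch_def by(rule dilation_split[OF qpoch_inf_holomorphic[OF q] _ p]) simp

lemma dpoch_split_q: "dpoch z p q=qpoch_inf z p * dpoch(z * q) p q"
proof -
 have "dpoch z p q=(\<Prod>j. (1-z * p^j)* qpoch_inf(z * q * p^j) q)"
  unfolding dpoch_def
 proof(rule prodinf_cong)
  show "qpoch_inf(z * p^j) q=(1-z * p^j)* qpoch_inf(z * q * p^j) q" for j
   using qpoch_inf_split[OF q, of "z * p^j"] by(simp only: mult_ac)
 qed
 also have "\<dots>=(\<Prod>j. 1-z * p^j)* dpoch(z * q) p q"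
  unfolding dpoch_def
  using prodinf_mult[OF dilation_convergent[OF holomorphic_linear_factor _ p, of z] dpoch_convergent[of "z * q"]]
  by simp
 finally show ?thesis by(simp add: qpoch_inf_def)
qed

lemma dpoch_0 [simp]: "dpoch 0 p q=1"
 by(simp add: dpoch_def)

lemma dpoch_nonzero: "norm z<1==>dpoch z p q~=0"
proof
 assume z: "norm z<1" and "dpoch z p q=0"
 then obtain j k where *: "z * p^j * q^k=1" by(auto simp: dpoch_eq_0_iff)
 have "norm(z * p^j * q^k)\<le>norm z * 1 * 1"
  unfolding norm_mult norm_power using p q by(intro mult_mono power_le_one mult_nonneg_nonneg) auto
 then show False using z * by simp
qed

text \<open>All functional equations below are derived from this quotient, whose numerator and
  denominator can be split and shifted separately.\<close>

lemma ell_gamma_eq: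
 assumes "dpoch z p q~=0"
 shows "ell_gamma z p q=dpoch(p * q/z) p q/dpoch z p q"
proof -
 have 1: "(\<Prod>k. (1-inverse z * p^(j+1)* q^(k+1))/(1-z * p^j * q^k))
   = qpoch_inf(p * q/z * p^j) q/qpoch_inf(z * p^j) q" for j
 proof -
  have "qpoch_inf(p * q/z * p^j) q/qpoch_inf(z * p^j) q
   = (\<Prod>k. (1-(p * q/z * p^j)* q^k)/(1-(z * p^j)* q^k))"
   unfolding qpoch_inf_def
   by(rule prodinf_divide; rule dilation_convergent[OF holomorphic_linear_factor _ q]) simp_all
  moreover have "inverse z * p^(j+1)* q^(k+1)=(p * q/z * p^j)* q^k" for k
   by(simp add: divide_inverse mult_ac)
  ultimately show ?thesis by simp
 qed
 show ?thesis
  unfolding ell_gamma_def 1 unfolding dpoch_def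
  by(rule prodinf_divide[symmetric])(rule dpoch_convergent)+
qed

end

section \<open>The theta function of nome p: quasi-periodicity and simple zeros\<close>

definition jtheta :: "complex => complex => complex" where
 "jtheta z p=qpoch_inf z p * qpoch_inf(p/z) p"

context
 fixes p :: complex
 assumes p: "norm p<1" and p0: "p~=0"
begin

lemma jtheta_holomorphic: "(%z. jtheta z p) holomorphic_on(- {0})"
 unfolding jtheta_def
 by(intro holomorphic_intros holomorphic_on_subset[OF qpoch_inf_holomorphic[OF p]]
   holomorphic_on_compose_gen[OF _ qpoch_inf_holomorphic[OF p], unfolded o_def]) auto

lemma jtheta_reflect: "z~=0==>jtheta(p/z) p=jtheta z p"
 by(simp add: jtheta_def p0)

lemma jtheta_inverse:
 assumes "z~=0"
 shows "jtheta(1/z) p = - jtheta z p/z"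
proof -
 have 1: "qpoch_inf(1/z) p=(1-1/z)* qpoch_inf(p/z) p"
  using qpoch_inf_split[OF p, of "1/z"] by simp
 have 2: "qpoch_inf z p=(1-z)* qpoch_inf(z * p) p"
  using qpoch_inf_split[OF p] .
 have "jtheta(1/z) p=(1-1/z)* qpoch_inf(p/z) p * qpoch_inf(z * p) p"
  by(simp add: jtheta_def 1 mult_ac)
 also have "\<dots> = - ((1-z)* qpoch_inf(z * p) p * qpoch_inf(p/z) p)/z"
  using assms by(simp add: divide_simps)(simp add: algebra_simps)
 also have "\<dots> = - jtheta z p/z" by(simp only: jtheta_def 2[symmetric])
 finally show ?thesis .
qed

lemma jtheta_mult_p: "z~=0==>jtheta(p * z) p = - jtheta z p/z"
 using jtheta_inverse[of z] jtheta_reflect[of "1/z"] by simp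

text \<open>Iteration of \<open>jtheta_mult_p\<close> in both directions; the powers of p add up to
  the triangular numbers, tracked by E.\<close>

lemma jtheta_powi_mult:
 assumes "z~=0"
 shows "jtheta(z * p powi k) p=(- 1/z) powi k * p powi(- (k *(k-1) div 2))* jtheta z p"
proof -
 define E where "E=(%k::int. k *(k-1) div 2)"
 have E: "E(k+1)=E k+k" for k
 proof -
  have "(k+1)*(k+1-1)=k *(k-1)+2 * k" by(simp add: algebra_simps)
  then show ?thesis unfolding E_def by simp
 qed
 have step: "jtheta(z * p powi(k+1)) p = - jtheta(z * p powi k) p/(z * p powi k)" for k
  using jtheta_mult_p[of "z * p powi k"] assms p0
  by(simp add: power_int_add mult_ac)
 have "jtheta(z * p powi k) p=(- 1/z) powi k * p powi(- E k)* jtheta z p"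
 proof(induction k rule: int_induct[where k=0])
  case base
  then show ?case by(simp add: E_def)
 next
  case(step1 i)
  have "jtheta(z * p powi(i+1)) p
    = - ((- 1/z) powi i * p powi(- E i)* jtheta z p)/(z * p powi i)"
   by(simp only: step step1)
  also have "\<dots>=(- 1/z) powi(i+1)* p powi(- E(i+1))* jtheta z p"
  proof -
   have "p powi(- E(i+1))=p powi(- E i)/p powi i"
    using p0 by(simp add: E power_int_diff)
   then show ?thesis using assms by(simp add: power_int_add)
  qed
  finally show ?case .
 next
  case(step2 i)
  have "jtheta(z * p powi(i-1)) p = - (z * p powi(i-1))* jtheta(z * p powi i) p"
   using step[of "i-1"] assms p0 by(simp add: field_simps)
  also have "\<dots> = - (z * p powi(i-1))*((- 1/z) powi i * p powi(- E i)* jtheta z p)"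
   by(simp only: step2)
  also have Ei: "E i=E(i-1)+(i-1)" using E[of "i-1"] by simp
  also have "(- 1/z) powi i=(- 1/z) powi(i-1)*(- 1/z)"
   using assms power_int_add[of "- 1/z" "i-1" 1] by simp
  also have "- (z * p powi(i-1))*((- 1/z) powi(i-1)*(- 1/z)* p powi(- (E(i-1)+(i-1)))* jtheta z p)
    = (- 1/z) powi(i-1)* p powi(- E(i-1))* jtheta z p"
  proof -
   have "p powi(- (E(i-1)+(i-1)))=p powi(- E(i-1))/p powi(i-1)"
    using p0 by(simp only: power_int_minus power_int_add[OF disjI1[OF p0]])(simp add: field_simps)
   then show ?thesis using assms p0 by simp
  qed
  finally show ?case .
 qed
 then show ?thesis by(simp add: E_def)
qed

lemma jtheta_eq_0_iff:
 assumes "z~=0"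
 shows "jtheta z p=0 \<longleftrightarrow> (\<exists>k::int. z=p powi k)"
proof
 assume "jtheta z p=0"
 then consider j where "z * p^j=1" | j where "p/z * p^j=1"
  by(auto simp: jtheta_def qpoch_inf_eq_0_iff[OF p])
 then show "\<exists>k::int. z=p powi k"
 proof cases
  case 1
  then have "z=p powi(- int j)" using p0 by(simp add: power_int_minus field_simps)
  then show ?thesis ..
 next
  case 2
  then have "z=p powi(int j+1)" using p0 assms by(simp add: power_int_add field_simps)
  then show ?thesis ..
 qed
next
 assume "\<exists>k::int. z=p powi k"
 then obtain k where "z=p powi k" ..
 moreover have "jtheta 1 p=0"
  unfolding jtheta_def using qpoch_inf_eq_0_iff[OF p, of 1] by(auto intro: exI[of _ 0])
 ultimately show "jtheta z p=0" using jtheta_powi_mult[of 1 k] by simp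
qed

text \<open>At a zero z = p^k quasi-periodicity transports the explicit factor 1 - w of the product
  to 1 - w/z, and the cofactor does not vanish. Simplicity of the zeros is what later permits
  division of theta functions.\<close>

lemma jtheta_deriv_nonzero:
 assumes "z~=0" "jtheta z p=0"
 shows "deriv(%w. jtheta w p) z~=0"
proof -
 obtain k where k: "z=p powi k" using assms jtheta_eq_0_iff by blast
 define f where "f=(%w. qpoch_inf(w * p) p * qpoch_inf(p/w) p)"
 have f_hol: "f holomorphic_on(- {0})"
  unfolding f_def
  by(intro holomorphic_intros holomorphic_on_compose_gen[OF _ qpoch_inf_holomorphic[OF p], unfolded o_def]) auto
 have f1: "f 1~=0"
 proof -
  have "qpoch_inf p p~=0"
  proof
   assume "qpoch_inf p p=0"
   then obtain j where "p * p^j=1" by(auto simp: qpoch_inf_eq_0_iff[OF p])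
   then have "norm p^Suc j=1" by(metis norm_one norm_power power_Suc)
   then show False using p power_Suc_less_one[of "norm p" j] by(cases "norm p=0") auto
  qed
  then show ?thesis by(simp add: f_def)
 qed
 define c where "c=p powi(- (k *(k-1) div 2))"
 define h where "h=(%w. (- 1/(w/z)) powi k * c * f(w/z))"
 have eq: "jtheta w p=(1-w/z)* h w" if "w~=0" for w
 proof -
  have "jtheta w p=jtheta((w/z)* p powi k) p" using assms(1) k by simp
  also have "\<dots>=(- 1/(w/z)) powi k * c * jtheta(w/z) p"
   unfolding c_def by(rule jtheta_powi_mult)(use that assms(1) in auto)
  also have "jtheta(w/z) p=(1-w/z)* f(w/z)"
   unfolding jtheta_def f_def using qpoch_inf_split[OF p, of "w/z"] by simp
  finally show ?thesis by(simp add: h_def)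
 qed
 have h_hol: "h holomorphic_on(- {0})"
  unfolding h_def using assms(1)
  by(intro holomorphic_intros holomorphic_on_compose_gen[OF _ f_hol, unfolded o_def]) auto
 have hd: "(h has_field_derivative deriv h z)(at z)"
  using h_hol assms(1) by(intro holomorphic_derivI[of h "-{0}"]) auto
 have "((%w. (1-w/z)* h w) has_field_derivative(- 1/z)* h z+deriv h z *(1-z/z))(at z)"
  by(rule derivative_eq_intros hd refl | use assms(1) in simp)+
 then have "((%w. jtheta w p) has_field_derivative(- 1/z)* h z+deriv h z *(1-z/z))(at z)"
 proof(rule has_field_derivative_transform_within[where d = "norm z"])
  show "(1-x/z)* h x=jtheta x p" if "dist x z<norm z" for x
   using eq[of x] that by(cases "x=0")(auto simp: dist_norm)
 qed(use assms(1) in auto)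
 then have "deriv(%w. jtheta w p) z = - h z/z"
  using assms(1) by(simp add: DERIV_imp_deriv)
 moreover have "h z~=0" using assms(1) f1 p0 by(simp add: h_def c_def)
 ultimately show ?thesis using assms(1) by simp
qed

end

text \<open>Functional equations are computed only where no infinite product in a denominator
  vanishes; continuity carries them to the exceptional points.\<close>

lemma isCont_eq_generic:
 fixes f g :: "complex => complex"
 assumes "isCont f z" "isCont g z" "eventually(%w. f w=g w)(at z)"
 shows "f z=g z"
proof -
 have "f \<midarrow>z\<rightarrow> g z"
  using assms(2,3) by(subst filterlim_cong[OF refl refl, of f g])(auto simp: isCont_def)
 then show ?thesis using assms(1) LIM_unique isCont_def by blast
qed

lemma powi_exp: "exp a powi k=exp(of_int k * a)" for a :: complex
 by(cases "k \<ge> 0")(auto simp: power_int_def exp_of_nat_mult[symmetric] exp_minus[symmetric] mult.commute)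

lemma of_int_div_exact: "b dvd a==>b~=0 ==> of_int(a div b)=(of_int a / of_int b :: complex)"
 by(auto simp: dvd_def)

lemma dvd_2_consecutive: "2 dvd k *(k-1)" for k :: int
 by simp

lemma dvd_6_consecutive: "6 dvd k *(k-1)*(k-2)" for k :: int
proof -
 have "6 dvd(k+1)*(k+1-1)*(k+1-2)-k *(k-1)*(k-2)" for k :: int
 proof -
  have "(k+1)*(k+1-1)*(k+1-2)-k *(k-1)*(k-2)=3 *(k *(k-1))"
   by(simp add: algebra_simps)
  moreover have "3 * 2 dvd 3 *(k *(k-1))" by(rule mult_dvd_mono)(auto simp: dvd_2_consecutive)
  ultimately show ?thesis by simp
 qed
 note step=this
 show ?thesis
 proof(induction k rule: int_induct[where k=0])
  case(step1 i)
  show ?case using dvd_add[OF step[of i] step1(2)] by simp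
 next
  case(step2 i)
  show ?case using dvd_diff[OF step2(2) step[of "i-1"]] by simp
 qed simp
qed

lemma dvd_6_cube: "6 dvd k *(k\<^sup>2-1)" for k :: int
 using dvd_6_consecutive[of "k+1"] by(simp add: algebra_simps power2_eq_square)

lemma exp_two_pi_int: "exp(2 * of_int k * of_real pi * \<i>)=1"
 by(simp add: exp_eq_1 mult_ac)

section \<open>Functional equations of the elliptic gamma function\<close>

context
 fixes a b :: complex
 assumes a: "norm a<1" "a~=0" and b: "norm b<1" "b~=0"
begin

lemma ell_gamma_mult_fst:
 assumes "z~=0" "dpoch z a b~=0"
 shows "ell_gamma(z * a) a b=jtheta z b * ell_gamma z a b"
proof -
 have 1: "dpoch z a b=qpoch_inf z b * dpoch(z * a) a b" using dpoch_split_p[OF a(1) b(1)] .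
 have 2: "dpoch(b/z) a b=qpoch_inf(b/z) b * dpoch(a * b/z) a b"
  using dpoch_split_p[OF a(1) b(1), of "b/z"] by(simp add: mult_ac)
 have nz: "dpoch(z * a) a b~=0" "qpoch_inf z b~=0" using assms(2) 1 by auto
 have "a * b/(z * a)=b/z" using a by simp
 then show ?thesis
  using ell_gamma_eq[OF a(1) b(1) nz(1)] ell_gamma_eq[OF a(1) b(1) assms(2)] nz
  by(simp add: 2 jtheta_def 1)
qed

lemma ell_gamma_mult_snd:
 assumes "z~=0" "dpoch z a b~=0"
 shows "ell_gamma(z * b) a b=jtheta z a * ell_gamma z a b"
proof -
 have 1: "dpoch z a b=qpoch_inf z a * dpoch(z * b) a b" using dpoch_split_q[OF a(1) b(1)] .
 have 2: "dpoch(a/z) a b=qpoch_inf(a/z) a * dpoch(a * b/z) a b"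
  using dpoch_split_q[OF a(1) b(1), of "a/z"] by(simp add: mult_ac)
 have nz: "dpoch(z * b) a b~=0" "qpoch_inf z a~=0" using assms(2) 1 by auto
 have "a * b/(z * b)=a/z" using b by simp
 then show ?thesis
  using ell_gamma_eq[OF a(1) b(1) nz(1)] ell_gamma_eq[OF a(1) b(1) assms(2)] nz
  by(simp add: 2 jtheta_def 1)
qed

lemma ell_gamma_reflect:
 assumes "z~=0" "dpoch z a b~=0" "dpoch(a * b/z) a b~=0"
 shows "ell_gamma z a b * ell_gamma(a * b/z) a b=1"
 using assms ell_gamma_eq[OF a(1) b(1) assms(2)] ell_gamma_eq[OF a(1) b(1) assms(3)] a b
 by simp

text \<open>After one splitting in each direction the double products of z and 1/z cancel crosswise;
  one theta function of each nome is left over.\<close>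

lemma ell_gamma_inverse:
 assumes z: "z~=0" and d: "dpoch z a b~=0" "dpoch(1/z) a b~=0"
 shows "ell_gamma z a b * ell_gamma(1/z) a b *(jtheta z a * jtheta(1/z) b)=1"
  and "jtheta z a~=0" "jtheta(1/z) b~=0"
proof -
 have 1: "dpoch z a b=qpoch_inf z a *(qpoch_inf(z * b) b * dpoch(a * b * z) a b)"
  using dpoch_split_q[OF a(1) b(1), of z] dpoch_split_p[OF a(1) b(1), of "z * b"] by(simp add: mult_ac)
 have 2: "dpoch(1/z) a b=qpoch_inf(1/z) b *(qpoch_inf(a/z) a * dpoch(a * b/z) a b)"
  using dpoch_split_p[OF a(1) b(1), of "1/z"] dpoch_split_q[OF a(1) b(1), of "a/z"] by(simp add: mult_ac)
 have e: "ell_gamma z a b=dpoch(a * b/z) a b/dpoch z a b"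
   "ell_gamma(1/z) a b=dpoch(a * b * z) a b/dpoch(1/z) a b"
  using ell_gamma_eq[OF a(1) b(1) d(1)] ell_gamma_eq[OF a(1) b(1) d(2)] by simp_all
 have th: "jtheta z a=qpoch_inf z a * qpoch_inf(a/z) a"
   "jtheta(1/z) b=qpoch_inf(1/z) b * qpoch_inf(z * b) b"
  by(simp_all add: jtheta_def mult_ac)
 have nz: "qpoch_inf z a~=0" "qpoch_inf(z * b) b~=0" "dpoch(a * b * z) a b~=0"
   "qpoch_inf(1/z) b~=0" "qpoch_inf(a/z) a~=0" "dpoch(a * b/z) a b~=0"
  using d unfolding 1 2 by auto
 then show "jtheta z a~=0" "jtheta(1/z) b~=0" by(simp_all add: th)
 show "ell_gamma z a b * ell_gamma(1/z) a b *(jtheta z a * jtheta(1/z) b)=1"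
  unfolding e th 1 2 using nz by(simp add: mult_ac)
qed

text \<open>A holomorphic function on the connected punctured plane that is not identically zero has
  isolated zeros. The point w is the witness: for |f w| < 1 every factor is nonzero.\<close>

lemma eventually_dpoch_nonzero:
 assumes hol: "f holomorphic_on(- {0})" and z: "z~=0" and w: "w~=0" "norm(f w)<1"
 shows "eventually(%z. dpoch(f z) a b~=0)(at z)"
proof -
 have "(%z. dpoch(f z) a b) holomorphic_on(- {0})"
  by(rule holomorphic_on_compose_gen[OF hol dpoch_holomorphic[OF a(1) b(1)], unfolded o_def]) auto
 moreover have "connected(- {0::complex})" by(rule connected_punctured_universe) simp
 ultimately have "eventually(%z. dpoch(f z) a b~=0\<and>z \<in> -{0})(at z)"
  using z w dpoch_nonzero[OF a(1) b(1) w(2)]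
  by(intro non_zero_neighbour_alt[where \<beta>=w]) auto
 then show ?thesis by(rule eventually_mono) auto
qed

lemma eventually_dpoch_mult:
 assumes "z~=0"
 shows "eventually(%z. dpoch(z * c) a b~=0)(at z)"
proof(rule eventually_dpoch_nonzero[OF _ assms])
 have "norm c<2 * norm c+2" "norm c+1 > 0"
  using norm_ge_zero[of c] by linarith+
 then have K: "norm c<2 *(norm c+1)" "norm c+1 > 0" by simp_all
 have "norm(complex_of_real(1/(2 *(norm c+1)))* c)=norm c/(2 *(norm c+1))"
  using K by(simp only: norm_mult norm_of_real) simp
 then show "norm(complex_of_real(1/(2 *(norm c+1)))* c)<1"
  using K by simp
 show "complex_of_real(1/(2 *(norm c+1)))~=0"
  using K(2) by(simp only: of_real_eq_0_iff) simp
qed(intro holomorphic_intros)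

lemma eventually_dpoch_divide:
 assumes "z~=0"
 shows "eventually(%z. dpoch(c/z) a b~=0)(at z)"
proof(rule eventually_dpoch_nonzero[OF _ assms])
 have "norm c<2 * norm c+2" "norm c+1 > 0"
  using norm_ge_zero[of c] by linarith+
 moreover from this have "norm c<2 *(norm c+1)" by simp
 moreover have "norm(c/complex_of_real(2 *(norm c+1)))=norm c/\<bar>2 *(norm c+1)\<bar>"
  by(simp only: norm_divide norm_of_real)
 ultimately show "norm(c/complex_of_real(2 *(norm c+1)))<1"
  by simp
 show "complex_of_real(2 *(norm c+1))~=0"
  using \<open>norm c+1 > 0\<close> by(metis of_real_eq_0_iff mult_eq_0_iff less_irrefl zero_neq_numeral)
qed(auto intro!: holomorphic_intros)

end

section \<open>The explicit formula for the rarefied gamma function\<close>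

text \<open>Fixed logarithms of p and q give meaning to half-integral powers such as p^(m +
  \<epsilon>/2) and turn every elementary prefactor into one exponential, so that identities between
  prefactors become polynomial identities between exponents.\<close>

locale rarefied =
 fixes r :: nat and p q lp lq :: complex and \<epsilon> :: int
 assumes r0: "r > 0" and p: "norm p<1" and q: "norm q<1"
  and lp: "p=exp lp" and lq: "q=exp lq" and eps: "\<epsilon>\<in>{0, 1}"
begin

lemma p0: "p~=0" and q0: "q~=0" by(simp_all add: lp lq)

lemma pq: "norm(p * q)<1" "p * q~=0"
 using mult_strict_mono[of "norm p" 1 "norm q" 1] p q p0 q0 by(auto simp: norm_mult)

lemma pr: "norm(p^r)<1" "p^r~=0"
 using p p0 r0 power_less_one_iff[of "norm p" r] by(auto simp: norm_power)

lemma qr: "norm(q^r)<1" "q^r~=0"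
 using q q0 r0 power_less_one_iff[of "norm q" r] by(auto simp: norm_power)

abbreviation G :: "complex => int => complex" where "G z m \<equiv> rar_gamma r p q z m"

definition raw :: "complex => int => complex" where
 "raw w m=(- w) powi(m *(m-1) div 2)
    * p powi(m *(m-1)*(m-2) div 6)
    * q powi(- (m *(m\<^sup>2-1) div 6))
    * ell_gamma(w * p powi m)(p^r)(p * q)
    * ell_gamma(w * q powi(int r-m))(q^r)(p * q)"

text \<open>Here neither denominator of the formula vanishes, so \<open>raw\<close> gives the
  meromorphic function without \<open>remove_sings\<close>.\<close>

definition reg :: "complex => int => bool" where
 "reg z m \<longleftrightarrow> dpoch(z * p powi m)(p^r)(p * q)~=0 \<and>
   dpoch(z * q powi(int r-m))(q^r)(p * q)~=0"

lemma G_eq_remove_sings: "G z m=remove_sings(%w. raw w m) z"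
 by(simp add: rar_gamma_def raw_def)

lemma eventually_reg_mult:
 assumes "z~=0" "c~=0"
 shows "eventually(%z. reg(c * z) m)(at z)"
 using eventually_dpoch_mult[OF pr pq assms(1), of "c * p powi m"]
  eventually_dpoch_mult[OF qr pq assms(1), of "c * q powi(int r-m)"]
 by eventually_elim(simp add: reg_def mult_ac)

lemma eventually_reg_divide:
 assumes "z~=0"
 shows "eventually(%z. reg(c/z) m)(at z)"
 using eventually_dpoch_divide[OF pr pq assms, of "c * p powi m"]
  eventually_dpoch_divide[OF qr pq assms, of "c * q powi(int r-m)"]
 by eventually_elim(simp add: reg_def mult_ac)

lemma eventually_nonzero: "eventually(%z. z~=0)(at z)" for z :: complex
 by(cases "z=0")(auto simp: eventually_at_filter eventually_nhds intro: exI[of _ "-{0}"])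

definition raw_quot :: "complex => int => complex" where
 "raw_quot w m=(- w) powi(m *(m-1) div 2)
    * p powi(m *(m-1)*(m-2) div 6)
    * q powi(- (m *(m\<^sup>2-1) div 6))
    *(dpoch(p^r *(p * q)/(w * p powi m))(p^r)(p * q)/dpoch(w * p powi m)(p^r)(p * q))
    *(dpoch(q^r *(p * q)/(w * q powi(int r-m)))(q^r)(p * q)
     / dpoch(w * q powi(int r-m))(q^r)(p * q))"

lemma raw_eq_quot: "reg z m==>raw z m=raw_quot z m"
 by(simp add: reg_def raw_def raw_quot_def ell_gamma_eq pr qr pq)

lemma open_reg: "open {z. z~=0\<and>reg z m}"
proof -
 have "open {z. z~=0\<and>dpoch(z * p powi m)(p^r)(p * q)~=0 \<and>
   dpoch(z * q powi(int r-m))(q^r)(p * q)~=0}"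
  by(intro open_Collect_conj open_Collect_neq continuous_intros
   continuous_on_compose2[OF holomorphic_on_imp_continuous_on[OF dpoch_holomorphic[OF pr(1) pq(1)]]]
   continuous_on_compose2[OF holomorphic_on_imp_continuous_on[OF dpoch_holomorphic[OF qr(1) pq(1)]]]) auto
 then show ?thesis by(simp add: reg_def)
qed

lemma raw_quot_holomorphic: "(%z. raw_quot z m) holomorphic_on {z. z~=0\<and>reg z m}"
 unfolding raw_quot_def
 by(intro holomorphic_intros
   holomorphic_on_compose_gen[OF _ dpoch_holomorphic[OF pr(1) pq(1)], unfolded o_def]
   holomorphic_on_compose_gen[OF _ dpoch_holomorphic[OF qr(1) pq(1)], unfolded o_def])
   (auto simp: reg_def p0 q0)

lemma raw_analytic:
 assumes "z~=0" "reg z m"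
 shows "(%z. raw z m) analytic_on {z}"
proof -
 have "(%z. raw z m) holomorphic_on {z. z~=0\<and>reg z m}"
  by(rule holomorphic_transform[OF raw_quot_holomorphic])(simp add: raw_eq_quot)
 then show ?thesis using open_reg assms by(auto simp: analytic_at)
qed

lemma G_eq_raw:
 assumes "z~=0" "reg z m"
 shows "G z m=raw z m"
 using raw_analytic[OF assms] by(simp add: G_eq_remove_sings)

text \<open>Logarithm of the elementary prefactor at z = exp l, on the branch -z = exp(l + pi i),
  with the exact divisions written as fractions.\<close>

definition pre :: "complex => int => complex" where
 "pre l m = of_int(m *(m-1))/2 *(l + of_real pi * \<i>) + of_int(m *(m-1)*(m-2))/6 * lp
   - of_int(m *(m\<^sup>2-1))/6 * lq"

lemma minus_exp: "- exp l=exp(l + of_real pi * \<i>)"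
 by(simp add: exp_add)

lemma minus_exp': "- exp l=exp(l - of_real pi * \<i>)"
 by(simp add: exp_diff)

lemma powi_triangle_exp: "exp a powi(- (m *(m-1) div 2))=exp(- (of_int(m *(m-1))/2 * a))" for a :: complex
 unfolding powi_exp of_int_minus of_int_div_exact[OF dvd_2_consecutive zero_neq_numeral[symmetric]] by simp

lemma raw_exp:
 assumes "z=exp l"
 shows "raw z m=exp(pre l m)* ell_gamma(z * p powi m)(p^r)(p * q)
   * ell_gamma(z * q powi(int r-m))(q^r)(p * q)"
proof -
 have 1: "(- z) powi(m *(m-1) div 2)=exp(of_int(m *(m-1))/2 *(l + of_real pi * \<i>))"
  unfolding assms minus_exp powi_exp of_int_div_exact[OF dvd_2_consecutive zero_neq_numeral[symmetric]] by simp
 have 2: "p powi(m *(m-1)*(m-2) div 6)=exp(of_int(m *(m-1)*(m-2))/6 * lp)"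
  unfolding lp powi_exp of_int_div_exact[OF dvd_6_consecutive zero_neq_numeral[symmetric]] by simp
 have 3: "q powi(- (m *(m\<^sup>2-1) div 6))=exp(- (of_int(m *(m\<^sup>2-1))/6 * lq))"
  unfolding lq powi_exp of_int_minus of_int_div_exact[OF dvd_6_cube zero_neq_numeral[symmetric]] by simp
 have "exp(pre l m)=exp(of_int(m *(m-1))/2 *(l + of_real pi * \<i>))
   * exp(of_int(m *(m-1)*(m-2))/6 * lp)* exp(- (of_int(m *(m\<^sup>2-1))/6 * lq))"
  by(simp only: pre_def exp_add[symmetric] add_uminus_conv_diff)
 then show ?thesis unfolding raw_def 1 2 3 by(simp only: mult_ac)
qed

text \<open>The substitution multiplies the argument of one elliptic gamma factor by pq and leaves
  the other argument unchanged, so a single theta function, of nome p^r, appears.\<close>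

lemma raw_shift:
 assumes "z~=0" "reg z m"
 shows "raw(q * z)(m+1)
  = (- z) powi m * p powi(m *(m-1) div 2)* jtheta(z * p powi m)(p^r)* raw z m"
proof -
 obtain l where l: "z=exp l" using assms(1) by(metis exp_Ln)
 have qz: "q * z=exp(lq+l)" by(simp add: lq l exp_add)
 have 1: "q * z * p powi(m+1)=(z * p powi m)*(p * q)"
  using p0 by(simp add: power_int_add)
 have 2: "q * z * q powi(int r-(m+1))=z * q powi(int r-m)"
  using q0 by(simp add: power_int_diff power_int_add field_simps)
 have 3: "(- z) powi m * p powi(m *(m-1) div 2)
   = exp(of_int m *(l + of_real pi * \<i>) + of_int(m *(m-1))/2 * lp)"
  unfolding l minus_exp powi_exp lp of_int_div_exact[OF dvd_2_consecutive zero_neq_numeral[symmetric]]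
  by(simp add: exp_add)
 have 4: "pre(lq+l)(m+1) = of_int m *(l + of_real pi * \<i>) + of_int(m *(m-1))/2 * lp+pre l m"
  unfolding pre_def by(simp add: field_simps power2_eq_square)
 have 5: "ell_gamma((z * p powi m)*(p * q))(p^r)(p * q)
   = jtheta(z * p powi m)(p^r)* ell_gamma(z * p powi m)(p^r)(p * q)"
  by(rule ell_gamma_mult_snd)(use assms pr pq p0 in \<open>auto simp: reg_def\<close>)
 show ?thesis
  unfolding raw_exp[OF qz] raw_exp[OF l] 1 2 3 4 5 by(simp add: exp_add)
qed

text \<open>Logarithm of the factor acquired under m -> m + r, affine in l. The variant
  \<open>perz\<close> uses an integral power of -z and is therefore single-valued in z.\<close>

definition per :: "complex => int => complex" where
 "per l m = of_int((int r-1)*(2 * m+int r))/2 *(l + of_real pi * \<i>)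
  + of_int(int r-1)/2 *(of_int(m\<^sup>2+(int r-1)* m) + of_int(int r *(int r-2))/3)* lp
  - of_int(int r-1)/2 *(of_int(m\<^sup>2+(int r+1)* m) + of_int(int r *(int r+1))/3)* lq"

definition perz :: "complex => int => complex" where
 "perz z m=(- z) powi((int r-1)*(2 * m+int r) div 2)
  * exp(of_int(int r-1)/2 *(of_int(m\<^sup>2+(int r-1)* m) + of_int(int r *(int r-2))/3)* lp
  - of_int(int r-1)/2 *(of_int(m\<^sup>2+(int r+1)* m) + of_int(int r *(int r+1))/3)* lq)"

lemma perz_exp: "perz(exp l) m=exp(per l m)"
proof -
 have "2 dvd(int r-1)*(2 * m+int r)" by simp
 from of_int_div_exact[OF this zero_neq_numeral[symmetric]]
 have "(- exp l) powi((int r-1)*(2 * m+int r) div 2)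
  = exp(of_int((int r-1)*(2 * m+int r))/2 *(l + of_real pi * \<i>))"
  unfolding minus_exp powi_exp by(simp only: of_int_numeral)
 then show ?thesis unfolding perz_def per_def by(simp add: exp_add exp_diff)
qed

lemma perz_nonzero: "z~=0==>perz z m~=0"
 by(simp add: perz_def)

lemma perz_analytic: "z~=0==>(%z. perz z m) analytic_on {z}"
 unfolding perz_def analytic_at
 by(intro exI[of _ "-{0}"])(auto intro!: holomorphic_intros)

lemma powi_r: "p powi(m+int r)=p powi m * p^r" "q powi(m+int r)=q powi m * q^r"
 using p0 q0 by(simp_all add: power_int_add)

text \<open>Raising m by r multiplies one gamma argument by p^r and divides the other by q^r. Each
  change produces a theta function of nome pq; their arguments differ by (pq)^m, so they cancel up
  to an elementary factor.\<close>

lemma raw_period: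
 assumes "z~=0" "reg z m" "reg z(m+int r)"
 shows "raw z(m+int r)=perz z m * raw z m"
proof -
 obtain l where l: "z=exp l" using assms(1) by(metis exp_Ln)
 have nz: "z * p powi m~=0" "z * q powi(- m)~=0" using assms(1) p0 q0 by auto
 have 1: "z * p powi(m+int r)=(z * p powi m)* p^r"
  by(simp add: powi_r)
 have 2: "z * q powi(int r-m)=(z * q powi(- m))* q^r"
  using powi_r(2)[of "- m"] by(simp add: add.commute)
 have 3: "ell_gamma((z * p powi m)* p^r)(p^r)(p * q)
   = jtheta(z * p powi m)(p * q)* ell_gamma(z * p powi m)(p^r)(p * q)"
  by(rule ell_gamma_mult_fst)(use assms pr pq nz in \<open>auto simp: reg_def\<close>)
 have 4: "ell_gamma((z * q powi(- m))* q^r)(q^r)(p * q)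
   = jtheta(z * q powi(- m))(p * q)* ell_gamma(z * q powi(- m))(q^r)(p * q)"
  by(rule ell_gamma_mult_fst)(use assms qr pq nz in \<open>auto simp: reg_def\<close>)
 have "z * p powi m=(z * q powi(- m))*(p * q) powi m"
  using q0 by(simp add: power_int_mult_distrib power_int_minus)
 then have "jtheta(z * p powi m)(p * q)
  = (- 1/(z * q powi(- m))) powi m *(p * q) powi(- (m *(m-1) div 2))* jtheta(z * q powi(- m))(p * q)"
  by(simp only: jtheta_powi_mult[OF pq nz(2), of m])
 also have "- 1/(z * q powi(- m))=exp(of_int m * lq-l - of_real pi * \<i>)"
 proof -
  have "- 1/(z * q powi(- m)) = - exp(of_int m * lq-l)"
   by(simp add: l lq powi_exp exp_diff exp_minus field_simps)
  then show ?thesis by(simp only: minus_exp')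
 qed
 also have "p * q=exp(lp+lq)" by(simp add: lp lq exp_add)
 also have "exp(of_int m * lq-l - of_real pi * \<i>) powi m * exp(lp+lq) powi(- (m *(m-1) div 2))
   = exp(of_int m *(of_int m * lq-l - of_real pi * \<i>) - of_int(m *(m-1))/2 *(lp+lq))"
  unfolding powi_triangle_exp unfolding powi_exp by(simp only: exp_add[symmetric] uminus_add_conv_diff add_uminus_conv_diff)
 finally have 5: "jtheta(z * p powi m)(p * q)=exp(of_int m *(of_int m * lq-l - of_real pi * \<i>)
   - of_int(m *(m-1))/2 *(lp+lq))* jtheta(z * q powi(- m))(p * q)"
  by(simp add: lp lq exp_add)
 have 6: "pre l(m+int r)+(of_int m *(of_int m * lq-l - of_real pi * \<i>)
   - of_int(m *(m-1))/2 *(lp+lq))=per l m+pre l m"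
  unfolding pre_def per_def by(simp add: field_simps power2_eq_square)
 have 7: "int r-(m+int r) = - m" by simp
 have "raw z(m+int r)=exp(pre l(m+int r)+(of_int m *(of_int m * lq-l - of_real pi * \<i>)
   - of_int(m *(m-1))/2 *(lp+lq)))* ell_gamma(z * p powi m)(p^r)(p * q) *
   (jtheta(z * q powi(- m))(p * q)* ell_gamma(z * q powi(- m))(q^r)(p * q))"
  unfolding raw_exp[OF l] 1 7 3 5 exp_add by(simp add: mult_ac)
 also have "\<dots>=perz z m * raw z m"
  unfolding 6 raw_exp[OF l] 2 4 unfolding l perz_exp exp_add by(simp add: mult_ac)
 finally show ?thesis .
qed

text \<open>Inverting both gamma factors leaves theta functions of the nomes p^r, q^r and pq. Those
  of nome pq cancel because their arguments differ by (pq)^m.\<close>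

lemma raw_inverse:
 assumes z: "z~=0" and "reg z m" "reg(1/z)(- m)"
  and v: "dpoch(q powi m/z)(q^r)(p * q)~=0" "dpoch(z * q powi(- m))(q^r)(p * q)~=0"
 shows "raw z m * raw(1/z)(- m)*(jtheta(z * p powi m)(p^r)* jtheta(q powi m/z)(q^r))
  = (p * q) powi(- (m *(m-1) div 2))"
proof -
 obtain l where l: "z=exp l" using assms(1) by(metis exp_Ln)
 \<comment> \<open>On this branch l' + pi i = -(l + pi i), which makes the exponents in
   \<open>pre\<close> cancel exactly and not only modulo 2 pi i.\<close>
 have l': "1/z=exp(- l-2 * of_real pi * \<i>)"
  using exp_two_pi_int[of "-1"] by(simp add: l exp_diff exp_minus field_simps)
 define x where "x=z * p powi m"
 define w where "w=q powi m/z"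
 have nz: "x~=0" "w~=0" using z p0 q0 by(auto simp: x_def w_def)
 have x1: "1/z * p powi(- m)=1/x" using p0 by(simp add: x_def power_int_minus field_simps)
 have w1: "1/w=z * q powi(- m)" using q0 by(simp add: w_def power_int_minus field_simps)
 have 1: "z * q powi(int r-m)=(1/w)* q^r"
  using powi_r(2)[of "- m"] by(simp add: w1 add.commute)
 have 2: "1/z * q powi(int r - - m)=w * q^r"
  using powi_r(2)[of "m"] by(simp add: w_def add.commute)
 have d: "dpoch x(p^r)(p * q)~=0" "dpoch(1/x)(p^r)(p * q)~=0"
   "dpoch w(q^r)(p * q)~=0" "dpoch(1/w)(q^r)(p * q)~=0"
  using assms(2-) unfolding reg_def x1 w_def[symmetric] w1 x_def[symmetric] by blast+
 note X=ell_gamma_inverse[OF pr pq nz(1) d(1,2)]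
 note W=ell_gamma_inverse[OF qr pq nz(2) d(3,4)]
 have 3: "ell_gamma(w * q^r)(q^r)(p * q)=jtheta w(p * q)* ell_gamma w(q^r)(p * q)"
  by(rule ell_gamma_mult_fst)(use qr pq nz d in auto)
 have 4: "ell_gamma(1/w * q^r)(q^r)(p * q)=jtheta(1/w)(p * q)* ell_gamma(1/w)(q^r)(p * q)"
  by(rule ell_gamma_mult_fst)(use qr pq nz d in auto)
 have "w=1/x *(p * q) powi m"
  using p0 by(simp add: w_def x_def power_int_mult_distrib)
 then have "jtheta w(p * q)=(- 1/(1/x)) powi m *(p * q) powi(- (m *(m-1) div 2))* jtheta(1/x)(p * q)"
  using jtheta_powi_mult[OF pq, of "1/x" m] nz by simp
 also have "- 1/(1/x)=exp(l + of_int m * lp + of_real pi * \<i>)"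
  by(simp add: x_def l lp powi_exp exp_add)
 finally have 5: "jtheta w(p * q)=exp(of_int m *(l + of_int m * lp + of_real pi * \<i>))
   *(p * q) powi(- (m *(m-1) div 2))* jtheta(1/x)(p * q)"
  unfolding powi_exp .
 have 6: "pre l m+pre(- l-2 * of_real pi * \<i>)(- m) + of_int m *(l + of_int m * lp + of_real pi * \<i>)=0"
  unfolding pre_def by(simp add: field_simps power2_eq_square)
 define E where "E=(p * q) powi(- (m *(m-1) div 2))"
 have "raw z m * raw(1/z)(- m)*(jtheta x(p^r)* jtheta w(q^r))
  = exp(pre l m)* exp(pre(- l-2 * of_real pi * \<i>)(- m))* jtheta w(p * q) *
   (ell_gamma x(p^r)(p * q)* ell_gamma(1/x)(p^r)(p * q)* jtheta x(p^r)) *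
   (ell_gamma w(q^r)(p * q)* ell_gamma(1/w)(q^r)(p * q)*(jtheta w(q^r)* jtheta(1/w)(p * q)))"
  unfolding raw_exp[OF l] raw_exp[OF l'] 1 2 x1 3 4 x_def[symmetric] by(simp only: mult_ac)
 also have "\<dots>=exp(pre l m+pre(- l-2 * of_real pi * \<i>)(- m) + of_int m *(l + of_int m * lp + of_real pi * \<i>))* E *
   (ell_gamma x(p^r)(p * q)* ell_gamma(1/x)(p^r)(p * q)*(jtheta x(p^r)* jtheta(1/x)(p * q)))"
  unfolding W(1) 5 exp_add E_def by(simp only: mult_ac mult_1 mult_1_right)
 also have "\<dots>=E" unfolding 6 X(1) by simp
 finally show ?thesis by(simp add: x_def w_def E_def)
qed

text \<open>This reflection evaluates the product side for four parameters, the start of the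
  induction on the number of variables.\<close>

lemma raw_reflect_pq:
 assumes z: "z~=0" and "reg z m" "reg(p * q/z)(- m)"
  and v: "dpoch(p * q * q powi m/z)(q^r)(p * q)~=0"
   "dpoch(p^r *(p * q)* p powi(- m)/z)(p^r)(p * q)~=0"
 shows "raw z m * raw(p * q/z)(- m)=1"
proof -
 obtain l where l: "z=exp l" using assms(1) by(metis exp_Ln)
 have l': "p * q/z=exp(lp+lq-l-2 * of_real pi * \<i>)"
  using exp_two_pi_int[of "-1"] by(simp add: l lp lq exp_diff exp_add exp_minus field_simps)
 define x where "x=z * p powi m"
 define w where "w=p * q * q powi m/z"
 have nz: "x~=0" "w~=0" "p * q/x~=0" using z p0 q0 by(auto simp: x_def w_def)
 have x1: "p * q/z * p powi(- m)=p * q/x" using p0 by(simp add: x_def power_int_minus field_simps)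
 have x2: "p^r *(p * q)* p powi(- m)/z=p^r *(p * q)/x" using p0 by(simp add: x_def power_int_minus field_simps)
 have 1: "z * q powi(int r-m)=q^r *(p * q)/w"
  using powi_r(2)[of "- m"] p0 q0 z by(simp add: w_def power_int_minus power_int_diff field_simps)
 have 2: "p * q/z * q powi(int r - - m)=w * q^r"
  using powi_r(2)[of "m"] by(simp add: w_def add.commute)
 have d: "dpoch x(p^r)(p * q)~=0" "dpoch(p * q/x)(p^r)(p * q)~=0"
   "dpoch(p^r *(p * q)/x)(p^r)(p * q)~=0"
   "dpoch w(q^r)(p * q)~=0" "dpoch(q^r *(p * q)/w)(q^r)(p * q)~=0"
  using assms(2-) unfolding reg_def x1 x2 1[symmetric] w_def[symmetric] x_def[symmetric] by blast+
 note X=ell_gamma_reflect[OF pr pq nz(1) d(1,3)]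
 note W=ell_gamma_reflect[OF qr pq nz(2) d(4,5)]
 have 3: "ell_gamma(w * q^r)(q^r)(p * q)=jtheta w(p * q)* ell_gamma w(q^r)(p * q)"
  by(rule ell_gamma_mult_fst)(use qr pq nz d in auto)
 have 4: "ell_gamma(p^r *(p * q)/x)(p^r)(p * q)=jtheta(p * q/x)(p * q)* ell_gamma(p * q/x)(p^r)(p * q)"
  using ell_gamma_mult_fst[OF pr pq nz(3) d(2)] by(simp add: mult_ac)
 have "w=p * q/x *(p * q) powi m"
  using p0 by(simp add: w_def x_def power_int_mult_distrib)
 then have "jtheta w(p * q)=(- 1/(p * q/x)) powi m *(p * q) powi(- (m *(m-1) div 2))* jtheta(p * q/x)(p * q)"
  using jtheta_powi_mult[OF pq nz(3), of m] by simp
 also have "- 1/(p * q/x)=exp(l + of_int m * lp + of_real pi * \<i>-lp-lq)"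
  by(simp add: x_def l lp lq powi_exp exp_add exp_diff)
 also have "p * q=exp(lp+lq)" by(simp add: lp lq exp_add)
 also have "exp(l + of_int m * lp + of_real pi * \<i>-lp-lq) powi m * exp(lp+lq) powi(- (m *(m-1) div 2))
   = exp(of_int m *(l + of_int m * lp + of_real pi * \<i>-lp-lq) - of_int(m *(m-1))/2 *(lp+lq))"
  unfolding powi_triangle_exp unfolding powi_exp by(simp only: exp_add[symmetric] uminus_add_conv_diff add_uminus_conv_diff)
 finally have 5: "jtheta w(p * q)=exp(of_int m *(l + of_int m * lp + of_real pi * \<i>-lp-lq)
   - of_int(m *(m-1))/2 *(lp+lq))* jtheta(p * q/x)(p * q)"
  by(simp add: lp lq exp_add)
 have 6: "pre l m+pre(lp+lq-l-2 * of_real pi * \<i>)(- m)+(of_int m *(l + of_int m * lp + of_real pi * \<i>-lp-lq)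
   - of_int(m *(m-1))/2 *(lp+lq))=0"
  unfolding pre_def by(simp add: field_simps power2_eq_square)
 have "raw z m * raw(p * q/z)(- m)
  = exp(pre l m+pre(lp+lq-l-2 * of_real pi * \<i>)(- m)+(of_int m *(l + of_int m * lp + of_real pi * \<i>-lp-lq)
   - of_int(m *(m-1))/2 *(lp+lq))) *
   (ell_gamma x(p^r)(p * q)*(jtheta(p * q/x)(p * q)* ell_gamma(p * q/x)(p^r)(p * q))) *
   (ell_gamma w(q^r)(p * q)* ell_gamma(q^r *(p * q)/w)(q^r)(p * q))"
  unfolding raw_exp[OF l] raw_exp[OF l'] 1 2 x1 3 5 x_def[symmetric] exp_add by(simp only: mult_ac)
 also have "\<dots>=1" unfolding 6 4[symmetric] X W by simp
 finally show ?thesis .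
qed

end

section \<open>Domain of holomorphy, poles and functional equations of the rarefied gamma
  function\<close>

context rarefied
begin

definition mx :: real where "mx=max(norm p)(norm q)"

lemma mx: "0<mx" "mx<1" "norm p\<le>mx" "norm q\<le>mx"
 using p q p0 q0 by(auto simp: mx_def less_max_iff_disj)

text \<open>The disc of radius 1/max(|p|, |q|) contains the closed unit disc. Apart from the origin
  its only exceptional point is z = 1, where a simple pole sits if r divides m.\<close>

definition dom :: "int => complex set" where
 "dom m={z. z~=0\<and>norm z * mx<1\<and>(z=1 \<longrightarrow> \<not> int r dvd m)}"

lemma open_punctured_disc: "open {z::complex. z~=0\<and>norm z * mx<1}"
 by(intro open_Collect_conj open_Collect_neq open_Collect_less continuous_intros)

lemma open_dom: "open(dom m)"
proof(cases "int r dvd m")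
 case True
 then have "dom m={z::complex. z~=0\<and>norm z * mx<1} \<inter>-{1}" by(auto simp: dom_def)
 then show ?thesis using open_punctured_disc by auto
qed(simp add: dom_def open_punctured_disc)

lemma dom_period: "dom(m+int r)=dom m" "dom(m-int r)=dom m"
proof -
 have "int r dvd m-int r \<longleftrightarrow> int r dvd m" using dvd_add_right_iff[of "int r" "int r" "m-int r"] by simp
 then show "dom(m+int r)=dom m" "dom(m-int r)=dom m" by(auto simp: dom_def)
qed

lemma unit_disc_dom: "z~=0==>norm z<1==>z\<in>dom m"
 using mult_strict_mono[of "norm z" 1 mx 1] mx by(auto simp: dom_def)

lemma norm_monomial_less:
 assumes "norm z * mx<1" "j > 0 \<or> k > 0"
 shows "norm(z * p^j * q^k)<1"
proof -
 have "norm(z * p^j * q^k)\<le>norm z *(mx^j * mx^k)"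
  unfolding norm_mult norm_power mult.assoc
  using mx by(intro mult_left_mono mult_mono power_mono) auto
 also have "mx^j * mx^k=mx * mx^(j+k-1)"
  using assms(2) by(cases "j+k")(auto simp flip: power_add)
 also have "mx * mx^(j+k-1)\<le>mx * 1"
  using mx by(intro mult_left_mono power_le_one) auto
 finally show ?thesis using assms(1) by(simp add: mult_left_mono)
qed

text \<open>For 0 \<le> m < r a vanishing denominator means z p^j q^k = 1 with nonnegative
  exponents. If one of them is positive the modulus is below 1; otherwise z = 1 and m = 0, which
  \<open>dom\<close> excludes.\<close>

lemma reg_fundamental:
 assumes m: "0\<le>m" "m<int r" and z: "z\<in>dom m"
 shows "reg z m"
proof -
 have zz: "norm z * mx<1" using z by(simp add: dom_def)
 have "dpoch(z * p powi m)(p^r)(p * q)~=0"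
 proof
  assume "dpoch(z * p powi m)(p^r)(p * q)=0"
  then obtain j k where 1: "z * p powi m *(p^r)^j *(p * q)^k=1"
   by(auto simp: dpoch_eq_0_iff[OF pr(1) pq(1)])
  have pm: "p powi m=p^nat m" using m by(simp add: power_int_def)
  have 2: "z * p^(nat m+r * j+k)* q^k=1"
   using 1 by(simp add: pm power_mult[symmetric] power_add power_mult_distrib mult_ac)
  show False
  proof(cases "nat m+r * j+k > 0 \<or> k > 0")
   case True
   from norm_monomial_less[OF zz this] show False using 2 by simp
  next
   case False
   then have "z=1" "m=0" using 2 m by auto
   then show False using z by(simp add: dom_def)
  qed
 qed
 moreover have "dpoch(z * q powi(int r-m))(q^r)(p * q)~=0"
 proof
  assume "dpoch(z * q powi(int r-m))(q^r)(p * q)=0"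
  then obtain j k where 1: "z * q powi(int r-m)*(q^r)^j *(p * q)^k=1"
   by(auto simp: dpoch_eq_0_iff[OF qr(1) pq(1)])
  have pm: "q powi(int r-m)=q^nat(int r-m)" using m by(simp add: power_int_def)
  have 2: "z * p^k * q^(nat(int r-m)+r * j+k)=1"
   using 1 by(simp add: pm power_mult[symmetric] power_add power_mult_distrib mult_ac)
  have "k > 0 \<or> nat(int r-m)+r * j+k > 0" using m by auto
  from norm_monomial_less[OF zz this] show False using 2 by simp
 qed
 ultimately show ?thesis by(simp add: reg_def)
qed

lemma eventually_reg: "z~=0==>eventually(%z. reg z m)(at z)"
 using eventually_reg_mult[of z 1 m] by simp

lemma eventually_raw_period:
 assumes "z~=0"
 shows "eventually(%w. raw w(m+int r)=perz w m * raw w m)(at z)"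
 using eventually_nonzero eventually_reg[OF assms, of m] eventually_reg[OF assms, of "m+int r"]
 by eventually_elim(rule raw_period)

lemma eventually_G_raw:
 assumes "z~=0"
 shows "eventually(%w. G w m=raw w m)(at z)"
 using eventually_nonzero eventually_reg[OF assms, of m]
 by eventually_elim(rule G_eq_raw)

text \<open>\<open>remove_sings\<close> commutes with multiplication by an analytic factor, so the
  quasi-period survives at points where the explicit formula for m + r degenerates.\<close>

lemma G_period_up:
 assumes "z~=0" "(%z. G z m) analytic_on {z}"
 shows "G z(m+int r)=perz z m * G z m"
proof -
 have "eventually(%w. raw w(m+int r)=perz w m * G w m)(at z)"
  using eventually_raw_period[OF assms(1), of m] eventually_G_raw[OF assms(1), of m] by eventually_elim simp
 then have "G z(m+int r)=remove_sings(%w. perz w m * G w m) z"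
  unfolding G_eq_remove_sings[of z "m+int r"] by(rule remove_sings_cong) simp
 also have "\<dots>=perz z m * G z m"
  by(rule remove_sings_at_analytic)(intro analytic_on_mult perz_analytic assms)
 finally show ?thesis .
qed

lemma G_period_down:
 assumes "z~=0" "(%z. G z(m+int r)) analytic_on {z}"
 shows "G z m=G z(m+int r)/perz z m"
proof -
 have "eventually(%w. raw w m=G w(m+int r)/perz w m)(at z)"
  using eventually_nonzero eventually_raw_period[OF assms(1), of m] eventually_G_raw[OF assms(1), of "m+int r"]
  by eventually_elim(simp add: perz_nonzero)
 then have "G z m=remove_sings(%w. G w(m+int r)/perz w m) z"
  unfolding G_eq_remove_sings[of z m] by(rule remove_sings_cong) simp
 also have "\<dots>=G z(m+int r)/perz z m"
  by(rule remove_sings_at_analytic)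
   (use assms in \<open>intro analytic_on_divide perz_analytic\<close>, auto simp: perz_nonzero)
 finally show ?thesis .
qed

lemma perz_holomorphic: "0 \<notin> S==>(%z. perz z m) holomorphic_on S"
 unfolding perz_def by(intro holomorphic_intros) auto

lemma hol_imp_analytic: "f holomorphic_on S ==> open S==>z\<in>S==>f analytic_on {z}"
 by(auto simp: analytic_at)

text \<open>Statements about \<open>G z m\<close> reduce to \<open>0 \<le> m < r\<close> by quasi-periodicity.\<close>

lemma period_induct:
 fixes Q :: "int => bool"
 assumes "\<And>m. 0\<le>m==>m<int r==>Q m" "\<And>m. Q m==>Q(m+int r)" "\<And>m. Q m==>Q(m-int r)"
 shows "Q m"
proof -
 have "Q(m mod int r+k * int r)" for k
 proof(induction k rule: int_induct[where k=0])
  case base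
  show ?case using assms(1)[of "m mod int r"] r0 by simp
 next
  case(step1 i)
  show ?case using assms(2)[OF step1(2)] by(simp add: algebra_simps)
 next
  case(step2 i)
  show ?case using assms(3)[OF step2(2)] by(simp add: algebra_simps)
 qed
 from this[of "m div int r"] show ?thesis by simp
qed

lemma G_holomorphic: "(%z. G z m) holomorphic_on dom m"
proof(induction m rule: period_induct)
 case(1 m)
 show ?case
  by(rule holomorphic_transform[OF holomorphic_on_subset[OF raw_quot_holomorphic[of m]]])
    (use reg_fundamental[OF 1] in \<open>auto simp: G_eq_raw raw_eq_quot dom_def\<close>)
next
 case(2 m)
 have "G z(m+int r)=perz z m * G z m" if "z\<in>dom m" for z
  using that by(intro G_period_up hol_imp_analytic[OF 2 open_dom])(auto simp: dom_def)
 then show ?case unfolding dom_period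
  by(intro holomorphic_transform[OF holomorphic_on_mult[OF perz_holomorphic 2]])(auto simp: dom_def)
next
 case(3 m)
 have "G z(m-int r)=G z m/perz z(m-int r)" if "z\<in>dom m" for z
  using that G_period_down[of z "m-int r"] hol_imp_analytic[OF 3 open_dom] by(auto simp: dom_def)
 then show ?case unfolding dom_period
  by(intro holomorphic_transform[OF holomorphic_on_divide[OF 3 perz_holomorphic]])(auto simp: dom_def perz_nonzero)
qed

lemma G_analytic: "z\<in>dom m==>(%z. G z m) analytic_on {z}"
 by(rule hol_imp_analytic[OF G_holomorphic open_dom])

lemma G_isCont: "z\<in>dom m==>isCont(%z. G z m) z"
 by(rule analytic_at_imp_isCont[OF G_analytic])

lemma G_period: "z\<in>dom m==>G z(m+int r)=perz z m * G z m"
 by(rule G_period_up[OF _ G_analytic])(auto simp: dom_def)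

text \<open>Zeros come from the numerators. For 0 \<le> m < r their arguments are pq/z times
  monomials in p and q, hence of modulus below 1; other m follow by quasi-periodicity.\<close>

lemma G_nonzero:
 assumes "z\<in>dom m" "norm(p * q)<norm z"
 shows "G z m~=0"
 using assms
proof(induction m rule: period_induct)
 case(1 m)
 have rg: "reg z m" by(rule reg_fundamental)(use 1 in auto)
 have z: "z~=0" using 1 by(auto simp: dom_def)
 have l: "norm(p * q/z * p^j * q^k)<1" for j k
 proof -
  have "norm(p * q/z)<1" using 1 z by(simp add: norm_divide)
  moreover have "norm(p^j * q^k)\<le>1 * 1"
   unfolding norm_mult norm_power using p q by(intro mult_mono power_le_one) auto
  ultimately have "norm(p * q/z)* norm(p^j * q^k)<1"
   using mult_left_mono[of "norm(p^j * q^k)" 1 "norm(p * q/z)"] by simp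
  then show ?thesis by(simp only: norm_mult[symmetric] mult.assoc)
 qed
 have "p^r *(p * q)/(z * p powi m)=p * q/z * p^(nat(int r-m))* q^0"
 proof -
  have "p^r=p^(nat(int r-m))* p powi m"
   using 1 p0 power_int_add[of p "int r-m" m] by(simp add: power_int_def)
  then show ?thesis using p0 by simp
 qed
 then have "dpoch(p^r *(p * q)/(z * p powi m))(p^r)(p * q)~=0"
  using dpoch_nonzero[OF pr(1) pq(1)] l by metis
 moreover have "q^r *(p * q)/(z * q powi(int r-m))=p * q/z * p^0 * q^nat m"
 proof -
  have "q^r=q^(nat m)* q powi(int r-m)"
   using 1 q0 power_int_add[of q m "int r-m"] by(simp add: power_int_def)
  then show ?thesis using q0 by simp
 qed
 then have "dpoch(q^r *(p * q)/(z * q powi(int r-m)))(q^r)(p * q)~=0"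
  using dpoch_nonzero[OF qr(1) pq(1)] l by metis
 ultimately show ?case
  using rg z p0 q0 by(simp add: G_eq_raw raw_eq_quot raw_quot_def reg_def)
next
 case(2 m)
 then show ?case using G_period[of z m] perz_nonzero[of z m] by(auto simp: dom_period dom_def)
next
 case(3 m)
 then show ?case using G_period[of z "m-int r"] by(auto simp: dom_period)
qed

lemma G_shift:
 assumes "z~=0" "norm z<1"
 shows "G(q * z)(m+1)
  = (- z) powi m * p powi(m *(m-1) div 2)* jtheta(z * p powi m)(p^r)* G z m"
proof(rule isCont_eq_generic[where f = "%z. G(q * z)(m+1)" and z=z])
 have "norm(q * z)<1" using mult_strict_mono[of "norm q" 1 "norm z" 1] q assms by(simp add: norm_mult)
 then have "isCont(%z. G z(m+1))(q * z)"
  by(intro G_isCont unit_disc_dom)(use assms q0 in auto)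
 then show "isCont(%z. G(q * z)(m+1)) z"
  by(intro isCont_o2[where g = "%z. G z(m+1)" and f = "%z. q * z"] continuous_intros) auto
 have "(%z. jtheta(z * p powi m)(p^r)) holomorphic_on(-{0})"
  by(rule holomorphic_on_compose_gen[OF _ jtheta_holomorphic[OF pr], unfolded o_def])
    (use p0 in \<open>auto intro!: holomorphic_intros\<close>)
 then have "isCont(%z. jtheta(z * p powi m)(p^r)) z"
  using assms by(intro analytic_at_imp_isCont hol_imp_analytic[of _ "-{0}"]) auto
 then show "isCont(%z. (- z) powi m * p powi(m *(m-1) div 2)* jtheta(z * p powi m)(p^r)* G z m) z"
  using assms by(intro continuous_intros G_isCont unit_disc_dom) auto
 show "\<forall>\<^sub>F w in at z. G(q * w)(m+1)
   = (- w) powi m * p powi(m *(m-1) div 2)* jtheta(w * p powi m)(p^r)* G w m"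
  using eventually_nonzero eventually_reg[OF assms(1), of m] eventually_reg_mult[OF assms(1) q0, of "m+1"]
  by eventually_elim(simp add: G_eq_raw raw_shift q0)
qed

lemma isCont_jtheta:
 assumes "norm b<1" "b~=0" "isCont f z" "f z~=0"
 shows "isCont(%z. jtheta(f z) b) z"
proof -
 have "isCont(%w. jtheta w b)(f z)"
  using assms by(intro analytic_at_imp_isCont hol_imp_analytic[OF jtheta_holomorphic]) auto
 then show ?thesis using assms(3) by(rule isCont_o2[rotated])
qed

lemma G_inverse:
 assumes z: "z\<in>dom m" and "1/z\<in>dom(- m)"
 shows "G z m * G(1/z)(- m)*(jtheta(z * p powi m)(p^r)* jtheta(q powi m/z)(q^r))
  = (p * q) powi(- (m *(m-1) div 2))"
proof(rule isCont_eq_generic[where f = "%z. G z m * G(1/z)(- m) *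
  (jtheta(z * p powi m)(p^r)* jtheta(q powi m/z)(q^r))" and z=z and g = "%z. (p * q) powi(- (m *(m-1) div 2))"])
 have z0: "z~=0" using z by(auto simp: dom_def)
 have "isCont(%z. G(1/z)(- m)) z"
  by(rule isCont_o2[where g = "%z. G z(- m)" and f = "%z. 1/z"])
    (use z0 G_isCont[OF assms(2)] in \<open>auto intro!: continuous_intros\<close>)
 then show "isCont(%z. G z m * G(1/z)(- m) *
  (jtheta(z * p powi m)(p^r)* jtheta(q powi m/z)(q^r))) z"
  using z0 p0 q0 by(intro continuous_intros isCont_jtheta pr qr G_isCont z) auto
 show "\<forall>\<^sub>F w in at z. G w m * G(1/w)(- m) *
  (jtheta(w * p powi m)(p^r)* jtheta(q powi m/w)(q^r))=(p * q) powi(- (m *(m-1) div 2))"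
  using eventually_nonzero eventually_reg[OF z0, of m] eventually_reg_divide[OF z0, of 1 "- m"]
   eventually_dpoch_divide[OF qr pq z0, of "q powi m"] eventually_dpoch_mult[OF qr pq z0, of "q powi(- m)"]
  by eventually_elim(simp add: G_eq_raw raw_inverse)
qed simp

lemma G_reflect_pq:
 assumes z: "norm(p * q)<norm z" "norm z<1"
 shows "G z m * G(p * q/z)(- m)=1"
proof(rule isCont_eq_generic[where f = "%z. G z m * G(p * q/z)(- m)" and z=z and g = "%z. 1"])
 have z0: "z~=0" using z by auto
 have "p * q/z\<in>dom(- m)" using z z0 p0 q0 by(intro unit_disc_dom)(auto simp: norm_divide)
 then have "isCont(%z. G(p * q/z)(- m)) z"
  by(intro isCont_o2[where g = "%z. G z(- m)" and f = "%z. p * q/z"])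
    (use z0 G_isCont in \<open>auto intro!: continuous_intros\<close>)
 then show "isCont(%z. G z m * G(p * q/z)(- m)) z"
  using z0 z by(intro continuous_intros G_isCont unit_disc_dom) auto
 show "\<forall>\<^sub>F w in at z. G w m * G(p * q/w)(- m)=1"
  using eventually_nonzero eventually_reg[OF z0, of m] eventually_reg_divide[OF z0, of "p * q" "- m"]
   eventually_dpoch_divide[OF qr pq z0, of "p * q * q powi m"]
   eventually_dpoch_divide[OF pr pq z0, of "p^r *(p * q)* p powi(- m)"]
  by eventually_elim(simp add: G_eq_raw raw_reflect_pq p0 q0)
qed simp

text \<open>The value of (1 - z) G z 0 at z = 1, that is, minus the residue. Its powers finally
  cancel against the constants in \<open>kappa\<close>.\<close>

definition res0 :: complex where
 "res0=1/(qpoch_inf(p^r)(p^r)* qpoch_inf(q^r)(q^r))"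

lemma qpoch_self_nonzero: "norm a<1==>qpoch_inf a a~=0"
proof
 assume a: "norm a<1" and "qpoch_inf a a=0"
 then obtain j where "a * a^j=1" by(auto simp: qpoch_inf_eq_0_iff)
 then have "norm a^Suc j=1" by(metis norm_one norm_power power_Suc)
 then show False using a power_Suc_less_one[of "norm a" j] by(cases "norm a=0") auto
qed

lemma res0_nonzero: "res0~=0"
 using qpoch_self_nonzero pr qr by(simp add: res0_def)

lemma G_pole_0:
 obtains h where "h holomorphic_on {z. z~=0\<and>norm z * mx<1}"
  "\<And>z. z~=0==>norm z * mx<1==>z~=1==>G z 0=h z/(1-z)" "h 1=res0"
proof
 let ?s = "p * q"
 define D where "D=(%z. qpoch_inf(z * ?s) ?s * dpoch(z * p^r)(p^r) ?s)"
 have D: "dpoch z(p^r) ?s=(1-z)* D z" for z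
  unfolding D_def using dpoch_split_p[OF pr(1) pq(1), of z] qpoch_inf_split[OF pq(1), of z] by simp
 define h where "h=(%z. dpoch(p^r * ?s/z)(p^r) ?s * dpoch(?s/z)(q^r) ?s
   / (D z * dpoch(z * q^r)(q^r) ?s))"
 have n0: "D z~=0" if z: "norm z * mx<1" for z
 proof
  assume "D z=0"
  then consider j where "z * ?s * ?s^j=1" | j k where "z * p^r *(p^r)^j * ?s^k=1"
   by(auto simp: D_def qpoch_inf_eq_0_iff[OF pq(1)] dpoch_eq_0_iff[OF pr(1) pq(1)])
  then show False
  proof cases
   case 1
   then have "z * p^(Suc j)* q^(Suc j)=1" by(simp add: power_mult_distrib mult_ac)
   then show False using norm_monomial_less[OF z, of "Suc j" "Suc j"] by simp
  next
   case 2
   then have "z * p^(r+r * j+k)* q^k=1"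
    by(simp add: power_mult[symmetric] power_add power_mult_distrib mult_ac)
   then show False using norm_monomial_less[OF z, of "r+r * j+k" k] r0 by simp
  qed
 qed
 have n1: "dpoch(z * q^r)(q^r) ?s~=0" if z: "norm z * mx<1" for z
 proof
  assume "dpoch(z * q^r)(q^r) ?s=0"
  then obtain j k where "z * q^r *(q^r)^j * ?s^k=1"
   by(auto simp: dpoch_eq_0_iff[OF qr(1) pq(1)])
  then have "z * p^k * q^(r+r * j+k)=1"
   by(simp add: power_mult[symmetric] power_add power_mult_distrib mult_ac)
  then show False using norm_monomial_less[OF z, of k "r+r * j+k"] r0 by simp
 qed
 show "h holomorphic_on {z. z~=0\<and>norm z * mx<1}"
  unfolding h_def D_def
  by(intro holomorphic_intros
   holomorphic_on_compose_gen[OF _ dpoch_holomorphic[OF pr(1) pq(1)], unfolded o_def]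
   holomorphic_on_compose_gen[OF _ qpoch_inf_holomorphic[OF pq(1)], unfolded o_def]
   holomorphic_on_compose_gen[OF _ dpoch_holomorphic[OF qr(1) pq(1)], unfolded o_def])
   (use n0 n1 in \<open>auto simp: D_def\<close>)
 show "G z 0=h z/(1-z)" if "z~=0" "norm z * mx<1" "z~=1" for z
 proof -
  have "z\<in>dom 0" using that by(simp add: dom_def)
  then have "reg z 0" using r0 by(intro reg_fundamental) auto
  then show ?thesis using that q0
   by(simp add: G_eq_raw raw_eq_quot raw_quot_def D h_def mult_ac)
 qed
 have 1: "dpoch(p^r)(p^r) ?s=qpoch_inf(p^r)(p^r)* dpoch(p^r * ?s)(p^r) ?s"
  by(rule dpoch_split_q[OF pr(1) pq(1)])
 have 2: "dpoch(q^r)(q^r) ?s=qpoch_inf(q^r)(q^r)* dpoch(q^r * ?s)(q^r) ?s"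
  by(rule dpoch_split_q[OF qr(1) pq(1)])
 have 3: "dpoch ?s(q^r) ?s=qpoch_inf ?s ?s * dpoch(q^r * ?s)(q^r) ?s"
  using dpoch_split_p[OF qr(1) pq(1), of ?s] by(simp add: mult_ac)
 have "norm(1::complex)* mx<1" using mx by simp
 from n0[OF this] n1[OF this] show "h 1=res0"
  by(simp add: h_def res0_def D_def 1 2 3)
qed

text \<open>The nonvanishing quasi-period factors carry the simple pole from m = 0 to all multiples
  of r.\<close>

lemma G_pole:
 assumes "int r dvd m"
 shows "\<exists>h. h holomorphic_on {z. z~=0\<and>norm z * mx<1} \<and>
  (\<forall>z. z~=0 \<longrightarrow> norm z * mx<1 \<longrightarrow> z~=1 \<longrightarrow> G z m=h z/(1-z))\<and>h 1~=0"
 using assms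
proof(induction m rule: period_induct)
 case(1 m)
 then have "m=0" by(metis dvd_imp_le int_dvd_int_iff not_less zdvd_not_zless order_le_less)
 obtain h where h: "h holomorphic_on {z. z~=0\<and>norm z * mx<1}"
  "\<And>z. z~=0==>norm z * mx<1==>z~=1==>G z 0=h z/(1-z)" "h 1=res0"
  using G_pole_0 by blast
 show ?case unfolding \<open>m=0\<close> by(rule exI[of _ h])(use h res0_nonzero in simp)
next
 case(2 m)
 then obtain h where h: "h holomorphic_on {z. z~=0\<and>norm z * mx<1}"
  "\<And>z. z~=0==>norm z * mx<1==>z~=1==>G z m=h z/(1-z)" "h 1~=0" by auto
 show ?case
 proof(intro exI[of _ "%z. perz z m * h z"] conjI allI impI)
  show "(%z. perz z m * h z) holomorphic_on {z. z~=0\<and>norm z * mx<1}"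
   by(intro holomorphic_intros perz_holomorphic h(1)) auto
  show "G z(m+int r)=perz z m * h z/(1-z)" if "z~=0" "norm z * mx<1" "z~=1" for z
   using G_period[of z m] h(2)[OF that] that by(simp add: dom_def)
  show "perz 1 m * h 1~=0" using h(3) perz_nonzero[of 1 m] by simp
 qed
next
 case(3 m)
 then obtain h where h: "h holomorphic_on {z. z~=0\<and>norm z * mx<1}"
  "\<And>z. z~=0==>norm z * mx<1==>z~=1==>G z m=h z/(1-z)" "h 1~=0"
  using dvd_add_right_iff[of "int r" "int r" "m-int r"] by auto
 show ?case
 proof(intro exI[of _ "%z. h z/perz z(m-int r)"] conjI allI impI)
  show "(%z. h z/perz z(m-int r)) holomorphic_on {z. z~=0\<and>norm z * mx<1}"
   by(intro holomorphic_intros perz_holomorphic h(1))(auto simp: perz_nonzero)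
  show "G z(m-int r)=h z/perz z(m-int r)/(1-z)" if "z~=0" "norm z * mx<1" "z~=1" for z
   using G_period[of z "m-int r"] h(2)[OF that] that perz_nonzero[OF that(1), of "m-int r"]
   by(simp add: dom_def field_simps)
  show "h 1/perz 1(m-int r)~=0" using h(3) perz_nonzero[of 1 "m-int r"] by simp
 qed
qed

text \<open>\<open>remove_sings\<close> assigns 0 to a pole, and this default is what keeps the
  inversion formula true at the one bad point of the circle.\<close>

lemma G_at_pole:
 assumes "int r dvd m"
 shows "G 1 m=0"
proof -
 obtain h where h: "h holomorphic_on {z. z~=0\<and>norm z * mx<1}"
  "\<And>z. z~=0==>norm z * mx<1==>z~=1==>G z m=h z/(1-z)" "h 1~=0"
  using G_pole[OF assms] by auto
 have m1: "(1::complex)\<in>{z. z~=0\<and>norm z * mx<1}" using mx by simp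
 have "eventually(%w. w\<in>{z. z~=0\<and>norm z * mx<1}-{1})(at(1::complex))"
  by(rule eventually_at_in_open[OF open_punctured_disc m1])
 with eventually_G_raw[of 1 m, simplified]
 have ev: "eventually(%w. raw w m=h w/(1-w))(at 1)"
  by eventually_elim(use h(2) in auto)
 have "is_pole(%w. h w/(1-w)) 1"
 proof(rule is_pole_divide)
  show "isCont h 1" by(intro analytic_at_imp_isCont hol_imp_analytic[OF h(1) open_punctured_disc m1])
  have "((%w. 1-w)\<longlongrightarrow>0)(at(1::complex))" by(auto intro!: tendsto_eq_intros)
  then show "filterlim(%w. 1-w)(at 0)(at(1::complex))"
   by(rule filterlim_atI)(auto simp: eventually_at_filter)
 qed(rule h(3))
 then have "is_pole(%w. raw w m) 1"
  using is_pole_cong[OF ev refl] by simp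
 then show ?thesis unfolding G_eq_remove_sings by(rule remove_sings_at_pole)
qed

text \<open>On the unit circle the reflection formula also holds at the poles: there \<open>G 1 m = 0\<close>
  by convention, both sides vanish.\<close>

lemma G_inverse_circle:
 assumes "norm z=1"
 shows "1/(G z m * G(1/z)(- m))
  = (p * q) powi(m *(m-1) div 2)*(jtheta(z * p powi m)(p^r)* jtheta(q powi m/z)(q^r))"
proof(cases "z=1\<and>int r dvd m")
 case True
 then obtain k where "m=int r * k" by(auto simp: dvd_def)
 then have "p powi m=(p^r) powi k" by(simp add: power_int_mult)
 then have "jtheta(p powi m)(p^r)=0" using jtheta_eq_0_iff[OF pr, of "p powi m"] p0 by auto
 then show ?thesis using True G_at_pole[of m] by simp
next
 case False
 have z0: "z~=0" using assms by auto
 have "z\<in>dom m" "1/z\<in>dom(- m)"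
  using False assms mx z0 by(auto simp: dom_def norm_divide)
 note G=G_inverse[OF this]
 have nz: "(p * q) powi(- (m *(m-1) div 2))~=0" using p0 q0 by simp
 then have "G z m * G(1/z)(- m)~=0" using G by auto
 moreover have "1/a=t/e" if "a * t=e" "a~=0" "e~=0" for a t e :: complex
  using that by(simp add: divide_eq_eq eq_divide_eq mult_ac)
 ultimately have "1/(G z m * G(1/z)(- m))
  = (jtheta(z * p powi m)(p^r)* jtheta(q powi m/z)(q^r))/(p * q) powi(- (m *(m-1) div 2))"
  using G nz by blast
 then show ?thesis by(simp add: power_int_minus mult_ac divide_inverse)
qed

end

section \<open>Circle means: invariance, change of radius, dependence on parameters\<close>

text \<open>The contour integral of f(z)/(2 pi i z) as a plain average over the circle. In this form
  rotation, inversion and scaling are substitutions in a periodic integral.\<close>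

definition cmean :: "real => (complex => complex) => complex" where
 "cmean \<rho> f=integral {0..1} (%x. f(of_real \<rho> * exp(2 * of_real pi * \<i> * of_real x)))"

lemma norm_unit_exp [simp]: "norm(exp(2 * of_real pi * \<i> * of_real x))=1"
 by(simp add: norm_exp_eq_Re)

lemma cmean_contour:
 assumes "\<rho> > 0"
 shows "contour_integral(circlepath 0 \<rho>)(%z. f z/z)=2 * of_real pi * \<i> * cmean \<rho> f"
proof -
 have "contour_integral(circlepath 0 \<rho>)(%z. f z/z)
   = integral {0..1} (%x. 2 * of_real pi * \<i> * f(of_real \<rho> * exp(2 * of_real pi * \<i> * of_real x)))"
  unfolding contour_integral_integral
 proof(rule integral_cong)
  show "f(circlepath 0 \<rho> x)/circlepath 0 \<rho> x * vector_derivative(circlepath 0 \<rho>)(at x)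
    = 2 * of_real pi * \<i> * f(of_real \<rho> * exp(2 * of_real pi * \<i> * of_real x))" for x
   unfolding vector_derivative_circlepath using assms by(simp add: circlepath)
 qed
 then show ?thesis by(simp add: cmean_def)
qed

lemma cmean_cong:
 assumes "\<rho> \<ge> 0" "\<And>z. norm z=\<rho>==>f z=g z"
 shows "cmean \<rho> f=cmean \<rho> g"
 unfolding cmean_def by(rule integral_cong)(use assms in \<open>auto simp: norm_mult intro!: assms(2)\<close>)

lemma continuous_on_circle_param:
 fixes f :: "complex => complex"
 assumes "continuous_on(sphere 0 \<rho>) f" "\<rho> \<ge> 0"
 shows "continuous_on UNIV(%x. f(of_real \<rho> * exp(2 * of_real pi * \<i> * of_real x)))"
 by(rule continuous_on_compose2[OF assms(1)])(use assms(2) in \<open>auto intro!: continuous_intros simp: norm_mult\<close>)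

lemma cmean_integrable:
 fixes f :: "complex => complex"
 assumes "continuous_on(sphere 0 \<rho>) f" "\<rho> \<ge> 0"
 shows "(%x. f(of_real \<rho> * exp(2 * of_real pi * \<i> * of_real x))) integrable_on {0..1}"
 by(rule integrable_continuous_real, rule continuous_on_subset[OF continuous_on_circle_param[OF assms]]) simp

lemma cmean_add:
 assumes "continuous_on(sphere 0 \<rho>) f" "continuous_on(sphere 0 \<rho>) g" "\<rho> \<ge> 0"
 shows "cmean \<rho> (%z. f z+g z)=cmean \<rho> f+cmean \<rho> g"
 unfolding cmean_def by(rule integral_add)(intro cmean_integrable assms)+

lemma cmean_sum:
 assumes "finite I" "\<And>i. i\<in>I==>continuous_on(sphere 0 \<rho>)(f i)" "\<rho> \<ge> 0"
 shows "cmean \<rho> (%z. \<Sum>i\<in>I. f i z)=(\<Sum>i\<in>I. cmean \<rho> (f i))"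
 unfolding cmean_def by(rule integral_sum)(use assms cmean_integrable in auto)

lemma cmean_cmult: "cmean \<rho> (%z. c * f z)=c * cmean \<rho> f"
 by(simp add: cmean_def)

lemma cmean_minus: "cmean \<rho> (%z. - f z) = - cmean \<rho> f"
 using cmean_cmult[of \<rho> "-1" f] by simp

lemma exp_two_pi_shift: "exp(2 * of_real pi * \<i> * of_real(x+1))=exp(2 * of_real pi * \<i> * of_real x)"
 by(simp add: ring_distribs exp_add)

lemma cmean_rotate:
 assumes cont: "continuous_on(sphere 0 \<rho>) f" and \<rho>: "\<rho> \<ge> 0" and c: "norm c=1"
 shows "cmean \<rho> (%z. f(c * z))=cmean \<rho> f"
proof -
 define F where "F=(%x. f(of_real \<rho> * exp(2 * of_real pi * \<i> * of_real x)))"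
 have cF: "continuous_on S F" for S
  using continuous_on_circle_param[OF cont \<rho>] continuous_on_subset unfolding F_def by blast
 have int: "F integrable_on {a..b}" for a b by(rule integrable_continuous_real[OF cF])
 have per: "F(x+1)=F x" for x unfolding F_def exp_two_pi_shift ..
 define a where "a=Arg2pi c/(2 * pi)"
 have a: "0\<le>a" "a<1" using Arg2pi_ge_0[of c] Arg2pi_lt_2pi[of c] by(auto simp: a_def)
 have ca: "c=exp(2 * of_real pi * \<i> * of_real a)"
  using Arg2pi_eq[of c] c by(simp add: a_def mult_ac)
 have "cmean \<rho> (%z. f(c * z))=integral {0..1} (%x. F(x+a))"
  unfolding cmean_def F_def ca by(simp add: ring_distribs exp_add mult_ac)
 also have "\<dots>=integral {a..1+a} F"
  using integral_shift_real_ivl[of a a "1+a" F] by simp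
 also have "\<dots>=integral {a..1} F+integral {1..1+a} F"
  by(rule Henstock_Kurzweil_Integration.integral_combine[symmetric])(use a int in auto)
 also have "integral {1..1+a} F=integral {0..a} (%x. F(x+1))"
  using integral_shift_real_ivl[of 1 1 "1+a" F] by simp
 also have "\<dots>=integral {0..a} F" by(simp add: per)
 also have "integral {a..1} F+integral {0..a} F=integral {0..1} F"
  using Henstock_Kurzweil_Integration.integral_combine[of 0 a 1 F] a int by(simp add: add.commute)
 finally show ?thesis by(simp add: cmean_def F_def)
qed

lemma cmean_inverse:
 assumes cont: "continuous_on(sphere 0(1/\<rho>)) f" and \<rho>: "\<rho> > 0"
 shows "cmean \<rho> (%z. f(1/z))=cmean(1/\<rho>) f"
proof -
 define F where "F=(%x. f(of_real(1/\<rho>)* exp(2 * of_real pi * \<i> * of_real x)))"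
 have per: "F(x+1)=F x" for x unfolding F_def exp_two_pi_shift ..
 have "cmean \<rho> (%z. f(1/z))=integral {0..1} (%x. F(- x))"
  unfolding cmean_def F_def by(simp add: exp_minus divide_inverse)
 also have "\<dots>=integral {-1..0} F" using Henstock_Kurzweil_Integration.integral_reflect_real[of 0 "-1" F] by simp
 also have "\<dots>=integral {-1..0} (%x. F(x+1))" by(simp add: per)
 also have "\<dots>=integral {0..1} F" using integral_shift_real_ivl[of 0 1 1 F] by simp
 finally show ?thesis by(simp add: cmean_def F_def)
qed

lemma cmean_scale:
 assumes cont: "continuous_on(sphere 0(norm c * \<rho>)) f" and \<rho>: "\<rho> \<ge> 0" and c: "c~=0"
 shows "cmean \<rho> (%z. f(c * z))=cmean(norm c * \<rho>) f"
proof -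
 have "cmean(norm c * \<rho>) f=cmean(norm c * \<rho>)(%z. f(sgn c * z))"
  by(rule cmean_rotate[symmetric, OF cont])(use \<rho> c in \<open>auto simp: norm_sgn\<close>)
 also have "\<dots>=cmean \<rho> (%z. f(c * z))"
  unfolding cmean_def
 proof(rule integral_cong)
  fix x :: real
  have "sgn c * of_real(norm c)=c" using c by(simp add: sgn_div_norm scaleR_conv_of_real)
  then have "sgn c *(of_real(norm c * \<rho>)* exp(2 * of_real pi * \<i> * of_real x))
   = c *(of_real \<rho> * exp(2 * of_real pi * \<i> * of_real x))"
   by(simp only: of_real_mult mult.assoc[symmetric])
  then show "f(sgn c *(of_real(norm c * \<rho>)* exp(2 * of_real pi * \<i> * of_real x)))
   = f(c *(of_real \<rho> * exp(2 * of_real pi * \<i> * of_real x)))" by(rule arg_cong)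
 qed
 finally show ?thesis ..
qed

lemma cmean_inverse_scale:
 assumes cont: "continuous_on(sphere 0(norm c)) f" and c: "c~=0"
 shows "cmean 1(%z. f(c/z))=cmean(norm c) f"
proof -
 have "cmean 1(%z. f(c/z))=cmean 1(%z. (%w. f(c * w))(1/z))" by simp
 also have "\<dots>=cmean 1(%w. f(c * w))"
 proof -
  have "continuous_on(sphere 0 1)(%w. f(c * w))"
   by(rule continuous_on_compose2[OF cont])(auto intro!: continuous_intros simp: norm_mult)
  then show ?thesis using cmean_inverse[of 1 "%w. f(c * w)"] by simp
 qed
 also have "\<dots>=cmean(norm c) f" using cmean_scale[of c 1 f] cont c by simp
 finally show ?thesis .
qed

text \<open>Cauchy's theorem along the radial homotopy between the two circles.\<close>

lemma cmean_annulus: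
 assumes hol: "f holomorphic_on S" and S: "open S" and ab: "0<a" "a\<le>b"
  and sub: "\<And>z. a\<le>norm z==>norm z\<le>b==>z\<in>S"
 shows "cmean a f=cmean b f"
proof -
 have "homotopic_loops(S-{0})(circlepath 0 a)(circlepath 0 b)"
 proof(rule homotopic_loops_linear)
  fix t :: real
  show "closed_segment(circlepath 0 a t)(circlepath 0 b t) \<subseteq> S-{0}"
  proof
   fix w assume "w\<in>closed_segment(circlepath 0 a t)(circlepath 0 b t)"
   then obtain u where u: "0\<le>u" "u\<le>1"
    and w: "w=(1-u) *\<^sub>R circlepath 0 a t+u *\<^sub>R circlepath 0 b t"
    by(auto simp: closed_segment_def)
   have "w = of_real((1-u)* a+u * b)* exp(2 * of_real pi * \<i> * of_real t)"
    unfolding w by(simp add: circlepath scaleR_conv_of_real algebra_simps)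
   then have nw: "norm w=\<bar>(1-u)* a+u * b\<bar>" by(simp only: norm_mult norm_of_real) simp
   have "a\<le>(1-u)* a+u * b" "(1-u)* a+u * b\<le>b"
    using u ab mult_left_mono[of a b u] mult_left_mono[of a b "1-u"] by(auto simp: algebra_simps)
   then show "w\<in>S-{0}" using sub[of w] nw ab by auto
  qed
 qed auto
 moreover have "(%z. f z/z) holomorphic_on(S-{0})"
  by(intro holomorphic_intros holomorphic_on_subset[OF hol]) auto
 ultimately have "contour_integral(circlepath 0 a)(%z. f z/z)=contour_integral(circlepath 0 b)(%z. f z/z)"
  using S by(intro Cauchy_theorem_homotopic_loops[of "S-{0}"]) auto
 then show ?thesis using ab by(simp add: cmean_contour)
qed

lemma cmean_continuous_param:
 fixes f :: "'a::topological_space => complex => complex"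
 assumes cont: "continuous_on(U \<times> sphere 0 \<rho>)(%(l, z). f l z)" and \<rho>: "\<rho> \<ge> 0"
 shows "continuous_on U(%l. cmean \<rho> (f l))"
proof -
 have "continuous_on U(%l. integral(cbox 0 1)(%x. f l(of_real \<rho> * exp(2 * of_real pi * \<i> * of_real x))))"
 proof(rule integral_continuous_on_param)
  have "continuous_on(U \<times> cbox 0 1)(%y. (case(fst y, of_real \<rho> * exp(2 * of_real pi * \<i> * of_real(snd y))) of(l, z) => f l z))"
   by(rule continuous_on_compose2[OF cont])(use \<rho> in \<open>auto intro!: continuous_intros simp: norm_mult\<close>)
  then show "continuous_on(U \<times> cbox 0 1)(%(l, x). f l(of_real \<rho> * exp(2 * of_real pi * \<i> * of_real x)))"
   by(simp add: case_prod_unfold)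
 qed
 then show ?thesis by(simp add: cmean_def)
qed

text \<open>Morera's theorem: the integral over a triangle is exchanged with the one over the
  circle, and for each fixed z it vanishes.\<close>

lemma cmean_holomorphic_param:
 assumes cont: "continuous_on(U \<times> sphere 0 1)(%(l, z). f l z)" and U: "open U"
  and hol: "\<And>z. norm z=1==>(%l. f l z) holomorphic_on U"
 shows "(%l. cmean 1(f l)) holomorphic_on U"
proof -
 define F where "F=(%l. contour_integral(circlepath 0 1)(%z. f l z/z))"
 have F: "F=(%l. 2 * of_real pi * \<i> * cmean 1(f l))" by(simp add: F_def cmean_contour)
 have "F analytic_on U"
 proof(rule Morera_triangle[OF _ U], goal_cases)
  case 1
  show ?case unfolding F by(intro continuous_intros cmean_continuous_param cont) simp
 next
  case(2 a b c)
  show ?case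
  proof
   assume sub: "convex hull {a, b, c} \<subseteq> U"
   have swap: "contour_integral(linepath u v) F
     = contour_integral(circlepath 0 1)(%z. contour_integral(linepath u v)(%l. f l z/z))"
    if "closed_segment u v \<subseteq> U" for u v
    unfolding F_def
   proof(rule contour_integral_swap)
    have "continuous_on(closed_segment u v \<times> sphere 0 1)(%y. (case y of(l, z) => f l z)/snd y)"
     by(intro continuous_intros continuous_on_subset[OF cont])(use that in auto)
    then show "continuous_on(path_image(linepath u v) \<times> path_image(circlepath 0 1))(%(l, z). f l z/z)"
     by(simp add: case_prod_unfold)
    show "continuous_on {0..1} (%t. vector_derivative(circlepath 0 1)(at t))"
     unfolding vector_derivative_circlepath by(intro continuous_intros)
   qed auto
   have seg: "closed_segment a b \<subseteq> U" "closed_segment b c \<subseteq> U" "closed_segment c a \<subseteq> U"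
    using sub by(meson dual_order.trans segments_subset_convex_hull)+
   have int: "(%z. contour_integral(linepath u v)(%l. f l z/z)) contour_integrable_on(circlepath 0 1)"
    if "closed_segment u v \<subseteq> U" for u v
   proof(rule contour_integrable_continuous_circlepath)
    have "continuous_on(sphere 0 1)(%z. integral(cbox 0 1)(%x. f(linepath u v x) z/z *(v-u)))"
    proof(rule integral_continuous_on_param)
     have "continuous_on(sphere 0 1 \<times> cbox 0 1)
      (%y. (case(linepath u v(snd y), fst y) of(l, z) => f l z)/fst y *(v-u))"
      by(intro continuous_intros continuous_on_compose2[OF cont]) 
       (use that in \<open>auto intro!: continuous_intros continuous_on_compose2[OF continuous_on_linepath[of UNIV]] simp: linepath_in_path subset_iff\<close>)
     then show "continuous_on(sphere 0 1 \<times> cbox 0 1)(%(z, x). f(linepath u v x) z/z *(v-u))"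
      by(simp add: case_prod_unfold)
    qed
    then show "continuous_on(path_image(circlepath 0 1))(%z. contour_integral(linepath u v)(%l. f l z/z))"
     by(simp add: contour_integral_integral)
   qed
   have "contour_integral(linepath a b) F+contour_integral(linepath b c) F+contour_integral(linepath c a) F
     = contour_integral(circlepath 0 1)(%z. contour_integral(linepath a b)(%l. f l z/z)
      + contour_integral(linepath b c)(%l. f l z/z)+contour_integral(linepath c a)(%l. f l z/z))"
    unfolding swap[OF seg(1)] swap[OF seg(2)] swap[OF seg(3)]
    by(subst contour_integral_add; (intro contour_integrable_add int seg)?) 
     (subst contour_integral_add; (intro contour_integrable_add int seg)?; simp)
   also have "\<dots>=contour_integral(circlepath 0 1)(%z. 0)"
   proof(rule contour_integral_cong[OF refl])
    fix z assume "z\<in>path_image(circlepath 0 1)"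
    then have z: "norm z=1" by simp
    have h: "(%l. f l z/z) holomorphic_on U" using hol[OF z] z by(intro holomorphic_intros) auto
    then have c: "continuous_on(closed_segment u v)(%l. f l z/z)" if "closed_segment u v \<subseteq> U" for u v
     using holomorphic_on_imp_continuous_on continuous_on_subset that by blast
    have "((%l. f l z/z) has_contour_integral 0)(linepath a b +++ linepath b c +++ linepath c a)"
     by(rule Cauchy_theorem_triangle[OF holomorphic_on_subset[OF h sub]])
    then have "contour_integral(linepath a b +++ linepath b c +++ linepath c a)(%l. f l z/z)=0"
     by(rule contour_integral_unique)
    then show "contour_integral(linepath a b)(%l. f l z/z)
      + contour_integral(linepath b c)(%l. f l z/z)+contour_integral(linepath c a)(%l. f l z/z)=0"
     using contour_integrable_continuous_linepath[OF c[OF seg(1)]]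
      contour_integrable_continuous_linepath[OF c[OF seg(2)]]
      contour_integrable_continuous_linepath[OF c[OF seg(3)]]
     by(simp add: add.assoc)
   qed
   finally show "contour_integral(linepath a b) F+contour_integral(linepath b c) F+contour_integral(linepath c a) F=0"
    by simp
  qed
 qed
 then have "(%l. F l/(2 * of_real pi * \<i>)) holomorphic_on U"
  by(intro holomorphic_intros analytic_imp_holomorphic) auto
 then show ?thesis by(simp add: F)
qed

section \<open>Constancy of families invariant under a dilation\<close>

lemma power_int_scaling:
 fixes \<beta> x \<rho> :: real
 assumes \<beta>: "0<\<beta>" "\<beta><1" and x: "0<x" and \<rho>: "0<\<rho>"
 obtains k :: int where "\<rho> * \<beta>\<le>\<beta> powi k * x" "\<beta> powi k * x\<le>\<rho>"
proof -
 define L where "L=ln(\<rho>/x)/ln \<beta>"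
 have lb: "ln \<beta><0" using \<beta> by simp
 define k where "k=\<lceil>L\<rceil>"
 have k: "L\<le>k" "k<L+1" unfolding k_def by linarith+
 have eq: "\<beta> powi k * x=exp(k * ln \<beta>+ln x)"
  using \<beta> x by(simp add: exp_add powr_real_of_int'[symmetric] powr_def)
 have e1: "k * ln \<beta>\<le>ln(\<rho>/x)"
  using mult_right_mono_neg[OF k(1), of "ln \<beta>"] lb by(simp add: L_def)
 have e2: "k * ln \<beta> \<ge> ln(\<rho>/x)+ln \<beta>"
  using mult_right_mono_neg[OF less_imp_le[OF k(2)], of "ln \<beta>"] lb by(simp add: L_def algebra_simps)
 have "exp(k * ln \<beta>+ln x)\<le>exp(ln \<rho>)"
  unfolding exp_le_cancel_iff using e1 x \<rho> by(simp add: ln_div)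
 moreover have "exp(ln \<rho>+ln \<beta>)\<le>exp(k * ln \<beta>+ln x)"
  unfolding exp_le_cancel_iff using e2 x \<rho> by(simp add: ln_div)
 ultimately show ?thesis using eq \<rho> \<beta> by(intro that[of k])(simp_all add: exp_add)
qed

text \<open>Powers of b carry every point into one compact annulus K, and periodicity leaves
  finitely many indices. So the maximum modulus over all members is attained at an interior point
  and one member is constant. The relation between neighbours and the identity theorem spread the
  constant to all indices.\<close>

lemma dilation_family_constant:
 fixes f :: "int => complex => complex" and b :: complex and a c :: real and r :: nat
 assumes hol: "\<And>j. f j holomorphic_on {z. a<norm z\<and>norm z<c}"
  and b: "0<norm b" "norm b<1" and a: "0\<le>a" "a<norm b * c" and r: "r > 0"
  and per: "\<And>j z. a<norm z==>norm z<c==>f(j+int r) z=f j z"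
  and step: "\<And>j z. a<norm(b * z)==>norm z<c==>f(j+1)(b * z)=f j z"
 obtains C where "\<And>j z. a<norm z==>norm z<c==>f j z=C"
proof -
 let ?D = "{z::complex. a<norm z\<and>norm z<c}"
 have c: "c > 0" using a b by(smt(verit) zero_less_mult_pos)
 have D_open: "open ?D" by(intro open_Collect_conj open_Collect_less continuous_intros)
 have D_conn: "connected ?D" using connected_annulus(1)[where a = "0::complex" and ?r1.0=a and ?r2.0=c] by simp
 define \<beta> where "\<beta>=norm b"
 have "max(a/\<beta>) 0<c" using a b c by(simp add: \<beta>_def field_simps)
 \<comment> \<open>With a/\<beta> < \<rho> < c the fundamental annulus \<rho> \<beta> \<le> |z|
   \<le> \<rho> lies strictly inside the domain; the assumption a < |b| c provides the room.\<close>
 then obtain \<rho> where \<rho>: "max(a/\<beta>) 0<\<rho>" "\<rho><c" using dense by blast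
 have \<rho>': "a<\<rho> * \<beta>" "\<rho> > 0" using \<rho>(1) b by(auto simp: \<beta>_def field_simps)
 have step_n: "f(j+int k)(b^k * z)=f j z" if "a<norm(b^k * z)" "norm z<c" for j k z
  using that
 proof(induction k)
  case(Suc k)
  have le: "norm(b^Suc k * z)\<le>norm(b^k * z)"
   using b mult_right_mono[of "norm b" 1 "norm(b^k * z)"] by(simp add: norm_mult mult_ac)
  have le2: "norm(b^k * z)\<le>norm z"
   using b power_le_one[of "norm b" k] mult_right_mono[of "norm b^k" 1 "norm z"]
   by(simp add: norm_mult norm_power)
  have "f(j+int k+1)(b *(b^k * z))=f(j+int k)(b^k * z)"
   by(rule step)(use Suc.prems le le2 in \<open>auto simp: mult_ac\<close>)
  also have "\<dots>=f j z" by(rule Suc.IH)(use Suc.prems le in auto)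
  finally show ?case by(simp add: mult_ac add_ac)
 qed simp
 have step_i: "\<exists>j' z'. f j z=f j' z'\<and>\<rho> * \<beta>\<le>norm z'\<and>norm z'\<le>\<rho>" if z: "z \<in> ?D" for j z
 proof -
  have "0<norm z" using z a by auto
  then obtain k :: int where k: "\<rho> * \<beta>\<le>\<beta> powi k * norm z" "\<beta> powi k * norm z\<le>\<rho>"
   using power_int_scaling[of \<beta> "norm z" \<rho>] b \<rho>' by(auto simp: \<beta>_def)
  have n: "norm(b powi k * z)=\<beta> powi k * norm z" by(simp add: \<beta>_def norm_mult norm_power_int)
  show ?thesis
  proof(cases "k \<ge> 0")
   case True
   have bk: "b powi k * z=b^nat k * z" using True by(simp add: power_int_def)
   have "f(j+int(nat k))(b^nat k * z)=f j z"
    by(rule step_n)(use z k n \<rho>' bk in auto)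
   then show ?thesis using k n bk by metis
  next
   case False
   define w where "w=b powi k * z"
   have zw: "z=b^nat(- k)* w"
    using False b by(auto simp: w_def power_int_def field_simps)
   have "f((j-int(nat(-k)))+int(nat(-k)))(b^nat(- k)* w)=f(j-int(nat(-k))) w"
   proof(rule step_n)
    show "a<norm(b^nat(- k)* w)" unfolding zw[symmetric] using z by simp
    show "norm w<c" using k n \<rho> by(simp add: w_def)
   qed
   then have "f j z=f(j-int(nat(- k))) w" unfolding zw[symmetric] by simp
   then show ?thesis using k n unfolding w_def by metis
  qed
 qed
 have per_k: "f(j+k * int r) z=f j z" if "z \<in> ?D" for j k z
 proof(induction k rule: int_induct[where k=0])
  case(step1 i)
  then show ?case using per[of z "j+i * int r"] that by(simp add: algebra_simps)
 next
  case(step2 i)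
  then show ?case using per[of z "j+(i-1)* int r"] that by(simp add: algebra_simps)
 qed simp
 have per_mod: "f j z=f(j mod int r) z" if "z \<in> ?D" for j z
  using per_k[OF that, of "j mod int r" "j div int r"] by simp
 define K where "K={z::complex. \<rho> * \<beta>\<le>norm z\<and>norm z\<le>\<rho>}"
 have K: "compact K"
 proof -
  have "K=cball 0 \<rho> \<inter> {z. \<rho> * \<beta>\<le>norm z}" by(auto simp: K_def)
  then show ?thesis by(auto intro!: compact_Int_closed closed_Collect_le continuous_intros)
 qed
 have KD: "K \<subseteq> ?D" using \<rho> \<rho>' by(auto simp: K_def)
 have "of_real \<rho>\<in>K" using \<rho>' b mult_left_le[of \<beta> \<rho>] by(auto simp: K_def \<beta>_def)
 then have Kne: "K~={}" by auto
 have "\<exists>x\<in>K. \<forall>y\<in>K. norm(f j y)\<le>norm(f j x)" for j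
  by(rule continuous_attains_sup[OF K Kne])
   (intro continuous_intros continuous_on_subset[OF holomorphic_on_imp_continuous_on[OF hol] KD])
 then obtain x where x: "\<And>j. x j\<in>K" "\<And>j y. y\<in>K==>norm(f j y)\<le>norm(f j(x j))" by metis
 define M where "M=Max((%j. norm(f j(x j))) ` {0..<int r})"
 have ne: "(%j. norm(f j(x j))) ` {0..<int r}~={}" using r by auto
 have "M\<in>(%j. norm(f j(x j))) ` {0..<int r}" unfolding M_def by(rule Max_in[OF _ ne]) simp
 then obtain j0 where j0: "M=norm(f j0(x j0))" by auto
 have bound: "norm(f j z)\<le>M" if "z \<in> ?D" for j z
 proof -
  obtain j' z' where "f j z=f j' z'" and z': "z'\<in>K" using step_i[OF \<open>z \<in> ?D\<close>, of j] by(auto simp: K_def)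
  then have "norm(f j z)=norm(f(j' mod int r) z')" using per_mod[of z' j'] KD by auto
  also have "\<dots>\<le>norm(f(j' mod int r)(x(j' mod int r)))" by(rule x(2)[OF z'])
  also have "\<dots>\<le>M" unfolding M_def using r by(intro Max_ge) auto
  finally show ?thesis .
 qed
 have "f j0 constant_on ?D"
 proof(rule maximum_modulus_principle[OF hol D_open D_conn D_open order_refl, of "x j0"])
  show "x j0 \<in> ?D" using x(1) KD by auto
  show "norm(f j0 z)\<le>norm(f j0(x j0))" if "z \<in> ?D" for z using bound[OF that] j0 by simp
 qed
 then obtain C where C: "\<And>z. z \<in> ?D==>f j0 z=C" by(auto simp: constant_on_def)
 have extend: "f j z=C" if U: "open U" "U \<subseteq> ?D" "U~={}" "\<And>z. z\<in>U==>f j z=C" and z: "z \<in> ?D" for j U z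
 proof -
  obtain u where u: "u\<in>U" using U(3) by auto
  show ?thesis
   by(rule analytic_continuation_open[OF U(1) D_open U(3) D_conn U(2) hol, of "%_. C"])(use U(4) z in auto)
 qed
 define w where "w=complex_of_real((a/\<beta>+c)/2)"
 have acb: "a/\<beta><c" "0\<le>a/\<beta>" using a b by(auto simp: \<beta>_def field_simps)
 have nw: "norm w=(a/\<beta>+c)/2" unfolding w_def norm_of_real using acb c by simp
 then have w: "a/\<beta><norm w" "norm w<c" using acb by auto
 \<comment> \<open>The relation reaches only those z for which z/b still lies in the annulus; the
   identity theorem covers the rest.\<close>
 have up: "f(j+1) z=C" if "\<And>z. z \<in> ?D==>f j z=C" "z \<in> ?D" for j z
 proof(rule extend[OF _ _ _ _ that(2)])
  let ?U = "{z::complex. a<norm z\<and>norm z<\<beta> * c}"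
  show "open ?U" by(intro open_Collect_conj open_Collect_less continuous_intros)
  have "\<beta> * c\<le>1 * c" using b c by(intro mult_right_mono)(auto simp: \<beta>_def)
  then show "?U \<subseteq> ?D" by auto
  have "b * w \<in> ?U" using w b by(auto simp: norm_mult \<beta>_def field_simps)
  then show "?U~={}" by auto
  show "f(j+1) z=C" if "z \<in> ?U" for z
  proof -
   have z1: "b *(z/b)=z" using b by auto
   have n1: "norm(z/b)<c" using that b by(auto simp: norm_divide \<beta>_def field_simps)
   have "a * \<beta>\<le>a * 1" using a b by(intro mult_left_mono)(auto simp: \<beta>_def)
   then have "a * \<beta><norm z" using that by simp
   then have n2: "a<norm(z/b)" using b by(auto simp: norm_divide \<beta>_def field_simps)
   have "f(j+1)(b *(z/b))=f j(z/b)" by(rule step)(use that n1 z1 in auto)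
   also have "\<dots>=C" using n1 n2 \<open>\<And>z. z \<in> ?D==>f j z=C\<close> by auto
   finally show ?thesis using z1 by simp
  qed
 qed
 have down: "f(j-1) z=C" if "\<And>z. z \<in> ?D==>f j z=C" "z \<in> ?D" for j z
 proof(rule extend[OF _ _ _ _ that(2)])
  let ?U = "{z::complex. a/\<beta><norm z\<and>norm z<c}"
  show "open ?U" by(intro open_Collect_conj open_Collect_less continuous_intros)
  have "a * \<beta>\<le>a * 1" using b a by(intro mult_left_mono)(auto simp: \<beta>_def)
  then have "a\<le>a/\<beta>" using b by(simp add: \<beta>_def field_simps)
  then show "?U \<subseteq> ?D" by auto
  have "w \<in> ?U" using w by auto
  then show "?U~={}" by auto
  show "f(j-1) z=C" if "z \<in> ?U" for z
  proof -
   have n1: "a<norm(b * z)" using that b by(auto simp: norm_mult \<beta>_def field_simps)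
   have "norm(b * z)\<le>norm z" using b mult_right_mono[of "norm b" 1 "norm z"] by(simp add: norm_mult)
   then have n2: "norm(b * z)<c" using that by auto
   have "f(j-1+1)(b * z)=f(j-1) z" by(rule step)(use n1 that in auto)
   then show ?thesis using n1 n2 \<open>\<And>z. z \<in> ?D==>f j z=C\<close>[of "b * z"] by simp
  qed
 qed
 have "\<forall>z\<in>?D. f j z=C" for j
 proof(induction j rule: int_induct[where k=j0])
  case base then show ?case using C by auto
 next
  case(step1 i) then show ?case using up[of i] by auto
 next
  case(step2 i) then show ?case using down[of i] by auto
 qed
 then show ?thesis by(intro that[of C]) auto
qed

text \<open>The zeros of g are simple and shared by f, so l'Hopital's rule gives a limit of f/g at
  each of them and all singularities are removable.\<close>

lemma holomorphic_quotient:
 assumes f: "f holomorphic_on S" and g: "g holomorphic_on S" and S: "open S"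
  and zero: "\<And>a. a\<in>S==>g a=0==>f a=0\<and>deriv g a~=0"
 obtains h where "h holomorphic_on S" "\<And>z. z\<in>S==>f z=g z * h z"
proof
 let ?h = "remove_sings(%z. f z/g z)"
 have ev: "eventually(%w. w\<in>S\<and>g w~=0)(at z)" if z: "z\<in>S" for z
 proof(cases "g z=0")
  case True
  have "((%w. (g w-g z)/(w-z))\<longlongrightarrow>deriv g z)(at z)"
   using holomorphic_derivI[OF g S z] by(simp add: has_field_derivative_iff)
  then have "eventually(%w. (g w-g z)/(w-z)~=0)(at z)"
   using zero[OF z True] by(intro tendsto_imp_eventually_ne) auto
  moreover have "eventually(%w. w\<in>S)(at z)" by(rule eventually_at_in_open'[OF S z])
  ultimately show ?thesis by eventually_elim(auto simp: True)
 next
  case False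
  have "isCont g z" using g S z by(intro analytic_at_imp_isCont holomorphic_on_imp_analytic_at) auto
  then have "eventually(%w. g w~=0)(at z)" using False by(intro tendsto_imp_eventually_ne)(auto simp: isCont_def)
  moreover have "eventually(%w. w\<in>S)(at z)" by(rule eventually_at_in_open'[OF S z])
  ultimately show ?thesis by eventually_elim auto
 qed
 have an: "(%z. f z/g z) analytic_on {z}" if "z\<in>S" "g z~=0" for z
  using f g S that by(intro analytic_on_divide holomorphic_on_imp_analytic_at) auto
 have iso: "isolated_singularity_at(%z. f z/g z) z" if z: "z\<in>S" for z
 proof -
  obtain e where "e > 0" and e: "\<And>w. w~=z==>dist w z<e==>w\<in>S\<and>g w~=0"
   using ev[OF z] unfolding eventually_at by auto
  have "(%z. f z/g z) analytic_on(ball z e-{z})"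
   by(subst analytic_on_analytic_at)(use e an in \<open>auto simp: dist_commute\<close>)
  then show ?thesis using \<open>e > 0\<close> unfolding isolated_singularity_at_def by blast
 qed
 have lim: "\<exists>c. ((%w. f w/g w)\<longlongrightarrow>c)(at z)" if z: "z\<in>S" for z
 proof(cases "g z=0")
  case True
  then show ?thesis
   using lhopital_complex_simple[OF holomorphic_derivI[OF f S z] holomorphic_derivI[OF g S z]] zero[OF z True] by blast
 next
  case False
  then show ?thesis using analytic_at_imp_isCont[OF an[OF z False]] isCont_def by blast
 qed
 have "?h analytic_on S"
  by(subst analytic_on_analytic_at)(use iso lim remove_sings_analytic_at in blast)
 then show "?h holomorphic_on S" by(rule analytic_imp_holomorphic)
 show "f z=g z * ?h z" if z: "z\<in>S" for z
 proof(cases "g z=0")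
  case True then show ?thesis using zero[OF z] by simp
 next
  case False then show ?thesis using an[OF z False] by simp
 qed
qed

section \<open>Even theta functions of degree d\<close>

text \<open>Theta functions of type BC: invariant under inversion, with multiplier b^(-d) x^(-2d)
  under x -> b x. They are spanned by d + 1 of them.\<close>

definition even_theta :: "complex => nat => (complex => complex) => bool" where
 "even_theta b d f \<longleftrightarrow> f holomorphic_on(- {0})\<and>(\<forall>x. x~=0 \<longrightarrow> f(1/x)=f x) \<and>
   (\<forall>x. x~=0 \<longrightarrow> b^d * x^(2 * d)* f(b * x)=f x)"

text \<open>The even theta function of degree 1 with zeros at the b-orbits of y and 1/y; the factor
  1/x makes it antisymmetric in x and y.\<close>

definition theta_prod :: "complex => complex => complex => complex" where
 "theta_prod b x y=jtheta(x * y) b * jtheta(x/y) b/x"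

lemma even_thetaD:
 assumes "even_theta b d f"
 shows "f holomorphic_on(- {0})" "x~=0==>f(1/x)=f x"
  "x~=0==>b^d * x^(2 * d)* f(b * x)=f x"
 using assms by(auto simp: even_theta_def)

lemma even_theta_mult:
 assumes "even_theta b d f" "even_theta b e g"
 shows "even_theta b(d+e)(%x. f x * g x)"
 unfolding even_theta_def
proof(intro conjI allI impI)
 show "(%x. f x * g x) holomorphic_on(- {0})"
  by(intro holomorphic_intros even_thetaD(1)[OF assms(1)] even_thetaD(1)[OF assms(2)])
 fix x :: complex assume x: "x~=0"
 show "f(1/x)* g(1/x)=f x * g x"
  using even_thetaD(2)[OF assms(1) x] even_thetaD(2)[OF assms(2) x] by simp
 have "b^(d+e)* x^(2 *(d+e))*(f(b * x)* g(b * x))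
   = (b^d * x^(2 * d)* f(b * x))*(b^e * x^(2 * e)* g(b * x))"
  by(simp add: power_add ring_distribs mult_ac)
 then show "b^(d+e)* x^(2 *(d+e))*(f(b * x)* g(b * x))=f x * g x"
  using even_thetaD(3)[OF assms(1) x] even_thetaD(3)[OF assms(2) x] by simp
qed

lemma even_theta_const: "even_theta b 0(%_. c)"
 by(simp add: even_theta_def)

lemma even_theta_power:
 assumes "even_theta b 1 f"
 shows "even_theta b k(%x. f x^k)"
proof(induction k)
 case(Suc k)
 then show ?case using even_theta_mult[OF assms Suc] by simp
qed(simp add: even_theta_const)

lemma even_theta_cmult: "even_theta b d f==>even_theta b d(%x. c * f x)"
 using even_theta_mult[OF even_theta_const, of b d f c] by simp

lemma even_theta_diff:
 assumes "even_theta b d f" "even_theta b d g"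
 shows "even_theta b d(%x. f x-g x)"
 using assms unfolding even_theta_def by(auto intro!: holomorphic_intros simp: right_diff_distrib)

lemma even_theta_monomial:
 assumes "even_theta b 1 u" "even_theta b 1 v" "i\<le>d"
 shows "even_theta b d(%x. u x^i * v x^(d-i))"
 using even_theta_mult[OF even_theta_power[OF assms(1), of i] even_theta_power[OF assms(2), of "d-i"]] assms(3)
 by simp

lemma connected_nonzero: "connected(- {0::complex})"
 by(rule connected_punctured_universe) simp

lemma isCont_nonzero: "f holomorphic_on(- {0::complex})==>z~=0==>isCont f z"
 by(rule analytic_at_imp_isCont, rule holomorphic_on_imp_analytic_at) auto

text \<open>The factor h may vanish at z itself; it suffices that it is nonzero somewhere, for then
  its zeros are isolated.\<close>

lemma cancel_generic:
 fixes h :: "complex => complex"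
 assumes h: "h holomorphic_on(- {0})" "y~=0" "h y~=0"
  and f: "\<And>z. z~=0==>isCont f z" and g: "\<And>z. z~=0==>isCont g z"
  and eq: "\<And>z. z~=0==>h z * f z=h z * g z" and z: "z~=0"
 shows "f z=g z"
proof(rule isCont_eq_generic[where z=z])
 have "eventually(%w. h w~=0\<and>w \<in> -{0})(at z)"
  by(rule non_zero_neighbour_alt[OF h(1) _ connected_nonzero, of _ y])(use h z in auto)
 then show "eventually(%w. f w=g w)(at z)"
  by eventually_elim(use eq in auto)
qed(use f g z in auto)

context
 fixes b :: complex
 assumes b: "norm b<1" "b~=0"
begin

text \<open>Degree 0 means invariance under z -> b z, so a one-member dilation family on a punctured
  disc containing both points is constant.\<close>

lemma even_theta_0_constant:
 assumes "even_theta b 0 f"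
 obtains C where "\<And>x. x~=0==>f x=C"
proof -
 have *: "f x=f y" if xy: "x~=0" "y~=0" for x y
 proof -
  let ?c = "max(norm x)(norm y)+1"
  obtain C where C: "\<And>(j::int) z. 0<norm z==>norm z < ?c==>f z=C"
  proof(rule dilation_family_constant[of "%_. f" 0 ?c b 1])
   show "f holomorphic_on {z. 0<norm z\<and>norm z < ?c}" for j :: int
    by(rule holomorphic_on_subset[OF even_thetaD(1)[OF assms]]) auto
   have "0 < ?c" using norm_ge_zero[of x] by linarith
   then show "0<norm b * ?c" using b by simp
   show "f(b * z)=f z" if "0<norm(b * z)" for z using even_thetaD(3)[OF assms, of z] that by simp
  qed(use b in auto)
  then show ?thesis using xy by(metis add.commute less_add_one max.cobounded1 max.cobounded2 order_le_less_trans zero_less_norm_iff)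
 qed
 show ?thesis by(rule that[of "f 1"], rule *) auto
qed

lemma theta_prod_holomorphic: "y~=0==>(%x. theta_prod b x y) holomorphic_on(- {0})"
 unfolding theta_prod_def
 by(intro holomorphic_intros holomorphic_on_compose_gen[OF _ jtheta_holomorphic[OF b], unfolded o_def]) auto

lemma theta_prod_antisym:
 assumes "x~=0" "y~=0"
 shows "theta_prod b x y = - theta_prod b y x"
 using jtheta_inverse[OF b, of "x/y"] assms by(simp add: theta_prod_def mult.commute)

lemma theta_prod_inverse:
 assumes "x~=0" "y~=0"
 shows "theta_prod b(1/x) y=theta_prod b x y"
proof -
 have e: "jtheta(1/x * y) b = - jtheta(x/y) b/(x/y)" "jtheta(1/x/y) b = - jtheta(x * y) b/(x * y)"
  using jtheta_inverse[OF b, of "x/y"] jtheta_inverse[OF b, of "x * y"] assms by simp_all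
 show ?thesis unfolding theta_prod_def e using assms by simp
qed

lemma theta_prod_even:
 assumes y: "y~=0"
 shows "even_theta b 1(%x. theta_prod b x y)"
 unfolding even_theta_def
proof(intro conjI allI impI)
 fix x :: complex assume x: "x~=0"
 show "theta_prod b(1/x) y=theta_prod b x y" by(rule theta_prod_inverse)(use x y in auto)
 have e: "jtheta(b * x * y) b = - jtheta(x * y) b/(x * y)" "jtheta(b * x/y) b = - jtheta(x/y) b/(x/y)"
  using jtheta_mult_p[OF b, of "x * y"] jtheta_mult_p[OF b, of "x/y"] x y by(simp_all add: mult.assoc)
 show "b^1 * x^(2 * 1)* theta_prod b(b * x) y=theta_prod b x y"
  unfolding theta_prod_def e using x y b by(simp add: power2_eq_square)
qed(rule theta_prod_holomorphic[OF y])

lemma theta_prod_self: "x~=0==>theta_prod b x x=0"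
 using theta_prod_antisym[of x x] by simp

lemma theta_prod_eq_0:
 assumes "x~=0" "y~=0"
 shows "theta_prod b x y=0 \<longleftrightarrow> (\<exists>k::int. x * y=b powi k) \<or> (\<exists>k::int. x/y=b powi k)"
 using assms jtheta_eq_0_iff[OF b, of "x * y"] jtheta_eq_0_iff[OF b, of "x/y"] by(simp add: theta_prod_def)

lemma even_theta_powi:
 assumes "even_theta b d f" "x~=0"
 shows "f(b powi k * x)=0 \<longleftrightarrow> f x=0"
proof -
 have 1: "f(b * x)=0 \<longleftrightarrow> f x=0" if "x~=0" for x
  using even_thetaD(3)[OF assms(1) that] b that by auto
 show ?thesis
 proof(induction k rule: int_induct[where k=0])
  case(step1 i)
  then show ?case using 1[of "b powi i * x"] assms(2) b by(simp add: power_int_add mult_ac)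
 next
  case(step2 i)
  have "b powi i * x=b *(b powi(i-1)* x)"
   using b power_int_add[of b "i-1" 1] by simp
  then have "f(b powi i * x)=0 \<longleftrightarrow> f(b powi(i-1)* x)=0"
   using 1[of "b powi(i-1)* x"] assms(2) b by(metis mult_eq_0_iff power_int_eq_0_iff)
  then show ?case using step2 by simp
 qed simp
qed

lemma deriv_jtheta_compose:
 assumes "(g has_field_derivative g')(at z)" "g z~=0"
 shows "((%x. jtheta(g x) b) has_field_derivative deriv(%w. jtheta w b)(g z)* g')(at z)"
proof -
 have "((%w. jtheta w b) has_field_derivative deriv(%w. jtheta w b)(g z))(at(g z))"
  using assms(2) by(intro holomorphic_derivI[OF jtheta_holomorphic[OF b]]) auto
 then show ?thesis by(rule DERIV_chain2)(rule assms(1))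
qed

text \<open>If both theta factors vanished at x, then y^2 would be a power of b. So only one
  vanishes, and its zeros are simple.\<close>

lemma theta_prod_deriv_nonzero:
 assumes x: "x~=0" and y: "y~=0" and 0: "theta_prod b x y=0"
  and y2: "\<And>k::int. y\<^sup>2~=b powi k"
 shows "deriv(%x. theta_prod b x y) x~=0"
proof -
 let ?d = "deriv(%w. jtheta w b)"
 have d1: "((%x. jtheta(x * y) b) has_field_derivative ?d(x * y)* y)(at x)"
  by(rule deriv_jtheta_compose)(use x y in \<open>auto intro!: derivative_eq_intros\<close>)
 have d2: "((%x. jtheta(x/y) b) has_field_derivative ?d(x/y)*(1/y))(at x)"
  by(rule deriv_jtheta_compose)(use x y in \<open>auto intro!: derivative_eq_intros\<close>)
 have n: "jtheta(x * y) b * jtheta(x/y) b=0" using 0 x by(simp add: theta_prod_def)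
 have not_both: "\<not> (jtheta(x * y) b=0\<and>jtheta(x/y) b=0)"
 proof
  assume "jtheta(x * y) b=0\<and>jtheta(x/y) b=0"
  then obtain k l where "x * y=b powi k" "x/y=b powi l"
   using jtheta_eq_0_iff[OF b] x y by(metis divide_eq_0_iff mult_eq_0_iff)
  then have "y\<^sup>2=b powi(k-l)"
   using x y b by(simp add: power_int_diff power2_eq_square field_simps)
  then show False using y2 by blast
 qed
 have "((%x. theta_prod b x y) has_field_derivative
   ((?d(x * y)* y * jtheta(x/y) b+jtheta(x * y) b *(?d(x/y)*(1/y)))* x
    - jtheta(x * y) b * jtheta(x/y) b * 1)/(x * x))(at x)"
  unfolding theta_prod_def
  by(rule derivative_eq_intros d1 d2 refl x | simp add: x)+
 then have "deriv(%x. theta_prod b x y) x =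
   (?d(x * y)* y * jtheta(x/y) b+jtheta(x * y) b *(?d(x/y)*(1/y)))/x"
  using x n by(simp add: DERIV_imp_deriv)
 moreover have "?d(x * y)* y * jtheta(x/y) b+jtheta(x * y) b *(?d(x/y)*(1/y))~=0"
 proof(cases "jtheta(x * y) b=0")
  case True
  then show ?thesis using not_both jtheta_deriv_nonzero[OF b, of "x * y"] x y by auto
 next
  case False
  then have "jtheta(x/y) b=0" using n by simp
  then show ?thesis using False jtheta_deriv_nonzero[OF b, of "x/y"] x y by auto
 qed
 ultimately show ?thesis using x by simp
qed

text \<open>As X^2 is no power of b, the divisor has simple zeros, exactly on the orbit of X under
  inversion and dilation, where f vanishes too. The point Y certifies that the divisor is not
  identically zero, so the symmetries of the quotient follow by cancellation.\<close>

lemma even_theta_divide: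
 assumes f: "even_theta b(Suc d) f" and X: "X~=0" "\<And>k::int. X\<^sup>2~=b powi k" and fX: "f X=0"
  and Y: "Y~=0" "theta_prod b X Y~=0"
 obtains g where "even_theta b d g" "\<And>x. x~=0==>f x=theta_prod b x X * g x"
proof -
 let ?u = "%x. theta_prod b x X"
 note u=theta_prod_even[OF X(1)]
 obtain g where g: "g holomorphic_on(- {0})" "\<And>z. z \<in> -{0}==>f z = ?u z * g z"
 proof(rule holomorphic_quotient[OF even_thetaD(1)[OF f] even_thetaD(1)[OF u]])
  fix a :: complex assume a: "a \<in> -{0}" "?u a=0"
  have "f a=0"
  proof -
   consider k :: int where "a * X=b powi k" | k :: int where "a/X=b powi k"
    using a X theta_prod_eq_0[of a X] by auto
   then show ?thesis
   proof cases
    case 1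
    then have "a=b powi k *(1/X)" using X by(simp add: field_simps)
    then show ?thesis using even_theta_powi[OF f, of "1/X" k] even_thetaD(2)[OF f, of X] X fX by simp
   next
    case 2
    then have "a=b powi k * X" using X by(simp add: field_simps)
    then show ?thesis using even_theta_powi[OF f, of X k] X fX by simp
   qed
  qed
  then show "f a=0\<and>deriv ?u a~=0"
   using theta_prod_deriv_nonzero[of a X] a X by auto
 qed auto
 have YX: "?u Y~=0" using theta_prod_antisym[OF X(1) Y(1)] Y by simp
 have cg: "isCont g z" if "z~=0" for z using isCont_nonzero[OF g(1) that] .
 have "even_theta b d g"
  unfolding even_theta_def
 proof(intro conjI allI impI)
  fix x :: complex assume x: "x~=0"
  show "g(1/x)=g x"
  proof(rule cancel_generic[OF even_thetaD(1)[OF u] Y(1) YX _ cg _ x])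
   show "isCont(%z. g(1/z)) z" if "z~=0" for z
    by(rule isCont_o2[OF _ cg])(use that in \<open>auto intro!: continuous_intros\<close>)
   show "?u z * g(1/z) = ?u z * g z" if "z~=0" for z
   proof -
    have "?u z * g(1/z) = ?u(1/z)* g(1/z)" by(simp only: even_thetaD(2)[OF u that])
    also have "\<dots>=f(1/z)" by(rule g(2)[symmetric])(use that in simp)
    also have "\<dots>=f z" by(rule even_thetaD(2)[OF f that])
    also have "\<dots> = ?u z * g z" by(rule g(2))(use that in simp)
    finally show ?thesis .
   qed
  qed
  show "b^d * x^(2 * d)* g(b * x)=g x"
  proof(rule cancel_generic[OF even_thetaD(1)[OF u] Y(1) YX _ cg _ x])
   show "isCont(%z. b^d * z^(2 * d)* g(b * z)) z" if "z~=0" for z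
   proof -
    have "isCont(%z. g(b * z)) z"
     by(rule isCont_o2[OF _ cg])(use that b in \<open>auto intro!: continuous_intros\<close>)
    then show ?thesis by(intro continuous_intros)
   qed
   show "?u z *(b^d * z^(2 * d)* g(b * z)) = ?u z * g z" if z: "z~=0" for z
   proof -
    have "?u z=b * z\<^sup>2 * ?u(b * z)" using even_thetaD(3)[OF u z] by simp
    then have "?u z *(b^d * z^(2 * d)* g(b * z))
      = b^Suc d * z^(2 * Suc d)*(?u(b * z)* g(b * z))"
     by(simp add: power2_eq_square mult_ac)
    also have "\<dots>=f z" using even_thetaD(3)[OF f z] g(2)[of "b * z"] b z by simp
    finally show ?thesis using g(2)[of z] z by simp
   qed
  qed
 qed(rule g(1))
 then show ?thesis using g(2) by(intro that[of g]) auto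
qed

text \<open>Even theta functions of degree \<open>d\<close> are the binary forms of degree \<open>d\<close> in two of degree 1.\<close>

lemma even_theta_span:
 assumes f: "even_theta b d f" and X: "X~=0" "\<And>k::int. X\<^sup>2~=b powi k"
  and Y: "Y~=0" "theta_prod b X Y~=0"
 shows "\<exists>c. \<forall>x. x~=0 \<longrightarrow> f x=(\<Sum>i\<le>d. c i *(theta_prod b x X^i * theta_prod b x Y^(d-i)))"
 using f
proof(induction d arbitrary: f)
 case 0
 then obtain C where "\<And>x. x~=0==>f x=C" using even_theta_0_constant by blast
 then show ?case by(intro exI[of _ "%_. C"]) auto
next
 case(Suc d)
 let ?u = "%x. theta_prod b x X" and ?v = "%x. theta_prod b x Y"
 \<comment> \<open>Subtracting C times the power of the second function creates a zero at X, so the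
   difference is divisible by the first one and the degree drops.\<close>
 define C where "C=f X / ?v X^Suc d"
 have "even_theta b(Suc d)(%x. f x-C * ?v x^Suc d)"
  by(intro even_theta_diff even_theta_cmult even_theta_power theta_prod_even Suc Y)
 moreover have "f X-C * ?v X^Suc d=0" using Y by(simp add: C_def)
 ultimately obtain g where g: "even_theta b d g" "\<And>x. x~=0==>f x-C * ?v x^Suc d = ?u x * g x"
  using even_theta_divide[OF _ X _ Y] by blast
 obtain c where c: "\<And>x. x~=0==>g x=(\<Sum>i\<le>d. c i *(?u x^i * ?v x^(d-i)))"
  using Suc.IH[OF g(1)] by blast
 show ?case
 proof(intro exI[of _ "%i. case i of 0 => C | Suc j => c j"] allI impI)
  fix x :: complex assume x: "x~=0"
  have "f x=C * ?v x^Suc d + ?u x * g x" using g(2)[OF x] by(simp add: algebra_simps)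
  also have "\<dots>=C * ?v x^Suc d+(\<Sum>i\<le>d. c i *(?u x^Suc i * ?v x^(Suc d-Suc i)))"
   unfolding c[OF x] sum_distrib_left by(simp add: mult_ac)
  also have "\<dots>=(\<Sum>i\<le>Suc d. (case i of 0 => C | Suc j => c j)*(?u x^i * ?v x^(Suc d-i)))"
   by(subst sum.atMost_Suc_shift) simp
  finally show "f x=\<dots>" .
 qed
qed

text \<open>Weierstrass' three-term relation: the left side is an even theta function of degree 1 in
  x, and its two coefficients are read off at X and Y. It exhibits the interaction of two variables
  as a 2 x 2 determinant and thus the product over pairs as a Vandermonde determinant.\<close>

lemma theta_prod_relation:
 assumes X: "X~=0" "\<And>k::int. X\<^sup>2~=b powi k" and Y: "Y~=0" "theta_prod b X Y~=0"
  and "x~=0" "y~=0"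
 shows "theta_prod b x y * theta_prod b X Y
  = theta_prod b x X * theta_prod b y Y-theta_prod b x Y * theta_prod b y X"
proof -
 obtain c where c: "\<And>x. x~=0==>theta_prod b x y=(\<Sum>i\<le>1. c i *(theta_prod b x X^i * theta_prod b x Y^(1-i)))"
  using even_theta_span[OF theta_prod_even[OF assms(6)] X Y] by blast
 then have e: "theta_prod b x y=c 0 * theta_prod b x Y+c 1 * theta_prod b x X" if "x~=0" for x
  using that by simp
 have "theta_prod b X y=c 0 * theta_prod b X Y" using e[OF X(1)] theta_prod_self[OF X(1)] by simp
 moreover have "theta_prod b Y y=c 1 * theta_prod b Y X" using e[OF Y(1)] theta_prod_self[OF Y(1)] by simp
 moreover have "theta_prod b Y X = - theta_prod b X Y" "theta_prod b X y = - theta_prod b y X"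
   "theta_prod b Y y = - theta_prod b y Y"
  by(simp_all only: theta_prod_antisym[OF Y(1) X(1)] theta_prod_antisym[OF X(1) assms(6)] theta_prod_antisym[OF Y(1) assms(6)])
 ultimately have c0: "c 0 * theta_prod b X Y = - theta_prod b y X" and c1: "c 1 * theta_prod b X Y=theta_prod b y Y"
  by(metis, metis minus_equation_iff mult_minus_right)
 have "theta_prod b x y * theta_prod b X Y
  = (c 0 * theta_prod b X Y)* theta_prod b x Y+(c 1 * theta_prod b X Y)* theta_prod b x X"
  using e[OF assms(5)] by(simp add: algebra_simps)
 then show ?thesis unfolding c0 c1 by(simp add: algebra_simps)
qed

text \<open>The theta quotient behind the difference equation of the integrand.\<close>

lemma even_theta_shift_function:
 fixes x :: "'i => complex"
 assumes S: "finite S" "card S=2 * n+4" and x: "\<And>a. a\<in>S==>x a~=0" and prod: "(\<Prod>a\<in>S. x a)=1"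
 obtains F where "even_theta b n F" "\<And>z. z~=0 ==>
   F z * jtheta(z\<^sup>2) b=(\<Prod>a\<in>S. jtheta(x a * z) b)/z^(n+1)-z^(n+3)*(\<Prod>a\<in>S. jtheta(x a/z) b)"
proof -
 define y where "y=(%z. (\<Prod>a\<in>S. jtheta(x a * z) b)/z^(n+1))"
 define Y where "Y=(%z. y z-z\<^sup>2 * y(1/z))"
 have y_hol: "y holomorphic_on(- {0})"
  unfolding y_def
  by(intro holomorphic_intros holomorphic_on_compose_gen[OF _ jtheta_holomorphic[OF b], unfolded o_def])(use x in auto)
 have Y_hol: "Y holomorphic_on(- {0})"
  unfolding Y_def
  by(intro holomorphic_intros y_hol holomorphic_on_compose_gen[OF _ y_hol, unfolded o_def]) auto
 have yb: "b^(n+1)* z^(2 * n+4)* y(b * z)=y z" if z: "z~=0" for z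
 proof -
  have "(\<Prod>a\<in>S. jtheta(x a *(b * z)) b)=(\<Prod>a\<in>S. jtheta(x a * z) b *(- 1/z)*(1/x a))"
  proof(rule prod.cong[OF refl])
   fix a assume "a\<in>S"
   then show "jtheta(x a *(b * z)) b=jtheta(x a * z) b *(- 1/z)*(1/x a)"
    using jtheta_mult_p[OF b, of "x a * z"] x z by(simp add: mult_ac)
  qed
  also have "\<dots>=(\<Prod>a\<in>S. jtheta(x a * z) b)*(- 1/z)^(2 * n+4)"
   unfolding prod.distrib prod_dividef prod by(simp add: S power_one_over)
  also have "(- 1/z)^(2 * n+4)=1/z^(2 * n+4)"
   by(simp add: power_divide power_minus_even)
  finally have "y(b * z)=(\<Prod>a\<in>S. jtheta(x a * z) b)*(1/z^(2 * n+4))/(b * z)^(n+1)"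
   unfolding y_def by simp
  then show ?thesis using z b by(simp add: y_def power_mult_distrib)
 qed
 have Yb: "b^(n+1)* z^(2 * n+4)* Y(b * z)=Y z" if z: "z~=0" for z
 proof -
  have "b^(n+1)*(1/(b * z))^(2 * n+4)* y(b *(1/(b * z)))=y(1/(b * z))"
   by(rule yb)(use z b in auto)
  then have "y(1/(b * z))=b^(n+1)/(b * z)^(2 * n+4)* y(1/z)"
   using b by(simp add: power_divide)
  then have "b^(n+1)* z^(2 * n+4)*((b * z)\<^sup>2 * y(1/(b * z)))
   = b^(n+1)* z^(2 * n+4)*((b * z)\<^sup>2 *(b^(n+1)/(b * z)^(2 * n+4)* y(1/z)))" by simp
  also have "\<dots>=z\<^sup>2 * y(1/z)"
  proof -
   have "(b * z)^(2 * n+4)=b^(n+1)* b^(n+1)* b\<^sup>2 * z^(2 * n+4)"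
   proof -
    have "b^(2 * n+4)=b^((n+1)+(n+1)+2)" by(rule arg_cong[of _ _ "%k. b^k"]) simp
    also have "\<dots>=b^(n+1)* b^(n+1)* b\<^sup>2" by(simp only: power_add)
    finally show ?thesis by(simp only: power_mult_distrib)
   qed
   then show ?thesis using b z by(simp add: power_mult_distrib)
  qed
  finally have "b^(n+1)* z^(2 * n+4)* Y(b * z)
   = b^(n+1)* z^(2 * n+4)* y(b * z)-z\<^sup>2 * y(1/z)"
   unfolding Y_def right_diff_distrib by simp
  then show ?thesis using yb[OF z] by(simp add: Y_def)
 qed
 \<comment> \<open>Modulo powers of b a zero of the theta function of z^2 is a point w with w^2 = 1
   or w^2 = b. There 1/w is w or w/b, and the two terms of Y cancel.\<close>
 have Y0: "Y z=0" if z: "z~=0" "jtheta(z\<^sup>2) b=0" for z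
 proof -
  have Y_shift: "Y(b powi k * z)=0 \<longleftrightarrow> Y z=0" if "z~=0" for k z
  proof -
   have 1: "Y(b * z)=0 \<longleftrightarrow> Y z=0" if "z~=0" for z
    using Yb[OF that] b that by auto
   show ?thesis
   proof(induction k rule: int_induct[where k=0])
    case(step1 i)
    then show ?case using 1[of "b powi i * z"] that b by(simp add: power_int_add mult_ac)
   next
    case(step2 i)
    have "b powi i * z=b *(b powi(i-1)* z)" using b power_int_add[of b "i-1" 1] by simp
    then have "Y(b powi i * z)=0 \<longleftrightarrow> Y(b powi(i-1)* z)=0"
     using 1[of "b powi(i-1)* z"] that b by(metis mult_eq_0_iff power_int_eq_0_iff)
    then show ?case using step2 by simp
   qed simp
  qed
  obtain k where k: "z\<^sup>2=b powi k" using z jtheta_eq_0_iff[OF b, of "z\<^sup>2"] by auto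
  define w where "w=b powi(- (k div 2))* z"
  have w0: "w~=0" using z b by(simp add: w_def)
  have "w\<^sup>2=b powi(- (k div 2))* b powi(- (k div 2))* b powi k"
   by(simp only: w_def power_mult_distrib k power2_eq_square[of "b powi(- (k div 2))"])
  also have "\<dots>=b powi(- (k div 2) + - (k div 2)+k)"
   using b by(simp only: power_int_add disjI1[OF b(2)] simp_thms)
  also have "- (k div 2) + - (k div 2)+k=k mod 2" by presburger
  finally have w2: "w\<^sup>2=b powi(k mod 2)" .
  have "Y w=0"
  proof(cases "even k")
   case True
   then have "w * w=1" using w2 by(simp add: power2_eq_square)
   then have "1/w=w" using w0 by(simp add: divide_eq_eq)
   then show ?thesis using \<open>w * w=1\<close> by(simp add: Y_def power2_eq_square)
  next
   case False
   then have wb: "w\<^sup>2=b" using w2 by(simp add: odd_iff_mod_2_eq_one)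
   have inv: "b *(1/w)=w" using wb w0 by(simp add: power2_eq_square[symmetric] divide_eq_eq)
   have "b^(n+1)*(1/w)^(2 * n+4)* y w=y(1/w)"
    using yb[of "1/w"] w0 unfolding inv by simp
   moreover have "(1/w)^(2 * n+4)=1/b^(n+2)"
   proof -
    have "w^(2 * n+4)=w^(2 *(n+2))" by(rule arg_cong[of _ _ "%k. w^k"]) simp
    also have "\<dots>=(w\<^sup>2)^(n+2)" by(rule power_mult)
    finally have "w^(2 * n+4)=(w\<^sup>2)^(n+2)" .
    then show ?thesis by(simp add: wb power_divide)
   qed
   ultimately have "y w=b * y(1/w)" using b by(simp add: field_simps)
   then show ?thesis by(simp add: Y_def wb)
  qed
  then show ?thesis using Y_shift[of z "- (k div 2)"] z by(simp add: w_def)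
 qed
 let ?g = "%z. jtheta(z\<^sup>2) b"
 have g_hol: "?g holomorphic_on(- {0})"
  by(intro holomorphic_on_compose_gen[OF _ jtheta_holomorphic[OF b], unfolded o_def] holomorphic_intros) auto
 obtain F where F: "F holomorphic_on(- {0})" "\<And>z. z \<in> -{0}==>Y z = ?g z * F z"
 proof(rule holomorphic_quotient[OF Y_hol g_hol])
  fix a :: complex assume a: "a \<in> -{0}" "?g a=0"
  have "(?g has_field_derivative deriv(%w. jtheta w b)(a\<^sup>2)*(2 * a))(at a)"
   by(rule deriv_jtheta_compose)(use a in \<open>auto intro!: derivative_eq_intros\<close>)
  then have "deriv ?g a=deriv(%w. jtheta w b)(a\<^sup>2)*(2 * a)" by(rule DERIV_imp_deriv)
  then show "Y a=0\<and>deriv ?g a~=0" using a Y0[of a] jtheta_deriv_nonzero[OF b, of "a\<^sup>2"] by simp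
 qed auto
 \<comment> \<open>A square root of -1 serves as witness for \<open>cancel_generic\<close>: -1 is no
   power of b.\<close>
 obtain c where c: "c~=0" "?g c~=0"
 proof -
  define c where "c=csqrt(-1)"
  have c2: "c\<^sup>2 = -1" by(simp add: c_def)
  have "jtheta(-1) b~=0"
  proof
   assume "jtheta(-1) b=0"
   then obtain k where "b powi k = -1" using jtheta_eq_0_iff[OF b, of "-1"] by auto
   then have nb: "norm b powi k=1" by(metis norm_minus_cancel norm_one norm_power_int)
   have "k=0"
   proof(rule ccontr)
    assume "k~=0"
    then consider "k > 0" | "- k > 0" by linarith
    then show False
    proof cases
     case 1
     then have "norm b^nat k<1" using b power_less_one_iff[of "norm b" "nat k"] by auto
     then show False using nb 1 by(simp add: power_int_def)
    next
     case 2
     then have "norm b^nat(- k)<1" using b power_less_one_iff[of "norm b" "nat(- k)"] by auto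
     then show False using nb 2 by(simp add: power_int_def power_inverse split: if_splits)
    qed
   qed
   then show False using \<open>b powi k = -1\<close> by simp
  qed
  then show ?thesis using c2 by(intro that[of c]) auto
 qed
 have cF: "isCont F z" if "z~=0" for z using isCont_nonzero[OF F(1) that] .
 have "even_theta b n F"
  unfolding even_theta_def
 proof(intro conjI allI impI)
  fix z :: complex assume z: "z~=0"
  show "F(1/z)=F z"
  proof(rule cancel_generic[OF g_hol c _ cF _ z])
   show "isCont(%z. F(1/z)) z" if "z~=0" for z
    by(rule isCont_o2[OF _ cF])(use that in \<open>auto intro!: continuous_intros\<close>)
   show "?g z * F(1/z) = ?g z * F z" if z: "z~=0" for z
   proof -
    have "?g(1/z) = - ?g z/z\<^sup>2" using jtheta_inverse[OF b, of "z\<^sup>2"] z by(simp add: power_divide)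
    moreover have "Y(1/z) = - Y z/z\<^sup>2" using z by(simp add: Y_def power_divide field_simps)
    ultimately have "- Y z/z\<^sup>2 = - ?g z/z\<^sup>2 * F(1/z)" using F(2)[of "1/z"] z by simp
    then have "?g z * F(1/z)=Y z" using z by(simp add: field_simps)
    then show ?thesis using F(2)[of z] z by simp
   qed
  qed
  show "b^n * z^(2 * n)* F(b * z)=F z"
  proof(rule cancel_generic[OF g_hol c _ cF _ z])
   show "isCont(%z. b^n * z^(2 * n)* F(b * z)) z" if "z~=0" for z
   proof -
    have "isCont(%z. F(b * z)) z"
     by(rule isCont_o2[OF _ cF])(use that b in \<open>auto intro!: continuous_intros\<close>)
    then show ?thesis by(intro continuous_intros)
   qed
   show "?g z *(b^n * z^(2 * n)* F(b * z)) = ?g z * F z" if z: "z~=0" for z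
   proof -
    have "(b * z)\<^sup>2=b *(b * z\<^sup>2)" by(simp add: power2_eq_square)
    then have "?g(b * z) = ?g z/(z\<^sup>2 *(b * z\<^sup>2))"
     using jtheta_mult_p[OF b, of "b * z\<^sup>2"] jtheta_mult_p[OF b, of "z\<^sup>2"] z b by simp
    then have "?g z=b * z^4 * ?g(b * z)" using z b by(simp add: power2_eq_square power4_eq_xxxx)
    then have "?g z *(b^n * z^(2 * n)* F(b * z))=b^(n+1)* z^(2 * n+4)*(?g(b * z)* F(b * z))"
     by(simp add: power_add mult_ac)
    also have "\<dots>=Y z" using F(2)[of "b * z"] Yb[OF z] z b by simp
    finally show ?thesis using F(2)[of z] z by simp
   qed
  qed
 qed(rule F(1))
 moreover have "F z * jtheta(z\<^sup>2) b=(\<Prod>a\<in>S. jtheta(x a * z) b)/z^(n+1)-z^(n+3)*(\<Prod>a\<in>S. jtheta(x a/z) b)"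
  if "z~=0" for z
 proof -
  have "z\<^sup>2 * y(1/z)=z^(n+3)*(\<Prod>a\<in>S. jtheta(x a/z) b)"
   by(simp add: y_def power_divide power_add[symmetric] numeral_eq_Suc mult_ac)
  then show ?thesis using F(2)[of z] that by(simp add: Y_def y_def mult.commute)
 qed
 ultimately show ?thesis by(rule that)
qed

end

text \<open>The class containing F(x) times the theta function of x^2, for F even of degree k - 1.
  In this product the sign under inversion comes from the second factor.\<close>

definition odd_theta :: "complex => nat => (complex => complex) => bool" where
 "odd_theta b k f \<longleftrightarrow> f holomorphic_on(- {0})\<and>(\<forall>x. x~=0 \<longrightarrow> x\<^sup>2 * f(1/x) = - f x) \<and>
   (\<forall>x. x~=0 \<longrightarrow> b^k * x^(2 * k+2)* f(b * x)=f x)"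

lemma even_theta_imp_odd_theta:
 assumes b: "norm b<1" "b~=0" and F: "even_theta b d F"
 shows "odd_theta b(Suc d)(%x. F x * jtheta(x\<^sup>2) b)"
 unfolding odd_theta_def
proof(intro conjI allI impI)
 show "(%x. F x * jtheta(x\<^sup>2) b) holomorphic_on(- {0})"
  by(intro holomorphic_intros even_thetaD(1)[OF F]
   holomorphic_on_compose_gen[OF _ jtheta_holomorphic[OF b], unfolded o_def]) auto
 fix z :: complex assume z: "z~=0"
 have "jtheta((1/z)\<^sup>2) b = - jtheta(z\<^sup>2) b/z\<^sup>2" using jtheta_inverse[OF b, of "z\<^sup>2"] z by(simp add: power_divide)
 then show "z\<^sup>2 *(F(1/z)* jtheta((1/z)\<^sup>2) b) = - (F z * jtheta(z\<^sup>2) b)"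
  using even_thetaD(2)[OF F z] z by simp
 have "(b * z)\<^sup>2=b *(b * z\<^sup>2)" by(simp add: power2_eq_square)
 then have "jtheta((b * z)\<^sup>2) b=jtheta(z\<^sup>2) b/(z\<^sup>2 *(b * z\<^sup>2))"
  using jtheta_mult_p[OF b, of "b * z\<^sup>2"] jtheta_mult_p[OF b, of "z\<^sup>2"] z b by simp
 then have "b * z^4 * jtheta((b * z)\<^sup>2) b=jtheta(z\<^sup>2) b"
  using z b by(simp add: power2_eq_square power4_eq_xxxx)
 moreover have "b^Suc d * z^(2 * Suc d+2)*(F(b * z)* jtheta((b * z)\<^sup>2) b)
   = (b^d * z^(2 * d)* F(b * z))*(b * z^4 * jtheta((b * z)\<^sup>2) b)"
  by(simp add: power_add mult_ac power2_eq_square power4_eq_xxxx)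
 ultimately show "b^Suc d * z^(2 * Suc d+2)*(F(b * z)* jtheta((b * z)\<^sup>2) b)=F z * jtheta(z\<^sup>2) b"
  using even_thetaD(3)[OF F z] by simp
qed

lemma odd_thetaD:
 assumes "odd_theta b k f"
 shows "f holomorphic_on(- {0})" "x~=0==>x\<^sup>2 * f(1/x) = - f x"
  "x~=0==>b^k * x^(2 * k+2)* f(b * x)=f x"
 using assms by(auto simp: odd_theta_def)

text \<open>The reflection m -> K - m permutes the residues modulo r.\<close>

lemma sum_reflect_periodic:
 fixes c :: "int => 'a::comm_monoid_add"
 assumes r: "r > 0" and per: "\<And>m. c(m+int r)=c m"
 shows "(\<Sum>m\<in>{0..<int r}. c(K-m))=(\<Sum>m\<in>{0..<int r}. c m)"
proof -
 have per_k: "c(m+k * int r)=c m" for m k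
 proof(induction k rule: int_induct[where k=0])
  case(step1 i)
  then show ?case using per[of "m+i * int r"] by(simp add: algebra_simps)
 next
  case(step2 i)
  then show ?case using per[of "m+(i-1)* int r"] by(simp add: algebra_simps)
 qed simp
 have mod: "c m=c(m mod int r)" for m
  using per_k[of "m mod int r" "m div int r"] by simp
 have "(\<Sum>m\<in>{0..<int r}. c(K-m))=(\<Sum>m\<in>{0..<int r}. c((K-m) mod int r))"
  using mod by simp
 also have "\<dots>=(\<Sum>m\<in>{0..<int r}. c m)"
 proof(rule sum.reindex_bij_witness[of _ "%m. (K-m) mod int r" "%m. (K-m) mod int r"])
  show "(K-(K-m) mod int r) mod int r=m" if "m\<in>{0..<int r}" for m
   using that by(simp add: mod_diff_right_eq)
  show "(K-(K-m) mod int r) mod int r=m" if "m\<in>{0..<int r}" for m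
   using that by(simp add: mod_diff_right_eq)
 qed(use r in auto)
 finally show ?thesis .
qed

text \<open>Exponents over all parameters are brought to this form, because the balancing conditions
  evaluate precisely the two sums on the right.\<close>

lemma sum_affine: "(\<Sum>a\<in>S. c0+c1 * x a+c2 * of_int(k a))
  = of_nat(card S)* c0+c1 *(\<Sum>a\<in>S. x a)+c2 * of_int(\<Sum>a\<in>S. k a)" for c0 c1 c2 :: complex
 by(simp add: sum.distrib sum_distrib_left)

section \<open>The one-variable integrand and its symmetries\<close>

context rarefied
begin

text \<open>The variables z p^(m + \<epsilon>/2) and, in \<open>zq\<close>, q^(m + \<epsilon>/2)/z.
  Raising m by r multiplies them by p^r and q^r, so theta functions of these nomes perceive the
  discrete variable as a dilation.\<close>

definition zp :: "complex => int => complex" where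
 "zp z m=z * exp(of_int(2 * m+\<epsilon>)* lp/2)"

definition zq :: "complex => int => complex" where
 "zq z m=exp(of_int(2 * m+\<epsilon>)* lq/2)/z"

definition EE :: "int => int" where "EE m=m *(m+\<epsilon>)"

definition B :: "complex => int => complex => int => complex" where
 "B t \<nu> z m=G(t * z)(\<nu>+m+\<epsilon>)* G(t/z)(\<nu>-m)"

text \<open>The integrand with arbitrary functions f and g inserted. The power of pq collects the
  elementary factors of the reciprocal gamma functions, and the factor with exponent \<delta> is the
  one that a q-shift of one parameter produces.\<close>

definition core :: "nat set => nat => nat => (nat => complex) => (nat => int) =>
  (complex => complex) => (complex => complex) => complex => int => complex" where
 "core S N \<delta> t \<nu> f g z m=f(zp z m)* g(zq z m)*(z powi(2 * m+\<epsilon>)* p powi(EE m))^\<delta>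
   *(p * q) powi(int(N+1)* EE m-m)*(\<Prod>a\<in>S. B(t a)(\<nu> a) z m)"

text \<open>With \<delta> = 0 this is the condition of the theorem. With \<delta> = 1 one factor q
  and one unit of the discrete sum are missing; raising any single parameter restores them.\<close>

definition balanced :: "nat set => nat => nat => (nat => complex) => (nat => int) => bool" where
 "balanced S N \<delta> t \<nu> \<longleftrightarrow> finite S\<and>card S=2 * N+4\<and>(\<forall>a\<in>S. t a~=0\<and>norm(t a)<1)\<and>\<delta>\<le>1 \<and>
   (\<Prod>a\<in>S. t a)=p * q^(1-\<delta>)\<and>(\<Sum>a\<in>S. 2 * \<nu> a+\<epsilon>) = - 2 * int \<delta>"

lemma zp_nonzero [simp]: "zp z m=0 \<longleftrightarrow> z=0" and zq_nonzero [simp]: "zq z m=0 \<longleftrightarrow> z=0"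
 by(simp_all add: zp_def zq_def)

lemma pr_exp: "p^r=exp(of_nat r * lp)" and qr_exp: "q^r=exp(of_nat r * lq)"
 by(simp_all add: lp lq exp_of_nat_mult)

lemma zp_period: "zp z(m+int r)=p^r * zp z m"
 unfolding zp_def pr_exp by(simp add: exp_add[symmetric] field_simps)

lemma zq_period: "zq z(m+int r)=q^r * zq z m"
 unfolding zq_def qr_exp by(simp add: exp_add[symmetric] field_simps)

lemma zp_exp: "zp(exp l) m=exp(l + of_int(2 * m+\<epsilon>)* lp/2)"
 by(simp add: zp_def exp_add)

lemma zq_exp: "zq(exp l) m=exp(of_int(2 * m+\<epsilon>)* lq/2-l)"
 by(simp add: zq_def exp_diff)

lemma zp_zq:
 assumes "z~=0"
 shows "(zp z m)\<^sup>2 *(zq z m)\<^sup>2=(p * q) powi(2 * m+\<epsilon>)"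
proof -
 obtain l where l: "z=exp l" using assms by(metis exp_Ln)
 have "(p * q) powi(2 * m+\<epsilon>)=exp(of_int(2 * m+\<epsilon>)*(lp+lq))"
  by(simp only: lp lq exp_add[symmetric] powi_exp)
 moreover have "(zp z m)\<^sup>2 *(zq z m)\<^sup>2=exp(of_int(2 * m+\<epsilon>)*(lp+lq))"
  unfolding l zp_exp zq_exp power2_eq_square exp_add[symmetric]
  by(rule arg_cong[of _ _ exp])(simp add: field_simps)
 ultimately show ?thesis by simp
qed

lemma odd_theta_exp:
 assumes "odd_theta(exp b) k f"
 shows "f(exp b * exp x)=exp(- (of_nat k * b) - of_nat(2 * k+2)* x)* f(exp x)"
proof -
 have "exp b^k * exp x^(2 * k+2)=exp(of_nat k * b + of_nat(2 * k+2)* x)"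
  by(simp only: exp_of_nat_mult exp_add)
 then have "exp(of_nat k * b + of_nat(2 * k+2)* x)* f(exp b * exp x)=f(exp x)"
  using odd_thetaD(3)[OF assms, of "exp x"] by simp
 then have "exp(- (of_nat k * b + of_nat(2 * k+2)* x))*(exp(of_nat k * b + of_nat(2 * k+2)* x)* f(exp b * exp x))
  = exp(- (of_nat k * b + of_nat(2 * k+2)* x))* f(exp x)" by simp
 then show ?thesis by(simp add: mult.assoc[symmetric] exp_add[symmetric])
qed

lemma B_period:
 assumes "exp L * exp l\<in>dom(\<nu>+m+\<epsilon>)" "exp L/exp l\<in>dom(\<nu>-m)"
 shows "B(exp L) \<nu> (exp l)(m+int r)=exp(of_int(int r-1) *
   (of_int(2 * m+\<epsilon>+int r)*(L + of_real pi * \<i>) + of_int(2 * \<nu>+\<epsilon>)* l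
    + of_int(2 * m+\<epsilon>+int r)* of_int(2 * \<nu>+\<epsilon>-1)/2 * lp
    - of_int(2 * m+\<epsilon>+int r)* of_int(2 * \<nu>+\<epsilon>+1)/2 * lq))* B(exp L) \<nu> (exp l) m"
proof -
 have 1: "G(exp L * exp l)(\<nu>+m+\<epsilon>+int r)=exp(per(L+l)(\<nu>+m+\<epsilon>))* G(exp L * exp l)(\<nu>+m+\<epsilon>)"
  using G_period[OF assms(1)] perz_exp[of "L+l"] by(simp add: exp_add)
 have "exp L/exp l\<in>dom(\<nu>-m-int r)" using assms(2) by(simp add: dom_period)
 then have "G(exp L/exp l)(\<nu>-m)=exp(per(L-l)(\<nu>-m-int r))* G(exp L/exp l)(\<nu>-m-int r)"
  using G_period[of "exp L/exp l" "\<nu>-m-int r"] perz_exp[of "L-l"] by(simp add: exp_diff)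
 then have 2: "G(exp L/exp l)(\<nu>-m-int r)=exp(- per(L-l)(\<nu>-m-int r))* G(exp L/exp l)(\<nu>-m)"
  by(simp add: mult.assoc[symmetric] exp_add[symmetric])
 have 3: "per(L+l)(\<nu>+m+\<epsilon>)+(- per(L-l)(\<nu>-m-int r)) = of_int(int r-1) *
   (of_int(2 * m+\<epsilon>+int r)*(L + of_real pi * \<i>) + of_int(2 * \<nu>+\<epsilon>)* l
    + of_int(2 * m+\<epsilon>+int r)* of_int(2 * \<nu>+\<epsilon>-1)/2 * lp
    - of_int(2 * m+\<epsilon>+int r)* of_int(2 * \<nu>+\<epsilon>+1)/2 * lq)"
  unfolding per_def by(simp add: field_simps power2_eq_square)
 have 4: "\<nu>+(m+int r)+\<epsilon>=\<nu>+m+\<epsilon>+int r" "\<nu>-(m+int r)=\<nu>-m-int r" by simp_all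
 have "B(exp L) \<nu> (exp l)(m+int r)
  = exp(per(L+l)(\<nu>+m+\<epsilon>)+(- per(L-l)(\<nu>-m-int r)))* B(exp L) \<nu> (exp l) m"
  unfolding B_def 4 1 2 exp_add by(simp only: mult_ac)
 then show ?thesis unfolding 3 .
qed

text \<open>The principal logarithms satisfy the balancing condition only modulo 2 pi i. The integer
  \<kappa> is carried along and disappears from every exponential.\<close>

lemma balanced_log:
 assumes "balanced S N \<delta> t \<nu>"
 obtains \<kappa> :: int where "(\<Sum>a\<in>S. Ln(t a))=lp + of_nat(1-\<delta>)* lq+2 * of_int \<kappa> * of_real pi * \<i>"
proof -
 have "exp(\<Sum>a\<in>S. Ln(t a))=(\<Prod>a\<in>S. t a)"
  using assms by(subst exp_sum)(auto simp: balanced_def intro!: prod.cong)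
 also have "\<dots>=p * q^(1-\<delta>)" using assms by(simp add: balanced_def)
 also have "\<dots>=exp(lp + of_nat(1-\<delta>)* lq)"
  by(simp add: lp lq exp_add exp_of_nat_mult)
 finally obtain n :: int where "(\<Sum>a\<in>S. Ln(t a))=lp + of_nat(1-\<delta>)* lq + of_real(of_int(2 * n)* pi)* \<i>"
  unfolding exp_eq by blast
 then show ?thesis by(intro that[of n])(simp add: mult_ac)
qed

text \<open>The annulus around the unit circle where the arguments t_a z and t_a/z stay in the unit
  disc, so that no pole of a gamma factor is met.\<close>

definition ann :: "nat set => (nat => complex) => complex set" where
 "ann S t={z. z~=0\<and>(\<forall>a\<in>S. norm(t a)<norm z\<and>norm(t a)* norm z<1)}"

lemma circle_ann: "balanced S N \<delta> t \<nu>==>norm z=1==>z\<in>ann S t"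
 by(auto simp: ann_def balanced_def)

lemma ann_disc:
 assumes "balanced S N \<delta> t \<nu>" "z\<in>ann S t" "a\<in>S"
 shows "z~=0" "t a * z~=0" "norm(t a * z)<1" "t a/z~=0" "norm(t a/z)<1"
proof -
 show "z~=0" using assms(2) by(auto simp: ann_def)
 then show "t a * z~=0" "norm(t a * z)<1" "t a/z~=0" "norm(t a/z)<1"
  using assms by(auto simp: ann_def balanced_def norm_mult norm_divide)
qed

lemma core_exp: "core S N \<delta> t \<nu> f g(exp l) m=f(zp(exp l) m)* g(zq(exp l) m)
  * exp(of_nat \<delta> *(of_int(2 * m+\<epsilon>)* l + of_int(EE m)* lp) + of_int(int(N+1)* EE m-m)*(lp+lq))
  *(\<Prod>a\<in>S. B(t a)(\<nu> a)(exp l) m)"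
proof -
 have "(exp l powi(2 * m+\<epsilon>)* p powi EE m)^\<delta>=exp(of_nat \<delta> *(of_int(2 * m+\<epsilon>)* l + of_int(EE m)* lp))"
  unfolding lp powi_exp exp_of_nat_mult exp_add by simp
 moreover have "(p * q) powi(int(N+1)* EE m-m)=exp(of_int(int(N+1)* EE m-m)*(lp+lq))"
  unfolding lp lq exp_add[symmetric] powi_exp ..
 ultimately show ?thesis unfolding core_def exp_add by(simp only: mult_ac)
qed

text \<open>Each factor \<open>B\<close> is only quasi-periodic in \<open>m\<close>; the balancing condition makes the integrand periodic.\<close>

lemma core_period:
 assumes bal: "balanced S N \<delta> t \<nu>" and z: "z\<in>ann S t"
  and f: "odd_theta(p^r)(N+\<delta>) f \<or> (\<forall>x. x~=0 \<longrightarrow> (p^r)^(N+\<delta>)* x^(2 *(N+\<delta>)+2)* f(p^r * x)=f x)"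
  and g: "odd_theta(q^r) N g"
 shows "core S N \<delta> t \<nu> f g z(m+int r)=core S N \<delta> t \<nu> f g z m"
proof -
 obtain \<kappa> where \<kappa>: "(\<Sum>a\<in>S. Ln(t a))=lp + of_nat(1-\<delta>)* lq+2 * of_int \<kappa> * of_real pi * \<i>"
  using balanced_log[OF bal] .
 have fin: "finite S" "card S=2 * N+4" and d1: "\<delta>\<le>1" and
  sb: "(\<Sum>a\<in>S. 2 * \<nu> a+\<epsilon>) = - 2 * int \<delta>" using bal by(auto simp: balanced_def)
 have z0: "z~=0" using z by(auto simp: ann_def)
 obtain l where l: "z=exp l" using z0 by(metis exp_Ln)
 define A :: complex where "A = of_int(2 * m+\<epsilon>)"
 define R :: complex where "R = of_nat r"
 define c0 where "c0=(R-1)*((A+R)*(of_real pi * \<i>)-(A+R)/2 * lp-(A+R)/2 * lq)"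
 define c1 where "c1=(R-1)*(A+R)"
 define c2 where "c2=(R-1)*(l+(A+R)/2 * lp-(A+R)/2 * lq)"
 have Bp: "B(t a)(\<nu> a) z(m+int r)=exp(c0+c1 * Ln(t a)+c2 * of_int(2 * \<nu> a+\<epsilon>))* B(t a)(\<nu> a) z m"
  if a: "a\<in>S" for a
 proof -
  have ta: "t a=exp(Ln(t a))" using bal a by(simp add: balanced_def)
  note an=ann_disc[OF bal z a]
  have "exp(Ln(t a))* exp l\<in>dom(\<nu> a+m+\<epsilon>)" "exp(Ln(t a))/exp l\<in>dom(\<nu> a-m)"
   using an(2-) unfolding ta[symmetric] l[symmetric] by(auto intro: unit_disc_dom)
  from B_period[OF this] show ?thesis unfolding ta[symmetric] l[symmetric]
   by(simp add: c0_def c1_def c2_def A_def R_def algebra_simps add_divide_distrib diff_divide_distrib)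
 qed
 have "(\<Prod>a\<in>S. B(t a)(\<nu> a) z(m+int r))
  = exp(\<Sum>a\<in>S. c0+c1 * Ln(t a)+c2 * of_int(2 * \<nu> a+\<epsilon>))*(\<Prod>a\<in>S. B(t a)(\<nu> a) z m)"
  using fin by(simp add: Bp exp_sum prod.distrib)
 also have "(\<Sum>a\<in>S. c0+c1 * Ln(t a)+c2 * of_int(2 * \<nu> a+\<epsilon>))
   = of_nat(2 * N+4)* c0+c1 *(\<Sum>a\<in>S. Ln(t a))+c2 * of_int(\<Sum>a\<in>S. 2 * \<nu> a+\<epsilon>)"
  unfolding sum_affine fin ..
 finally have PB: "(\<Prod>a\<in>S. B(t a)(\<nu> a) z(m+int r))
  = exp(of_nat(2 * N+4)* c0+c1 *(lp + of_nat(1-\<delta>)* lq+2 * of_int \<kappa> * of_real pi * \<i>)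
    + c2 * of_int(- 2 * int \<delta>))*(\<Prod>a\<in>S. B(t a)(\<nu> a) z m)"
  unfolding \<kappa> sb .
 have fper: "(p^r)^(N+\<delta>)* x^(2 *(N+\<delta>)+2)* f(p^r * x)=f x" if "x~=0" for x
  using f odd_thetaD(3) that by blast
 have fp: "f(zp z(m+int r))=exp(- (of_nat(N+\<delta>)*(R * lp)) - of_nat(2 *(N+\<delta>)+2)*(l+A * lp/2))* f(zp z m)"
 proof -
  have e: "exp(R * lp)^k * exp x^k'=exp(of_nat k *(R * lp) + of_nat k' * x)" for x k k'
   by(simp only: exp_of_nat_mult exp_add)
  have "exp(of_nat(N+\<delta>)*(R * lp) + of_nat(2 *(N+\<delta>)+2)*(l+A * lp/2))* f(zp z(m+int r))=f(zp z m)"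
   using fper[of "zp z m"] z0 unfolding zp_period pr_exp R_def[symmetric] unfolding l zp_exp A_def[symmetric] e by simp
  then have "f(zp z m)=exp(of_nat(N+\<delta>)*(R * lp) + of_nat(2 *(N+\<delta>)+2)*(l+A * lp/2))* f(zp z(m+int r))" ..
  then show ?thesis by(simp add: mult.assoc[symmetric] exp_add[symmetric])
 qed
 have gp: "g(zq z(m+int r))=exp(- (of_nat N *(R * lq)) - of_nat(2 * N+2)*(A * lq/2-l))* g(zq z m)"
  unfolding zq_period l zq_exp qr_exp A_def R_def
  by(rule odd_theta_exp)(use g in \<open>simp add: qr_exp\<close>)
 define D :: complex where "D = of_nat \<delta>"
 have dd: "of_nat(1-\<delta>)=1-D" "of_int(- 2 * int \<delta>) = - 2 * D" using d1 by(auto simp: D_def of_nat_diff)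
 define pf where "pf=(%m. D *(of_int(2 * m+\<epsilon>)* l + of_int(EE m)* lp) + of_int(int(N+1)* EE m-m)*(lp+lq))"
 have "core S N \<delta> t \<nu> f g z(m+int r)=exp(
   (- (of_nat(N+\<delta>)*(R * lp)) - of_nat(2 *(N+\<delta>)+2)*(l+A * lp/2)) +
   (- (of_nat N *(R * lq)) - of_nat(2 * N+2)*(A * lq/2-l)) +
   (of_nat(2 * N+4)* c0+c1 *(lp+(1-D)* lq+2 * of_int \<kappa> * of_real pi * \<i>)+c2 *(- 2 * D)) +
   pf(m+int r))*(f(zp z m)* g(zq z m)*(\<Prod>a\<in>S. B(t a)(\<nu> a) z m))"
  using core_exp[of S N \<delta> t \<nu> f g l "m+int r"] unfolding l[symmetric] D_def[symmetric] fp gp PB dd exp_add pf_def[symmetric]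
  by(simp only: pf_def mult_ac exp_add)
 \<comment> \<open>The contributions of f, g, the gamma factors and the prefactor cancel up to an
   integral multiple of 2 pi i.\<close>
 also have "(- (of_nat(N+\<delta>)*(R * lp)) - of_nat(2 *(N+\<delta>)+2)*(l+A * lp/2)) +
   (- (of_nat N *(R * lq)) - of_nat(2 * N+2)*(A * lq/2-l)) +
   (of_nat(2 * N+4)* c0+c1 *(lp+(1-D)* lq+2 * of_int \<kappa> * of_real pi * \<i>)+c2 *(- 2 * D)) +
   pf(m+int r)=pf m+2 * of_int((int r-1)*(2 * m+\<epsilon>+int r)*(int N+2+\<kappa>))* of_real pi * \<i>"
  unfolding c0_def c1_def c2_def pf_def EE_def A_def R_def D_def by(simp add: field_simps)
 also have "exp \<dots>=exp(pf m)" unfolding exp_add exp_two_pi_int by simp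
 also have "exp(pf m)*(f(zp z m)* g(zq z m)*(\<Prod>a\<in>S. B(t a)(\<nu> a) z m))=core S N \<delta> t \<nu> f g z m"
  using core_exp[of S N \<delta> t \<nu> f g l m] unfolding l[symmetric] D_def[symmetric] pf_def by(simp only: mult_ac)
 finally show ?thesis .
qed

lemma zp_inverse: "zp(1/z)(- m-\<epsilon>)=1/zp z m" and zq_inverse: "zq(1/z)(- m-\<epsilon>)=1/zq z m"
proof -
 have 1: "2 *(- m-\<epsilon>)+\<epsilon> = - (2 * m+\<epsilon>)" by simp
 have 2: "exp(of_int(- (2 * m+\<epsilon>))* c/2)=1/exp(of_int(2 * m+\<epsilon>)* c/2)" for c :: complex
  by(simp only: of_int_minus mult_minus_left minus_divide_left[symmetric] exp_minus inverse_eq_divide)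
 show "zp(1/z)(- m-\<epsilon>)=1/zp z m" unfolding zp_def 1 2 by simp
 show "zq(1/z)(- m-\<epsilon>)=1/zq z m" unfolding zq_def 1 2 by simp
qed

lemma EE_inverse: "EE(- m-\<epsilon>)=EE m"
 by(simp add: EE_def algebra_simps)

lemma B_inverse: "B t \<nu> (1/z)(- m-\<epsilon>)=B t \<nu> z m"
proof -
 have "\<nu>-(- m-\<epsilon>)=\<nu>+m+\<epsilon>" "\<nu>+(- m-\<epsilon>)+\<epsilon>=\<nu>-m" by simp_all
 then show ?thesis by(simp only: B_def mult.commute) simp
qed

text \<open>The gamma factors are interchanged and g contributes the sign. The power of pq produced
  by m -> -m - \<epsilon> equals the product of the squares of \<open>zp\<close> and
  \<open>zq\<close>, which compensates the denominators.\<close>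

lemma core_inverse_general:
 assumes z: "z~=0" and g: "odd_theta(q^r) N g"
 shows "core S N \<delta> t \<nu> f g(1/z)(- m-\<epsilon>) = - core S N \<delta> t \<nu> (%x. x\<^sup>2 * f(1/x)) g z m"
proof -
 have g1: "g(1/zq z m) = - g(zq z m)/(zq z m)\<^sup>2"
  using odd_thetaD(2)[OF g, of "zq z m"] z by(simp add: field_simps)
 have "int(N+1)* EE m-(- m-\<epsilon>)=(int(N+1)* EE m-m)+(2 * m+\<epsilon>)" by simp
 then have pp: "(p * q) powi(int(N+1)* EE m-(- m-\<epsilon>))=(p * q) powi(int(N+1)* EE m-m)*((zp z m)\<^sup>2 *(zq z m)\<^sup>2)"
  unfolding zp_zq[OF z] by(simp only: power_int_add[OF disjI1[OF pq(2)]])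
 have zz: "(1/z) powi(2 *(- m-\<epsilon>)+\<epsilon>)=z powi(2 * m+\<epsilon>)"
 proof -
  have "2 *(- m-\<epsilon>)+\<epsilon> = - (2 * m+\<epsilon>)" by simp
  then show ?thesis by(simp only: power_int_minus power_int_divide_distrib power_int_1_left) simp
 qed
 show ?thesis
  unfolding core_def zp_inverse zq_inverse EE_inverse B_inverse pp zz g1
  using z by(simp add: power2_eq_square)
qed

lemma core_inverse:
 assumes z: "z~=0" and f: "odd_theta(p^r) k f" and g: "odd_theta(q^r) N g"
 shows "core S N \<delta> t \<nu> f g(1/z)(- m-\<epsilon>)=core S N \<delta> t \<nu> f g z m"
 unfolding core_inverse_general[OF z g]
 unfolding core_def using odd_thetaD(2)[OF f, of "zp z m"] z by simp

lemma G_compose_holomorphic: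
 assumes "h holomorphic_on A" "\<And>z. z\<in>A==>h z\<in>dom m"
 shows "(%z. G(h z) m) holomorphic_on A"
 using holomorphic_on_compose_gen[OF assms(1) G_holomorphic[of m]] assms(2) by(auto simp: o_def)

lemma zp_holomorphic: "(%z. zp z m) holomorphic_on A"
 unfolding zp_def by(intro holomorphic_intros)

lemma zq_holomorphic: "0 \<notin> A==>(%z. zq z m) holomorphic_on A"
 unfolding zq_def by(intro holomorphic_intros) auto

lemma compose_nonzero_holomorphic:
 assumes "f holomorphic_on(- {0::complex})" "h holomorphic_on A" "\<And>z. z\<in>A==>h z~=0"
 shows "(%z. f(h z)) holomorphic_on A"
proof -
 have "h ` A \<subseteq>-{0}" using assms(3) by auto
 then show ?thesis using holomorphic_on_compose_gen[OF assms(2,1)] by(simp add: o_def)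
qed

lemma core_holomorphic:
 assumes bal: "balanced S N \<delta> t \<nu>"
  and f: "f holomorphic_on(- {0})" and g: "g holomorphic_on(- {0})"
 shows "(%z. core S N \<delta> t \<nu> f g z m) holomorphic_on ann S t"
proof -
 have 0: "0 \<notin> ann S t" by(auto simp: ann_def)
 show ?thesis unfolding core_def B_def
  by(intro holomorphic_intros compose_nonzero_holomorphic[OF f zp_holomorphic]
    compose_nonzero_holomorphic[OF g zq_holomorphic[OF 0]] G_compose_holomorphic unit_disc_dom)
   (use 0 ann_disc[OF bal] in auto)
qed

lemma core_continuous_circle:
 assumes bal: "balanced S N \<delta> t \<nu>"
  and f: "f holomorphic_on(- {0})" and g: "g holomorphic_on(- {0})"
 shows "continuous_on(sphere 0 1)(%z. core S N \<delta> t \<nu> f g z m)"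
 by(rule continuous_on_subset[OF holomorphic_on_imp_continuous_on[OF core_holomorphic[OF assms]]])
   (use circle_ann[OF bal] in auto)

definition cint :: "nat set => nat => nat => (nat => complex) => (nat => int) =>
  (complex => complex) => (complex => complex) => complex" where
 "cint S N \<delta> t \<nu> f g=(\<Sum>m\<in>{0..<int r}. cmean 1(%z. core S N \<delta> t \<nu> f g z m))"

text \<open>A q-shift of a parameter acts as multiplication by a degree-1 even theta function in
  \<open>zp z m\<close>. Besides constants, the only further factor is z^(2m + \<epsilon>) p^(EE m),
  the same for all parameters; this is the reason for \<delta> in \<open>core\<close>.\<close>

lemma B_shift:
 assumes "exp L * z~=0" "norm(exp L * z)<1" "norm(exp L/z)<1" "y=exp(L + of_int(2 * \<nu>+\<epsilon>)* lp/2)"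
 shows "B(q * exp L)(\<nu>+1) z m
  = (- y * exp(of_int(2 * \<nu>+\<epsilon>)*(L + of_real pi * \<i>) + of_int(EE \<nu>-\<nu>)* lp))
   *(z powi(2 * m+\<epsilon>)* p powi EE m)* theta_prod(p^r)(zp z m) y * B(exp L) \<nu> z m"
proof -
 have z0: "z~=0" using assms(1) by auto
 obtain l where l: "z=exp l" using z0 by(metis exp_Ln)
 define k where "k=\<nu>+m+\<epsilon>"
 define k' where "k'=\<nu>-m"
 have ce: "(- exp w) powi k * p powi(k *(k-1) div 2)=exp(of_int k *(w + of_real pi * \<i>) + of_int(k *(k-1))/2 * lp)" for w k
  unfolding minus_exp powi_exp lp of_int_div_exact[OF dvd_2_consecutive zero_neq_numeral[symmetric]]
  by(simp only: exp_add of_int_numeral)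
 have 1: "G(q *(exp L * z))(k+1)=exp(of_int k *(L+l + of_real pi * \<i>) + of_int(k *(k-1))/2 * lp)
   * jtheta(exp L * z * p powi k)(p^r)* G(exp L * z) k"
  using G_shift[OF assms(1,2), of k] ce[of "L+l" k] by(simp add: l exp_add)
 have 2: "G(q *(exp L/z))(k'+1)=exp(of_int k' *(L-l + of_real pi * \<i>) + of_int(k' *(k'-1))/2 * lp)
   * jtheta(exp L/z * p powi k')(p^r)* G(exp L/z) k'"
  using G_shift[OF _ assms(3), of k'] z0 ce[of "L-l" k'] by(simp add: l exp_diff)
 have a1: "exp L * z * p powi k=zp z m * y"
  unfolding assms(4) l zp_exp lp powi_exp k_def exp_add[symmetric]
  by(rule arg_cong[of _ _ exp])(simp add: field_simps)
 have a2: "exp L/z * p powi k'=1/(zp z m/y)"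
 proof -
  have "zp z m/y=exp(l + of_int(2 * m+\<epsilon>)* lp/2-(L + of_int(2 * \<nu>+\<epsilon>)* lp/2))"
   unfolding assms(4) l zp_exp exp_diff ..
  then have "1/(zp z m/y)=exp(- (l + of_int(2 * m+\<epsilon>)* lp/2-(L + of_int(2 * \<nu>+\<epsilon>)* lp/2)))"
   by(simp only: exp_minus inverse_eq_divide)
  moreover have "exp L/z * p powi k'=exp(L-l + of_int k' * lp)"
   unfolding l lp powi_exp exp_add exp_diff ..
  moreover have "- (l + of_int(2 * m+\<epsilon>)* lp/2-(L + of_int(2 * \<nu>+\<epsilon>)* lp/2))=L-l + of_int k' * lp"
   by(simp add: k'_def field_simps)
  ultimately show ?thesis by(simp only:)
 qed
 have y0: "y~=0" using assms(4) by simp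
 have tp: "jtheta(zp z m * y)(p^r)* jtheta(1/(zp z m/y))(p^r) = - y * theta_prod(p^r)(zp z m) y"
  using jtheta_inverse[OF pr, of "zp z m/y"] z0 y0 by(simp add: theta_prod_def)
 have ee: "of_int k *(L+l + of_real pi * \<i>) + of_int(k *(k-1))/2 * lp +
   (of_int k' *(L-l + of_real pi * \<i>) + of_int(k' *(k'-1))/2 * lp)
   = of_int(2 * \<nu>+\<epsilon>)*(L + of_real pi * \<i>) + of_int(EE \<nu>-\<nu>)* lp+(of_int(2 * m+\<epsilon>)* l + of_int(EE m)* lp)"
 proof -
  have e2: "\<epsilon> * \<epsilon>=\<epsilon>" using eps by auto
  have "(of_int \<epsilon> * of_int \<epsilon> :: complex) = of_int \<epsilon>" unfolding of_int_mult[symmetric] e2 ..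
  then have "of_int \<epsilon> *(of_int \<epsilon> * x) = of_int \<epsilon> * x" for x :: complex by(simp add: mult.assoc[symmetric])
  then show ?thesis
   unfolding k_def k'_def EE_def by(simp add: field_simps)
 qed
 have zm: "z powi(2 * m+\<epsilon>)* p powi EE m=exp(of_int(2 * m+\<epsilon>)* l + of_int(EE m)* lp)"
  unfolding l lp powi_exp exp_add ..
 have "B(q * exp L)(\<nu>+1) z m=G(q *(exp L * z))(k+1)* G(q *(exp L/z))(k'+1)"
  by(simp add: B_def k_def k'_def algebra_simps)
 also have "\<dots>=exp(of_int k *(L+l + of_real pi * \<i>) + of_int(k *(k-1))/2 * lp +
   (of_int k' *(L-l + of_real pi * \<i>) + of_int(k' *(k'-1))/2 * lp)) *
   (jtheta(zp z m * y)(p^r)* jtheta(1/(zp z m/y))(p^r))*(G(exp L * z) k * G(exp L/z) k')"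
  unfolding 1 2 a1 a2 exp_add by(simp only: mult_ac)
 also have "\<dots>=(- y * exp(of_int(2 * \<nu>+\<epsilon>)*(L + of_real pi * \<i>) + of_int(EE \<nu>-\<nu>)* lp))
   *(z powi(2 * m+\<epsilon>)* p powi EE m)* theta_prod(p^r)(zp z m) y * B(exp L) \<nu> z m"
  unfolding ee tp zm B_def k_def[symmetric] k'_def[symmetric]
  unfolding exp_add[of "of_int(2 * \<nu>+\<epsilon>)*(L + of_real pi * \<i>) + of_int(EE \<nu>-\<nu>)* lp"]
  by(simp only: mult_ac)
 finally show ?thesis .
qed

end

section \<open>The telescoping identity\<close>

context rarefied
begin

text \<open>The theta variable of a parameter, formed as in \<open>zp\<close>. For a system with
  \<delta> = 1 these variables multiply to 1.\<close>

definition xpt :: "complex => int => complex" where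
 "xpt t \<nu>=t * exp(of_int(2 * \<nu>+\<epsilon>)* lp/2)"

context
 fixes S :: "nat set" and N :: nat and t :: "nat => complex" and \<nu> :: "nat => int"
  and g :: "complex => complex"
 assumes bal: "balanced S N 1 t \<nu>" and g: "odd_theta(q^r) N g"
begin

text \<open>This theta product turns all factors G(t_a z) into their q-shifts at once; its
  antisymmetrisation is the function in \<open>even_theta_shift_function\<close>.\<close>

definition ytheta :: "complex => complex" where
 "ytheta x=(\<Prod>a\<in>S. jtheta(xpt(t a)(\<nu> a)* x)(p^r))/x^(N+1)"

definition psi_log :: "int => complex" where
 "psi_log m=(\<Sum>a\<in>S. of_int(\<nu> a+m+\<epsilon>)*(Ln(t a) + of_real pi * \<i>)
   + of_int((\<nu> a+m+\<epsilon>)*(\<nu> a+m+\<epsilon>-1))/2 * lp)"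

definition psi_const :: "int => complex" where
 "psi_const m = of_int(EE m)* lp + of_int(int(N+1)* EE m-m)*(lp+lq)
   - of_nat(N+1)*(of_int(2 * m+\<epsilon>)* lp/2)-psi_log m"

text \<open>The integrand after absorbing the theta product. Its gamma arguments q t_a z and t_a/z
  are exchanged by z -> 1/(q z), a reflection other than z -> 1/z.\<close>

definition Psi :: "complex => int => complex" where
 "Psi z m=z powi(- int N-int(N+1)*(2 * m+\<epsilon>))* exp(psi_const m)* g(zq z m)
   *(\<Prod>a\<in>S. G(q * t a * z)(\<nu> a+m+\<epsilon>+1)* G(t a/z)(\<nu> a-m))"

lemma bal_facts: "finite S" "card S=2 * N+4" "a\<in>S==>t a~=0" "a\<in>S==>norm(t a)<1"
 "(\<Sum>a\<in>S. 2 * \<nu> a+\<epsilon>) = - 2"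
 using bal by(auto simp: balanced_def)

lemma core_eq_Psi:
 assumes z: "z\<in>ann S t"
 shows "core S N 1 t \<nu> ytheta g z m=Psi z m"
proof -
 have z0: "z~=0" using z by(auto simp: ann_def)
 obtain l where l: "z=exp l" using z0 by(metis exp_Ln)
 define k where "k=(%a. \<nu> a+m+\<epsilon>)"
 define e where "e=(%a. of_int(k a)*(Ln(t a)+l + of_real pi * \<i>) + of_int(k a *(k a-1))/2 * lp)"
 have th: "jtheta(xpt(t a)(\<nu> a)* zp z m)(p^r)* G(t a * z)(k a)=exp(- e a)* G(q * t a * z)(k a+1)"
  if a: "a\<in>S" for a
 proof -
  note an=ann_disc[OF bal z a]
  have ta: "t a=exp(Ln(t a))" using bal_facts(3)[OF a] by simp
  have 1: "xpt(t a)(\<nu> a)* zp z m=t a * z * p powi k a"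
  proof -
   have "exp(of_int(2 * \<nu> a+\<epsilon>)* lp/2)* exp(of_int(2 * m+\<epsilon>)* lp/2)=p powi k a"
    unfolding lp powi_exp exp_add[symmetric] k_def by(rule arg_cong[of _ _ exp])(simp add: field_simps)
   moreover have "xpt(t a)(\<nu> a)* zp z m
    = t a * z *(exp(of_int(2 * \<nu> a+\<epsilon>)* lp/2)* exp(of_int(2 * m+\<epsilon>)* lp/2))"
    unfolding xpt_def zp_def by(simp only: mult_ac)
   ultimately show ?thesis by simp
  qed
  have "(- (t a * z)) powi k a * p powi(k a *(k a-1) div 2)=exp(e a)"
  proof -
   have "t a * z=exp(Ln(t a)+l)" using ta l by(simp add: exp_add)
   then have "(- (t a * z)) powi k a=exp(of_int(k a)*(Ln(t a)+l + of_real pi * \<i>))"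
    by(simp only: minus_exp powi_exp)
   moreover have "p powi(k a *(k a-1) div 2)=exp(of_int(k a *(k a-1))/2 * lp)"
    unfolding lp powi_exp of_int_div_exact[OF dvd_2_consecutive zero_neq_numeral[symmetric]] by(simp only: of_int_numeral)
   ultimately show ?thesis unfolding e_def by(simp only: exp_add)
  qed
  then have "G(q *(t a * z))(k a+1)=exp(e a)* jtheta(t a * z * p powi k a)(p^r)* G(t a * z)(k a)"
   using G_shift[OF an(2,3), of "k a"] by simp
  then have "exp(- e a)* G(q * t a * z)(k a+1)
    = exp(- e a)* exp(e a)*(jtheta(t a * z * p powi k a)(p^r)* G(t a * z)(k a))"
   by(simp only: mult_ac)
  also have "exp(- e a)* exp(e a)=1" by(simp only: exp_add[symmetric]) simp
  finally show ?thesis unfolding 1 by simp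
 qed
 have "(\<Prod>a\<in>S. jtheta(xpt(t a)(\<nu> a)* zp z m)(p^r))*(\<Prod>a\<in>S. B(t a)(\<nu> a) z m)
   = (\<Prod>a\<in>S. exp(- e a)*(G(q * t a * z)(k a+1)* G(t a/z)(\<nu> a-m)))"
  unfolding prod.distrib[symmetric]
 proof(rule prod.cong[OF refl])
  fix a assume a: "a\<in>S"
  have "jtheta(xpt(t a)(\<nu> a)* zp z m)(p^r)* B(t a)(\<nu> a) z m
   = (jtheta(xpt(t a)(\<nu> a)* zp z m)(p^r)* G(t a * z)(k a))* G(t a/z)(\<nu> a-m)"
   unfolding B_def k_def by(simp only: mult_ac)
  then show "jtheta(xpt(t a)(\<nu> a)* zp z m)(p^r)* B(t a)(\<nu> a) z m
   = exp(- e a)*(G(q * t a * z)(k a+1)* G(t a/z)(\<nu> a-m))"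
   unfolding th[OF a] by(simp only: mult_ac)
 qed
 also have "\<dots>=exp(- (\<Sum>a\<in>S. e a))*(\<Prod>a\<in>S. G(q * t a * z)(k a+1)* G(t a/z)(\<nu> a-m))"
  unfolding prod.distrib using bal_facts(1) by(simp add: exp_sum[symmetric] sum_negf)
 finally have PR: "(\<Prod>a\<in>S. jtheta(xpt(t a)(\<nu> a)* zp z m)(p^r))*(\<Prod>a\<in>S. B(t a)(\<nu> a) z m)
   = exp(- (\<Sum>a\<in>S. e a))*(\<Prod>a\<in>S. G(q * t a * z)(k a+1)* G(t a/z)(\<nu> a-m))" .
 have sk: "(\<Sum>a\<in>S. of_int(k a))=(of_int(int(N+2)*(2 * m+\<epsilon>)-1) :: complex)"
 proof -
  have "2 *(\<Sum>a\<in>S. k a)=(\<Sum>a\<in>S. (2 * \<nu> a+\<epsilon>)+(2 * m+\<epsilon>))"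
   unfolding sum_distrib_left k_def by(rule sum.cong) auto
  also have "\<dots> = - 2+int(2 * N+4)*(2 * m+\<epsilon>)"
   unfolding sum.distrib[of "%a. 2 * \<nu> a+\<epsilon>"] bal_facts(5) by(simp add: bal_facts(2))
  finally have "(\<Sum>a\<in>S. k a)=int(N+2)*(2 * m+\<epsilon>)-1" by(simp add: algebra_simps)
  then show ?thesis unfolding of_int_sum[symmetric] by(simp only:)
 qed
 have "(\<Sum>a\<in>S. e a)=psi_log m+l *(\<Sum>a\<in>S. of_int(k a))"
  unfolding psi_log_def e_def k_def[symmetric] sum_distrib_left sum.distrib[symmetric]
  by(rule sum.cong)(auto simp: k_def algebra_simps)
 then have se: "(\<Sum>a\<in>S. e a)=psi_log m+l * of_int(int(N+2)*(2 * m+\<epsilon>)-1)" unfolding sk .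
 have zN: "zp z m^(N+1)=exp(of_nat(N+1)*(l + of_int(2 * m+\<epsilon>)* lp/2))"
  unfolding l zp_exp exp_of_nat_mult ..
 have "core S N 1 t \<nu> ytheta g z m=g(zq z m) *
   exp(of_int(2 * m+\<epsilon>)* l + of_int(EE m)* lp + of_int(int(N+1)* EE m-m)*(lp+lq)) *
   (1/zp z m^(N+1))*((\<Prod>a\<in>S. jtheta(xpt(t a)(\<nu> a)* zp z m)(p^r))*(\<Prod>a\<in>S. B(t a)(\<nu> a) z m))"
  using core_exp[of S N 1 t \<nu> ytheta g l m] unfolding l[symmetric] ytheta_def
  by(simp add: mult_ac)
 also have "\<dots>=exp(of_int(2 * m+\<epsilon>)* l + of_int(EE m)* lp + of_int(int(N+1)* EE m-m)*(lp+lq)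
    + - (of_nat(N+1)*(l + of_int(2 * m+\<epsilon>)* lp/2))
    + - (psi_log m+l * of_int(int(N+2)*(2 * m+\<epsilon>)-1)))* g(zq z m) *
    (\<Prod>a\<in>S. G(q * t a * z)(k a+1)* G(t a/z)(\<nu> a-m))"
  unfolding PR se zN exp_add exp_minus by(simp only: divide_inverse mult_1 mult_ac)
 also have "of_int(2 * m+\<epsilon>)* l + of_int(EE m)* lp + of_int(int(N+1)* EE m-m)*(lp+lq)
    + - (of_nat(N+1)*(l + of_int(2 * m+\<epsilon>)* lp/2))
    + - (psi_log m+l * of_int(int(N+2)*(2 * m+\<epsilon>)-1))
   = of_int(- int N-int(N+1)*(2 * m+\<epsilon>))* l+psi_const m"
  unfolding psi_const_def by(simp add: field_simps)
 also have "exp \<dots>=z powi(- int N-int(N+1)*(2 * m+\<epsilon>))* exp(psi_const m)"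
  unfolding l exp_add powi_exp ..
 finally show ?thesis unfolding Psi_def k_def .
qed

text \<open>The gamma factors trade places and g supplies the sign; the elementary factors match
  because the parameters multiply to p and their discrete sum is one unit short.\<close>

lemma Psi_reflect:
 assumes z0: "z~=0"
 shows "Psi(1/(q * z))(- 1-m-\<epsilon>) = - Psi z m"
proof -
 obtain l where l: "z=exp l" using z0 by(metis exp_Ln)
 define A :: complex where "A = of_int(2 * m+\<epsilon>)"
 have z': "1/(q * z)=exp(- l-lq)" by(simp add: l lq exp_diff exp_minus field_simps)
 have m2: "2 *(- 1-m-\<epsilon>)+\<epsilon> = - (2 * m+\<epsilon>)-2" by simp
 have A2: "of_int(2 *(- 1-m-\<epsilon>)+\<epsilon>) = - A-2" unfolding m2 A_def by simp
 have zq': "zq(1/(q * z))(- 1-m-\<epsilon>)=1/zq z m"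
 proof -
  have "zq(1/(q * z))(- 1-m-\<epsilon>)=exp((- A-2)* lq/2-(- l-lq))"
   unfolding z' zq_exp A2 ..
  also have "(- A-2)* lq/2-(- l-lq) = - (A * lq/2-l)" by(simp add: field_simps)
  also have "exp \<dots>=1/zq z m" unfolding l zq_exp A_def by(simp only: exp_minus inverse_eq_divide)
  finally show ?thesis .
 qed
 have gi: "g(1/zq z m) = - g(zq z m)* exp(- 2 *(A * lq/2-l))"
 proof -
  have "(zq z m)\<^sup>2=exp(2 *(A * lq/2-l))"
   unfolding l zq_exp A_def by(simp only: power2_eq_square exp_add[symmetric] mult_2)
  moreover have "(zq z m)\<^sup>2 * g(1/zq z m) = - g(zq z m)" using odd_thetaD(2)[OF g, of "zq z m"] z0 by simp
  ultimately have "exp(- (2 *(A * lq/2-l)))*(exp(2 *(A * lq/2-l))* g(1/zq z m))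
   = exp(- (2 *(A * lq/2-l)))*(- g(zq z m))" by simp
  moreover have "exp(- (2 *(A * lq/2-l)))* exp(2 *(A * lq/2-l))=1"
   by(simp only: exp_add[symmetric]) simp
  ultimately have "g(1/zq z m)=exp(- (2 *(A * lq/2-l)))*(- g(zq z m))"
   by(simp only: mult.assoc[symmetric] mult_1)
  then show ?thesis by(simp only: mult_minus_left mult_minus_right mult.commute)
 qed
 have PR: "(\<Prod>a\<in>S. G(q * t a *(1/(q * z)))(\<nu> a+(- 1-m-\<epsilon>)+\<epsilon>+1)* G(t a/(1/(q * z)))(\<nu> a-(- 1-m-\<epsilon>)))
   = (\<Prod>a\<in>S. G(q * t a * z)(\<nu> a+m+\<epsilon>+1)* G(t a/z)(\<nu> a-m))"
 proof(rule prod.cong[OF refl])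
  fix a
  have "\<nu> a+(- 1-m-\<epsilon>)+\<epsilon>+1=\<nu> a-m" "\<nu> a-(- 1-m-\<epsilon>)=\<nu> a+m+\<epsilon>+1" by simp_all
  moreover have "q * t a *(1/(q * z))=t a/z" "t a/(1/(q * z))=q * t a * z" using q0 by simp_all
  ultimately show "G(q * t a *(1/(q * z)))(\<nu> a+(- 1-m-\<epsilon>)+\<epsilon>+1)* G(t a/(1/(q * z)))(\<nu> a-(- 1-m-\<epsilon>))
   = G(q * t a * z)(\<nu> a+m+\<epsilon>+1)* G(t a/z)(\<nu> a-m)" by(simp only: mult.commute)
 qed
 obtain \<kappa> where \<kappa>: "(\<Sum>a\<in>S. Ln(t a))=lp + of_nat(1-1)* lq+2 * of_int \<kappa> * of_real pi * \<i>"
  using balanced_log[OF bal] .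
 define c0 where "c0=(A+1)*(of_real pi * \<i>)-(A+1)* lp"
 define c1 where "c1=A+1"
 define c2 where "c2=(A+1)* lp/2"
 have "psi_log m-psi_log(- 1-m-\<epsilon>)=(\<Sum>a\<in>S. c0+c1 * Ln(t a)+c2 * of_int(2 * \<nu> a+\<epsilon>))"
  unfolding psi_log_def sum_subtractf[symmetric]
  by(rule sum.cong)(auto simp: c0_def c1_def c2_def A_def field_simps)
 also have "\<dots> = of_nat(2 * N+4)* c0+c1 *(lp+2 * of_int \<kappa> * of_real pi * \<i>)+c2 * of_int(- 2)"
  unfolding sum_affine \<kappa> bal_facts(5) bal_facts(2) by simp
 finally have pl: "psi_log(- 1-m-\<epsilon>)=psi_log m
   - (of_nat(2 * N+4)* c0+c1 *(lp+2 * of_int \<kappa> * of_real pi * \<i>)+c2 * of_int(- 2))"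
  by(simp add: algebra_simps)
 have EE': "EE(- 1-m-\<epsilon>)=EE m+2 * m+\<epsilon>+1" by(simp add: EE_def algebra_simps)
 have ex: "of_int(- int N-int(N+1)*(2 *(- 1-m-\<epsilon>)+\<epsilon>))*(- l-lq)+psi_const(- 1-m-\<epsilon>) + - 2 *(A * lq/2-l)
   = of_int(- int N-int(N+1)*(2 * m+\<epsilon>))* l+psi_const m
    + 2 * of_int((2 * m+\<epsilon>+1)*(int N+2+\<kappa>))* of_real pi * \<i>"
  unfolding psi_const_def pl EE' c0_def c1_def c2_def A_def by(simp add: field_simps)
 have "Psi(1/(q * z))(- 1-m-\<epsilon>)
  = exp(of_int(- int N-int(N+1)*(2 *(- 1-m-\<epsilon>)+\<epsilon>))*(- l-lq)+psi_const(- 1-m-\<epsilon>) + - 2 *(A * lq/2-l))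
   *(- g(zq z m))*(\<Prod>a\<in>S. G(q * t a * z)(\<nu> a+m+\<epsilon>+1)* G(t a/z)(\<nu> a-m))"
  unfolding Psi_def PR zq' gi unfolding z' powi_exp exp_add by(simp only: mult_ac)
 also have "\<dots> = - Psi z m"
  unfolding ex exp_add exp_two_pi_int Psi_def l powi_exp by(simp only: mult_minus_left mult_minus_right mult_1_right)
 finally show ?thesis .
qed

lemma prod_xpt: "(\<Prod>a\<in>S. xpt(t a)(\<nu> a))=1"
proof -
 have "(\<Prod>a\<in>S. xpt(t a)(\<nu> a))=(\<Prod>a\<in>S. t a)* exp(\<Sum>a\<in>S. of_int(2 * \<nu> a+\<epsilon>)* lp/2)"
  unfolding xpt_def prod.distrib exp_sum[OF bal_facts(1)] ..
 also have "(\<Sum>a\<in>S. of_int(2 * \<nu> a+\<epsilon>)* lp/2) = of_int(\<Sum>a\<in>S. 2 * \<nu> a+\<epsilon>)* lp/2"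
  unfolding of_int_sum sum_distrib_right sum_divide_distrib ..
 also have "\<dots> = - lp" unfolding bal_facts(5) by simp
 also have "(\<Prod>a\<in>S. t a)=p" using bal by(simp add: balanced_def)
 also have "p * exp(- lp)=1" by(simp add: lp exp_minus)
 finally show ?thesis .
qed

lemma ytheta_quasi: "x~=0==>(p^r)^(N+1)* x^(2 *(N+1)+2)* ytheta(p^r * x)=ytheta x"
proof -
 assume x: "x~=0"
 have x0: "xpt(t a)(\<nu> a)~=0" if "a\<in>S" for a using bal_facts(3)[OF that] by(simp add: xpt_def)
 have "(\<Prod>a\<in>S. jtheta(xpt(t a)(\<nu> a)*(p^r * x))(p^r))
   = (\<Prod>a\<in>S. jtheta(xpt(t a)(\<nu> a)* x)(p^r)*(- 1/x)*(1/xpt(t a)(\<nu> a)))"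
 proof(rule prod.cong[OF refl])
  fix a assume "a\<in>S"
  then show "jtheta(xpt(t a)(\<nu> a)*(p^r * x))(p^r)
    = jtheta(xpt(t a)(\<nu> a)* x)(p^r)*(- 1/x)*(1/xpt(t a)(\<nu> a))"
   using jtheta_mult_p[OF pr, of "xpt(t a)(\<nu> a)* x"] x0 x by(simp add: mult_ac)
 qed
 also have "\<dots>=(\<Prod>a\<in>S. jtheta(xpt(t a)(\<nu> a)* x)(p^r))*(- 1/x)^(2 * N+4)"
  unfolding prod.distrib prod_dividef prod_xpt by(simp add: bal_facts(2) power_one_over)
 also have "(- 1/x)^(2 * N+4)=1/x^(2 * N+4)"
  by(simp add: power_divide power_minus_even)
 finally have P: "(\<Prod>a\<in>S. jtheta(xpt(t a)(\<nu> a)*(p^r * x))(p^r))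
  = (\<Prod>a\<in>S. jtheta(xpt(t a)(\<nu> a)* x)(p^r))*(1/x^(2 * N+4))" .
 have e: "2 *(N+1)+2=2 * N+4" by simp
 have "a * X *(C *(1/X)/(a * d))=C/d" if "a~=0" "X~=0" for a X C d :: complex
  using that by simp
 then show ?thesis unfolding ytheta_def P e power_mult_distrib using x pr(2) by(simp only: power_not_zero simp_thms)
qed

lemma ytheta_holomorphic: "ytheta holomorphic_on(- {0})"
proof -
 have "xpt(t a)(\<nu> a)~=0" if "a\<in>S" for a using bal_facts(3)[OF that] by(simp add: xpt_def)
 then show ?thesis unfolding ytheta_def
  by(intro holomorphic_intros holomorphic_on_compose_gen[OF _ jtheta_holomorphic[OF pr], unfolded o_def]) auto
qed

text \<open>For 1 \<le> |z| \<le> 1/|q| the arguments q t_a z and t_a/z remain in the unit disc, so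
  the contour crosses no pole.\<close>

lemma Psi_cmean: "cmean 1(%z. Psi z m)=cmean(norm(1/q))(%z. Psi z m)"
proof -
 let ?A = "ann S t \<union> {z. z~=0\<and>(\<forall>a\<in>S. norm(t a)<norm z\<and>norm(q * t a)* norm z<1)}"
 let ?A = "{z. z~=0} \<inter> (\<Inter>a\<in>S. {z. norm(t a)<norm z\<and>norm(q * t a)* norm z<1})"
 have op: "open ?A"
  by(intro open_Int open_INT bal_facts(1) ballI open_Collect_conj open_Collect_less open_Collect_neq continuous_intros)
 have "(%z. Psi z m) holomorphic_on ?A"
  unfolding Psi_def
  by(intro holomorphic_intros compose_nonzero_holomorphic[OF odd_thetaD(1)[OF g] zq_holomorphic]
    G_compose_holomorphic unit_disc_dom)
    (use bal_facts(3) q0 in \<open>auto simp: norm_mult norm_divide\<close>)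
 moreover have "1\<le>norm(1/q)" using q q0 by(simp add: norm_divide)
 moreover have "z \<in> ?A" if z: "1\<le>norm z" "norm z\<le>norm(1/q)" for z
 proof -
  have "norm(q * t a)* norm z<1" if "a\<in>S" for a
  proof -
   have "norm q * norm z\<le>1" using z q0 by(simp add: norm_divide field_simps)
   then have "norm(t a)*(norm q * norm z)\<le>norm(t a)* 1" by(intro mult_left_mono) auto
   then show ?thesis using bal_facts(4)[OF that] by(simp add: norm_mult mult_ac)
  qed
  moreover have "norm(t a)<norm z" if "a\<in>S" for a using bal_facts(4)[OF that] z by simp
  ultimately show ?thesis using z by auto
 qed
 ultimately show ?thesis by(intro cmean_annulus[OF _ op]) auto
qed

text \<open>Moving the contour to |z| = 1/|q| and reflecting back gives c(m) = -c(-1 - \<epsilon> -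
  m). Summed over the residues, the total equals its own negative.\<close>

lemma telescoping: "cint S N 1 t \<nu> ytheta g=0"
proof -
 have circ: "z\<in>ann S t" if "norm z=1" for z using circle_ann[OF bal that] .
 define c where "c=(%m. cmean 1(%z. Psi z m))"
 have per: "c(m+int r)=c m" for m
  unfolding c_def
 proof(rule cmean_cong)
  fix z :: complex assume "norm z=1"
  then show "Psi z(m+int r)=Psi z m"
   using core_period[OF bal circ _ g, of z ytheta m] ytheta_quasi core_eq_Psi[OF circ] by auto
 qed simp
 have c_refl: "c m = - c(- 1-\<epsilon>-m)" for m
 proof -
  have cont: "continuous_on(sphere 0(norm(1/q)))(%z. Psi z m)"
  proof -
   have "norm(t a/z)<1\<and>norm(q * t a * z)<1\<and>z~=0" if "a\<in>S" "norm z=norm(1/q)" for a z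
   proof -
    have "norm z > 1" using that q q0 by(simp add: norm_divide)
    then have "norm(t a)<norm z" using bal_facts(4)[OF that(1)] by simp
    then have "norm(t a/z)<1" using \<open>norm z > 1\<close> by(simp add: norm_divide divide_less_eq)
    moreover have "norm(q * t a * z)=norm(t a)" using that q0 by(simp add: norm_mult norm_divide)
    ultimately show ?thesis using \<open>norm z > 1\<close> bal_facts(4)[OF that(1)] by(auto simp: norm_divide)
   qed
   note n=this
   have "(%z. Psi z m) holomorphic_on {z. z~=0\<and>(\<forall>a\<in>S. norm(t a/z)<1\<and>norm(q * t a * z)<1)}"
    unfolding Psi_def
    by(intro holomorphic_intros compose_nonzero_holomorphic[OF odd_thetaD(1)[OF g] zq_holomorphic]
     G_compose_holomorphic unit_disc_dom)(use bal_facts(3) q0 in auto)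
   then show ?thesis
    by(rule continuous_on_subset[OF holomorphic_on_imp_continuous_on])(use n q0 in auto)
  qed
  have "c m=cmean 1(%z. Psi((1/q)/z) m)"
   unfolding c_def Psi_cmean by(rule cmean_inverse_scale[symmetric, OF cont])(use q0 in simp)
  also have "\<dots>=cmean 1(%z. - Psi z(- 1-\<epsilon>-m))"
  proof(rule cmean_cong)
   fix z :: complex assume "norm z=1"
   then have "z~=0" by auto
   from Psi_reflect[OF this, of "- 1-\<epsilon>-m"]
   show "Psi((1/q)/z) m = - Psi z(- 1-\<epsilon>-m)" by simp
  qed simp
  finally show ?thesis by(simp add: cmean_minus c_def)
 qed
 have "(\<Sum>m\<in>{0..<int r}. c m) = - (\<Sum>m\<in>{0..<int r}. c(- 1-\<epsilon>-m))"
  unfolding sum_negf[symmetric] by(rule sum.cong[OF refl])(rule c_refl)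
 also have "(\<Sum>m\<in>{0..<int r}. c(- 1-\<epsilon>-m))=(\<Sum>m\<in>{0..<int r}. c m)"
  by(rule sum_reflect_periodic[where c=c, OF r0 per])
 finally have "(\<Sum>m\<in>{0..<int r}. c m)=0" by simp
 moreover have "cint S N 1 t \<nu> ytheta g=(\<Sum>m\<in>{0..<int r}. c m)"
  unfolding cint_def c_def
  by(intro sum.cong refl cmean_cong core_eq_Psi circ) auto
 ultimately show ?thesis by simp
qed

text \<open>The symmetrised version: the integrand is \<open>\<Phi>(z, m) + \<Phi>(1/z, -m-\<epsilon>)\<close>.\<close>

lemma telescoping_even:
 assumes f: "\<And>x. x~=0==>f x=ytheta x-x\<^sup>2 * ytheta(1/x)"
 shows "cint S N 1 t \<nu> f g=0"
proof -
 have circ: "z\<in>ann S t" if "norm z=1" for z using circle_ann[OF bal that] .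
 define c where "c=(%m. cmean 1(%z. core S N 1 t \<nu> ytheta g z m))"
 have cont: "continuous_on(sphere 0 1)(%z. core S N 1 t \<nu> ytheta g z m)" for m
  by(rule core_continuous_circle[OF bal ytheta_holomorphic odd_thetaD(1)[OF g]])
 have cont2: "continuous_on(sphere 0 1)(%z. core S N 1 t \<nu> ytheta g(1/z) m)" for m
  by(rule continuous_on_compose2[OF cont])(auto intro!: continuous_intros simp: norm_divide)
 have "core S N 1 t \<nu> f g z m=core S N 1 t \<nu> ytheta g z m+core S N 1 t \<nu> ytheta g(1/z)(- m-\<epsilon>)"
  if "norm z=1" for z m
 proof -
  have z0: "z~=0" using that by auto
  have nz: "zp z m~=0" using z0 by simp
  show ?thesis unfolding core_inverse_general[OF z0 g] unfolding core_def f[OF nz]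
   by(simp only: left_diff_distrib add_uminus_conv_diff)
 qed
 then have "cint S N 1 t \<nu> f g=(\<Sum>m\<in>{0..<int r}. cmean 1(%z. core S N 1 t \<nu> ytheta g z m
   + core S N 1 t \<nu> ytheta g(1/z)(- m-\<epsilon>)))"
  unfolding cint_def by(intro sum.cong refl cmean_cong) auto
 also have "\<dots>=(\<Sum>m\<in>{0..<int r}. c m+c(- \<epsilon>-m))"
 proof(rule sum.cong[OF refl])
  fix m
  have e: "- m-\<epsilon> = - \<epsilon>-m" by simp
  have "cmean 1(%z. core S N 1 t \<nu> ytheta g(1/z)(- m-\<epsilon>))=c(- \<epsilon>-m)"
   unfolding c_def e using cmean_inverse[of 1 "%z. core S N 1 t \<nu> ytheta g z(- \<epsilon>-m)"] cont by simp
  then show "cmean 1(%z. core S N 1 t \<nu> ytheta g z m+core S N 1 t \<nu> ytheta g(1/z)(- m-\<epsilon>))=c m+c(- \<epsilon>-m)"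
   unfolding c_def by(subst cmean_add[OF cont cont2]) simp_all
 qed
 also have "\<dots>=(\<Sum>m\<in>{0..<int r}. c m)+(\<Sum>m\<in>{0..<int r}. c(- \<epsilon>-m))" by(rule sum.distrib)
 also have "(\<Sum>m\<in>{0..<int r}. c(- \<epsilon>-m))=(\<Sum>m\<in>{0..<int r}. c m)"
 proof(rule sum_reflect_periodic[where c=c, OF r0])
  show "c(m+int r)=c m" for m unfolding c_def
   by(rule cmean_cong)(use core_period[OF bal circ _ g] ytheta_quasi in auto)
 qed
 also have "(\<Sum>m\<in>{0..<int r}. c m)=0" using telescoping by(simp add: cint_def c_def)
 finally show ?thesis by simp
qed

end

end

section \<open>Determinants and their integration over the torus\<close>

text \<open>The relation expresses the last row through the first N, so a companion matrix maps the
  rows 0, ..., N - 1 to the rows 1, ..., N; its determinant is the quotient of the extreme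
  coefficients up to sign.\<close>

lemma det_shift_rows:
 fixes R :: "nat => nat => complex" and c :: "nat => complex"
 assumes N: "N > 0" and rel: "\<And>k. k<N==>(\<Sum>a\<le>N. c a * R a k)=0" and cN: "c N~=0"
 shows "c N * det(mat N N(%(i, k). R(Suc i) k))=(-1)^N * c 0 * det(mat N N(%(i, k). R i k))"
proof -
 obtain n where n: "N=Suc n" using N by(cases N) auto
 define C where "C=mat N N(%(i, j). if i=n then-c j/c N else if j=Suc i then 1 else 0 :: complex)"
 have C: "C\<in>carrier_mat N N" by(simp add: C_def)
 define M where "M=mat N N(%(i, k). R i k)"
 have M: "M\<in>carrier_mat N N" by(simp add: M_def)
 have "mat N N(%(i, k). R(Suc i) k)=C * M"
 proof(rule eq_matI)
  fix i k assume "i<dim_row(C * M)" "k<dim_col(C * M)"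
  then have ik: "i<N" "k<N" by(simp_all add: C_def M_def)
  have e: "(C * M) $$ (i, k)=(\<Sum>j<N. C $$ (i, j)* R j k)"
   using ik by(simp add: C_def M_def scalar_prod_def atLeast0LessThan)
  show "mat N N(%(i, k). R(Suc i) k) $$ (i, k)=(C * M) $$ (i, k)"
  proof(cases "i=n")
   case True
   have "(\<Sum>j<N. C $$ (i, j)* R j k)=(\<Sum>j<N. - c j * R j k)/c N"
    unfolding sum_divide_distrib by(rule sum.cong)(use True ik n in \<open>auto simp: C_def\<close>)
   also have "(\<Sum>j<N. - c j * R j k)=c N * R N k"
   proof -
    have "(\<Sum>a\<le>N. c a * R a k)=(\<Sum>a<N. c a * R a k)+c N * R N k"
     by(simp add: lessThan_Suc_atMost[symmetric])
    then show ?thesis using rel[OF ik(2)] by(simp add: sum_negf add_eq_0_iff)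
   qed
   finally show ?thesis using True ik cN n e by simp
  next
   case False
   then have "i<n" using ik n by simp
   have "(\<Sum>j<N. C $$ (i, j)* R j k)=(\<Sum>j<N. if j=Suc i then R j k else 0)"
    by(rule sum.cong)(use False ik in \<open>auto simp: C_def\<close>)
   also have "\<dots>=R(Suc i) k" using \<open>i<n\<close> n by simp
   finally show ?thesis using ik e by simp
  qed
 qed(simp_all add: C_def M_def)
 then have "det(mat N N(%(i, k). R(Suc i) k))=det C * det M" using det_mult[OF C M] by simp
 moreover have "det C=(-1)^N * c 0/c N"
 proof -
  have "det C=(\<Sum>i<N. C $$ (i, 0)* cofactor C i 0)" by(rule laplace_expansion_column[OF C N])
  also have "\<dots>=(\<Sum>i<N. if i=n then C $$ (n, 0)* cofactor C n 0 else 0)"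
   by(rule sum.cong)(auto simp: C_def N)
  also have "\<dots>=C $$ (n, 0)* cofactor C n 0" using n by simp
  also have "C $$ (n, 0) = - c 0/c N" by(simp add: C_def n)
  also have "cofactor C n 0=(-1)^n"
  proof -
   have "mat_delete C n 0=1\<^sub>m n"
    by(rule eq_matI)(auto simp: mat_delete_def C_def n)
   then show ?thesis by(simp add: cofactor_def)
  qed
  finally show ?thesis by(simp add: n)
 qed
 ultimately show ?thesis using cN by(simp add: M_def)
qed

definition pair_prod :: "nat => (nat => nat => complex) => complex" where
 "pair_prod N f=(\<Prod>j\<in>{1..N}. \<Prod>k\<in>{j<..N}. f j k)"

lemma pair_prod_Suc:
 "pair_prod(Suc N) f=(\<Prod>k\<in>{1..N}. f 1(Suc k))* pair_prod N(%j k. f(Suc j)(Suc k))"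
proof -
 have sh: "(\<Prod>k\<in>{Suc j<..Suc N}. g k)=(\<Prod>k\<in>{j<..N}. g(Suc k))" for j and g :: "nat => complex"
  by(rule prod.reindex_bij_witness[of _ Suc "%k. k-1"]) auto
 have "pair_prod(Suc N) f=(\<Prod>k\<in>{1<..Suc N}. f 1 k)*(\<Prod>j\<in>{2..Suc N}. \<Prod>k\<in>{j<..Suc N}. f j k)"
 proof -
  have "{1..Suc N}=insert 1 {2..Suc N}" by auto
  then show ?thesis unfolding pair_prod_def by simp
 qed
 also have "(\<Prod>k\<in>{1<..Suc N}. f 1 k)=(\<Prod>k\<in>{1..N}. f 1(Suc k))"
  by(rule prod.reindex_bij_witness[of _ Suc "%k. k-1"]) auto
 also have "(\<Prod>j\<in>{2..Suc N}. \<Prod>k\<in>{j<..Suc N}. f j k)=(\<Prod>j\<in>{1..N}. \<Prod>k\<in>{Suc j<..Suc N}. f(Suc j) k)"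
  by(rule prod.reindex_bij_witness[of _ Suc "%k. k-1"]) auto
 finally show ?thesis unfolding sh pair_prod_def .
qed

lemma pair_prod_mult: "pair_prod N(%j k. f j k * g j k)=pair_prod N f * pair_prod N g"
 by(simp add: pair_prod_def prod.distrib)

lemma pair_prod_const: "pair_prod N(%j k. c)=c^(N *(N-1) div 2)"
proof(induction N)
 case(Suc N)
 have "Suc N *(Suc N-1) div 2=N+N *(N-1) div 2"
 proof -
  have "Suc N *(Suc N-1)=2 * N+N *(N-1)" by(cases N) auto
  then show ?thesis by simp
 qed
 then show ?case unfolding pair_prod_Suc Suc by(simp add: power_add)
qed(simp add: pair_prod_def)

lemma pair_prod_cong:
 "(\<And>j k. j\<in>{1..N}==>k\<in>{1..N}==>f j k=g j k)==>pair_prod N f=pair_prod N g"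
 unfolding pair_prod_def by(intro prod.cong refl) auto

lemma prod_list_diag: "prod_list(diag_mat L)=(\<Prod>i<dim_row L. L $$ (i, i))" for L :: "complex mat"
 unfolding diag_mat_def by(subst prod.distinct_set_conv_list[symmetric])(auto simp: atLeast0LessThan)

text \<open>The homogeneous Vandermonde determinant. The row operations that clear the first column
  are invertible only for v 1 nonzero; for v 1 = 0 that column already has a single entry.\<close>

lemma det_vandermonde:
 fixes u v :: "nat => complex"
 shows "det(mat N N(%(i, j). u(Suc j)^i * v(Suc j)^(N-1-i)))
  = pair_prod N(%j k. u k * v j-u j * v k)"
proof(induction N arbitrary: u v)
 case 0
 then show ?case by(simp add: pair_prod_def det_def)
next
 case(Suc N)
 define A where "A=mat(Suc N)(Suc N)(%(i, j). u(Suc j)^i * v(Suc j)^(N-i))"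
 have A: "A\<in>carrier_mat(Suc N)(Suc N)" by(simp add: A_def)
 let ?D = "mat N N(%(i, j). u(Suc(Suc j))^i * v(Suc(Suc j))^(N-1-i))"
 have D: "?D\<in>carrier_mat N N" by simp
 have IH: "det ?D=pair_prod N(%j k. u(Suc k)* v(Suc j)-u(Suc j)* v(Suc k))"
  using Suc[of "%j. u(Suc j)" "%j. v(Suc j)"] by simp
 have scale: "det(mat N N(%(i, j). w j *(u(Suc(Suc j))^i * v(Suc(Suc j))^(N-1-i))))=(\<Prod>k\<in>{1..N}. w(k-1))* det ?D"
  for w :: "nat => complex"
 proof -
  have "det(mat N N(%(i, j). w j *(u(Suc(Suc j))^i * v(Suc(Suc j))^(N-1-i))))
   = det(?D * mat N N(%(i, j). if i=j then w j else 0))"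
  proof(rule arg_cong[of _ _ det], rule eq_matI)
   fix i j assume "i<dim_row(?D * mat N N(%(i, j). if i=j then w j else 0))"
    "j<dim_col(?D * mat N N(%(i, j). if i=j then w j else 0))"
   then have ij: "i<N" "j<N" by auto
   have "(?D * mat N N(%(i, j). if i=j then w j else 0)) $$ (i, j)
    = (\<Sum>k\<in>{0..<N}. u(Suc(Suc k))^i * v(Suc(Suc k))^(N-1-i)*(if k=j then w j else 0))"
    using ij by(simp add: scalar_prod_def)
   also have "\<dots>=(\<Sum>k\<in>{0..<N}. if k=j then u(Suc(Suc k))^i * v(Suc(Suc k))^(N-1-i)* w j else 0)"
    by(rule sum.cong) auto
   finally have "(?D * mat N N(%(i, j). if i=j then w j else 0)) $$ (i, j)=\<dots>" .
   then show "mat N N(%(i, j). w j *(u(Suc(Suc j))^i * v(Suc(Suc j))^(N-1-i))) $$ (i, j)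
    = (?D * mat N N(%(i, j). if i=j then w j else 0)) $$ (i, j)" using ij by(simp add: mult_ac)
  qed auto
  also have "\<dots>=det ?D * det(mat N N(%(i, j). if i=j then w j else 0))"
   by(rule det_mult) auto
  also have "det(mat N N(%(i, j). if i=j then w j else 0))=(\<Prod>j<N. w j)"
  proof -
   have "upper_triangular(mat N N(%(i, j). if i=j then w j else 0))" by(auto simp: upper_triangular_def)
   from det_upper_triangular[OF this, of N] show ?thesis
    unfolding prod_list_diag by simp
  qed
  also have "(\<Prod>j<N. w j)=(\<Prod>k\<in>{1..N}. w(k-1))"
   by(rule prod.reindex_bij_witness[of _ "%k. k-1" Suc]) auto
  finally show ?thesis by(simp add: mult.commute)
 qed
 have "det A=(\<Prod>k\<in>{1..N}. u(Suc k)* v 1-u 1 * v(Suc k))* det ?D"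
 proof(cases "v 1=0")
  case False
  \<comment> \<open>Row i of L A is v_1 times row i minus u_1 times row i - 1. This annihilates the
    first column below the top and extracts u_j v_1 - u_1 v_j from column j.\<close>
  define L where "L=mat(Suc N)(Suc N)(%(i, j). if i=0 then(if j=0 then 1 else 0)
    else if j=i then v 1 else if Suc j=i then-u 1 else 0)"
  have L: "L\<in>carrier_mat(Suc N)(Suc N)" by(simp add: L_def)
  have detL: "det L=v 1^N"
  proof -
   have "det L=prod_list(diag_mat L)"
    by(rule det_lower_triangular[OF _ L])(auto simp: L_def)
   also have "\<dots>=(\<Prod>i<Suc N. L $$ (i, i))"
    unfolding prod_list_diag by(simp add: L_def)
   also have "\<dots>=v 1^N" unfolding prod.lessThan_Suc_shift by(simp add: L_def)
   finally show ?thesis .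
  qed
  have LA: "L * A\<in>carrier_mat(Suc N)(Suc N)" using L A by simp
  have ent: "(L * A) $$ (i, j)=(if i=0 then v(Suc j)^N
    else(u(Suc j)* v 1-u 1 * v(Suc j))*(u(Suc j)^(i-1)* v(Suc j)^(N-i)))"
   if ij: "i<Suc N" "j<Suc N" for i j
  proof -
   have "(L * A) $$ (i, j)=(\<Sum>k<Suc N. L $$ (i, k)* A $$ (k, j))"
    using ij L A by(simp add: scalar_prod_def atLeast0LessThan)
   also have "\<dots>=(if i=0 then v(Suc j)^N
    else(u(Suc j)* v 1-u 1 * v(Suc j))*(u(Suc j)^(i-1)* v(Suc j)^(N-i)))"
   proof(cases "i=0")
    case True
    have "(\<Sum>k<Suc N. L $$ (i, k)* A $$ (k, j))=(\<Sum>k<Suc N. if k=0 then A $$ (0, j) else 0)"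
     by(rule sum.cong)(use True in \<open>auto simp: L_def\<close>)
    then show ?thesis using True ij by(simp add: A_def)
   next
    case False
    then obtain i' where i': "i=Suc i'" by(cases i) auto
    have "(\<Sum>k<Suc N. L $$ (i, k)* A $$ (k, j))
     = (\<Sum>k<Suc N. (if k=i then v 1 * A $$ (i, j) else 0)+(if k=i' then-u 1 * A $$ (i', j) else 0))"
     by(rule sum.cong)(use i' ij in \<open>auto simp: L_def\<close>)
    also have "\<dots>=v 1 * A $$ (i, j) + - u 1 * A $$ (i', j)"
     unfolding sum.distrib using i' ij by simp
    also have "\<dots>=(u(Suc j)* v 1-u 1 * v(Suc j))*(u(Suc j)^(i-1)* v(Suc j)^(N-i))"
    proof -
     have "N-i'=Suc(N-i)" using i' ij by simp
     then show ?thesis using i' ij by(simp add: A_def algebra_simps)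
    qed
    finally show ?thesis using False by simp
   qed
   finally show ?thesis .
  qed
  define Q where "Q=L * A"
  have Qd: "dim_row Q=Suc N" "dim_col Q=Suc N" using LA by(auto simp: Q_def)
  note entQ=ent[folded Q_def]
  have "det(L * A)=(\<Sum>i<Suc N. (L * A) $$ (i, 0)* cofactor(L * A) i 0)"
   by(rule laplace_expansion_column[OF LA]) simp
  also have "\<dots>=(\<Sum>i<Suc N. if i=0 then v 1^N * cofactor(L * A) 0 0 else 0)"
   by(rule sum.cong)(auto simp: ent)
  also have "\<dots>=v 1^N * det(mat_delete Q 0 0)" by(simp add: cofactor_def Q_def)
  also have "mat_delete Q 0 0=mat N N(%(i, j). (u(Suc(Suc j))* v 1-u 1 * v(Suc(Suc j)))
    *(u(Suc(Suc j))^i * v(Suc(Suc j))^(N-1-i)))"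
   by(rule eq_matI)(use Qd in \<open>auto simp: mat_delete_def entQ\<close>)
  also have "det \<dots>=(\<Prod>k\<in>{1..N}. u(Suc(Suc(k-1)))* v 1-u 1 * v(Suc(Suc(k-1))))* det ?D"
   by(rule scale)
  also have "(\<Prod>k\<in>{1..N}. u(Suc(Suc(k-1)))* v 1-u 1 * v(Suc(Suc(k-1))))
    = (\<Prod>k\<in>{1..N}. u(Suc k)* v 1-u 1 * v(Suc k))"
   by(rule prod.cong) auto
  finally have "det L * det A=v 1^N *((\<Prod>k\<in>{1..N}. u(Suc k)* v 1-u 1 * v(Suc k))* det ?D)"
   using det_mult[OF L A] by simp
  then show ?thesis using False detL by simp
 next
  case True
  have "det A=(\<Sum>i<Suc N. A $$ (i, 0)* cofactor A i 0)"
   by(rule laplace_expansion_column[OF A]) simp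
  also have "\<dots>=(\<Sum>i<Suc N. if i=N then u 1^N * cofactor A N 0 else 0)"
   by(rule sum.cong)(use True in \<open>auto simp: A_def\<close>)
  also have "\<dots>=(- u 1)^N * det(mat_delete A N 0)"
   by(simp add: cofactor_def power_minus[of "u(Suc 0)"] mult_ac)
  also have "mat_delete A N 0=mat N N(%(i, j). v(Suc(Suc j))*(u(Suc(Suc j))^i * v(Suc(Suc j))^(N-1-i)))"
  proof(rule eq_matI)
   fix i j assume "i<dim_row(mat N N(%(i, j). v(Suc(Suc j))*(u(Suc(Suc j))^i * v(Suc(Suc j))^(N-1-i))))"
    "j<dim_col(mat N N(%(i, j). v(Suc(Suc j))*(u(Suc(Suc j))^i * v(Suc(Suc j))^(N-1-i))))"
   then have ij: "i<N" "j<N" by auto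
   then have "N-i=Suc(N-1-i)" by simp
   then show "mat_delete A N 0 $$ (i, j)=mat N N(%(i, j). v(Suc(Suc j))*(u(Suc(Suc j))^i * v(Suc(Suc j))^(N-1-i))) $$ (i, j)"
    using ij by(simp add: mat_delete_def A_def mult_ac)
  qed(auto simp: mat_delete_def A_def)
  also have "det \<dots>=(\<Prod>k\<in>{1..N}. v(Suc(Suc(k-1))))* det ?D" by(rule scale)
  also have "(\<Prod>k\<in>{1..N}. v(Suc(Suc(k-1))))=(\<Prod>k\<in>{1..N}. v(Suc k))"
   by(rule prod.cong) auto
  also have "(- u 1)^N *((\<Prod>k\<in>{1..N}. v(Suc k))* det ?D)=(\<Prod>k\<in>{1..N}. - u 1 * v(Suc k))* det ?D"
   unfolding prod.distrib by simp
  finally show ?thesis using True by simp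
 qed
 then show ?case unfolding pair_prod_Suc IH[symmetric] by(simp add: A_def)
qed

lemma torus_integral_expand:
 fixes h :: "'s => nat => complex => complex"
 assumes I: "finite I" and cont: "\<And>s j. s\<in>I==>j\<in>{1..N}==>continuous_on(sphere 0 1)(h s j)"
  and eq: "\<And>z. (\<And>j. j\<in>{1..N}==>norm(z j)=1)==>f z=(\<Sum>s\<in>I. c s *(\<Prod>j\<in>{1..N}. h s j(z j)))"
 shows "torus_integral N f=(\<Sum>s\<in>I. c s *(\<Prod>j\<in>{1..N}. contour_integral(circlepath 0 1)(h s j)))"
proof -
 interpret product_sigma_finite "%_::nat. lborel :: real measure" by standard
 define \<phi> where "\<phi>=(%s j x. indicator {0..1::real} x *\<^sub>R
  (h s j(circlepath 0 1 x)* vector_derivative(circlepath 0 1)(at x)))"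
 have contc: "continuous_on {0..1} (%x. h s j(circlepath 0 1 x)* vector_derivative(circlepath 0 1)(at x))"
  if "s\<in>I" "j\<in>{1..N}" for s j
  unfolding vector_derivative_circlepath
  by(intro continuous_intros continuous_on_compose2[OF cont[OF that]])(auto simp: circlepath intro!: continuous_intros)
 have int: "integrable lborel(\<phi> s j)" if "s\<in>I" "j\<in>{1..N}" for s j
  using borel_integrable_atLeastAtMost'[OF contc[OF that]] by(simp add: \<phi>_def set_integrable_def)
 have val: "integral\<^sup>L lborel(\<phi> s j)=contour_integral(circlepath 0 1)(h s j)" if "s\<in>I" "j\<in>{1..N}" for s j
  using set_borel_integral_eq_integral(2)[OF borel_integrable_atLeastAtMost'[OF contc[OF that]]]
  by(simp add: \<phi>_def set_lebesgue_integral_def contour_integral_integral)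
 have prod_int: "integrable(\<Pi>\<^sub>M j\<in>{1..N}. lborel)(%x. \<Prod>j\<in>{1..N}. \<phi> s j(x j))" if "s\<in>I" for s
  by(rule product_integrable_prod)(use int that in auto)
 have "torus_integral N f=(\<integral>x. (\<Sum>s\<in>I. c s *(\<Prod>j\<in>{1..N}. \<phi> s j(x j))) \<partial>(\<Pi>\<^sub>M j\<in>{1..N}. lborel))"
  unfolding torus_integral_def set_lebesgue_integral_def
 proof(rule Bochner_Integration.integral_cong[OF refl])
  fix x :: "nat => real" assume "x\<in>space(\<Pi>\<^sub>M j\<in>{1..N}. lborel)"
  then have ext: "x\<in>{1..N} \<rightarrow>\<^sub>E UNIV" by(simp add: space_PiM)
  show "indicat_real({1..N} \<rightarrow>\<^sub>E {0..1}) x *\<^sub>R(f(%j. circlepath 0 1(x j)) *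
    (\<Prod>j\<in>{1..N}. vector_derivative(circlepath 0 1)(at(x j))))=(\<Sum>s\<in>I. c s *(\<Prod>j\<in>{1..N}. \<phi> s j(x j)))"
  proof(cases "x\<in>{1..N} \<rightarrow>\<^sub>E {0..1}")
   case True
   then have x01: "x j\<in>{0..1}" if "j\<in>{1..N}" for j using that by auto
   have "f(%j. circlepath 0 1(x j))=(\<Sum>s\<in>I. c s *(\<Prod>j\<in>{1..N}. h s j(circlepath 0 1(x j))))"
    by(rule eq)(simp add: circlepath)
   moreover have "(\<Prod>j\<in>{1..N}. \<phi> s j(x j))=(\<Prod>j\<in>{1..N}. h s j(circlepath 0 1(x j)))
     *(\<Prod>j\<in>{1..N}. vector_derivative(circlepath 0 1)(at(x j)))" for s
    unfolding prod.distrib[symmetric] by(rule prod.cong)(use x01 in \<open>auto simp: \<phi>_def\<close>)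
   ultimately show ?thesis using True by(simp add: sum_distrib_left sum_distrib_right mult_ac)
  next
   case False
   then obtain j where j: "j\<in>{1..N}" "x j \<notin> {0..1}" using ext by(auto simp: PiE_iff)
   then have p0: "(\<Prod>j\<in>{1..N}. \<phi> s j(x j))=0" for s
    by(intro prod_zero)(auto simp: \<phi>_def intro!: bexI[of _ j])
   have i0: "indicat_real({1..N} \<rightarrow>\<^sub>E {0..1}) x=0" using False by(auto simp: indicator_def)
   show ?thesis unfolding i0 p0 by simp
  qed
 qed
 also have "\<dots>=(\<Sum>s\<in>I. c s *(\<integral>x. (\<Prod>j\<in>{1..N}. \<phi> s j(x j)) \<partial>(\<Pi>\<^sub>M j\<in>{1..N}. lborel)))"
  by(subst Bochner_Integration.integral_sum)(use prod_int in auto)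
 also have "\<dots>=(\<Sum>s\<in>I. c s *(\<Prod>j\<in>{1..N}. contour_integral(circlepath 0 1)(h s j)))"
 proof(rule sum.cong[OF refl])
  fix s assume s: "s\<in>I"
  have "(\<integral>x. (\<Prod>j\<in>{1..N}. \<phi> s j(x j)) \<partial>(\<Pi>\<^sub>M j\<in>{1..N}. lborel))=(\<Prod>j\<in>{1..N}. integral\<^sup>L lborel(\<phi> s j))"
   by(rule product_integral_prod)(use int s in auto)
  then show "c s *(\<integral>x. (\<Prod>j\<in>{1..N}. \<phi> s j(x j)) \<partial>(\<Pi>\<^sub>M j\<in>{1..N}. lborel))
   = c s *(\<Prod>j\<in>{1..N}. contour_integral(circlepath 0 1)(h s j))" using val[OF s] by simp
 qed
 finally show ?thesis .
qed

text \<open>Each pair of permutations contributes a product of one-variable integrals. For a fixed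
  second permutation the sum over the first is a row-permuted determinant whose sign cancels, so
  every one of the N! permutations gives the same value.\<close>

lemma andreief:
 fixes F H :: "nat => complex => int => complex" and w :: "complex => int => complex"
 assumes R: "finite R"
  and cont: "\<And>i k m. i<N==>k<N==>m\<in>R==>continuous_on(sphere 0 1)(%z. F i z m * H k z m * w z m)"
  and eq: "\<And>m z. m\<in>{1..N} \<rightarrow>\<^sub>E R==>(\<And>j. j\<in>{1..N}==>norm(z j)=1)==>f m z =
    det(mat N N(%(i, j). F i(z(Suc j))(m(Suc j))))* det(mat N N(%(i, j). H i(z(Suc j))(m(Suc j))))
    *(\<Prod>j\<in>{1..N}. w(z j)(m j))"
 shows "(\<Sum>m\<in>{1..N} \<rightarrow>\<^sub>E R. torus_integral N(f m))
  = fact N * det(mat N N(%(i, k). \<Sum>m\<in>R. contour_integral(circlepath 0 1)(%z. F i z m * H k z m * w z m)))"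
proof -
 let ?P = "{\<sigma>. \<sigma> permutes {0..<N}}"
 have finP: "finite ?P" by(simp add: finite_permutations)
 define e where "e=(%i k. \<Sum>m\<in>R. contour_integral(circlepath 0 1)(%z. F i z m * H k z m * w z m))"
 define h where "h=(%m(\<sigma>::nat=>nat, \<tau>::nat=>nat) j z. F(\<sigma> (j-1)) z(m j)* H(\<tau> (j-1)) z(m j)* w z(m j))"
 define c where "c=(%(\<sigma>::nat=>nat, \<tau>::nat=>nat). signof \<sigma> * signof \<tau> :: complex)"
 have det_cols: "det(mat N N(%(i, j). K i j))=(\<Sum>\<sigma>\<in>?P. signof \<sigma> *(\<Prod>j\<in>{1..N}. K(\<sigma> (j-1))(j-1)))"
  for K :: "nat => nat => complex"
 proof -
  have "det(mat N N(%(i, j). K i j))=(\<Sum>\<sigma>\<in>?P. signof \<sigma> *(\<Prod>j=0..<N. K(\<sigma> j) j))"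
   by(subst det_col[of _ N])(auto intro!: sum.cong prod.cong dest: permutes_in_image simp: atLeast0LessThan)
  moreover have "(\<Prod>j=0..<N. K(\<sigma> j) j)=(\<Prod>j\<in>{1..N}. K(\<sigma> (j-1))(j-1))" for \<sigma>
   by(rule prod.reindex_bij_witness[of _ "%k. k-1" Suc]) auto
  ultimately show ?thesis by simp
 qed
 have perm_lt: "\<sigma> (j-1)<N" if "\<sigma> \<in> ?P" "j\<in>{1..N}" for \<sigma> j
  using permutes_in_image[of \<sigma> "{0..<N}" "j-1"] that by auto
 have "torus_integral N(f m)=(\<Sum>s\<in>?P \<times> ?P. c s *(\<Prod>j\<in>{1..N}. contour_integral(circlepath 0 1)(h m s j)))"
  if m: "m\<in>{1..N} \<rightarrow>\<^sub>E R" for m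
 proof(rule torus_integral_expand)
  show "continuous_on(sphere 0 1)(h m s j)" if "s \<in> ?P \<times> ?P" "j\<in>{1..N}" for s j
  proof -
   obtain \<sigma> \<tau> where s: "s=(\<sigma>, \<tau>)" "\<sigma> \<in> ?P" "\<tau> \<in> ?P" using \<open>s \<in> ?P \<times> ?P\<close> by auto
   show ?thesis unfolding h_def s(1) prod.case
    by(rule cont)(use perm_lt s that m in auto)
  qed
  show "f m z=(\<Sum>s\<in>?P \<times> ?P. c s *(\<Prod>j\<in>{1..N}. h m s j(z j)))"
   if z: "\<And>j. j\<in>{1..N}==>norm(z j)=1" for z
  proof -
   have "f m z=(\<Sum>\<sigma>\<in>?P. signof \<sigma> *(\<Prod>j\<in>{1..N}. F(\<sigma> (j-1))(z j)(m j)))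
     *(\<Sum>\<tau>\<in>?P. signof \<tau> *(\<Prod>j\<in>{1..N}. H(\<tau> (j-1))(z j)(m j)))*(\<Prod>j\<in>{1..N}. w(z j)(m j))"
    using eq[of m z, OF m z] unfolding det_cols by simp
   also have "\<dots>=(\<Sum>\<sigma>\<in>?P. \<Sum>\<tau>\<in>?P. signof \<sigma> * signof \<tau> *(\<Prod>j\<in>{1..N}. F(\<sigma> (j-1))(z j)(m j)* H(\<tau> (j-1))(z j)(m j)* w(z j)(m j)))"
    unfolding sum_product sum_distrib_right prod.distrib by(simp add: sum_distrib_left mult_ac)
   finally show ?thesis unfolding sum.cartesian_product by(simp add: c_def h_def case_prod_unfold)
  qed
 qed(use finP in auto)
 then have "(\<Sum>m\<in>{1..N} \<rightarrow>\<^sub>E R. torus_integral N(f m))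
  = (\<Sum>m\<in>{1..N} \<rightarrow>\<^sub>E R. \<Sum>s\<in>?P \<times> ?P. c s *(\<Prod>j\<in>{1..N}. contour_integral(circlepath 0 1)(h m s j)))"
  by(intro sum.cong refl) auto
 also have "\<dots>=(\<Sum>s\<in>?P \<times> ?P. c s *(\<Sum>m\<in>{1..N} \<rightarrow>\<^sub>E R. \<Prod>j\<in>{1..N}. contour_integral(circlepath 0 1)(h m s j)))"
  by(subst sum.swap)(simp add: sum_distrib_left)
 also have "\<dots>=(\<Sum>s\<in>?P \<times> ?P. c s *(\<Prod>j\<in>{1..N}. e(fst s(j-1))(snd s(j-1))))"
 proof(rule sum.cong[OF refl])
  fix s :: "(nat => nat) \<times> (nat => nat)"
  have "(\<Prod>j\<in>{1..N}. e(fst s(j-1))(snd s(j-1)))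
    = (\<Sum>m\<in>{1..N} \<rightarrow>\<^sub>E R. \<Prod>j\<in>{1..N}. contour_integral(circlepath 0 1)(h m s j))"
   unfolding e_def by(subst prod_sum_PiE)(use R in \<open>auto simp: h_def case_prod_unfold\<close>)
  then show "c s *(\<Sum>m\<in>{1..N} \<rightarrow>\<^sub>E R. \<Prod>j\<in>{1..N}. contour_integral(circlepath 0 1)(h m s j))
   = c s *(\<Prod>j\<in>{1..N}. e(fst s(j-1))(snd s(j-1)))" by simp
 qed
 also have "\<dots>=(\<Sum>\<tau>\<in>?P. signof \<tau> *(\<Sum>\<sigma>\<in>?P. signof \<sigma> *(\<Prod>j\<in>{1..N}. e(\<sigma> (j-1))(\<tau> (j-1)))))"
 proof -
  have "(\<Sum>s\<in>?P \<times> ?P. c s *(\<Prod>j\<in>{1..N}. e(fst s(j-1))(snd s(j-1))))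
   = (\<Sum>(\<sigma>, \<tau>)\<in>?P \<times> ?P. signof \<sigma> * signof \<tau> *(\<Prod>j\<in>{1..N}. e(\<sigma> (j-1))(\<tau> (j-1))))"
   by(rule sum.cong)(auto simp: c_def)
  also have "\<dots>=(\<Sum>\<sigma>\<in>?P. \<Sum>\<tau>\<in>?P. signof \<sigma> * signof \<tau> *(\<Prod>j\<in>{1..N}. e(\<sigma> (j-1))(\<tau> (j-1))))"
   by(rule sum.cartesian_product[symmetric])
  also have "\<dots>=(\<Sum>\<tau>\<in>?P. \<Sum>\<sigma>\<in>?P. signof \<sigma> * signof \<tau> *(\<Prod>j\<in>{1..N}. e(\<sigma> (j-1))(\<tau> (j-1))))"
   by(rule sum.swap)
  finally show ?thesis by(simp add: sum_distrib_left mult_ac)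
 qed
 also have "\<dots>=(\<Sum>\<tau>\<in>?P. det(mat N N(%(i, k). e i k)))"
 proof(rule sum.cong[OF refl])
  fix \<tau> assume \<tau>: "\<tau> \<in> ?P"
  have "(\<Sum>\<sigma>\<in>?P. signof \<sigma> *(\<Prod>j\<in>{1..N}. e(\<sigma> (j-1))(\<tau> (j-1))))=det(mat N N(%(i, j). e i(\<tau> j)))"
   by(rule det_cols[symmetric])
  also have "\<dots>=det(mat N N(%(j, i). e i(\<tau> j)))"
   by(subst det_transpose[symmetric, of _ N])(auto intro!: arg_cong[of _ _ det] simp: transpose_mat_def)
  also have "\<dots>=det(mat N N(%(j, i). mat N N(%(k, i). e i k) $$ (\<tau> j, i)))"
   by(rule arg_cong[of _ _ det], rule eq_matI)(use \<tau> perm_lt[of \<tau> "Suc _"] in auto)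
  also have "\<dots>=signof \<tau> * det(mat N N(%(k, i). e i k))"
   by(rule det_permute_rows)(use \<tau> in auto)
  also have "det(mat N N(%(k, i). e i k))=det(mat N N(%(i, k). e i k))"
   by(subst det_transpose[symmetric, of _ N])(auto intro!: arg_cong[of _ _ det] simp: transpose_mat_def)
  finally show "signof \<tau> *(\<Sum>\<sigma>\<in>?P. signof \<sigma> *(\<Prod>j\<in>{1..N}. e(\<sigma> (j-1))(\<tau> (j-1))))=det(mat N N(%(i, k). e i k))"
   using signof_pm_one[of \<tau>] by(auto simp: sign_def)
 qed
 also have "\<dots>=fact N * det(mat N N(%(i, k). e i k))"
  by(simp add: card_permutations[of "{0..<N}" N])
 finally show ?thesis by(simp add: e_def)
qed

lemma torus_integral_cmult: "torus_integral N(%z. c * f z)=c * torus_integral N f"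
 unfolding torus_integral_def by(simp only: mult.assoc set_integral_mult_right)

text \<open>The condition under which the monomials of \<open>theta_mono\<close> with base points X
  and Y span the even theta functions.\<close>

definition generic :: "complex => complex => complex => bool" where
 "generic b X Y \<longleftrightarrow> X~=0\<and>Y~=0\<and>(\<forall>k::int. X\<^sup>2~=b powi k)\<and>theta_prod b X Y~=0"

definition theta_mono :: "complex => complex => complex => nat => nat => complex => complex" where
 "theta_mono b X Y d i x=theta_prod b x X^i * theta_prod b x Y^(d-i)"

lemma genericD:
 assumes "generic b X Y"
 shows "X~=0" "Y~=0" "X\<^sup>2~=b powi k" "theta_prod b X Y~=0"
 using assms by(auto simp: generic_def)

lemma theta_mono_even:
 assumes "norm b<1" "b~=0" "generic b X Y" "i\<le>d"
 shows "even_theta b d(theta_mono b X Y d i)"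
proof -
 have "even_theta b d(%x. theta_prod b x X^i * theta_prod b x Y^(d-i))"
  by(intro even_theta_monomial theta_prod_even)(use assms genericD in auto)
 then show ?thesis by(simp add: theta_mono_def[abs_def])
qed

lemma generic_exists:
 assumes b: "norm b<1" "b~=0"
 obtains X Y where "generic b X Y"
proof
 \<comment> \<open>With Y = 1 the conditions concern s and s^2, of modulus |b|^(1/4) and |b|^(1/2),
   which are no integral powers of |b|.\<close>
 define s where "s=norm b powr(1/4)"
 have s: "s > 0" "s^4=norm b" using b by(auto simp: s_def powr_power)
 have s1: "s<1"
 proof(rule ccontr)
  assume "\<not> s<1"
  then have "1\<le>s^4" by(intro one_le_power) simp
  then show False using s b by simp
 qed
 have bk: "norm(b powi k)=s powi(4 * k)" for k
  unfolding power_int_mult by(simp add: norm_power_int s(2))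
 have ne: "s powi i~=s powi j" if "i~=j" for i j :: int
  using that s s1 by(metis linorder_neqE power_int_strict_decreasing less_irrefl)
 have A: "of_real s^n~=b powi k" if "n\<in>{1, 2}" for n k
 proof
  assume "of_real s^n=b powi k"
  then have "s powi int n=s powi(4 * k)" using bk[of k] s by(metis abs_of_pos norm_of_real norm_power power_int_of_nat)
  then have "int n=4 * k" using ne by blast
  then show False using that by auto presburger+
 qed
 have "theta_prod b(of_real s) 1~=0"
  using theta_prod_eq_0[OF b, of "of_real s" 1] s A[of 1] by simp
 then show "generic b(of_real s) 1" using s A[of 2] by(simp add: generic_def)
qed

section \<open>The multiple integral as a determinant of pairings\<close>

context rarefied
begin

definition pairing :: "nat set => nat => (nat => complex) => (nat => int) =>
  (complex => complex) => (complex => complex) => complex" where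
 "pairing S N t \<nu> F H=cint S N 0 t \<nu> (%x. F x * jtheta(x\<^sup>2)(p^r))(%x. H x * jtheta(x\<^sup>2)(q^r))"

definition weight :: "nat set => nat => (nat => complex) => (nat => int) => complex => int => complex" where
 "weight S N t \<nu>=core S N 0 t \<nu> (%x. jtheta(x\<^sup>2)(p^r))(%x. jtheta(x\<^sup>2)(q^r))"

text \<open>Up to a power of pq this is the integrand of the theorem, with the reciprocal gamma
  factors of pairs of variables written through theta functions; see
  \<open>Delta_I_eq\<close>.\<close>

definition TT_integrand :: "nat set => nat => (nat => complex) => (nat => int) => (nat => int) => (nat => complex) => complex" where
 "TT_integrand S N t \<nu> m z =
   pair_prod N(%j k. theta_prod(p^r)(zp(z j)(m j))(zp(z k)(m k))* theta_prod(q^r)(zq(z j)(m j))(zq(z k)(m k)))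
   *(\<Prod>j\<in>{1..N}. weight S N t \<nu> (z j)(m j)/z j)"

definition TT :: "nat set => nat => (nat => complex) => (nat => int) => complex" where
 "TT S N t \<nu>=(\<Sum>m\<in>{1..N} \<rightarrow>\<^sub>E {0..<int r}. torus_integral N(TT_integrand S N t \<nu> m))"

definition pmat :: "nat set => nat => (nat => complex) => (nat => int) => complex => complex => complex => complex => complex mat" where
 "pmat S N t \<nu> X Y X' Y'=mat N N(%(i, k). pairing S N t \<nu>
   (theta_mono(p^r) X Y(N-1) i)(theta_mono(q^r) X' Y'(N-1) k))"

lemma core_factor: "core S N 0 t \<nu> (%x. F x * jtheta(x\<^sup>2)(p^r))(%x. H x * jtheta(x\<^sup>2)(q^r)) z m
  = F(zp z m)* H(zq z m)* weight S N t \<nu> z m"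
 by(simp add: weight_def core_def mult_ac)

lemma jtheta_square_holomorphic:
 assumes "norm b<1" "b~=0"
 shows "(%x. jtheta(x\<^sup>2) b) holomorphic_on(- {0})"
 by(rule compose_nonzero_holomorphic[OF jtheta_holomorphic[OF assms]])(auto intro!: holomorphic_intros)

lemma core_continuous_pairing:
 assumes bal: "balanced S N 0 t \<nu>" and F: "F holomorphic_on(- {0})" and H: "H holomorphic_on(- {0})"
 shows "continuous_on(sphere 0 1)(%z. core S N 0 t \<nu> (%x. F x * jtheta(x\<^sup>2)(p^r))(%x. H x * jtheta(x\<^sup>2)(q^r)) z m)"
 by(intro core_continuous_circle[OF bal] holomorphic_intros F H jtheta_square_holomorphic pr qr)

text \<open>By \<open>theta_prod_relation\<close> the interaction is a product of two Vandermonde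
  determinants, one of nome p^r and one of nome q^r. Each pair costs the two normalising constants,
  hence the exponent N (N - 1)/2.\<close>

lemma TT_det:
 assumes bal: "balanced S N 0 t \<nu>" and X: "generic(p^r) X Y" and X': "generic(q^r) X' Y'"
 shows "(theta_prod(p^r) X Y * theta_prod(q^r) X' Y')^(N *(N-1) div 2)* TT S N t \<nu>
  = fact N *(2 * of_real pi * \<i>)^N * det(pmat S N t \<nu> X Y X' Y')"
proof -
 define c where "c=theta_prod(p^r) X Y"
 define c' where "c'=theta_prod(q^r) X' Y'"
 define C where "C=(c * c')^(N *(N-1) div 2)"
 define F where "F=(%i z m. theta_mono(p^r) X Y(N-1) i(zp z m))"
 define H where "H=(%i z m. theta_mono(q^r) X' Y'(N-1) i(zq z m))"
 define w where "w=(%z m. weight S N t \<nu> z m/z)"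
 have core: "F i z m * H k z m * w z m=core S N 0 t \<nu> (%x. theta_mono(p^r) X Y(N-1) i x * jtheta(x\<^sup>2)(p^r))
   (%x. theta_mono(q^r) X' Y'(N-1) k x * jtheta(x\<^sup>2)(q^r)) z m/z" for i k z m
  unfolding core_factor F_def H_def w_def by simp
 note hp=even_thetaD(1)[OF theta_mono_even[OF pr X]] and hq=even_thetaD(1)[OF theta_mono_even[OF qr X']]
 have ci: "(\<Sum>m\<in>{0..<int r}. contour_integral(circlepath 0 1)(%z. F i z m * H k z m * w z m))
   = (2 * of_real pi * \<i>)* pairing S N t \<nu> (theta_mono(p^r) X Y(N-1) i)(theta_mono(q^r) X' Y'(N-1) k)" for i k
  unfolding core by(simp add: cmean_contour pairing_def cint_def sum_distrib_left)
 have "C * TT S N t \<nu>=(\<Sum>m\<in>{1..N} \<rightarrow>\<^sub>E {0..<int r}. torus_integral N(%z. C * TT_integrand S N t \<nu> m z))"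
  unfolding TT_def torus_integral_cmult sum_distrib_left ..
 also have "\<dots>=fact N * det(mat N N(%(i, k). \<Sum>m\<in>{0..<int r}. contour_integral(circlepath 0 1)(%z. F i z m * H k z m * w z m)))"
 proof(rule andreief)
  fix i k :: nat and m :: int assume "i<N" "k<N"
  then have "i\<le>N-1" "k\<le>N-1" by auto
  then show "continuous_on(sphere 0 1)(%z. F i z m * H k z m * w z m)"
   unfolding core by(intro continuous_on_divide core_continuous_pairing[OF bal] hp hq continuous_intros) auto
 next
  fix m :: "nat => int" and z :: "nat => complex"
  assume z: "\<And>j. j\<in>{1..N}==>norm(z j)=1"
  then have z0: "z j~=0" if "j\<in>{1..N}" for j using that by fastforce
  define u where "u=(%j. theta_prod(p^r)(zp(z j)(m j)) X)"
  define v where "v=(%j. theta_prod(p^r)(zp(z j)(m j)) Y)"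
  define u' where "u'=(%j. theta_prod(q^r)(zq(z j)(m j)) X')"
  define v' where "v'=(%j. theta_prod(q^r)(zq(z j)(m j)) Y')"
  have d1: "det(mat N N(%(i, j). F i(z(Suc j))(m(Suc j))))=pair_prod N(%j k. u k * v j-u j * v k)"
   unfolding F_def theta_mono_def using det_vandermonde[of N u v] by(simp add: u_def v_def)
  have d2: "det(mat N N(%(i, j). H i(z(Suc j))(m(Suc j))))=pair_prod N(%j k. u' k * v' j-u' j * v' k)"
   unfolding H_def theta_mono_def using det_vandermonde[of N u' v'] by(simp add: u'_def v'_def)
  have "pair_prod N(%j k. u k * v j-u j * v k)* pair_prod N(%j k. u' k * v' j-u' j * v' k)
   = pair_prod N(%j k. (c * c')*(theta_prod(p^r)(zp(z j)(m j))(zp(z k)(m k))* theta_prod(q^r)(zq(z j)(m j))(zq(z k)(m k))))"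
   unfolding pair_prod_mult[symmetric]
  proof(rule pair_prod_cong)
   fix j k assume jk: "j\<in>{1..N}" "k\<in>{1..N}"
   have a: "theta_prod(p^r)(zp(z j)(m j))(zp(z k)(m k))* c=u j * v k-v j * u k"
    unfolding c_def u_def v_def by(rule theta_prod_relation[OF pr])(use genericD[OF X] jk z0 in auto)
   have b: "theta_prod(q^r)(zq(z j)(m j))(zq(z k)(m k))* c'=u' j * v' k-v' j * u' k"
    unfolding c'_def u'_def v'_def by(rule theta_prod_relation[OF qr])(use genericD[OF X'] jk z0 in auto)
   have "(u k * v j-u j * v k)*(u' k * v' j-u' j * v' k)=(u j * v k-v j * u k)*(u' j * v' k-v' j * u' k)"
    by(simp add: algebra_simps)
   then show "(u k * v j-u j * v k)*(u' k * v' j-u' j * v' k)=(c * c') *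
     (theta_prod(p^r)(zp(z j)(m j))(zp(z k)(m k))* theta_prod(q^r)(zq(z j)(m j))(zq(z k)(m k)))"
    unfolding a[symmetric] b[symmetric] by(simp only: mult_ac)
  qed
  also have "\<dots>=C * pair_prod N(%j k. theta_prod(p^r)(zp(z j)(m j))(zp(z k)(m k))* theta_prod(q^r)(zq(z j)(m j))(zq(z k)(m k)))"
   unfolding pair_prod_mult[of N "%j k. c * c'"] pair_prod_const C_def ..
  finally show "C * TT_integrand S N t \<nu> m z=det(mat N N(%(i, j). F i(z(Suc j))(m(Suc j))))
    * det(mat N N(%(i, j). H i(z(Suc j))(m(Suc j))))*(\<Prod>j\<in>{1..N}. w(z j)(m j))"
   unfolding d1 d2 TT_integrand_def w_def by(simp only: mult_ac)
 qed auto
 also have "mat N N(%(i, k). \<Sum>m\<in>{0..<int r}. contour_integral(circlepath 0 1)(%z. F i z m * H k z m * w z m))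
   = (2 * of_real pi * \<i>) \<cdot>\<^sub>m pmat S N t \<nu> X Y X' Y'"
  unfolding ci pmat_def by(rule eq_matI) auto
 also have "det \<dots>=(2 * of_real pi * \<i>)^N * det(pmat S N t \<nu> X Y X' Y')"
  unfolding det_smult by(simp add: pmat_def)
 finally show ?thesis by(simp add: C_def c_def c'_def)
qed

lemma cint_cong:
 assumes "\<And>z m. norm z=1==>core S N \<delta> t \<nu> f g z m=core S' N' \<delta>' t' \<nu>' f' g' z m"
 shows "cint S N \<delta> t \<nu> f g=cint S' N' \<delta>' t' \<nu>' f' g'"
 unfolding cint_def by(intro sum.cong refl cmean_cong assms) auto

lemma cint_cmult: "cint S N \<delta> t \<nu> (%x. c * f x) g=c * cint S N \<delta> t \<nu> f g"
 unfolding cint_def core_def sum_distrib_left cmean_cmult[symmetric] by(simp add: mult_ac)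

lemma cint_sum:
 assumes bal: "balanced S N \<delta> t \<nu>" and A: "finite A" and f: "\<And>a. a\<in>A==>f a holomorphic_on(- {0})"
  and g: "g holomorphic_on(- {0})"
 shows "cint S N \<delta> t \<nu> (%x. \<Sum>a\<in>A. c a * f a x) g=(\<Sum>a\<in>A. c a * cint S N \<delta> t \<nu> (f a) g)"
proof -
 have "core S N \<delta> t \<nu> (%x. \<Sum>a\<in>A. c a * f a x) g z m=(\<Sum>a\<in>A. c a * core S N \<delta> t \<nu> (f a) g z m)" for z m
  unfolding core_def by(simp add: sum_distrib_right sum_distrib_left mult_ac)
 then have "cint S N \<delta> t \<nu> (%x. \<Sum>a\<in>A. c a * f a x) g=(\<Sum>m\<in>{0..<int r}. \<Sum>a\<in>A. c a * cmean 1(%z. core S N \<delta> t \<nu> (f a) g z m))"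
  unfolding cint_def by(simp add: cmean_sum[OF A] cmean_cmult continuous_on_mult_left core_continuous_circle[OF bal f g])
 also have "\<dots>=(\<Sum>a\<in>A. c a * cint S N \<delta> t \<nu> (f a) g)"
  unfolding cint_def sum_distrib_left by(rule sum.swap)
 finally show ?thesis .
qed

end

text \<open>Indexing by a finite set allows any element to be split off; for symmetric h its place
  in the order is immaterial.\<close>

definition pairp :: "nat set => (nat => nat => complex) => complex" where
 "pairp S h=(\<Prod>a\<in>S. \<Prod>b\<in>{b\<in>S. a<b}. h a b)"

lemma pairp_insert:
 assumes S: "finite S" "i \<notin> S" and sym: "\<And>a b. h a b=h b a"
 shows "pairp(insert i S) h=(\<Prod>c\<in>S. h i c)* pairp S h"
proof -
 have 1: "{b\<in>insert i S. i<b}={b\<in>S. i<b}" by auto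
 have 2: "(\<Prod>b\<in>{b\<in>insert i S. a<b}. h a b)=(if a<i then h i a else 1)*(\<Prod>b\<in>{b\<in>S. a<b}. h a b)"
  if "a\<in>S" for a
 proof(cases "a<i")
  case True
  then have "{b\<in>insert i S. a<b}=insert i {b\<in>S. a<b}" by auto
  then show ?thesis using S True sym[of a i] by simp
 next
  case False
  then have "{b\<in>insert i S. a<b}={b\<in>S. a<b}" by auto
  then show ?thesis using False by simp
 qed
 have "(\<Prod>a\<in>S. \<Prod>b\<in>{b\<in>insert i S. a<b}. h a b)
   = (\<Prod>a\<in>S. (if a<i then h i a else 1)*(\<Prod>b\<in>{b\<in>S. a<b}. h a b))"
  by(rule prod.cong[OF refl 2])
 then have "pairp(insert i S) h=(\<Prod>b\<in>{b\<in>S. i<b}. h i b)*((\<Prod>a\<in>S. if a<i then h i a else 1)* pairp S h)"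
  unfolding pairp_def prod.insert[OF S] 1 by(simp only: prod.distrib)
 moreover have "(\<Prod>b\<in>{b\<in>S. i<b}. h i b)*(\<Prod>a\<in>S. if a<i then h i a else 1)=(\<Prod>c\<in>S. h i c)"
 proof -
  have "(\<Prod>b\<in>{b\<in>S. i<b}. h i b)=(\<Prod>b\<in>S. if i<b then h i b else 1)"
   using S(1) by(simp add: prod.inter_filter)
  moreover have "(if i<c then h i c else 1)*(if c<i then h i c else 1)=h i c" if "c\<in>S" for c
   using that S(2) by auto
  ultimately show ?thesis by(simp add: prod.distrib[symmetric])
 qed
 ultimately show ?thesis by simp
qed

lemma pairp_insert2:
 assumes S: "finite S" "i \<notin> S" "j \<notin> S" "i~=j" and sym: "\<And>a b. h a b=h b a"
 shows "pairp(insert i(insert j S)) h=h i j *(\<Prod>c\<in>S. h i c * h j c)* pairp S h"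
 using assms by(simp add: pairp_insert prod.distrib mult_ac)

lemma pairp_cong: "(\<And>a b. a\<in>S==>b\<in>S==>h a b=h' a b)==>pairp S h=pairp S h'"
 unfolding pairp_def by(intro prod.cong refl) auto

section \<open>The q-shift relation for the integral\<close>

context rarefied
begin

definition RR :: "nat set => (nat => complex) => (nat => int) => complex" where
 "RR S t \<nu>=pairp S(%a b. G(t a * t b)(\<nu> a+\<nu> b+\<epsilon>))"

lemma balanced_shift:
 assumes bal: "balanced S N 1 t \<nu>" and i: "i\<in>S"
 shows "balanced S N 0(t(i := q * t i))(\<nu>(i := \<nu> i+1))"
proof -
 have fin: "finite S" using bal by(simp add: balanced_def)
 have "(\<Prod>a\<in>S. (t(i := q * t i)) a)=q *(\<Prod>a\<in>S. t a)"
  unfolding prod.remove[OF fin i] by simp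
 moreover have "(\<Sum>a\<in>S. 2 *(\<nu>(i := \<nu> i+1)) a+\<epsilon>)=2+(\<Sum>a\<in>S. 2 * \<nu> a+\<epsilon>)"
  unfolding sum.remove[OF fin i] by simp
 moreover have "norm(q * t i)<1"
 proof -
  have "norm(t i)<1" using bal i by(simp add: balanced_def)
  then have "norm q * norm(t i)\<le>norm q" by(intro mult_left_le) auto
  then show ?thesis using q by(simp add: norm_mult)
 qed
 ultimately show ?thesis using bal q0 by(auto simp: balanced_def)
qed

text \<open>Logarithm of the constant in \<open>B_shift\<close>, including its sign and the factor
  y.\<close>

definition shift_exponent :: "complex => int => complex" where
 "shift_exponent t \<nu>=Ln t + of_int(2 * \<nu>+\<epsilon>)* lp/2 + of_real pi * \<i>
   + (of_int(2 * \<nu>+\<epsilon>)*(Ln t + of_real pi * \<i>) + of_int(EE \<nu>-\<nu>)* lp)"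

lemma xpt_exp: "t~=0==>xpt t \<nu>=exp(Ln t + of_int(2 * \<nu>+\<epsilon>)* lp/2)"
 by(simp add: xpt_def exp_add)

lemma core_shift:
 assumes bal: "balanced S N 1 t \<nu>" and i: "i\<in>S" and z: "norm z=1"
 shows "core S N 0(t(i := q * t i))(\<nu>(i := \<nu> i+1)) f g z m
  = exp(shift_exponent(t i)(\<nu> i))* core S N 1 t \<nu> (%x. theta_prod(p^r) x(xpt(t i)(\<nu> i))* f x) g z m"
proof -
 have fin: "finite S" using bal by(simp add: balanced_def)
 have ti: "t i~=0" "norm(t i)<1" using bal i by(auto simp: balanced_def)
 have z0: "z~=0" using z by auto
 have eL: "exp(Ln(t i))=t i" using ti by simp
 have "B(q * t i)(\<nu> i+1) z m=(- xpt(t i)(\<nu> i)* exp(of_int(2 * \<nu> i+\<epsilon>)*(Ln(t i) + of_real pi * \<i>) + of_int(EE(\<nu> i)-\<nu> i)* lp))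
   *(z powi(2 * m+\<epsilon>)* p powi EE m)* theta_prod(p^r)(zp z m)(xpt(t i)(\<nu> i))* B(t i)(\<nu> i) z m"
  using B_shift[of "Ln(t i)" z "xpt(t i)(\<nu> i)" "\<nu> i" m] xpt_exp[OF ti(1), of "\<nu> i"] ti z z0
  unfolding eL by(simp add: norm_mult norm_divide)
 moreover have "- xpt(t i)(\<nu> i)* exp(of_int(2 * \<nu> i+\<epsilon>)*(Ln(t i) + of_real pi * \<i>) + of_int(EE(\<nu> i)-\<nu> i)* lp)
   = exp(shift_exponent(t i)(\<nu> i))"
  unfolding xpt_exp[OF ti(1)] minus_exp shift_exponent_def
  unfolding exp_add[symmetric] ..
 ultimately have B: "B(q * t i)(\<nu> i+1) z m=exp(shift_exponent(t i)(\<nu> i))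
   *(z powi(2 * m+\<epsilon>)* p powi EE m)* theta_prod(p^r)(zp z m)(xpt(t i)(\<nu> i))* B(t i)(\<nu> i) z m" by(simp only:)
 have P: "(\<Prod>a\<in>S. B((t(i := q * t i)) a)((\<nu>(i := \<nu> i+1)) a) z m)=exp(shift_exponent(t i)(\<nu> i))
   *(z powi(2 * m+\<epsilon>)* p powi EE m)* theta_prod(p^r)(zp z m)(xpt(t i)(\<nu> i))*(\<Prod>a\<in>S. B(t a)(\<nu> a) z m)"
  unfolding prod.remove[OF fin i] using B by simp
 show ?thesis unfolding core_def P by(simp add: mult_ac)
qed

lemma odd_theta_mono:
 assumes X: "generic(q^r) X Y" and k: "k<N"
 shows "odd_theta(q^r) N(%x. theta_mono(q^r) X Y(N-1) k x * jtheta(x\<^sup>2)(q^r))"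
proof -
 have "even_theta(q^r)(N-1)(theta_mono(q^r) X Y(N-1) k)"
  using theta_mono_even[OF qr X, of k "N-1"] k by simp
 from even_theta_imp_odd_theta[OF qr this] show ?thesis using k by simp
qed

text \<open>Row a of the N + 1 rows attached to a system with \<delta> = 1. On the p side the theta
  functions have degree N, one more than in \<open>pairing\<close>.\<close>

definition shift_row :: "nat set => nat => (nat => complex) => (nat => int) => complex => complex => complex => complex => nat => nat => complex" where
 "shift_row S N t \<nu> X Y X' Y' a k=cint S N 1 t \<nu> (%x. theta_mono(p^r) X Y N a x * jtheta(x\<^sup>2)(p^r))
   (%x. theta_mono(q^r) X' Y'(N-1) k x * jtheta(x\<^sup>2)(q^r))"

lemma pairing_shift:
 assumes bal: "balanced S N 1 t \<nu>" and i: "i\<in>S" and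
  eq: "\<And>x. x~=0==>theta_prod(p^r) x(xpt(t i)(\<nu> i))* theta_mono(p^r) X Y(N-1) a x=theta_mono(p^r) X Y N b x"
 shows "pairing S N(t(i := q * t i))(\<nu>(i := \<nu> i+1))(theta_mono(p^r) X Y(N-1) a)(theta_mono(q^r) X' Y'(N-1) k)
  = exp(shift_exponent(t i)(\<nu> i))* shift_row S N t \<nu> X Y X' Y' b k"
 unfolding pairing_def shift_row_def cint_cmult[symmetric]
proof(rule cint_cong)
 fix z :: complex and m assume z: "norm z=1"
 then have "z~=0" by auto
 then have e: "theta_prod(p^r)(zp z m)(xpt(t i)(\<nu> i))* theta_mono(p^r) X Y(N-1) a(zp z m)=theta_mono(p^r) X Y N b(zp z m)"
  by(intro eq) simp
 show "core S N 0(t(i := q * t i))(\<nu>(i := \<nu> i+1))(%x. theta_mono(p^r) X Y(N-1) a x * jtheta(x\<^sup>2)(p^r))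
    (%x. theta_mono(q^r) X' Y'(N-1) k x * jtheta(x\<^sup>2)(q^r)) z m
   = core S N 1 t \<nu> (%x. exp(shift_exponent(t i)(\<nu> i))*(theta_mono(p^r) X Y N b x * jtheta(x\<^sup>2)(p^r)))
    (%x. theta_mono(q^r) X' Y'(N-1) k x * jtheta(x\<^sup>2)(q^r)) z m"
  unfolding core_shift[OF bal i z] unfolding core_def e[symmetric] by(simp only: mult_ac)
qed

lemma det_scale_mat: "det(mat N N(%(i, k). c * R i k))=c^N * det(mat N N(%(i, k). R i k))" for c :: complex
proof -
 have "mat N N(%(i, k). c * R i k)=c \<cdot>\<^sub>m mat N N(%(i, k). R i k)" by(rule eq_matI) auto
 then show ?thesis by(simp add: det_smult)
qed

text \<open>The basis points are the theta variables of the two parameters. A shift of t_i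
  multiplies each monomial by the first basis function and yields the rows 1, ..., N; a shift of t_j
  multiplies by the second and yields the rows 0, ..., N - 1.\<close>

lemma det_pmat_shift:
 assumes bal: "balanced S N 1 t \<nu>" and ij: "i\<in>S" "j\<in>S"
 defines "x \<equiv> xpt(t i)(\<nu> i)" and "y \<equiv> xpt(t j)(\<nu> j)"
 shows "det(pmat S N(t(i := q * t i))(\<nu>(i := \<nu> i+1)) x y X' Y')
   = exp(shift_exponent(t i)(\<nu> i))^N * det(mat N N(%(a, k). shift_row S N t \<nu> x y X' Y'(Suc a) k))"
  and "det(pmat S N(t(j := q * t j))(\<nu>(j := \<nu> j+1)) x y X' Y')
   = exp(shift_exponent(t j)(\<nu> j))^N * det(mat N N(%(a, k). shift_row S N t \<nu> x y X' Y' a k))"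
proof -
 have "pairing S N(t(i := q * t i))(\<nu>(i := \<nu> i+1))(theta_mono(p^r) x y(N-1) a)(theta_mono(q^r) X' Y'(N-1) k)
  = exp(shift_exponent(t i)(\<nu> i))* shift_row S N t \<nu> x y X' Y'(Suc a) k" if "a<N" for a k
  by(rule pairing_shift[OF bal ij(1)])(use that in \<open>simp add: theta_mono_def x_def\<close>)
 then have "pmat S N(t(i := q * t i))(\<nu>(i := \<nu> i+1)) x y X' Y'
   = mat N N(%(a, k). exp(shift_exponent(t i)(\<nu> i))* shift_row S N t \<nu> x y X' Y'(Suc a) k)"
  unfolding pmat_def by(intro eq_matI) auto
 then show "det(pmat S N(t(i := q * t i))(\<nu>(i := \<nu> i+1)) x y X' Y')
   = exp(shift_exponent(t i)(\<nu> i))^N * det(mat N N(%(a, k). shift_row S N t \<nu> x y X' Y'(Suc a) k))"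
  by(simp only: det_scale_mat)
 have "pairing S N(t(j := q * t j))(\<nu>(j := \<nu> j+1))(theta_mono(p^r) x y(N-1) a)(theta_mono(q^r) X' Y'(N-1) k)
  = exp(shift_exponent(t j)(\<nu> j))* shift_row S N t \<nu> x y X' Y' a k" if "a<N" for a k
 proof(rule pairing_shift[OF bal ij(2)])
  fix w :: complex
  have "N-a=Suc(N-1-a)" using that by simp
  then show "theta_prod(p^r) w(xpt(t j)(\<nu> j))* theta_mono(p^r) x y(N-1) a w=theta_mono(p^r) x y N a w"
   by(simp add: theta_mono_def y_def)
 qed
 then have "pmat S N(t(j := q * t j))(\<nu>(j := \<nu> j+1)) x y X' Y'
   = mat N N(%(a, k). exp(shift_exponent(t j)(\<nu> j))* shift_row S N t \<nu> x y X' Y' a k)"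
  unfolding pmat_def by(intro eq_matI) auto
 then show "det(pmat S N(t(j := q * t j))(\<nu>(j := \<nu> j+1)) x y X' Y')
   = exp(shift_exponent(t j)(\<nu> j))^N * det(mat N N(%(a, k). shift_row S N t \<nu> x y X' Y' a k))"
  by(simp only: det_scale_mat)
qed

lemma jtheta_one: "norm b<1==>b~=0==>jtheta 1 b=0"
 by(subst jtheta_eq_0_iff)(auto intro: exI[of _ 0])

text \<open>The telescoping function F has degree N, so its coefficients in the monomial basis form
  a linear relation between the N + 1 rows. Only the extreme coefficients matter, and they are the
  values of F at x and y, where F is explicit.\<close>

lemma TT_shift_generic:
 assumes bal: "balanced S N 1 t \<nu>" and N: "N > 0" and ij: "i\<in>S" "j\<in>S" "i~=j"
  and gen: "generic(p^r)(xpt(t i)(\<nu> i))(xpt(t j)(\<nu> j))"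
  and gen2: "\<And>k::int. (xpt(t j)(\<nu> j))\<^sup>2~=(p^r) powi k"
 shows "TT S N(t(i := q * t i))(\<nu>(i := \<nu> i+1))*(exp(shift_exponent(t j)(\<nu> j))^N
   *((\<Prod>a\<in>S-{i, j}. jtheta(xpt(t a)(\<nu> a)* xpt(t j)(\<nu> j))(p^r))/xpt(t j)(\<nu> j)^(N+1)))
  = TT S N(t(j := q * t j))(\<nu>(j := \<nu> j+1))*(exp(shift_exponent(t i)(\<nu> i))^N
   *((\<Prod>a\<in>S-{i, j}. jtheta(xpt(t a)(\<nu> a)* xpt(t i)(\<nu> i))(p^r))/xpt(t i)(\<nu> i)^(N+1)))"
proof -
 define x where "x=xpt(t i)(\<nu> i)"
 define y where "y=xpt(t j)(\<nu> j)"
 have fin: "finite S" "card S=2 * N+4" using bal by(auto simp: balanced_def)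
 have xa0: "xpt(t a)(\<nu> a)~=0" if "a\<in>S" for a using bal that by(simp add: xpt_def balanced_def)
 have x0: "x~=0" and y0: "y~=0" using xa0 ij by(simp_all add: x_def y_def)
 note gen'=gen[folded x_def y_def]
 note XY=genericD(1)[OF gen'] genericD(3)[OF gen'] genericD(2)[OF gen'] genericD(4)[OF gen']
 obtain X' Y' where X': "generic(q^r) X' Y'" using generic_exists[OF qr] .
 obtain F where F: "even_theta(p^r) N F" and Feq: "\<And>z. z~=0==>F z * jtheta(z\<^sup>2)(p^r)
   = (\<Prod>a\<in>S. jtheta(xpt(t a)(\<nu> a)* z)(p^r))/z^(N+1)-z^(N+3)*(\<Prod>a\<in>S. jtheta(xpt(t a)(\<nu> a)/z)(p^r))"
  using even_theta_shift_function[OF pr fin xa0 prod_xpt[OF bal odd_theta_mono[OF X' N]]] by blast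
 obtain c where c: "\<And>w. w~=0==>F w=(\<Sum>a\<le>N. c a *(theta_prod(p^r) w x^a * theta_prod(p^r) w y^(N-a)))"
  using even_theta_span[OF pr F XY] by blast
 define R where "R=shift_row S N t \<nu> x y X' Y'"
 have rel: "(\<Sum>a\<le>N. c a * R a k)=0" if k: "k<N" for k
 proof -
  note g = odd_theta_mono[OF X' k]
  have "(\<Sum>a\<le>N. c a * R a k)=cint S N 1 t \<nu> (%w. \<Sum>a\<le>N. c a *(theta_mono(p^r) x y N a w * jtheta(w\<^sup>2)(p^r)))
    (%w. theta_mono(q^r) X' Y'(N-1) k w * jtheta(w\<^sup>2)(q^r))"
   unfolding R_def shift_row_def
   by(rule cint_sum[symmetric, OF bal _ _ odd_thetaD(1)[OF g]])
     (auto intro!: holomorphic_on_mult even_thetaD(1)[OF theta_mono_even[OF pr gen']] jtheta_square_holomorphic[OF pr])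
  also have "\<dots>=0"
  proof(rule telescoping_even[OF bal g])
   fix w :: complex assume w: "w~=0"
   have "(\<Sum>a\<le>N. c a *(theta_mono(p^r) x y N a w * jtheta(w\<^sup>2)(p^r)))=F w * jtheta(w\<^sup>2)(p^r)"
    unfolding c[OF w] theta_mono_def sum_distrib_right by(simp add: mult_ac)
   moreover have "w\<^sup>2 * ytheta S N t \<nu> (1/w)=w^(N+3)*(\<Prod>a\<in>S. jtheta(xpt(t a)(\<nu> a)/w)(p^r))"
   proof -
    have "N+3=2+(N+1)" by simp
    then have "w^(N+3)=w\<^sup>2 * w^(N+1)" by(simp only: power_add)
    then show ?thesis using w unfolding ytheta_def[OF bal g] by(simp add: power_one_over field_simps)
   qed
   ultimately show "(\<Sum>a\<le>N. c a *(theta_mono(p^r) x y N a w * jtheta(w\<^sup>2)(p^r)))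
     = ytheta S N t \<nu> w-w\<^sup>2 * ytheta S N t \<nu> (1/w)"
    using Feq[OF w] by(simp add: ytheta_def[OF bal g])
  qed
  finally show ?thesis .
 qed
 \<comment> \<open>At these two points one of the two theta products in F contains theta(1) = 0, and
   the factor theta(w^2) of the other cancels.\<close>
 have val: "F w=jtheta(x * y)(p^r)*((\<Prod>a\<in>S-{i, j}. jtheta(xpt(t a)(\<nu> a)* w)(p^r))/w^(N+1))"
  if w: "w=x\<and>(\<forall>k::int. x\<^sup>2~=(p^r) powi k) \<or> w=y\<and>(\<forall>k::int. y\<^sup>2~=(p^r) powi k)" for w
 proof -
  have w0: "w~=0" using w x0 y0 by auto
  have j0: "jtheta(w\<^sup>2)(p^r)~=0" using w x0 y0 by(subst jtheta_eq_0_iff[OF pr]) auto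
  have S: "S=insert i(insert j(S-{i, j}))" using ij by auto
  have z: "(\<Prod>a\<in>S. jtheta(xpt(t a)(\<nu> a)/w)(p^r))=0"
  proof(rule prod_zero[OF fin(1)])
   have "jtheta(x/w)(p^r)=0 \<or> jtheta(y/w)(p^r)=0"
    using w x0 y0 jtheta_one[OF pr] by auto
   then show "\<exists>a\<in>S. jtheta(xpt(t a)(\<nu> a)/w)(p^r)=0"
    using ij unfolding x_def y_def by blast
  qed
  have "(\<Prod>a\<in>S. jtheta(xpt(t a)(\<nu> a)* w)(p^r))
    = jtheta(x * w)(p^r)*(jtheta(y * w)(p^r)*(\<Prod>a\<in>S-{i, j}. jtheta(xpt(t a)(\<nu> a)* w)(p^r)))"
   using fin ij by(subst S)(simp add: x_def y_def)
  also have "jtheta(x * w)(p^r)*(jtheta(y * w)(p^r)* P)=jtheta(w\<^sup>2)(p^r)*(jtheta(x * y)(p^r)* P)" for P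
   using w by(auto simp: power2_eq_square mult_ac)
  finally have "F w * jtheta(w\<^sup>2)(p^r)=jtheta(w\<^sup>2)(p^r)*(jtheta(x * y)(p^r)*(\<Prod>a\<in>S-{i, j}. jtheta(xpt(t a)(\<nu> a)* w)(p^r)))/w^(N+1)"
   using Feq[OF w0] z by simp
  then have "jtheta(w\<^sup>2)(p^r)* F w=jtheta(w\<^sup>2)(p^r)*(jtheta(x * y)(p^r)*((\<Prod>a\<in>S-{i, j}. jtheta(xpt(t a)(\<nu> a)* w)(p^r))/w^(N+1)))"
   by(simp only: mult.commute[of "F w"] times_divide_eq_right)
  then show ?thesis by(rule mult_left_cancel[OF j0, THEN iffD1])
 qed
 have jxy: "jtheta(x * y)(p^r)~=0" using XY(4) by(auto simp: theta_prod_def)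
 define v where "v=theta_prod(p^r) x y"
 have v0: "v~=0" using XY(4) by(simp add: v_def)
 have yx: "theta_prod(p^r) y x = - v" unfolding v_def by(rule theta_prod_antisym[OF pr y0 x0])
 have Fx: "F x=c 0 * v^N"
 proof -
  have "F x=(\<Sum>a\<le>N. if a=0 then c 0 * v^N else 0)"
   unfolding c[OF x0] by(rule sum.cong)(auto simp: theta_prod_self[OF pr x0] v_def)
  then show ?thesis by simp
 qed
 have Fy: "F y=c N *(- v)^N"
 proof -
  have "F y=(\<Sum>a\<le>N. if a=N then c N *(- v)^N else 0)"
   unfolding c[OF y0] by(rule sum.cong)(auto simp: theta_prod_self[OF pr y0] yx)
  then show ?thesis by simp
 qed
 define D1 where "D1=det(mat N N(%(a, k). R(Suc a) k))"
 define D0 where "D0=det(mat N N(%(a, k). R a k))"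
 \<comment> \<open>If c N = 0, then F y = 0. Either c 0 = 0 and F x = 0 as well, or the first N rows
   are dependent and D0 = 0.\<close>
 have main: "F y * D1=F x * D0"
 proof(cases "c N=0")
  case False
  from det_shift_rows[OF N rel False] have "c N * D1=(- 1)^N * c 0 * D0" by(simp add: D1_def D0_def)
  moreover have "F y * D1=(- v)^N *(c N * D1)" by(simp add: Fy)
  moreover have "(- v)^N=(- 1)^N * v^N" by(rule power_minus)
  ultimately have "F y * D1=((- 1)^N *(- 1)^N)*(c 0 * v^N * D0)" by simp
  then show ?thesis unfolding Fx by(simp add: power_mult_distrib[symmetric])
 next
  case True
  show ?thesis
  proof(cases "c 0=0")
   case True
   then show ?thesis using \<open>c N=0\<close> by(simp add: Fx Fy)
  next
   case False
   have "N > 0==>D0=0"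
   proof -
    have "(\<Sum>a<N. c a * R a k)=0" if "k<N" for k
     using rel[OF that] \<open>c N=0\<close> by(simp add: lessThan_Suc_atMost[symmetric])
    then have eq0: "transpose_mat(mat N N(%(a, k). R a k)) *\<^sub>v vec N c=0\<^sub>v N"
     by(intro eq_vecI)(auto simp: scalar_prod_def atLeast0LessThan mult.commute)
    have "vec N c~=0\<^sub>v N" using False N by(metis index_vec index_zero_vec(1))
    then have "det(transpose_mat(mat N N(%(a, k). R a k)))=0"
     by(intro det_0_iff_vec_prod_zero_field[THEN iffD2, of _ N] exI[of _ "vec N c"])(auto simp: eq0)
    then show "D0=0" by(simp add: D0_def det_transpose[of _ N])
   qed
   then show ?thesis using N Fy True by simp
  qed
 qed
 define \<Theta> where "\<Theta>=(%w. (\<Prod>a\<in>S-{i, j}. jtheta(xpt(t a)(\<nu> a)* w)(p^r))/w^(N+1))"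
 have main2: "\<Theta> y * D1=\<Theta> x * D0"
 proof -
  have "F x=jtheta(x * y)(p^r)* \<Theta> x" unfolding \<Theta>_def by(rule val)(use XY(2) in auto)
  moreover have "F y=jtheta(x * y)(p^r)* \<Theta> y" unfolding \<Theta>_def by(rule val)(use gen2 in \<open>auto simp: y_def\<close>)
  ultimately have "jtheta(x * y)(p^r)*(\<Theta> y * D1)=jtheta(x * y)(p^r)*(\<Theta> x * D0)"
   using main by(simp only: mult.assoc)
  then show ?thesis by(rule mult_left_cancel[OF jxy, THEN iffD1])
 qed
 define K where "K=(theta_prod(p^r) x y * theta_prod(q^r) X' Y')^(N *(N-1) div 2)"
 define M where "M=(fact N *(2 * of_real pi * \<i>)^N :: complex)"
 have K0: "K~=0" using XY(4) genericD(4)[OF X'] by(simp add: K_def)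
 have T1: "K * TT S N(t(i := q * t i))(\<nu>(i := \<nu> i+1))=M *(exp(shift_exponent(t i)(\<nu> i))^N * D1)"
  using TT_det[OF balanced_shift[OF bal ij(1)] gen' X'] det_pmat_shift(1)[OF bal ij(1,2), folded x_def y_def, of X' Y']
  by(simp only: K_def M_def D1_def R_def)
 have T2: "K * TT S N(t(j := q * t j))(\<nu>(j := \<nu> j+1))=M *(exp(shift_exponent(t j)(\<nu> j))^N * D0)"
  using TT_det[OF balanced_shift[OF bal ij(2)] gen' X'] det_pmat_shift(2)[OF bal ij(1,2), folded x_def y_def, of X' Y']
  by(simp only: K_def M_def D0_def R_def)
 have "K *(TT S N(t(i := q * t i))(\<nu>(i := \<nu> i+1))*(exp(shift_exponent(t j)(\<nu> j))^N * \<Theta> y))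
   = M * exp(shift_exponent(t i)(\<nu> i))^N * exp(shift_exponent(t j)(\<nu> j))^N *(\<Theta> y * D1)"
  unfolding mult.assoc[symmetric] T1 by(simp only: mult_ac)
 also have "\<dots>=K *(TT S N(t(j := q * t j))(\<nu>(j := \<nu> j+1))*(exp(shift_exponent(t i)(\<nu> i))^N * \<Theta> x))"
  unfolding main2 unfolding mult.assoc[symmetric] T2 by(simp only: mult_ac)
 finally have "TT S N(t(i := q * t i))(\<nu>(i := \<nu> i+1))*(exp(shift_exponent(t j)(\<nu> j))^N * \<Theta> y)
  = TT S N(t(j := q * t j))(\<nu>(j := \<nu> j+1))*(exp(shift_exponent(t i)(\<nu> i))^N * \<Theta> x)"
  by(rule mult_left_cancel[OF K0, THEN iffD1])
 then show ?thesis unfolding \<Theta>_def x_def y_def .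
qed

end

section \<open>The q-shift relation for the product side\<close>

context rarefied
begin

definition pair_exponent :: "complex => int => complex => int => complex" where
 "pair_exponent t \<nu> s \<mu> = of_int(\<nu>+\<mu>+\<epsilon>)*(Ln t+Ln s + of_real pi * \<i>)
   + of_int((\<nu>+\<mu>+\<epsilon>)*(\<nu>+\<mu>+\<epsilon>-1))/2 * lp"

lemma G_pair_shift:
 assumes "t~=0" "s~=0" "norm(t * s)<1"
 shows "G(q *(t * s))(\<nu>+\<mu>+\<epsilon>+1)=exp(pair_exponent t \<nu> s \<mu>)* jtheta(xpt s \<mu> * xpt t \<nu>)(p^r)* G(t * s)(\<nu>+\<mu>+\<epsilon>)"
proof -
 define k where "k=\<nu>+\<mu>+\<epsilon>"
 have ts: "t * s=exp(Ln t+Ln s)" using assms by(simp add: exp_add)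
 have "(- (t * s)) powi k=exp(of_int k *(Ln t+Ln s + of_real pi * \<i>))"
  unfolding ts minus_exp powi_exp ..
 moreover have "p powi(k *(k-1) div 2)=exp(of_int(k *(k-1))/2 * lp)"
  unfolding lp powi_exp of_int_div_exact[OF dvd_2_consecutive zero_neq_numeral[symmetric]] by(simp only: of_int_numeral)
 moreover have "t * s * p powi k=xpt s \<mu> * xpt t \<nu>"
 proof -
  have "exp(of_int(2 * \<mu>+\<epsilon>)* lp/2)* exp(of_int(2 * \<nu>+\<epsilon>)* lp/2)=p powi k"
   unfolding lp powi_exp exp_add[symmetric] k_def by(rule arg_cong[of _ _ exp])(simp add: field_simps)
  moreover have "xpt s \<mu> * xpt t \<nu>=t * s *(exp(of_int(2 * \<mu>+\<epsilon>)* lp/2)* exp(of_int(2 * \<nu>+\<epsilon>)* lp/2))"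
   unfolding xpt_def by(simp only: mult_ac)
  ultimately show ?thesis by simp
 qed
 ultimately show ?thesis using G_shift[of "t * s" k] assms unfolding k_def[symmetric] pair_exponent_def exp_add by simp
qed

text \<open>The factor of the pair (i, j) becomes symmetric in i and j. The other affected factors
  contribute the very theta functions that occur in \<open>TT_shift_generic\<close>.\<close>

lemma RR_shift:
 assumes bal: "balanced S N 1 t \<nu>" and ij: "i\<in>S" "j\<in>S" "i~=j"
 shows "RR S(t(i := q * t i))(\<nu>(i := \<nu> i+1)) =
   G(q *(t i * t j))(\<nu> i+\<nu> j+\<epsilon>+1)*(\<Prod>c\<in>S-{i, j}. G(t i * t c)(\<nu> i+\<nu> c+\<epsilon>)* G(t j * t c)(\<nu> j+\<nu> c+\<epsilon>))
   * pairp(S-{i, j})(%a b. G(t a * t b)(\<nu> a+\<nu> b+\<epsilon>))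
   *(exp(\<Sum>c\<in>S-{i, j}. pair_exponent(t i)(\<nu> i)(t c)(\<nu> c))*(\<Prod>c\<in>S-{i, j}. jtheta(xpt(t c)(\<nu> c)* xpt(t i)(\<nu> i))(p^r)))"
proof -
 let ?S = "S-{i, j}"
 have fin: "finite S" and t: "\<And>a. a\<in>S==>t a~=0\<and>norm(t a)<1" using bal by(auto simp: balanced_def)
 have S: "S=insert i(insert j ?S)" using ij by auto
 let ?t = "t(i := q * t i)" and ?n = "\<nu>(i := \<nu> i+1)"
 have "RR S ?t ?n=G(?t i * ?t j)(?n i + ?n j+\<epsilon>)*(\<Prod>c\<in>?S. G(?t i * ?t c)(?n i + ?n c+\<epsilon>)* G(?t j * ?t c)(?n j + ?n c+\<epsilon>))
   * pairp ?S(%a b. G(?t a * ?t b)(?n a + ?n b+\<epsilon>))"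
  unfolding RR_def by(subst S, rule pairp_insert2)(use fin ij in \<open>auto simp: mult.commute add_ac\<close>)
 also have "pairp ?S(%a b. G(?t a * ?t b)(?n a + ?n b+\<epsilon>))=pairp ?S(%a b. G(t a * t b)(\<nu> a+\<nu> b+\<epsilon>))"
  by(rule pairp_cong) auto
 also have "(\<Prod>c\<in>?S. G(?t i * ?t c)(?n i + ?n c+\<epsilon>)* G(?t j * ?t c)(?n j + ?n c+\<epsilon>))
   = (\<Prod>c\<in>?S. G(t i * t c)(\<nu> i+\<nu> c+\<epsilon>)* G(t j * t c)(\<nu> j+\<nu> c+\<epsilon>) *
     (exp(pair_exponent(t i)(\<nu> i)(t c)(\<nu> c))* jtheta(xpt(t c)(\<nu> c)* xpt(t i)(\<nu> i))(p^r)))"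
 proof(rule prod.cong[OF refl])
  fix c assume c: "c \<in> ?S"
  have "norm(t i)* norm(t c)\<le>norm(t i)" using t[of c] c by(intro mult_left_le) auto
  also have "norm(t i)<1" using t[OF ij(1)] by simp
  finally have "norm(t i * t c)<1" unfolding norm_mult .
  then have "G(q *(t i * t c))(\<nu> i+\<nu> c+\<epsilon>+1)=exp(pair_exponent(t i)(\<nu> i)(t c)(\<nu> c))
    * jtheta(xpt(t c)(\<nu> c)* xpt(t i)(\<nu> i))(p^r)* G(t i * t c)(\<nu> i+\<nu> c+\<epsilon>)"
   using t[of c] t[OF ij(1)] c by(intro G_pair_shift) auto
  then show "G(?t i * ?t c)(?n i + ?n c+\<epsilon>)* G(?t j * ?t c)(?n j + ?n c+\<epsilon>)
   = G(t i * t c)(\<nu> i+\<nu> c+\<epsilon>)* G(t j * t c)(\<nu> j+\<nu> c+\<epsilon>) *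
     (exp(pair_exponent(t i)(\<nu> i)(t c)(\<nu> c))* jtheta(xpt(t c)(\<nu> c)* xpt(t i)(\<nu> i))(p^r))"
   using c ij by(simp add: mult_ac add_ac)
 qed
 also have "G(?t i * ?t j)(?n i + ?n j+\<epsilon>)=G(q *(t i * t j))(\<nu> i+\<nu> j+\<epsilon>+1)"
  using ij by(simp add: mult_ac add_ac)
 finally show ?thesis unfolding prod.distrib exp_sum[OF finite_Diff[OF fin]] by(simp only: mult_ac)
qed

text \<open>Under the balancing conditions the exponents on the two sides differ by an integral
  multiple of 2 pi i.\<close>

lemma shift_exponents_balance:
 assumes bal: "balanced S N 1 t \<nu>" and ij: "i\<in>S" "j\<in>S" "i~=j"
 shows "exp(\<Sum>c\<in>S-{i, j}. pair_exponent(t i)(\<nu> i)(t c)(\<nu> c))* xpt(t i)(\<nu> i)^(N+1)* exp(shift_exponent(t j)(\<nu> j))^N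
  = exp(\<Sum>c\<in>S-{i, j}. pair_exponent(t j)(\<nu> j)(t c)(\<nu> c))* xpt(t j)(\<nu> j)^(N+1)* exp(shift_exponent(t i)(\<nu> i))^N"
proof -
 let ?S = "S-{i, j}"
 obtain \<kappa> where \<kappa>: "(\<Sum>a\<in>S. Ln(t a))=lp + of_nat(1-1)* lq+2 * of_int \<kappa> * of_real pi * \<i>"
  using balanced_log[OF bal] .
 have fin: "finite S" "card S=2 * N+4" "(\<Sum>a\<in>S. 2 * \<nu> a+\<epsilon>) = - 2" and t0: "t i~=0" "t j~=0"
  using bal ij by(auto simp: balanced_def)
 have card: "card ?S=2 * N+2" using fin ij by(simp add: card_Diff_subset)
 have split: "(\<Sum>a\<in>S. f a)=f i+f j+(\<Sum>a\<in>?S. f a)" for f :: "nat => 'b::comm_monoid_add"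
 proof -
  have "(\<Sum>a\<in>S. f a)=f i+(f j+(\<Sum>a\<in>S-{i}-{j}. f a))"
   by(subst sum.remove[OF fin(1) ij(1)], subst sum.remove[of "S-{i}" j])(use fin ij in auto)
  moreover have "S-{i}-{j} = ?S" by auto
  ultimately show ?thesis by(simp add: add_ac)
 qed
 define Li where "Li=Ln(t i)"
 define Lj where "Lj=Ln(t j)"
 have sL: "(\<Sum>c\<in>?S. Ln(t c))=lp+2 * of_int \<kappa> * of_real pi * \<i>-Li-Lj"
  using \<kappa> split[of "%a. Ln(t a)"] by(simp add: algebra_simps Li_def Lj_def)
 have sn: "(\<Sum>c\<in>?S. 2 * \<nu> c+\<epsilon>) = - 2-(2 * \<nu> i+\<epsilon>)-(2 * \<nu> j+\<epsilon>)"
  using fin(3) split[of "%a. 2 * \<nu> a+\<epsilon>"] by simp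
 define A :: complex where "A = of_int(2 * \<nu> i+\<epsilon>)"
 define A' :: complex where "A' = of_int(2 * \<nu> j+\<epsilon>)"
 define d :: complex where "d = of_int(\<nu> i-\<nu> j)"
 define c0 where "c0=A/2 * Li-A'/2 * Lj+d *(of_real pi * \<i>)+lp/2 * d * of_int(\<nu> i+\<nu> j+\<epsilon>-1)"
 define c2 where "c2=Li/2-Lj/2+lp * d/2"
 have "(\<Sum>c\<in>?S. pair_exponent(t i)(\<nu> i)(t c)(\<nu> c))-(\<Sum>c\<in>?S. pair_exponent(t j)(\<nu> j)(t c)(\<nu> c))
   = (\<Sum>c\<in>?S. c0+d * Ln(t c)+c2 * of_int(2 * \<nu> c+\<epsilon>))"
  unfolding sum_subtractf[symmetric]
  by(rule sum.cong)(auto simp: pair_exponent_def c0_def c2_def A_def A'_def d_def Li_def Lj_def field_simps)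
 also have "\<dots> = of_nat(2 * N+2)* c0+d *(lp+2 * of_int \<kappa> * of_real pi * \<i>-Li-Lj)
   + c2 * of_int(- 2-(2 * \<nu> i+\<epsilon>)-(2 * \<nu> j+\<epsilon>))"
  unfolding sum_affine sL sn card ..
 finally have D: "(\<Sum>c\<in>?S. pair_exponent(t i)(\<nu> i)(t c)(\<nu> c))=(\<Sum>c\<in>?S. pair_exponent(t j)(\<nu> j)(t c)(\<nu> c))
   + (of_nat(2 * N+2)* c0+d *(lp+2 * of_int \<kappa> * of_real pi * \<i>-Li-Lj)
   + c2 * of_int(- 2-(2 * \<nu> i+\<epsilon>)-(2 * \<nu> j+\<epsilon>)))" (is "?E1 = ?E2 + ?D")
  by(simp add: algebra_simps)
 have "?D + of_nat(N+1)*(Li+A * lp/2) + of_nat N * shift_exponent(t j)(\<nu> j)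
   = of_nat(N+1)*(Lj+A' * lp/2) + of_nat N * shift_exponent(t i)(\<nu> i)+2 * of_int((\<nu> i-\<nu> j)*(\<kappa>+1))* of_real pi * \<i>"
  unfolding c0_def c2_def d_def A_def A'_def shift_exponent_def EE_def Li_def[symmetric] Lj_def[symmetric]
  by(simp add: field_simps)
 then have e: "?E1 + of_nat(N+1)*(Li+A * lp/2) + of_nat N * shift_exponent(t j)(\<nu> j)
  = ?E2 + of_nat(N+1)*(Lj+A' * lp/2) + of_nat N * shift_exponent(t i)(\<nu> i)+2 * of_int((\<nu> i-\<nu> j)*(\<kappa>+1))* of_real pi * \<i>"
  unfolding D by(simp only: add.assoc)
 have "exp ?E1 * xpt(t i)(\<nu> i)^(N+1)* exp(shift_exponent(t j)(\<nu> j))^N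
  = exp(?E1 + of_nat(N+1)*(Li+A * lp/2) + of_nat N * shift_exponent(t j)(\<nu> j))"
  unfolding xpt_exp[OF t0(1)] exp_of_nat_mult exp_add Li_def A_def ..
 also have "\<dots>=exp ?E2 * xpt(t j)(\<nu> j)^(N+1)* exp(shift_exponent(t i)(\<nu> i))^N"
  unfolding e exp_add exp_two_pi_int unfolding xpt_exp[OF t0(2)] exp_of_nat_mult exp_add Lj_def A'_def by simp
 finally show ?thesis .
qed

lemma TT_RR_shift_generic:
 assumes bal: "balanced S N 1 t \<nu>" and N: "N > 0" and ij: "i\<in>S" "j\<in>S" "i~=j"
  and gen: "generic(p^r)(xpt(t i)(\<nu> i))(xpt(t j)(\<nu> j))"
  and gen2: "\<And>k::int. (xpt(t j)(\<nu> j))\<^sup>2~=(p^r) powi k"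
 shows "TT S N(t(i := q * t i))(\<nu>(i := \<nu> i+1))* RR S(t(j := q * t j))(\<nu>(j := \<nu> j+1))
  = TT S N(t(j := q * t j))(\<nu>(j := \<nu> j+1))* RR S(t(i := q * t i))(\<nu>(i := \<nu> i+1))"
proof -
 let ?S = "S-{i, j}"
 define Bs where "Bs=G(q *(t i * t j))(\<nu> i+\<nu> j+\<epsilon>+1)*(\<Prod>c\<in>?S. G(t i * t c)(\<nu> i+\<nu> c+\<epsilon>)* G(t j * t c)(\<nu> j+\<nu> c+\<epsilon>))
   * pairp ?S(%a b. G(t a * t b)(\<nu> a+\<nu> b+\<epsilon>))"
 define T1 where "T1=TT S N(t(i := q * t i))(\<nu>(i := \<nu> i+1))"
 define T2 where "T2=TT S N(t(j := q * t j))(\<nu>(j := \<nu> j+1))"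
 define x where "x=xpt(t i)(\<nu> i)"
 define y where "y=xpt(t j)(\<nu> j)"
 define ci where "ci=exp(shift_exponent(t i)(\<nu> i))^N"
 define cj where "cj=exp(shift_exponent(t j)(\<nu> j))^N"
 define ei where "ei=exp(\<Sum>c\<in>?S. pair_exponent(t i)(\<nu> i)(t c)(\<nu> c))"
 define ej where "ej=exp(\<Sum>c\<in>?S. pair_exponent(t j)(\<nu> j)(t c)(\<nu> c))"
 define \<Theta> where "\<Theta>=(%w. \<Prod>c\<in>?S. jtheta(xpt(t c)(\<nu> c)* w)(p^r))"
 have nz: "x~=0" "y~=0" "ci~=0" "cj~=0"
  using bal ij by(auto simp: x_def y_def ci_def cj_def xpt_def balanced_def)
 have R1: "RR S(t(i := q * t i))(\<nu>(i := \<nu> i+1))=Bs *(ei * \<Theta> x)"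
  unfolding RR_shift[OF bal ij] Bs_def ei_def \<Theta>_def x_def ..
 have R2: "RR S(t(j := q * t j))(\<nu>(j := \<nu> j+1))=Bs *(ej * \<Theta> y)"
 proof -
  have "{j, i}={i, j}" by auto
  then show ?thesis
   using RR_shift[OF bal ij(2,1) ij(3)[symmetric]]
   by(simp add: Bs_def ej_def \<Theta>_def y_def mult_ac add_ac)
 qed
 have m: "T1 *(cj *(\<Theta> y/y^(N+1)))=T2 *(ci *(\<Theta> x/x^(N+1)))"
  using TT_shift_generic[OF bal N ij gen gen2] unfolding T1_def T2_def ci_def cj_def \<Theta>_def x_def y_def .
 have e: "ei * x^(N+1)* cj=ej * y^(N+1)* ci"
  unfolding ei_def ej_def x_def y_def ci_def cj_def by(rule shift_exponents_balance[OF bal ij])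
 have "T1 *(ej * \<Theta> y)* ci=T1 *(cj *(\<Theta> y/y^(N+1)))*(ei * x^(N+1))"
 proof -
  have "T1 *(cj *(\<Theta> y/y^(N+1)))*(ei * x^(N+1))=T1 *(\<Theta> y/y^(N+1))*(ei * x^(N+1)* cj)"
   by(simp only: mult_ac)
  then show ?thesis unfolding e using nz by simp
 qed
 also have "\<dots>=T2 *(ei * \<Theta> x)* ci" unfolding m using nz by simp
 finally have "T1 *(ej * \<Theta> y)=T2 *(ei * \<Theta> x)" using nz by simp
 then show ?thesis unfolding R1 R2 T1_def[symmetric] T2_def[symmetric] by(simp add: mult_ac)
qed

end

section \<open>Holomorphy in the parameters and removal of genericity\<close>

context rarefied
begin

lemma eventually_jtheta_nonzero:
 assumes b: "norm b<1" "b~=0" and a: "a~=0" and s: "s~=0"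
 shows "eventually(%l. jtheta(a * exp(s * l)) b~=0)(at 0)"
proof -
 \<comment> \<open>The modulus |b|^(1/2) is no integral power of |b|, so the theta function is
   nonzero at h.\<close>
 define h :: complex where "h = of_real(sqrt(norm b))"
 have h0: "h~=0" using b by(simp add: h_def)
 have hk: "h~=b powi k" for k
 proof
  assume e: "h=b powi k"
  have "norm h=norm b powr(1/2)" using b by(simp add: h_def powr_half_sqrt)
  moreover have "norm(b powi k)=norm b powr of_int k" using b by(simp add: norm_power_int powr_real_of_int')
  ultimately have "norm b powr(1/2)=norm b powr of_int k" using e by simp
  then have "1/2=(of_int k :: real)" using b by(subst(asm) powr_inj) auto
  then have "2 * k=1" by linarith
  then show False by presburger
 qed
 define \<beta> where "\<beta>=Ln(h/a)/s"
 have "a * exp(s * \<beta>)=h" using a h0 s by(simp add: \<beta>_def)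
 then have "jtheta(a * exp(s * \<beta>)) b~=0" using hk h0 by(simp add: jtheta_eq_0_iff[OF b])
 moreover have "(%l. jtheta(a * exp(s * l)) b) holomorphic_on UNIV"
  by(rule compose_nonzero_holomorphic[OF jtheta_holomorphic[OF b]])(use a in \<open>auto intro!: holomorphic_intros\<close>)
 ultimately show ?thesis
  using non_zero_neighbour_alt[of "%l. jtheta(a * exp(s * l)) b" UNIV 0 \<beta>] by(auto elim: eventually_mono)
qed

text \<open>All parameters multiply to pq, and the others, of which there is at least one, have
  modulus below 1. This keeps the factors of the product side away from zero.\<close>

lemma norm_pair_gt:
 assumes bal: "balanced S N 0 t \<nu>" and ab: "a\<in>S" "b\<in>S" "a~=b"
 shows "norm(p * q)<norm(t a * t b)"
proof -
 let ?S = "S-{a, b}"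
 have fin: "finite S" "card S=2 * N+4" and t: "\<And>c. c\<in>S==>t c~=0\<and>norm(t c)<1"
  and P: "(\<Prod>c\<in>S. t c)=p * q" using bal by(auto simp: balanced_def)
 have S: "S=insert a(insert b ?S)" using ab by auto
 have "card ?S=2 * N+2" using fin ab by(simp add: card_Diff_subset)
 then have "?S~={}" by(metis card.empty Suc_eq_plus1 add_2_eq_Suc' nat.distinct(1))
 then obtain c where c: "c \<in> ?S" by blast
 have "p * q=t a * t b *(\<Prod>c\<in>?S. t c)" unfolding P[symmetric] by(subst S)(use fin ab in simp)
 moreover have "norm(\<Prod>c\<in>?S. t c)<1"
 proof -
  have "norm(\<Prod>c\<in>?S. t c)=norm(t c)* norm(\<Prod>c\<in>?S-{c}. t c)"
   unfolding prod.remove[OF finite_Diff[OF fin(1)] c] norm_mult ..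
  also have "norm(\<Prod>c\<in>?S-{c}. t c)\<le>1"
   unfolding prod_norm[symmetric] using t by(intro prod_le_1)(auto intro: less_imp_le)
  then have "norm(t c)* norm(\<Prod>c\<in>?S-{c}. t c)\<le>norm(t c)" by(intro mult_left_le) auto
  also have "norm(t c)<1" using t c by auto
  finally show ?thesis .
 qed
 moreover have "norm(t a * t b) > 0" using t ab by simp
 ultimately show ?thesis by(metis mult.right_neutral mult_strict_left_mono norm_mult)
qed

lemma norm_pair_less: "balanced S N \<delta> t \<nu>==>a\<in>S==>b\<in>S==>norm(t a * t b)<1"
proof -
 assume "balanced S N \<delta> t \<nu>" "a\<in>S" "b\<in>S"
 then have t: "norm(t a)<1" "norm(t b)<1" by(auto simp: balanced_def)
 then have "norm(t a)* norm(t b)\<le>norm(t a)" by(intro mult_left_le) auto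
 also note t(1)
 finally show "norm(t a * t b)<1" unfolding norm_mult .
qed

lemma RR_nonzero:
 assumes bal: "balanced S N 0 t \<nu>"
 shows "RR S t \<nu>~=0"
proof -
 have "finite S" and t: "\<And>c. c\<in>S==>t c~=0" using bal by(auto simp: balanced_def)
 moreover have "G(t a * t b) k~=0" if "a\<in>S" "b\<in>S" "a~=b" for a b k
  using norm_pair_gt[OF bal that] norm_pair_less[OF bal that(1,2)] t that by(intro G_nonzero unit_disc_dom) auto
 ultimately show ?thesis unfolding RR_def pairp_def by auto
qed

lemma RR_holomorphic:
 assumes hol: "\<And>a. a\<in>S==>(%l. t l a) holomorphic_on U" and bal: "\<And>l. l\<in>U==>balanced S N 0(t l) \<nu>"
 shows "(%l. RR S(t l) \<nu>) holomorphic_on U"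
 unfolding RR_def pairp_def
proof(intro holomorphic_on_prod)
 fix a b assume ab: "a\<in>S" "b\<in>{b\<in>S. a<b}"
 show "(%l. G(t l a * t l b)(\<nu> a+\<nu> b+\<epsilon>)) holomorphic_on U"
 proof(rule G_compose_holomorphic)
  show "(%l. t l a * t l b) holomorphic_on U" using ab hol by(auto intro!: holomorphic_intros)
  fix l assume "l\<in>U"
  then have "balanced S N 0(t l) \<nu>" by(rule bal)
  then show "t l a * t l b\<in>dom(\<nu> a+\<nu> b+\<epsilon>)"
   using ab norm_pair_less[of S N 0 "t l" \<nu> a b] by(intro unit_disc_dom)(auto simp: balanced_def)
 qed
qed

lemma pairing_holomorphic:
 assumes U: "open U" and hol: "\<And>a. a\<in>S==>(%l. t l a) holomorphic_on U"
  and bal: "\<And>l. l\<in>U==>balanced S N 0(t l) \<nu>"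
  and F: "F holomorphic_on(- {0})" and H: "H holomorphic_on(- {0})"
 shows "(%l. pairing S N(t l) \<nu> F H) holomorphic_on U"
 unfolding pairing_def cint_def
proof(intro holomorphic_on_sum cmean_holomorphic_param U)
 fix m
 define f where "f=(%x. F x * jtheta(x\<^sup>2)(p^r))"
 define g where "g=(%x. H x * jtheta(x\<^sup>2)(q^r))"
 have fg: "f holomorphic_on(- {0})" "g holomorphic_on(- {0})"
  unfolding f_def g_def by(intro holomorphic_on_mult F H jtheta_square_holomorphic pr qr)+
 define c where "c=(%z. f(zp z m)* g(zq z m)*(p * q) powi(int(N+1)* EE m-m))"
 have core: "core S N 0(t l) \<nu> f g z m=c z *(\<Prod>a\<in>S. G(t l a * z)(\<nu> a+m+\<epsilon>)* G(t l a/z)(\<nu> a-m))" for l z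
  unfolding core_def c_def B_def by simp
 have in_dom: "t l a * z\<in>dom k" "t l a/z\<in>dom k" if "l\<in>U" "a\<in>S" "norm z=1" for l a z k
  using bal[OF that(1)] that by(auto intro!: unit_disc_dom simp: balanced_def norm_mult norm_divide)
 have cont_G: "continuous_on A(%x. G(h x) k)" if "continuous_on A h" "\<And>x. x\<in>A==>h x\<in>dom k"
  for A :: "(complex \<times> complex) set" and h k
 proof -
  have "h ` A \<subseteq> dom k" using that(2) by blast
  then show ?thesis by(rule continuous_on_compose2[OF holomorphic_on_imp_continuous_on[OF G_holomorphic] that(1)])
 qed
 have cont_t: "continuous_on(U \<times> sphere 0 1)(%(l, z). t l a)" if "a\<in>S" for a
  unfolding case_prod_unfold
  by(rule continuous_on_compose2[OF holomorphic_on_imp_continuous_on[OF hol[OF that]]])(auto intro!: continuous_intros)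
 have c: "continuous_on(sphere 0 1) c"
 proof(rule continuous_on_subset[OF holomorphic_on_imp_continuous_on])
  show "c holomorphic_on(- {0})"
   unfolding c_def by(intro holomorphic_intros compose_nonzero_holomorphic[OF fg(1) zp_holomorphic] compose_nonzero_holomorphic[OF fg(2) zq_holomorphic]) auto
 qed auto
 show "continuous_on(U \<times> sphere 0 1)(%(l, z). core S N 0(t l) \<nu> f g z m)"
  unfolding core case_prod_unfold
  by(intro continuous_on_mult continuous_on_prod cont_G continuous_on_divide cont_t[unfolded case_prod_unfold]
    continuous_on_compose2[OF c] continuous_intros)(auto intro: in_dom)
 show "(%l. core S N 0(t l) \<nu> f g z m) holomorphic_on U" if "norm z=1" for z
  unfolding core
  by(intro holomorphic_intros G_compose_holomorphic hol)(use that in_dom in auto)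
qed

text \<open>The determinant formula reduces the claim to one-variable integrals; its base points do
  not depend on the parameters.\<close>

lemma TT_holomorphic:
 assumes U: "open U" and hol: "\<And>a. a\<in>S==>(%l. t l a) holomorphic_on U"
  and bal: "\<And>l. l\<in>U==>balanced S N 0(t l) \<nu>"
 shows "(%l. TT S N(t l) \<nu>) holomorphic_on U"
proof -
 obtain X Y where X: "generic(p^r) X Y" using generic_exists[OF pr] .
 obtain X' Y' where X': "generic(q^r) X' Y'" using generic_exists[OF qr] .
 define K where "K=(theta_prod(p^r) X Y * theta_prod(q^r) X' Y')^(N *(N-1) div 2)"
 have K0: "K~=0" using genericD(4)[OF X] genericD(4)[OF X'] by(simp add: K_def)
 have eq: "TT S N(t l) \<nu>=fact N *(2 * of_real pi * \<i>)^N/K * det(pmat S N(t l) \<nu> X Y X' Y')" if "l\<in>U" for l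
  using TT_det[OF bal[OF that] X X'] K0 unfolding K_def[symmetric] by(simp add: field_simps)
 have "(%l. det(pmat S N(t l) \<nu> X Y X' Y')) holomorphic_on U"
 proof -
  have "det(pmat S N(t l) \<nu> X Y X' Y')=(\<Sum>\<sigma>\<in>{\<sigma>. \<sigma> permutes {0..<N}}. signof \<sigma> *
    (\<Prod>i=0..<N. pairing S N(t l) \<nu> (theta_mono(p^r) X Y(N-1) i)(theta_mono(q^r) X' Y'(N-1)(\<sigma> i))))" for l
   unfolding det_def pmat_def
   by(auto intro!: sum.cong prod.cong dest: permutes_in_image simp: atLeast0LessThan)
  moreover have "(%l. \<Sum>\<sigma>\<in>{\<sigma>. \<sigma> permutes {0..<N}}. signof \<sigma> *
    (\<Prod>i=0..<N. pairing S N(t l) \<nu> (theta_mono(p^r) X Y(N-1) i)(theta_mono(q^r) X' Y'(N-1)(\<sigma> i)))) holomorphic_on U"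
  proof(intro holomorphic_on_sum holomorphic_on_mult holomorphic_on_const holomorphic_on_prod)
   fix \<sigma> i assume \<sigma>: "\<sigma>\<in>{\<sigma>. \<sigma> permutes {0..<N}}" "i\<in>{0..<N}"
   then have s: "\<sigma> i<N" using permutes_in_image[of \<sigma> "{0..<N}" i] by auto
   have "i<N" using \<sigma> by simp
   with s have "i\<le>N-1" "\<sigma> i\<le>N-1" by linarith+
   then show "(%l. pairing S N(t l) \<nu> (theta_mono(p^r) X Y(N-1) i)(theta_mono(q^r) X' Y'(N-1)(\<sigma> i))) holomorphic_on U"
    by(intro pairing_holomorphic[OF U hol bal] even_thetaD(1)[OF theta_mono_even[OF pr X]] even_thetaD(1)[OF theta_mono_even[OF qr X']])
  qed
  ultimately show ?thesis by simp
 qed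
 then have "(%l. fact N *(2 * of_real pi * \<i>)^N/K * det(pmat S N(t l) \<nu> X Y X' Y')) holomorphic_on U"
  by(intro holomorphic_on_mult holomorphic_on_const)
 then show ?thesis by(rule holomorphic_transform)(simp add: eq)
qed

text \<open>A one-parameter deformation with exponents summing to zero stays balanced and is generic
  for small nonzero l; both sides are continuous at l = 0.\<close>

lemma TT_RR_shift:
 assumes bal: "balanced S N 1 t \<nu>" and N: "N > 0" and ij: "i\<in>S" "j\<in>S" "i~=j"
 shows "TT S N(t(i := q * t i))(\<nu>(i := \<nu> i+1))* RR S(t(j := q * t j))(\<nu>(j := \<nu> j+1))
  = TT S N(t(j := q * t j))(\<nu>(j := \<nu> j+1))* RR S(t(i := q * t i))(\<nu>(i := \<nu> i+1))"
proof -
 have fin: "finite S" "card S=2 * N+4" using bal by(auto simp: balanced_def)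
 have t: "\<And>a. a\<in>S==>t a~=0\<and>norm(t a)<1" using bal by(auto simp: balanced_def)
 have "card(S-{i, j})=2 * N+2" using fin ij by(simp add: card_Diff_subset)
 then have "S-{i, j}~={}" by(metis card.empty add_2_eq_Suc' nat.distinct(1))
 then obtain c where c: "c\<in>S" "c~=i" "c~=j" by blast
 \<comment> \<open>With the weights 2, 1, -3 the quantities x^2, x y, x/y and y^2 move with the
   exponents 4, 3, 1 and 2. None is zero, so each genericity condition fails only at isolated
   l.\<close>
 define e :: "nat => complex" where "e=(%a. if a=i then 2 else if a=j then 1 else if a=c then-3 else 0)"
 define T where "T=(%l a. t a * exp(e a * l))"
 define V where "V=(\<Inter>a\<in>S. {l. norm(T l a)<1})"
 have "open V" unfolding V_def T_def
  by(intro open_INT fin(1) ballI open_Collect_less continuous_intros)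
 have V0: "0\<in>V" using t by(auto simp: V_def T_def)
 have T0: "T 0=t" by(auto simp: T_def)
 have balV: "balanced S N 1(T l) \<nu>" if "l\<in>V" for l
 proof -
  have "(\<Sum>a\<in>S. e a)=0"
  proof -
   have "(\<Sum>a\<in>S. e a)=(\<Sum>a\<in>{i, j, c}. e a)"
    by(rule sum.mono_neutral_right)(use fin ij c in \<open>auto simp: e_def\<close>)
   then show ?thesis using ij c by(simp add: e_def)
  qed
  then have "(\<Sum>a\<in>S. e a * l)=0" by(simp add: sum_distrib_right[symmetric])
  then have "(\<Prod>a\<in>S. T l a)=(\<Prod>a\<in>S. t a)"
   unfolding T_def prod.distrib exp_sum[OF fin(1), symmetric] by simp
  then show ?thesis using bal that by(auto simp: balanced_def V_def T_def)
 qed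
 define f where "f=(%k l. TT S N((T l)(k := q * T l k))(\<nu>(k := \<nu> k+1)))"
 define h where "h=(%k l. RR S((T l)(k := q * T l k))(\<nu>(k := \<nu> k+1)))"
 have hol: "(%l. ((T l)(k := q * T l k)) a) holomorphic_on V" for k a
  by(cases "a=k")(auto simp: T_def intro!: holomorphic_intros)
 have "f k holomorphic_on V" "h k holomorphic_on V" if "k\<in>S" for k
  unfolding f_def h_def by(rule TT_holomorphic[OF \<open>open V\<close> hol balanced_shift[OF balV that]]
   RR_holomorphic[OF hol balanced_shift[OF balV that]], assumption)+
 then have "continuous_on V(f k)" "continuous_on V(h k)" if "k\<in>S" for k
  using that holomorphic_on_imp_continuous_on by blast+
 then have cont: "isCont(f k) 0" "isCont(h k) 0" if "k\<in>S" for k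
  using that V0 unfolding continuous_on_eq_continuous_at[OF \<open>open V\<close>] by blast+
 have xT: "xpt(T l a) k=xpt(t a) k * exp(e a * l)" for a k l by(simp add: xpt_def T_def)
 have x0: "xpt(t a)(\<nu> a)~=0" if "a\<in>S" for a using t[OF that] by(simp add: xpt_def)
 define x where "x=xpt(t i)(\<nu> i)"
 define y where "y=xpt(t j)(\<nu> j)"
 have xy0: "x~=0" "y~=0" using x0 ij by(auto simp: x_def y_def)
 have ev: "eventually(%l. l\<in>V\<and>jtheta(x\<^sup>2 * exp(4 * l))(p^r)~=0\<and>jtheta(x * y * exp(3 * l))(p^r)~=0
   \<and> jtheta(x/y * exp(1 * l))(p^r)~=0\<and>jtheta(y\<^sup>2 * exp(2 * l))(p^r)~=0)(at 0)"
  using xy0 eventually_at_in_open'[OF \<open>open V\<close> V0] by(intro eventually_conj eventually_jtheta_nonzero[OF pr]) auto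
 have "f i 0 * h j 0=f j 0 * h i 0"
 proof(rule isCont_eq_generic[where f = "%l. f i l * h j l" and g = "%l. f j l * h i l" and z=0])
  show "isCont(%l. f i l * h j l) 0" "isCont(%l. f j l * h i l) 0"
   using cont ij by(auto intro: continuous_mult)
  show "eventually(%l. f i l * h j l=f j l * h i l)(at 0)"
   using ev
  proof eventually_elim
   case(elim l)
   have X: "xpt(T l i)(\<nu> i)=x * exp(2 * l)" and Y: "xpt(T l j)(\<nu> j)=y * exp(1 * l)"
    using ij by(simp_all add: xT x_def y_def e_def)
   have sq: "(x * exp(2 * l))\<^sup>2=x\<^sup>2 * exp(4 * l)" "(y * exp(1 * l))\<^sup>2=y\<^sup>2 * exp(2 * l)"
    by(simp_all add: power_mult_distrib exp_double[symmetric])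
   have m: "x * exp(2 * l)*(y * exp(1 * l))=x * y * exp(3 * l)"
    by(simp add: exp_add[symmetric])
   have d: "x * exp(2 * l)/(y * exp(1 * l))=x/y * exp(1 * l)"
    using exp_add[of l l] by simp
   have "generic(p^r)(x * exp(2 * l))(y * exp(1 * l))"
    unfolding generic_def theta_prod_def sq m d using elim xy0 jtheta_eq_0_iff[OF pr, of "x\<^sup>2 * exp(4 * l)"] by auto
   moreover have "(y * exp(1 * l))\<^sup>2~=(p^r) powi k" for k :: int
    unfolding sq using elim xy0 jtheta_eq_0_iff[OF pr, of "y\<^sup>2 * exp(2 * l)"] by auto
   ultimately show ?case
    using TT_RR_shift_generic[OF balV[of l] N ij] elim unfolding X Y f_def h_def by blast
  qed
 qed
 then show ?thesis by(simp add: f_def h_def T0)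
qed

end

lemma norm_circlepath [simp]: "norm(circlepath 0 1 x)=1"
 by(simp add: circlepath norm_mult)

lemma torus_integral_cong:
 assumes "\<And>z. (\<And>j. norm(z j)=1)==>f z=g z"
 shows "torus_integral N f=torus_integral N g"
proof -
 have "f(%j. circlepath 0 1(x j))=g(%j. circlepath 0 1(x j))" for x :: "nat => real"
  by(rule assms) simp
 then show ?thesis unfolding torus_integral_def by(simp only:)
qed

section \<open>Periodicity in the discrete variables\<close>

context rarefied
begin

text \<open>The part of the quasi-period exponent belonging to the parameter. The other part, in (z,
  m), is common to all parameters and cancels when one discrete variable is raised and another
  lowered by r.\<close>

definition nu_const :: "complex => int => complex" where
 "nu_const L \<nu> = of_int(int r-1)*(of_int(2 * \<nu>+\<epsilon>+int r)*(L + of_real pi * \<i>)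
   + lp/2 *(of_int(2 * EE \<nu>+\<epsilon> * \<epsilon>+(int r-1)*(2 * \<nu>+\<epsilon>))+2 * of_int(int r *(int r-2))/3)
   - lq/2 *(of_int(2 * EE \<nu>+\<epsilon> * \<epsilon>+(int r+1)*(2 * \<nu>+\<epsilon>))+2 * of_int(int r *(int r+1))/3))"

lemma per_sum: "per(L+l)(\<nu>+m+\<epsilon>)+per(L-l)(\<nu>-m)
  = nu_const L \<nu> + of_int(int r-1)*(of_int(2 * m+\<epsilon>)* l + of_int(EE m)*(lp-lq))"
 unfolding per_def nu_const_def EE_def by(simp add: field_simps power2_eq_square)

lemma B_nu_period:
 assumes "exp L * exp l\<in>dom(\<nu>+m+\<epsilon>)" "exp L/exp l\<in>dom(\<nu>-m)"
 shows "B(exp L)(\<nu>+int r)(exp l) m=exp(nu_const L \<nu> + of_int(int r-1)*(of_int(2 * m+\<epsilon>)* l + of_int(EE m)*(lp-lq)))* B(exp L) \<nu> (exp l) m"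
proof -
 have 1: "G(exp L * exp l)(\<nu>+m+\<epsilon>+int r)=exp(per(L+l)(\<nu>+m+\<epsilon>))* G(exp L * exp l)(\<nu>+m+\<epsilon>)"
  using G_period[OF assms(1)] perz_exp[of "L+l"] by(simp add: exp_add)
 have 2: "G(exp L/exp l)(\<nu>-m+int r)=exp(per(L-l)(\<nu>-m))* G(exp L/exp l)(\<nu>-m)"
  using G_period[OF assms(2)] perz_exp[of "L-l"] by(simp add: exp_diff)
 have 3: "\<nu>+int r+m+\<epsilon>=\<nu>+m+\<epsilon>+int r" "\<nu>+int r-m=\<nu>-m+int r" by simp_all
 show ?thesis unfolding B_def 3 1 2 per_sum[symmetric] exp_add by(simp only: mult_ac)
qed

context
 fixes S :: "nat set" and N :: nat and t :: "nat => complex" and \<nu> \<nu>' :: "nat => int" and i j :: nat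
 assumes bal: "balanced S N 0 t \<nu>" and ij: "i\<in>S" "j\<in>S" "i~=j"
  and \<nu>': "\<nu>'=\<nu>(i := \<nu> i+int r, j := \<nu> j-int r)"
begin

lemma weight_nu_period:
 assumes z: "norm z=1"
 shows "weight S N t \<nu>' z m=exp(nu_const(Ln(t i))(\<nu> i)-nu_const(Ln(t j))(\<nu> j-int r))* weight S N t \<nu> z m"
proof -
 have fin: "finite S" and t: "\<And>a. a\<in>S==>t a~=0\<and>norm(t a)<1" using bal by(auto simp: balanced_def)
 have "z~=0" using z by auto
 then obtain l where l: "z=exp l" by(metis exp_Ln)
 define \<mu> where "\<mu> = of_int(int r-1)*(of_int(2 * m+\<epsilon>)* l + of_int(EE m)*(lp-lq))"
 have P: "B(t a)(k+int r) z m=exp(nu_const(Ln(t a)) k+\<mu>)* B(t a) k z m" if a: "a\<in>S" for a k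
 proof -
  have ta: "exp(Ln(t a))=t a" using t[OF a] by simp
  have "t a * z~=0" "norm(t a * z)<1" "t a/z~=0" "norm(t a/z)<1"
   using t[OF a] z \<open>z~=0\<close> by(auto simp: norm_mult norm_divide)
  then have "exp(Ln(t a))* exp l\<in>dom(k+m+\<epsilon>)" "exp(Ln(t a))/exp l\<in>dom(k-m)"
   unfolding ta l[symmetric] by(auto intro: unit_disc_dom)
  from B_nu_period[OF this] show ?thesis unfolding ta l[symmetric] \<mu>_def .
 qed
 have i: "B(t i)(\<nu>' i) z m=exp(nu_const(Ln(t i))(\<nu> i)+\<mu>)* B(t i)(\<nu> i) z m"
  using P[OF ij(1), of "\<nu> i"] ij by(simp add: \<nu>')
 have "B(t j)(\<nu> j) z m=exp(nu_const(Ln(t j))(\<nu> j-int r)+\<mu>)* B(t j)(\<nu>' j) z m"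
  using P[OF ij(2), of "\<nu> j-int r"] ij by(simp add: \<nu>')
 then have j: "B(t j)(\<nu>' j) z m=exp(- (nu_const(Ln(t j))(\<nu> j-int r)+\<mu>))* B(t j)(\<nu> j) z m"
  by(simp add: mult.assoc[symmetric] exp_add[symmetric])
 have S: "S=insert i(insert j(S-{i, j}))" using ij by auto
 have "(\<Prod>a\<in>S. B(t a)(\<nu>' a) z m)=B(t i)(\<nu>' i) z m *(B(t j)(\<nu>' j) z m *(\<Prod>a\<in>S-{i, j}. B(t a)(\<nu>' a) z m))"
  by(subst S)(use fin ij in simp)
 also have "(\<Prod>a\<in>S-{i, j}. B(t a)(\<nu>' a) z m)=(\<Prod>a\<in>S-{i, j}. B(t a)(\<nu> a) z m)"
  by(rule prod.cong)(auto simp: \<nu>')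
 also have "B(t i)(\<nu>' i) z m *(B(t j)(\<nu>' j) z m *(\<Prod>a\<in>S-{i, j}. B(t a)(\<nu> a) z m))
  = (exp(nu_const(Ln(t i))(\<nu> i)+\<mu>)* exp(- (nu_const(Ln(t j))(\<nu> j-int r)+\<mu>))) *
   (B(t i)(\<nu> i) z m *(B(t j)(\<nu> j) z m *(\<Prod>a\<in>S-{i, j}. B(t a)(\<nu> a) z m)))"
  unfolding i j by(simp only: mult_ac)
 also have "exp(nu_const(Ln(t i))(\<nu> i)+\<mu>)* exp(- (nu_const(Ln(t j))(\<nu> j-int r)+\<mu>))
   = exp(nu_const(Ln(t i))(\<nu> i)-nu_const(Ln(t j))(\<nu> j-int r))"
  unfolding exp_add[symmetric] by(rule arg_cong[of _ _ exp]) simp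
 also have "B(t i)(\<nu> i) z m *(B(t j)(\<nu> j) z m *(\<Prod>a\<in>S-{i, j}. B(t a)(\<nu> a) z m))=(\<Prod>a\<in>S. B(t a)(\<nu> a) z m)"
  by(subst(2) S)(use fin ij in simp)
 finally show ?thesis unfolding weight_def core_def by(simp only: mult_ac)
qed

lemma TT_nu_period: "TT S N t \<nu>'=exp(nu_const(Ln(t i))(\<nu> i)-nu_const(Ln(t j))(\<nu> j-int r))^N * TT S N t \<nu>"
 unfolding TT_def sum_distrib_left torus_integral_cmult[symmetric]
proof(intro sum.cong refl torus_integral_cong)
 fix m :: "nat => int" and z :: "nat => complex" assume "\<And>j. norm(z j)=1"
 then show "TT_integrand S N t \<nu>' m z=exp(nu_const(Ln(t i))(\<nu> i)-nu_const(Ln(t j))(\<nu> j-int r))^N * TT_integrand S N t \<nu> m z"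
  unfolding TT_integrand_def by(simp add: weight_nu_period prod.distrib prod_dividef)
qed

text \<open>The pair (i, j) keeps its discrete argument; the 2N + 2 remaining parameters, paired
  with i and with j, supply the same N-th power as the N variables of the integral.\<close>

lemma RR_nu_period: "RR S t \<nu>'=exp(nu_const(Ln(t i))(\<nu> i)-nu_const(Ln(t j))(\<nu> j-int r))^N * RR S t \<nu>"
proof -
 let ?S = "S-{i, j}"
 have fin: "finite S" "card S=2 * N+4" "(\<Sum>a\<in>S. 2 * \<nu> a+\<epsilon>)=0"
  and t: "\<And>a. a\<in>S==>t a~=0\<and>norm(t a)<1" using bal by(auto simp: balanced_def)
 have S: "S=insert i(insert j ?S)" using ij by auto
 obtain \<kappa> where \<kappa>: "(\<Sum>a\<in>S. Ln(t a))=lp + of_nat(1-0)* lq+2 * of_int \<kappa> * of_real pi * \<i>"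
  using balanced_log[OF bal] .
 have card: "card ?S=2 * N+2" using fin ij by(simp add: card_Diff_subset)
 have split: "(\<Sum>a\<in>S. f a)=f i+(f j+(\<Sum>a\<in>?S. f a))" for f :: "nat => 'b::comm_monoid_add"
  by(subst S)(use fin ij in simp)
 define Li where "Li=Ln(t i)"
 define Lj where "Lj=Ln(t j)"
 define nj where "nj=\<nu> j-int r"
 define R :: complex where "R = of_nat r"
 have sL: "(\<Sum>c\<in>?S. Ln(t c))=lp+lq+2 * of_int \<kappa> * of_real pi * \<i>-Li-Lj"
  using \<kappa> split[of "%a. Ln(t a)"] by(simp add: algebra_simps Li_def Lj_def)
 have sn: "(\<Sum>c\<in>?S. 2 * \<nu> c+\<epsilon>) = - (2 * \<nu> i+\<epsilon>)-(2 * nj+\<epsilon>)-2 * int r"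
  using fin(3) split[of "%a. 2 * \<nu> a+\<epsilon>"] by(simp add: nj_def)
 define e where "e=(%c. per(Li+Ln(t c))(\<nu> i+\<nu> c+\<epsilon>)-per(Lj+Ln(t c))(nj+\<nu> c+\<epsilon>))"
 define A :: complex where "A = of_int(2 * \<nu> i+\<epsilon>)"
 define A' :: complex where "A' = of_int(2 * nj+\<epsilon>)"
 define d :: complex where "d = of_int(\<nu> i-nj)"
 define s :: complex where "s = of_int(\<nu> i+nj+\<epsilon>)"
 define c0 where "c0=(R-1)/2 *((A+R)* Li-(A'+R)* Lj+(A-A')*(of_real pi * \<i>))
   + (R-1)/2 * d *((s+R-1)* lp-(s+R+1)* lq)"
 define c1 where "c1=(R-1)* d"
 define c2 where "c2=(R-1)/2 *(Li-Lj+d * lp-d * lq)"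
 have se: "(\<Sum>c\<in>?S. e c)=(\<Sum>c\<in>?S. c0+c1 * Ln(t c)+c2 * of_int(2 * \<nu> c+\<epsilon>))"
  by(rule sum.cong)
    (auto simp: e_def per_def c0_def c1_def c2_def A_def A'_def d_def s_def R_def field_simps power2_eq_square)
 have ex: "(\<Sum>c\<in>?S. e c) = of_nat N *(nu_const Li(\<nu> i)-nu_const Lj nj)+2 * of_int((int r-1)*(\<nu> i-nj)*(\<kappa>+1))* of_real pi * \<i>"
  unfolding se sum_affine sL sn card
  unfolding c0_def c1_def c2_def A_def A'_def d_def s_def R_def nu_const_def EE_def by(simp add: field_simps)
 have RR0: "RR S t \<nu>=G(t i * t j)(\<nu> i+\<nu> j+\<epsilon>)*(\<Prod>c\<in>?S. G(t i * t c)(\<nu> i+\<nu> c+\<epsilon>)* G(t j * t c)(\<nu> j+\<nu> c+\<epsilon>))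
   * pairp ?S(%a b. G(t a * t b)(\<nu> a+\<nu> b+\<epsilon>))"
  unfolding RR_def by(subst S, rule pairp_insert2)(use fin ij in \<open>auto simp: mult.commute add_ac\<close>)
 have "RR S t \<nu>'=G(t i * t j)(\<nu>' i+\<nu>' j+\<epsilon>)*(\<Prod>c\<in>?S. G(t i * t c)(\<nu>' i+\<nu>' c+\<epsilon>)* G(t j * t c)(\<nu>' j+\<nu>' c+\<epsilon>))
   * pairp ?S(%a b. G(t a * t b)(\<nu>' a+\<nu>' b+\<epsilon>))"
  unfolding RR_def by(subst S, rule pairp_insert2)(use fin ij in \<open>auto simp: mult.commute add_ac\<close>)
 also have "pairp ?S(%a b. G(t a * t b)(\<nu>' a+\<nu>' b+\<epsilon>))=pairp ?S(%a b. G(t a * t b)(\<nu> a+\<nu> b+\<epsilon>))"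
  by(rule pairp_cong)(auto simp: \<nu>')
 also have "\<nu>' i+\<nu>' j+\<epsilon>=\<nu> i+\<nu> j+\<epsilon>" using ij by(simp add: \<nu>')
 also have "(\<Prod>c\<in>?S. G(t i * t c)(\<nu>' i+\<nu>' c+\<epsilon>)* G(t j * t c)(\<nu>' j+\<nu>' c+\<epsilon>))
   = (\<Prod>c\<in>?S. exp(e c)*(G(t i * t c)(\<nu> i+\<nu> c+\<epsilon>)* G(t j * t c)(\<nu> j+\<nu> c+\<epsilon>)))"
 proof(rule prod.cong[OF refl])
  fix c assume c: "c \<in> ?S"
  have tt: "exp(Ln(t c))=t c" "exp Li=t i" "exp Lj=t j" using t c ij by(auto simp: Li_def Lj_def)
  have m: "t a * t c\<in>dom k" if "a\<in>S" for a k
   using norm_pair_less[OF bal that, of c] t[OF that] t[of c] c by(auto intro: unit_disc_dom)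
  have 1: "G(t i * t c)(\<nu> i+\<nu> c+\<epsilon>+int r)=exp(per(Li+Ln(t c))(\<nu> i+\<nu> c+\<epsilon>))* G(t i * t c)(\<nu> i+\<nu> c+\<epsilon>)"
   using G_period[OF m[OF ij(1)], of "\<nu> i+\<nu> c+\<epsilon>"] perz_exp[of "Li+Ln(t c)"] by(simp add: exp_add tt)
  have "G(t j * t c)(nj+\<nu> c+\<epsilon>+int r)=exp(per(Lj+Ln(t c))(nj+\<nu> c+\<epsilon>))* G(t j * t c)(nj+\<nu> c+\<epsilon>)"
   using G_period[OF m[OF ij(2)], of "nj+\<nu> c+\<epsilon>"] perz_exp[of "Lj+Ln(t c)"] by(simp add: exp_add tt)
  then have 2: "G(t j * t c)(nj+\<nu> c+\<epsilon>)=exp(- per(Lj+Ln(t c))(nj+\<nu> c+\<epsilon>))* G(t j * t c)(nj+\<nu> c+\<epsilon>+int r)"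
   by(simp add: mult.assoc[symmetric] exp_add[symmetric])
  have 3: "\<nu>' i+\<nu>' c+\<epsilon>=\<nu> i+\<nu> c+\<epsilon>+int r" "\<nu>' j+\<nu>' c+\<epsilon>=nj+\<nu> c+\<epsilon>"
   "nj+\<nu> c+\<epsilon>+int r=\<nu> j+\<nu> c+\<epsilon>"
   using c ij by(simp_all add: \<nu>' nj_def)
  show "G(t i * t c)(\<nu>' i+\<nu>' c+\<epsilon>)* G(t j * t c)(\<nu>' j+\<nu>' c+\<epsilon>)
   = exp(e c)*(G(t i * t c)(\<nu> i+\<nu> c+\<epsilon>)* G(t j * t c)(\<nu> j+\<nu> c+\<epsilon>))"
   unfolding 3(1,2) 1 2 unfolding 3(3) e_def exp_diff exp_minus by(simp add: divide_inverse mult_ac)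
 qed
 also have "\<dots>=exp(\<Sum>c\<in>?S. e c)*(\<Prod>c\<in>?S. G(t i * t c)(\<nu> i+\<nu> c+\<epsilon>)* G(t j * t c)(\<nu> j+\<nu> c+\<epsilon>))"
  unfolding exp_sum[OF finite_Diff[OF fin(1)]] prod.distrib ..
 also have "exp(\<Sum>c\<in>?S. e c)=exp(nu_const(Ln(t i))(\<nu> i)-nu_const(Ln(t j))(\<nu> j-int r))^N"
  unfolding ex exp_add exp_two_pi_int Li_def Lj_def nj_def exp_of_nat_mult[symmetric] by simp
 also have "G(t i * t j)(\<nu> i+\<nu> j+\<epsilon>)*(exp(nu_const(Ln(t i))(\<nu> i)-nu_const(Ln(t j))(\<nu> j-int r))^N *
    (\<Prod>c\<in>?S. G(t i * t c)(\<nu> i+\<nu> c+\<epsilon>)* G(t j * t c)(\<nu> j+\<nu> c+\<epsilon>)))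
   * pairp ?S(%a b. G(t a * t b)(\<nu> a+\<nu> b+\<epsilon>))
   = exp(nu_const(Ln(t i))(\<nu> i)-nu_const(Ln(t j))(\<nu> j-int r))^N *(G(t i * t j)(\<nu> i+\<nu> j+\<epsilon>) *
    (\<Prod>c\<in>?S. G(t i * t c)(\<nu> i+\<nu> c+\<epsilon>)* G(t j * t c)(\<nu> j+\<nu> c+\<epsilon>))
   * pairp ?S(%a b. G(t a * t b)(\<nu> a+\<nu> b+\<epsilon>)))"
  by(simp only: mult_ac)
 also have "G(t i * t j)(\<nu> i+\<nu> j+\<epsilon>) *
    (\<Prod>c\<in>?S. G(t i * t c)(\<nu> i+\<nu> c+\<epsilon>)* G(t j * t c)(\<nu> j+\<nu> c+\<epsilon>))
   * pairp ?S(%a b. G(t a * t b)(\<nu> a+\<nu> b+\<epsilon>))=RR S t \<nu>"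
  by(rule RR0[symmetric])
 finally show ?thesis .
qed

end

end

section \<open>Constancy of the quotient of the two sides\<close>

context rarefied
begin

definition KK :: "nat set => nat => (nat => complex) => (nat => int) => complex" where
 "KK S N t \<nu>=TT S N t \<nu>/RR S t \<nu>"

lemma balanced_update:
 assumes bal: "balanced S N 0 t \<nu>" and ij: "i\<in>S" "j\<in>S" "i~=j" and d: "\<delta>\<le>1"
  and X: "X~=0" "norm X<1" and Y: "Y~=0" "norm Y<1" and XY: "q^\<delta> *(X * Y)=t i * t j"
  and ab: "a+b+int \<delta>=\<nu> i+\<nu> j"
 shows "balanced S N \<delta> (t(i := X, j := Y))(\<nu>(i := a, j := b))"
proof -
 let ?S = "S-{i, j}"
 have fin: "finite S" using bal by(simp add: balanced_def)
 have S: "S=insert i(insert j ?S)" using ij by auto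
 have P: "(\<Prod>c\<in>S. f c)=f i *(f j *(\<Prod>c\<in>?S. f c))" for f :: "nat => complex"
  by(subst S)(use fin ij in simp)
 have Q: "(\<Sum>c\<in>S. f c)=f i+(f j+(\<Sum>c\<in>?S. f c))" for f :: "nat => int"
  by(subst S)(use fin ij in simp)
 have p1: "(\<Prod>c\<in>?S. (t(i := X, j := Y)) c)=(\<Prod>c\<in>?S. t c)" by(rule prod.cong) auto
 have p2: "(\<Sum>c\<in>?S. 2 *(\<nu>(i := a, j := b)) c+\<epsilon>)=(\<Sum>c\<in>?S. 2 * \<nu> c+\<epsilon>)" by(rule sum.cong) auto
 define R where "R=(\<Prod>c\<in>?S. t c)"
 have "p * q=t i * t j * R" using bal P[of t] by(simp add: balanced_def R_def mult.assoc)
 then have pq: "p * q=q^\<delta> *(X * Y * R)" using XY by(simp add: mult_ac)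
 have "X * Y * R=p * q^(1-\<delta>)"
 proof(cases "\<delta>=0")
  case False
  then have "\<delta>=1" using d by simp
  then show ?thesis using pq q0 by simp
 qed(use pq in simp)
 then have "(\<Prod>c\<in>S. (t(i := X, j := Y)) c)=p * q^(1-\<delta>)"
  using ij unfolding P[of "t(i := X, j := Y)"] p1 R_def by(simp add: mult.assoc)
 moreover have "(\<Sum>c\<in>S. 2 *(\<nu>(i := a, j := b)) c+\<epsilon>) = - 2 * int \<delta>"
  using ij ab bal Q[of "%c. 2 * \<nu> c+\<epsilon>"] unfolding Q[of "%c. 2 *(\<nu>(i := a, j := b)) c+\<epsilon>"] p2
  by(simp add: balanced_def)
 ultimately show ?thesis using bal d X Y by(auto simp: balanced_def)
qed

lemma TT_cong:
 assumes "\<And>a. a\<in>S==>s a=s' a" "\<And>a. a\<in>S==>\<mu> a=\<mu>' a"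
 shows "TT S N s \<mu>=TT S N s' \<mu>'"
proof -
 have "weight S N s \<mu>=weight S N s' \<mu>'"
  unfolding weight_def core_def fun_eq_iff using assms by(auto intro!: prod.cong)
 then show ?thesis unfolding TT_def TT_integrand_def by simp
qed

lemma RR_cong:
 assumes "\<And>a. a\<in>S==>s a=s' a" "\<And>a. a\<in>S==>\<mu> a=\<mu>' a"
 shows "RR S s \<mu>=RR S s' \<mu>'"
 unfolding RR_def by(rule pairp_cong)(simp add: assms)

lemma KK_cong:
 assumes "\<And>a. a\<in>S==>s a=s' a" "\<And>a. a\<in>S==>\<mu> a=\<mu>' a"
 shows "KK S N s \<mu>=KK S N s' \<mu>'"
 unfolding KK_def using TT_cong[of S s s' \<mu> \<mu>'] RR_cong[of S s s' \<mu> \<mu>'] assms by simp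

lemma KK_shift:
 assumes bal: "balanced S N 1 t \<nu>" and N: "N > 0" and ij: "i\<in>S" "j\<in>S" "i~=j"
 shows "KK S N(t(i := q * t i))(\<nu>(i := \<nu> i+1))=KK S N(t(j := q * t j))(\<nu>(j := \<nu> j+1))"
 using TT_RR_shift[OF bal N ij] RR_nonzero[OF balanced_shift[OF bal ij(1)]] RR_nonzero[OF balanced_shift[OF bal ij(2)]]
 unfolding KK_def by(simp add: frac_eq_eq)

lemma KK_nu_period:
 assumes bal: "balanced S N 0 t \<nu>" and ij: "i\<in>S" "j\<in>S" "i~=j"
 shows "KK S N t(\<nu>(i := \<nu> i+int r, j := \<nu> j-int r))=KK S N t \<nu>"
 unfolding KK_def TT_nu_period[OF bal ij refl] RR_nu_period[OF bal ij refl] by simp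

lemma KK_holomorphic:
 assumes U: "open U" and hol: "\<And>a. a\<in>S==>(%l. t l a) holomorphic_on U"
  and bal: "\<And>l. l\<in>U==>balanced S N 0(t l) \<nu>"
 shows "(%l. KK S N(t l) \<nu>) holomorphic_on U"
 unfolding KK_def by(intro holomorphic_on_divide TT_holomorphic[OF U hol bal] RR_holomorphic[OF hol bal] RR_nonzero[OF bal])

text \<open>With the product \<tau> of two parameters fixed, the quotient as a function of one of
  them is a dilation family for b = q on |\<tau>| < |X| < 1; this annulus admits a q-shift because
  |\<tau>| < |q|.\<close>

lemma KK_dilate:
 assumes bal: "balanced S N 0 t \<nu>" and N: "N > 0" and ij: "i\<in>S" "j\<in>S" "i~=j"
  and small: "norm(t i * t j)<norm q"
  and X: "norm(t i * t j)<norm X" "norm X<1"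
 shows "KK S N(t(i := X, j := t i * t j/X))(\<nu>(i := \<nu> i+k, j := \<nu> j-k))=KK S N t \<nu>"
proof -
 define \<tau> where "\<tau>=t i * t j"
 have t: "t i~=0" "t j~=0" "norm(t i)<1" "norm(t j)<1" using bal ij by(auto simp: balanced_def)
 have \<tau>0: "\<tau>~=0" using t by(simp add: \<tau>_def)
 define f where "f=(%k X. KK S N(t(i := X, j := \<tau>/X))(\<nu>(i := \<nu> i+k, j := \<nu> j-k)))"
 have nX: "X~=0\<and>\<tau>/X~=0\<and>norm(\<tau>/X)<1" if "norm \<tau><norm X" for X
  using that \<tau>0 by(auto simp: norm_divide divide_less_eq)
 have balX: "balanced S N 0(t(i := X, j := \<tau>/X))(\<nu>(i := \<nu> i+k, j := \<nu> j-k))"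
  if "norm \<tau><norm X" "norm X<1" for X k
  by(rule balanced_update[OF bal ij])(use nX[OF that(1)] that in \<open>auto simp: \<tau>_def\<close>)
 let ?A = "{z. norm \<tau><norm z\<and>norm z<1}"
 have opA: "open ?A" by(intro open_Collect_conj open_Collect_less continuous_intros)
 obtain C where C: "\<And>k X. norm \<tau><norm X==>norm X<1==>f k X=C"
 proof(rule dilation_family_constant[of f "norm \<tau>" 1 q r])
  show "f k holomorphic_on ?A" for k
   unfolding f_def
  proof(rule KK_holomorphic[OF opA])
   show "(%l. (t(i := l, j := \<tau>/l)) a) holomorphic_on ?A" for a
    by(cases "a=j"; cases "a=i")(use \<tau>0 in \<open>auto intro!: holomorphic_intros\<close>)
  qed(use balX in auto)
  show "0<norm q" "norm q<1" "0\<le>norm \<tau>" "norm \<tau><norm q * 1" "r > 0"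
   using q q0 small r0 by(auto simp: \<tau>_def)
  show "f(k+int r) X=f k X" if "norm \<tau><norm X" "norm X<1" for k X
  proof -
   let ?n = "\<nu>(i := \<nu> i+k, j := \<nu> j-k)"
   have "\<nu>(i := \<nu> i+(k+int r), j := \<nu> j-(k+int r)) = ?n(i := ?n i+int r, j := ?n j-int r)"
    using ij(3) by(auto simp: fun_eq_iff)
   then show ?thesis unfolding f_def using KK_nu_period[OF balX[OF that] ij] by simp
  qed
  show "f(k+1)(q * X)=f k X" if "norm \<tau><norm(q * X)" "norm X<1" for k X
  proof -
   have qX: "q * X~=0" "\<tau>/(q * X)~=0" "norm(\<tau>/(q * X))<1" using nX[OF that(1)] by auto
   \<comment> \<open>The common system with \<delta> = 1: raising its i-th parameter gives the
     quotient at q X, raising its j-th parameter gives the quotient at X.\<close>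
   let ?t = "t(i := X, j := \<tau>/(q * X))" and ?n = "\<nu>(i := \<nu> i+k, j := \<nu> j-k-1)"
   have "balanced S N 1 ?t ?n"
    by(rule balanced_update[OF bal ij])(use qX that in \<open>auto simp: \<tau>_def\<close>)
   from KK_shift[OF this N ij]
   have "KK S N(?t(i := q * ?t i))(?n(i := ?n i+1))=KK S N(?t(j := q * ?t j))(?n(j := ?n j+1))" .
   moreover have "?t(i := q * ?t i)=t(i := q * X, j := \<tau>/(q * X))" "?t(j := q * ?t j)=t(i := X, j := \<tau>/X)"
    "?n(i := ?n i+1)=\<nu>(i := \<nu> i+(k+1), j := \<nu> j-(k+1))" "?n(j := ?n j+1)=\<nu>(i := \<nu> i+k, j := \<nu> j-k)"
    using ij(3) q0 by(auto simp: fun_eq_iff)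
   ultimately show ?thesis unfolding f_def by simp
  qed
 qed blast
 have "norm \<tau><norm(t i)" using t by(simp add: \<tau>_def norm_mult mult_less_cancel_left1)
 then have "f 0(t i)=C" using t by(intro C) auto
 moreover have "f 0(t i)=KK S N t \<nu>" using t unfolding f_def \<tau>_def by simp
 moreover have "f k X=C" using X by(intro C)(auto simp: \<tau>_def)
 ultimately show ?thesis by(simp add: f_def \<tau>_def)
qed

text \<open>A small t_i serves as partner for every other parameter: each is moved to c with
  discrete variable 0, and t_i absorbs the change. Since no parameter exceeds c in modulus, t_i does
  not grow and stays small.\<close>

lemma KK_normalize_partial:
 assumes bal: "balanced S N 0 t \<nu>" and N: "N > 0" and i: "i\<in>S" and small: "norm(t i)<norm q"
  and c: "0<c" "c<1" "\<And>a. a\<in>S==>norm(t a)\<le>c" and A: "finite A" "A \<subseteq> S-{i}"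
 shows "let t'=(%a. if a=i then t i *(\<Prod>b\<in>A. t b) / of_real c^card A else if a\<in>A then of_real c else t a);
       \<nu>'=(%a. if a=i then \<nu> i+(\<Sum>b\<in>A. \<nu> b) else if a\<in>A then 0 else \<nu> a)
     in balanced S N 0 t' \<nu>'\<and>norm(t' i)\<le>norm(t i)\<and>KK S N t' \<nu>'=KK S N t \<nu>"
 using A
proof(induction A rule: finite_induct)
 case empty
 have e: "(%a. if a=i then t i *(\<Prod>b\<in>{}. t b) / of_real c^card {} else if a\<in>{} then of_real c else t a)=t"
  "(%a. if a=i then \<nu> i+(\<Sum>b\<in>{}. \<nu> b) else if a\<in>{} then 0 else \<nu> a)=\<nu>" by auto
 show ?case unfolding Let_def e using bal by simp
next
 case(insert b A)
 define t' where "t'=(%a. if a=i then t i *(\<Prod>b\<in>A. t b) / of_real c^card A else if a\<in>A then of_real c else t a)"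
 define \<nu>' where "\<nu>'=(%a. if a=i then \<nu> i+(\<Sum>b\<in>A. \<nu> b) else if a\<in>A then 0 else \<nu> a)"
 have IH: "balanced S N 0 t' \<nu>'" "norm(t' i)\<le>norm(t i)" "KK S N t' \<nu>'=KK S N t \<nu>"
  using insert.IH insert.prems by(auto simp: t'_def \<nu>'_def Let_def)
 have b: "b\<in>S" "b~=i" using insert.prems by auto
 have tb: "t' b=t b" "\<nu>' b=\<nu> b" using insert b by(auto simp: t'_def \<nu>'_def)
 have t0: "t b~=0" "t' i~=0" "norm(t b)<1" using IH(1) b i tb by(auto simp: balanced_def)
 have less: "norm(t b * t' i)<norm(t b)"
 proof -
  have "norm(t' i)<1" using IH(1) i by(auto simp: balanced_def)
  then show ?thesis using t0 by(simp add: norm_mult mult_less_cancel_left2)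
 qed
 have leq: "norm(t b * t' i)\<le>norm(t' i)" using t0(3) by(simp add: norm_mult mult_left_le_one_le)
 have "KK S N(t'(b := of_real c, i := t' b * t' i / of_real c))(\<nu>'(b := \<nu>' b + - \<nu>' b, i := \<nu>' i - - \<nu>' b))=KK S N t' \<nu>'"
 proof(rule KK_dilate[OF IH(1) N b(1) i b(2)])
  show "norm(t' b * t' i)<norm q" unfolding tb using leq IH(2) small by linarith
  show "norm(t' b * t' i)<norm(complex_of_real c)" unfolding tb using less c(3)[OF b(1)] c(1) by simp
  show "norm(complex_of_real c)<1" using c by simp
 qed
 moreover have bal': "balanced S N 0(t'(b := of_real c, i := t' b * t' i / of_real c))(\<nu>'(b := \<nu>' b + - \<nu>' b, i := \<nu>' i - - \<nu>' b))"
 proof(rule balanced_update[OF IH(1) b(1) i b(2)])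
  show "norm(t' b * t' i / of_real c)<1"
   unfolding tb norm_divide using less c(3)[OF b(1)] c(1) by(simp add: divide_less_eq)
 qed(use c t0 tb in auto)
 moreover have "t'(b := of_real c, i := t' b * t' i / of_real c)=(%a. if a=i then t i *(\<Prod>b\<in>insert b A. t b) / of_real c^card(insert b A) else if a\<in>insert b A then of_real c else t a)"
  using insert.hyps b tb by(auto simp: fun_eq_iff t'_def mult_ac)
 moreover have "\<nu>'(b := \<nu>' b + - \<nu>' b, i := \<nu>' i - - \<nu>' b)=(%a. if a=i then \<nu> i+(\<Sum>b\<in>insert b A. \<nu> b) else if a\<in>insert b A then 0 else \<nu> a)"
  using insert.hyps b tb by(auto simp: fun_eq_iff \<nu>'_def)
 moreover have "norm((t'(b := of_real c, i := t' b * t' i / of_real c)) i)\<le>norm(t i)"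
 proof -
  have "norm(t b)* norm(t' i)\<le>c * norm(t' i)" using c(3)[OF b(1)] by(intro mult_right_mono) auto
  then have "norm(t' b * t' i / of_real c)\<le>norm(t' i)"
   unfolding tb norm_divide norm_mult using c(1) by(simp add: divide_le_eq mult.commute)
  then show ?thesis using IH(2) by simp
 qed
 ultimately show ?case unfolding Let_def using IH(3) by simp
qed

lemma KK_normalize:
 assumes bal: "balanced S N 0 t \<nu>" and N: "N > 0" and i: "i\<in>S" and small: "norm(t i)<norm q"
  and c: "0<c" "c<1" "\<And>a. a\<in>S==>norm(t a)\<le>c"
 shows "KK S N t \<nu>=KK S N(%a. if a=i then p * q / of_real c^(2 * N+3) else if a\<in>S then of_real c else 0)
   (%a. if a=i then-(int N+2)* \<epsilon> else 0)"
  (is "_ = KK S N ?t ?n")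
proof -
 have fin: "finite S" "card S=2 * N+4" using bal by(auto simp: balanced_def)
 define t' where "t'=(%a. if a=i then t i *(\<Prod>b\<in>S-{i}. t b) / of_real c^card(S-{i}) else if a\<in>S-{i} then of_real c else t a)"
 define \<nu>' where "\<nu>'=(%a. if a=i then \<nu> i+(\<Sum>b\<in>S-{i}. \<nu> b) else if a\<in>S-{i} then 0 else \<nu> a)"
 have K: "KK S N t' \<nu>'=KK S N t \<nu>"
  using KK_normalize_partial[OF bal N i small c, of "S-{i}"] fin by(simp add: Let_def t'_def \<nu>'_def)
 have "KK S N t' \<nu>'=KK S N ?t ?n"
 proof(rule KK_cong)
  have "(\<Sum>a\<in>S. \<nu> a) = - (int N+2)* \<epsilon>"
  proof -
   have "(\<Sum>a\<in>S. 2 * \<nu> a+\<epsilon>)=2 *(\<Sum>a\<in>S. \<nu> a)+int(2 * N+4)* \<epsilon>" by(simp add: sum.distrib sum_distrib_left fin)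
   then have "2 *(\<Sum>a\<in>S. \<nu> a)+2 *((int N+2)* \<epsilon>)=0" using bal by(simp add: balanced_def algebra_simps)
   then have "(\<Sum>a\<in>S. \<nu> a) = - ((int N+2)* \<epsilon>)" by linarith
   then show ?thesis by(simp only: mult_minus_left)
  qed
  then have s: "\<nu> i+(\<Sum>b\<in>S-{i}. \<nu> b) = - (int N+2)* \<epsilon>" using sum.remove[OF fin(1) i, of \<nu>] by simp
  have pr: "t i *(\<Prod>b\<in>S-{i}. t b)=p * q" using prod.remove[OF fin(1) i, of t] bal by(simp add: balanced_def)
  have cd: "card(S-{i})=2 * N+3" using fin i by simp
  show "t' a = ?t a" if "a\<in>S" for a using that unfolding t'_def pr cd by simp
  show "\<nu>' a = ?n a" if "a\<in>S" for a using that unfolding \<nu>'_def s by simp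
 qed
 then show ?thesis using K by simp
qed

lemma KK_eq_small:
 assumes "balanced S N 0 t \<nu>" "balanced S N 0 t' \<nu>'" "N > 0" "i\<in>S" "norm(t i)<norm q" "norm(t' i)<norm q"
 shows "KK S N t \<nu>=KK S N t' \<nu>'"
proof -
 have fin: "finite S" using assms by(simp add: balanced_def)
 \<comment> \<open>One c dominating both systems brings them to the same normal form; the entry 1/2
   ensures that c is positive.\<close>
 let ?M = "insert(1/2)((%a. norm(t a)) ` S \<union> (%a. norm(t' a)) ` S)"
 define c where "c=Max ?M"
 have M: "finite ?M" "?M~={}" using fin by auto
 have "1/2\<le>c" unfolding c_def by(rule Max_ge[OF M(1)]) simp
 moreover have "c<1" unfolding c_def Max_less_iff[OF M] using assms(1,2) by(auto simp: balanced_def)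
 moreover have "norm(t a)\<le>c" "norm(t' a)\<le>c" if "a\<in>S" for a
  unfolding c_def by(rule Max_ge[OF M(1)], use that in auto)+
 ultimately show ?thesis
  using KK_normalize[OF assms(1,3,4,5), of c] KK_normalize[OF assms(2,3,4,6), of c] by simp
qed

lemma exists_power_gt:
 assumes "(x::real)<1"
 obtains c where "0<c" "c<1" "x<c^k"
proof -
 have "((%c. c^k)\<longlongrightarrow>1^k)(at_left(1::real))" by(intro tendsto_intros)
 then have "eventually(%c. x<c^k)(at_left 1)" using assms by(intro order_tendstoD(1)) auto
 moreover have "eventually(%c. c\<in>{0<..<1})(at_left(1::real))"
  by(rule eventually_at_left_real) simp
 ultimately have "eventually(%c. x<c^k\<and>c\<in>{0<..<1})(at_left(1::real))" by(rule eventually_conj)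
 then obtain c where "x<c^k\<and>c\<in>{0<..<1}" using eventually_happens'[OF trivial_limit_at_left_real] by blast
 then show ?thesis using that by auto
qed

text \<open>Moving the logarithms of the parameters along a segment reaches the region where one of them is
  small; analytic continuation along the segment then carries the constant back.\<close>

lemma KK_to_small:
 assumes bal: "balanced S N 0 t \<nu>" and N: "N > 0" and i: "i\<in>S"
 obtains t' where "balanced S N 0 t' \<nu>" "norm(t' i)<norm q" "KK S N t \<nu>=KK S N t' \<nu>"
proof -
 have fin: "finite S" "card S=2 * N+4" and t: "\<And>a. a\<in>S==>t a~=0\<and>norm(t a)<1" using bal by(auto simp: balanced_def)
 \<comment> \<open>The target is c for all parameters but t_i. Then t_i ends at pq/c^(2N + 3), of
   modulus below |q| precisely because |p| < c^(2N + 3).\<close>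
 obtain c where c: "0<c" "c<1" "norm p<c^(2 * N+3)" using exists_power_gt[OF p] .
 define M where "M=(%a. if a=i then(\<Sum>a\<in>S. Ln(t a)) - of_nat(2 * N+3)* of_real(ln c) else of_real(ln c))"
 define e where "e=(%a l. Ln(t a)+l *(M a-Ln(t a)))"
 define T where "T=(%l a. exp(e a l))"
 have sM: "(\<Sum>a\<in>S. M a)=(\<Sum>a\<in>S. Ln(t a))"
 proof -
  have "(\<Sum>a\<in>S-{i}. M a)=(\<Sum>a\<in>S-{i}. of_real(ln c))" by(rule sum.cong)(auto simp: M_def)
  also have "\<dots> = of_nat(2 * N+3)* of_real(ln c)" using fin i by simp
  finally show ?thesis using sum.remove[OF fin(1) i, of M] by(simp add: M_def)
 qed
 define V where "V=(\<Inter>a\<in>S. {l. Re(e a l)<0})"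
 have opV: "open V" unfolding V_def e_def
  by(intro open_INT fin(1) ballI open_Collect_less continuous_intros)
 have convV: "convex V"
  unfolding V_def
 proof(intro convex_INT ballI)
  fix a
  show "convex {l. Re(e a l)<0}"
  proof(rule convexI)
   fix x y u v assume *: "x\<in>{l. Re(e a l)<0}" "y\<in>{l. Re(e a l)<0}" and uv: "0\<le>u" "0\<le>v" "u+v=(1::real)"
   have v: "v=1-u" using uv by simp
   have "e a(u *\<^sub>R x+v *\<^sub>R y)=u *\<^sub>R e a x+v *\<^sub>R e a y"
    by(simp add: v e_def scaleR_conv_of_real algebra_simps)
   then have eq: "Re(e a(u *\<^sub>R x+v *\<^sub>R y))=u * Re(e a x)+v * Re(e a y)" by simp
   have "u * Re(e a x)+v * Re(e a y)<0"
   proof(cases "u=0")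
    case False
    then have "u * Re(e a x)<0" using * uv by(simp add: mult_pos_neg)
    moreover have "v * Re(e a y)\<le>0" using * uv by(simp add: mult_nonneg_nonpos)
    ultimately show ?thesis by linarith
   qed(use * v in simp)
   then show "u *\<^sub>R x+v *\<^sub>R y\<in>{l. Re(e a l)<0}" using eq by simp
  qed
 qed
 have nT: "norm(T l a)<1 \<longleftrightarrow> Re(e a l)<0" for l a by(simp add: T_def)
 have T0: "T 0 a=t a" if "a\<in>S" for a using t[OF that] by(simp add: T_def e_def)
 have T1: "T 1 a=exp(M a)" for a by(simp add: T_def e_def)
 have prodT: "(\<Prod>a\<in>S. T l a)=p * q" for l
 proof -
  have "(\<Prod>a\<in>S. T l a)=exp(\<Sum>a\<in>S. Ln(t a)+l *(M a-Ln(t a)))"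
   unfolding T_def e_def exp_sum[OF fin(1)] ..
  also have "(\<Sum>a\<in>S. Ln(t a)+l *(M a-Ln(t a)))=(\<Sum>a\<in>S. Ln(t a))"
   by(simp add: sum.distrib sum_distrib_left[symmetric] sum_subtractf sM)
  also have "exp \<dots>=(\<Prod>a\<in>S. t a)" unfolding exp_sum[OF fin(1)] by(rule prod.cong)(use t in auto)
  finally show ?thesis using bal by(simp add: balanced_def)
 qed
 have balV: "balanced S N 0(T l) \<nu>" if "l\<in>V" for l
  using bal that prodT nT by(auto simp: balanced_def V_def T_def)
 have "Re(e a 0)<0" if "a\<in>S" for a using nT[of 0 a] T0[OF that] t[OF that] by simp
 then have v0: "0\<in>V" by(simp add: V_def)
 have nTi: "norm(T 1 i)<norm q"
 proof -
  have "T 1 i * of_real c^(2 * N+3)=p * q"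
  proof -
   have "exp(\<Sum>a\<in>S. Ln(t a))=(\<Prod>a\<in>S. t a)" unfolding exp_sum[OF fin(1)] by(rule prod.cong)(use t in auto)
   moreover have "exp(of_nat(2 * N+3)* complex_of_real(ln c)) = of_real c^(2 * N+3)"
    unfolding exp_of_nat_mult using c by(simp add: exp_of_real)
   ultimately show ?thesis using c bal unfolding T1 M_def by(simp add: exp_diff balanced_def)
  qed
  then have "norm(T 1 i)* c^(2 * N+3)=norm p * norm q"
   using c by(metis abs_of_pos norm_mult norm_of_real norm_power)
  also have "\<dots><c^(2 * N+3)* norm q" using c q0 by(intro mult_strict_right_mono) auto
  finally have "c^(2 * N+3)* norm(T 1 i)<c^(2 * N+3)* norm q" by(simp only: mult.commute)
  then show ?thesis using c(1) by(simp only: mult_less_cancel_left_pos zero_less_power)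
 qed
 have v1: "1\<in>V"
  unfolding V_def
 proof(intro INT_I CollectI)
  fix a assume "a\<in>S"
  show "Re(e a 1)<0"
  proof(cases "a=i")
   case True
   then show ?thesis using nTi q nT[of 1 i] by simp
  next
   case False
   then show ?thesis using c by(simp add: e_def M_def)
  qed
 qed
 \<comment> \<open>On this neighbourhood of l = 1 in V the parameter t_i is already small, so the
   quotient is known to be constant there.\<close>
 define W where "W=V \<inter> {l. norm(T l i)<norm q}"
 have opW: "open W" unfolding W_def T_def e_def
  by(intro open_Int opV open_Collect_less continuous_intros)
 have "KK S N(T 0) \<nu>=KK S N(T 1) \<nu>"
 proof(rule analytic_continuation_open[of W V "%l. KK S N(T l) \<nu>" "%_. KK S N(T 1) \<nu>"])
  show "W~={}" using v1 nTi by(auto simp: W_def)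
  show "connected V" using convV by(rule convex_connected)
  show "(%l. KK S N(T l) \<nu>) holomorphic_on V"
   by(rule KK_holomorphic[OF opV _ balV])(auto simp: T_def e_def intro!: holomorphic_intros)
  show "KK S N(T l) \<nu>=KK S N(T 1) \<nu>" if "l\<in>W" for l
   using KK_eq_small[OF balV balV N i, of l 1] that v1 nTi by(simp add: W_def)
 qed(use opV opW v0 in \<open>auto simp: W_def\<close>)
 moreover have "KK S N(T 0) \<nu>=KK S N t \<nu>"
  by(rule KK_cong)(simp_all add: T0)
 ultimately show ?thesis using that[OF balV[OF v1] nTi] by simp
qed

lemma KK_constant:
 assumes "balanced S N 0 t \<nu>" "balanced S N 0 t' \<nu>'" "N > 0"
 shows "KK S N t \<nu>=KK S N t' \<nu>'"
proof -
 have "card S~=0" using assms(1) by(simp add: balanced_def)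
 then obtain i where i: "i\<in>S" by fastforce
 obtain s where "balanced S N 0 s \<nu>" "norm(s i)<norm q" "KK S N t \<nu>=KK S N s \<nu>"
  using KK_to_small[OF assms(1,3) i] .
 moreover obtain s' where "balanced S N 0 s' \<nu>'" "norm(s' i)<norm q" "KK S N t' \<nu>'=KK S N s' \<nu>'"
  using KK_to_small[OF assms(2,3) i] .
 ultimately show ?thesis using KK_eq_small[of S N s \<nu> s' \<nu>' i] assms(3) i by simp
qed

end

section \<open>Poisson kernel limits on the unit circle\<close>

lemma cmean_disc:
 assumes "f holomorphic_on cball 0 1"
 shows "cmean 1 f=f 0"
proof -
 have "((%u. f u/(u-0)) has_contour_integral 2 * of_real pi * \<i> * f 0)(circlepath 0 1)"
  by(rule Cauchy_integral_circlepath_simple[OF assms]) simp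
 then have "contour_integral(circlepath 0 1)(%z. f z/z)=2 * of_real pi * \<i> * f 0"
  by(simp add: contour_integral_unique)
 then show ?thesis using cmean_contour[of 1 f] by simp
qed

text \<open>The majorant is the real part of a complex function, so that for a holomorphic one the
  bound can be evaluated at the centre.\<close>

lemma cmean_norm_bound:
 assumes f: "continuous_on(sphere 0 1) f" and g: "continuous_on(sphere 0 1) g"
  and le: "\<And>z. norm z=1==>norm(f z)\<le>Re(g z)"
 shows "norm(cmean 1 f)\<le>Re(cmean 1 g)"
proof -
 let ?e = "%x. of_real 1 * exp(2 * of_real pi * \<i> * of_real x) :: complex"
 have fi: "(%x. f(?e x)) integrable_on {0..1}" and gi: "(%x. g(?e x)) integrable_on {0..1}"
  using cmean_integrable[of 1 f] cmean_integrable[of 1 g] f g by auto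
 have Re: "((%x. Re(g(?e x))) has_integral Re(cmean 1 g)) {0..1}"
  using has_integral_linear[OF integrable_integral[OF gi] bounded_linear_Re] by(simp add: cmean_def o_def)
 have "norm(integral {0..1} (%x. f(?e x)))\<le>integral {0..1} (%x. Re(g(?e x)))"
  by(rule integral_norm_bound_integral[OF fi])(use Re le in auto)
 then show ?thesis using Re by(simp add: cmean_def integral_unique)
qed

text \<open>On the unit circle \<open>pinch_kernel \<rho> z = \<bar>1 - \<rho>w\<bar>\<^sup>2\<close> with \<open>w = \<i>z\<close>; its reciprocal is a
  Poisson kernel concentrating at \<open>z = -\<i>\<close>.\<close>

definition pinch_kernel :: "real => complex => complex" where
 "pinch_kernel \<rho> z=(1 - of_real \<rho> *(\<i> * z))*(1 - of_real \<rho>/(\<i> * z))"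

context
 fixes \<rho> :: real
 assumes \<rho>: "0<\<rho>" "\<rho><1"
begin

text \<open>With w = i z on the circle, 1/w is the conjugate of w, so the two factors of the kernel
  are conjugate. The inequalities compare 1 - \<rho> and |1 - w| with |1 - \<rho> w|.\<close>

lemma pinch_dist:
 assumes "norm z=1"
 shows "norm(1 - of_real \<rho>/(\<i> * z))=norm(1 - of_real \<rho> *(\<i> * z))"
  "1-\<rho>\<le>norm(1 - of_real \<rho> *(\<i> * z))" "norm(1-\<i> * z)\<le>2 * norm(1 - of_real \<rho> *(\<i> * z))"
  "pinch_kernel \<rho> z = of_real((norm(1 - of_real \<rho> *(\<i> * z)))\<^sup>2)" "norm(1 - of_real \<rho> *(\<i> * z)) > 0"
proof -
 define w where "w=\<i> * z"
 have w: "norm w=1" using assms by(simp add: w_def norm_mult)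
 have "w * cnj w=1" using w by(simp add: complex_norm_square[symmetric])
 moreover have w0: "w~=0" using w by auto
 ultimately have inv: "1/w=cnj w" by(simp only: nonzero_divide_eq_eq[OF w0] mult.commute)
 have "of_real \<rho>/w = of_real \<rho> *(1/w)" by simp
 then have "of_real \<rho>/w = of_real \<rho> * cnj w" by(simp only: inv)
 then have c: "1 - of_real \<rho>/w=cnj(1 - of_real \<rho> * w)" by(simp only: complex_cnj_diff complex_cnj_mult complex_cnj_complex_of_real complex_cnj_one)
 show "norm(1 - of_real \<rho>/(\<i> * z))=norm(1 - of_real \<rho> *(\<i> * z))"
  unfolding w_def[symmetric] c complex_mod_cnj ..
 have "norm(1::complex)-norm(of_real \<rho> * w)\<le>norm(1 - of_real \<rho> * w)" by(rule norm_triangle_ineq2)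
 then show 1: "1-\<rho>\<le>norm(1 - of_real \<rho> *(\<i> * z))" using \<rho> w by(simp add: w_def[symmetric] norm_mult)
 have "1-w=(1 - of_real \<rho> * w) - of_real(1-\<rho>)* w" by(simp add: algebra_simps)
 then have "norm(1-w)\<le>norm(1 - of_real \<rho> * w)+norm(of_real(1-\<rho>)* w)" by(simp only: norm_triangle_ineq4)
 moreover have "norm(of_real(1-\<rho>)* w)=1-\<rho>" using w \<rho> unfolding norm_mult norm_of_real by simp
 ultimately show "norm(1-\<i> * z)\<le>2 * norm(1 - of_real \<rho> *(\<i> * z))"
  using 1 unfolding w_def[symmetric] by linarith
 show "pinch_kernel \<rho> z = of_real((norm(1 - of_real \<rho> *(\<i> * z)))\<^sup>2)"
  unfolding pinch_kernel_def w_def[symmetric] c by(rule complex_norm_square[symmetric])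
 show "norm(1 - of_real \<rho> *(\<i> * z)) > 0" using 1 \<rho> by linarith
qed

lemma pinch_nonzero: "norm z=1==>pinch_kernel \<rho> z~=0"
 using pinch_dist(4,5)[of z] by simp

lemma pinch_factor_nonzero: "norm z\<le>1==>1 - of_real \<rho> *(\<i> * z)~=0"
proof
 assume "norm z\<le>1" "1 - of_real \<rho> *(\<i> * z)=0"
 then have "1 = of_real \<rho> *(\<i> * z)" by(simp only: right_minus_eq)
 then have "norm(of_real \<rho> *(\<i> * z))=norm(1::complex)" by(simp only:)
 then show False using \<rho> \<open>norm z\<le>1\<close> mult_left_le[of "norm z" \<rho>] by(simp add: norm_mult)
qed

lemma pinch_continuous: "continuous_on(sphere 0 1)(%z. pinch_kernel \<rho> z)"
 unfolding pinch_kernel_def by(intro continuous_intros) auto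

text \<open>Partial fractions split the Poisson kernel into a holomorphic function of z and one of
  1/z, with central values 1 and 0.\<close>

lemma pinch_mean: "cmean 1(%z. of_real(1-\<rho>\<^sup>2)/pinch_kernel \<rho> z)=1"
proof -
 let ?f = "%z. 1/(1 - of_real \<rho> *(\<i> * z))" and ?g = "%z. (of_real \<rho> *(- \<i> * z))/(1 - of_real \<rho> *(- \<i> * z))"
 have neg: "1+\<i> *(of_real \<rho> * z)~=0" if "norm z\<le>1" for z
  using pinch_factor_nonzero[of "- z"] that by(simp add: mult_ac)
 have f: "?f holomorphic_on cball 0 1" by(intro holomorphic_intros)(use pinch_factor_nonzero in auto)
 have g: "?g holomorphic_on cball 0 1" by(intro holomorphic_intros)(use neg in \<open>auto simp: mult_ac\<close>)
 have sub: "sphere 0 1 \<subseteq> cball(0::complex) 1" by auto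
 note fc=continuous_on_subset[OF holomorphic_on_imp_continuous_on[OF f] sub]
  and gc=continuous_on_subset[OF holomorphic_on_imp_continuous_on[OF g] sub]
 have gc': "continuous_on(sphere 0 1)(%z. ?g(1/z))"
  by(rule continuous_on_compose2[OF gc])(auto intro!: continuous_intros simp: norm_divide)
 have "cmean 1(%z. of_real(1-\<rho>\<^sup>2)/pinch_kernel \<rho> z)=cmean 1(%z. ?f z + ?g(1/z))"
 proof(rule cmean_cong)
  fix z :: complex assume z: "norm z=1"
  define w where "w=\<i> * z"
  have w0: "w~=0" using z by(auto simp: w_def)
  have n1: "1 - of_real \<rho> * w~=0" using pinch_factor_nonzero[of z] z by(simp add: w_def)
  have n2: "1 - of_real \<rho>/w~=0" using pinch_dist(1,5)[OF z] by(auto simp: w_def)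
  have "- \<i> *(1/z)=1/w" by(simp add: w_def divide_inverse)
  then have "?g(1/z)=(of_real \<rho>/w)/(1 - of_real \<rho>/w)" by simp
  moreover have "of_real(1-\<rho>\<^sup>2)/((1 - of_real \<rho> * w)*(1 - of_real \<rho>/w))
   = 1/(1 - of_real \<rho> * w)+(of_real \<rho>/w)/(1 - of_real \<rho>/w)"
   using n1 n2 w0 by(simp add: divide_simps)(simp add: algebra_simps power2_eq_square)
  ultimately show "of_real(1-\<rho>\<^sup>2)/pinch_kernel \<rho> z = ?f z + ?g(1/z)"
   unfolding pinch_kernel_def w_def[symmetric] by simp
 qed simp
 also have "\<dots>=cmean 1 ?f+cmean 1(%z. ?g(1/z))" by(rule cmean_add[OF fc gc']) simp
 also have "cmean 1(%z. ?g(1/z))=cmean 1 ?g" using cmean_inverse[of 1 ?g] gc by simp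
 finally show ?thesis using cmean_disc[OF f] cmean_disc[OF g] by simp
qed

text \<open>\<open>(1 - \<rho>w)\<close> to the power \<open>-3/4\<close> is analytic with argument at most \<open>3\<pi>/8\<close>, so the mean of its modulus
  is controlled by its value at the origin.\<close>

lemma cmean_sqrt_kernel_bound:
 assumes f: "continuous_on(sphere 0 1) f" and C: "C \<ge> 0"
  and le: "\<And>z. norm z=1==>norm(f z)\<le>C *(sqrt(1-\<rho>)/norm(1 - of_real \<rho> *(\<i> * z)))"
 shows "norm(cmean 1 f)\<le>C/cos(3 * pi/8)*(1-\<rho>) powr(1/4)"
proof -
 have cp: "cos(3 * pi/8) > 0" by(rule cos_gt_zero_pi)(use pi_gt_zero in auto)
 define g where "g=(%z. of_real(C/cos(3 * pi/8)*(1-\<rho>) powr(1/4))* exp(- (3/4)* Ln(1 - of_real \<rho> *(\<i> * z))))"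
 have Re_pos: "Re(1 - of_real \<rho> *(\<i> * z)) > 0" if "norm z\<le>1" for z
 proof -
  have "\<bar>Re(of_real \<rho> *(\<i> * z))\<bar>\<le>norm(of_real \<rho> *(\<i> * z))" by(rule abs_Re_le_cmod)
  also have "\<dots>=\<rho> * norm z" using \<rho> by(simp add: norm_mult)
  also have "\<dots>\<le>\<rho>" using that \<rho> by(simp add: mult_left_le)
  finally show ?thesis using \<rho> by simp
 qed
 have nn: "1 - of_real \<rho> *(\<i> * z) \<notin> \<real>\<^sub>\<le>\<^sub>0" if "norm z\<le>1" for z
  using Re_pos[OF that] by(auto simp: complex_nonpos_Reals_iff)
 have g: "g holomorphic_on cball 0 1"
  unfolding g_def by(intro holomorphic_intros)(use nn in auto)
 have gc: "continuous_on(sphere 0 1) g"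
  by(rule continuous_on_subset[OF holomorphic_on_imp_continuous_on[OF g]]) auto
 have "norm(cmean 1 f)\<le>Re(cmean 1 g)"
 proof(rule cmean_norm_bound[OF f gc])
  fix z :: complex assume z: "norm z=1"
  define u where "u=1 - of_real \<rho> *(\<i> * z)"
  have u0: "u~=0" "norm u > 0" using pinch_dist(5)[OF z] by(auto simp: u_def)
  have d: "1-\<rho>\<le>norm u" using pinch_dist(2)[OF z] by(simp add: u_def)
  have "\<bar>Im(Ln u)\<bar><pi/2" using Re_pos[of z] z Re_Ln_pos_lt[OF u0(1)] by(simp add: u_def)
  then have "\<bar>3/4 * Im(Ln u)\<bar>\<le>3 * pi/8" by(simp add: abs_mult)
  then have c: "cos(3 * pi/8)\<le>cos(3/4 * Im(Ln u))"
   using cos_monotone_0_pi_le[of "\<bar>3/4 * Im(Ln u)\<bar>" "3 * pi/8"] by(simp only: cos_abs_real)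
  have "Re(exp(- (3/4)* Ln u))=norm u powr(- 3/4)* cos(3/4 * Im(Ln u))"
   using u0 by(simp add: Re_exp powr_def)
  then have R: "norm u powr(- 3/4)* cos(3 * pi/8)\<le>Re(exp(- (3/4)* Ln u))"
   using c by(simp add: mult_left_mono)
  \<comment> \<open>One half of the square root, (1 - \<rho>)^(1/4), is traded for |u|^(1/4). This
    leaves the harmless power -3/4 of |u| and a factor tending to 0.\<close>
  have "sqrt(1-\<rho>)/norm u\<le>(1-\<rho>) powr(1/4)* norm u powr(- 3/4)"
  proof -
   have "sqrt(1-\<rho>)=(1-\<rho>) powr(1/4)*(1-\<rho>) powr(1/4)"
    using \<rho> by(simp add: powr_add[symmetric] powr_half_sqrt)
   also have "\<dots>\<le>(1-\<rho>) powr(1/4)* norm u powr(1/4)"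
    using d \<rho> by(intro mult_left_mono powr_mono2) auto
   finally have "sqrt(1-\<rho>)/norm u\<le>(1-\<rho>) powr(1/4)* norm u powr(1/4)/norm u"
    using u0 by(simp add: divide_right_mono)
   also have "\<dots>=(1-\<rho>) powr(1/4)* norm u powr(1/4-1)"
    by(simp only: powr_diff powr_one[OF less_imp_le[OF u0(2)]] times_divide_eq_right)
   finally show ?thesis by simp
  qed
  then have "norm(f z)\<le>C *((1-\<rho>) powr(1/4)* norm u powr(- 3/4))"
   by(intro order_trans[OF le[OF z, folded u_def]] mult_left_mono C)
  also have "\<dots>=C/cos(3 * pi/8)*(1-\<rho>) powr(1/4)*(norm u powr(- 3/4)* cos(3 * pi/8))"
   using cp by simp
  also have "\<dots>\<le>C/cos(3 * pi/8)*(1-\<rho>) powr(1/4)* Re(exp(- (3/4)* Ln u))"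
   using R C cp by(intro mult_left_mono) auto
  also have "\<dots>=Re(g z)" unfolding g_def u_def[symmetric] by(simp only: times_complex.sel Re_complex_of_real Im_complex_of_real mult_zero_left diff_zero)
  finally show "norm(f z)\<le>Re(g z)" .
 qed
 also have "cmean 1 g=g 0" by(rule cmean_disc[OF g])
 also have "Re(g 0)=C/cos(3 * pi/8)*(1-\<rho>) powr(1/4)" by(simp add: g_def)
 finally show ?thesis .
qed

end

lemma tendsto_quarter_power: "((%\<rho>::real. K *(1-\<rho>) powr(1/4))\<longlongrightarrow>0)(at_left 1)"
proof -
 have "((%\<rho>::real. (1-\<rho>) powr(1/4))\<longlongrightarrow>(1-1) powr(1/4))(at_left 1)"
 proof(rule tendsto_powr')
  show "((%\<rho>::real. 1-\<rho>)\<longlongrightarrow>1-1)(at_left 1)" by(intro tendsto_intros)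
 qed(auto simp: eventually_at_filter)
 then show ?thesis using tendsto_mult_left[of _ 0 _ K] by simp
qed

context
 fixes \<phi> :: "real => complex => complex" and \<rho>\<^sub>0 :: real
 assumes r0: "0<\<rho>\<^sub>0" "\<rho>\<^sub>0<1" and cont: "continuous_on({\<rho>\<^sub>0..1} \<times> sphere 0 1)(%(\<rho>, z). \<phi> \<rho> z)"
begin

lemma pinch_slice: "\<rho>\<^sub>0\<le>\<rho>==>\<rho>\<le>1==>continuous_on(sphere 0 1)(\<phi> \<rho>)"
proof -
 assume "\<rho>\<^sub>0\<le>\<rho>" "\<rho>\<le>1"
 then have "continuous_on(sphere 0 1)(%z. (%(\<rho>, z). \<phi> \<rho> z)(\<rho>, z))"
  by(intro continuous_on_compose2[OF cont])(auto intro!: continuous_intros)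
 then show ?thesis by simp
qed

lemma pinch_bounded: obtains C where "C \<ge> 0" "\<And>\<rho> z. \<rho>\<^sub>0\<le>\<rho>==>\<rho>\<le>1==>norm z=1==>norm(\<phi> \<rho> z)\<le>C"
proof -
 have "compact((%(\<rho>, z). \<phi> \<rho> z) ` ({\<rho>\<^sub>0..1} \<times> sphere 0 1))"
  by(intro compact_continuous_image cont compact_Times) auto
 then obtain C where "\<And>x. x\<in>(%(\<rho>, z). \<phi> \<rho> z) ` ({\<rho>\<^sub>0..1} \<times> sphere 0 1)==>norm x\<le>C"
  using compact_imp_bounded bounded_iff by metis
 then show ?thesis by(intro that[of "\<bar>C\<bar>"]) force+
qed

lemma eventually_pinch: "eventually(%\<rho>. \<rho>\<^sub>0\<le>\<rho>\<and>\<rho><1)(at_left 1)"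
 using eventually_at_left_real[OF r0(2)] by eventually_elim auto

lemma pinch_limit_simple: "((%\<rho>. cmean 1(\<phi> \<rho>))\<longlongrightarrow>cmean 1(\<phi> 1))(at_left 1)"
proof -
 have "continuous_on {\<rho>\<^sub>0..1} (%\<rho>. cmean 1(\<phi> \<rho>))"
  by(rule cmean_continuous_param[OF cont]) simp
 then have "((%\<rho>. cmean 1(\<phi> \<rho>))\<longlongrightarrow>cmean 1(\<phi> 1))(at 1 within {\<rho>\<^sub>0..1})"
  using r0 by(simp add: continuous_on_def)
 then show ?thesis using r0 by(simp add: at_within_Icc_at_left)
qed

text \<open>Concentration at z = -i. The oscillation of \<phi> is bounded by e/2 plus a multiple of
  |1 - w|^2, and the kernel turns the second term into a multiple of 1 - \<rho>^2.\<close>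

lemma pinch_limit_pole:
 "((%\<rho>. of_real(1-\<rho>\<^sup>2)* cmean 1(%z. \<phi> \<rho> z/pinch_kernel \<rho> z))\<longlongrightarrow>\<phi> 1(- \<i>))(at_left 1)"
proof(rule tendstoI)
 fix e :: real assume e: "e > 0"
 obtain C where C: "C \<ge> 0" "\<And>\<rho> z. \<rho>\<^sub>0\<le>\<rho>==>\<rho>\<le>1==>norm z=1==>norm(\<phi> \<rho> z)\<le>C"
  by(rule pinch_bounded)(rule that)
 let ?A = "{\<rho>\<^sub>0..1} \<times> sphere 0 1" and ?\<phi> = "%(\<rho>, z). \<phi> \<rho> z"
 have "(1, - \<i>) \<in> ?A" using r0 by simp
 from mp[OF spec[OF bspec[OF cont[unfolded continuous_on_iff] this]] half_gt_zero[OF e]]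
 obtain d where d0: "d > 0" and dd: "\<forall>x\<in>?A. dist x(1, - \<i>)<d \<longrightarrow> dist(?\<phi> x)(?\<phi> (1, - \<i>))<e/2"
  by(elim exE conjE)(rule that)
 have d: "d > 0" "\<And>\<rho> z. \<rho>\<^sub>0\<le>\<rho>==>\<rho>\<le>1==>norm z=1==>dist(\<rho>, z)(1, - \<i>)<d==>dist(\<phi> \<rho> z)(\<phi> 1(- \<i>))<e/2"
  using d0 bspec[OF dd, of "(_, _)"] by auto
 \<comment> \<open>For |1 - w| \<ge> d/2 this makes M |1 - w|^2 at least 2 C, so the trivial bound
   on \<phi> is covered too.\<close>
 define M where "M=2 * C/(d/2)\<^sup>2"
 have M0: "M \<ge> 0" using C by(simp add: M_def)
 have near: "norm(\<phi> \<rho> z-\<phi> 1(- \<i>))\<le>e/2+M *(norm(1-\<i> * z))\<^sup>2"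
  if \<rho>: "\<rho>\<^sub>0\<le>\<rho>" "\<rho>\<le>1" "1-d/2<\<rho>" and z: "norm z=1" for \<rho> z
 proof(cases "norm(1-\<i> * z)<d/2")
  case True
  have "1-\<i> * z = - \<i> *(z-(- \<i>))" by(simp add: algebra_simps)
  then have "norm(1-\<i> * z)=dist z(- \<i>)" by(simp add: dist_norm norm_mult)
  moreover have "dist(\<rho>, z)(1, - \<i>)\<le>dist \<rho> 1+dist z(- \<i>)"
   unfolding dist_prod_def by(simp add: sqrt_sum_squares_le_sum)
  moreover have "dist \<rho> 1<d/2" using \<rho> by(simp add: dist_real_def)
  ultimately have "dist(\<rho>, z)(1, - \<i>)<d" using True by simp
  then have "norm(\<phi> \<rho> z-\<phi> 1(- \<i>))<e/2" using d(2)[OF \<rho>(1,2) z] by(simp add: dist_norm)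
  moreover have "0\<le>M *(norm(1-\<i> * z))\<^sup>2" using M0 by simp
  ultimately show ?thesis by linarith
 next
  case False
  then have "(d/2)\<^sup>2\<le>(norm(1-\<i> * z))\<^sup>2" using d(1) by(intro power_mono) auto
  then have "M *(d/2)\<^sup>2\<le>M *(norm(1-\<i> * z))\<^sup>2" using M0 by(rule mult_left_mono)
  moreover have "M *(d/2)\<^sup>2=2 * C" using d(1) by(simp add: M_def)
  moreover have "norm(\<phi> \<rho> z-\<phi> 1(- \<i>))\<le>norm(\<phi> \<rho> z)+norm(\<phi> 1(- \<i>))" by(rule norm_triangle_ineq4)
  moreover have "norm(\<phi> \<rho> z)\<le>C" "norm(\<phi> 1(- \<i>))\<le>C" using C(2) \<rho> z r0 by auto
  ultimately show ?thesis using e by linarith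
 qed
 have bound: "norm(of_real(1-\<rho>\<^sup>2)* cmean 1(%z. \<phi> \<rho> z/pinch_kernel \<rho> z)-\<phi> 1(- \<i>))\<le>e/2+4 * M *(1-\<rho>\<^sup>2)"
  if \<rho>: "\<rho>\<^sub>0\<le>\<rho>" "\<rho><1" "1-d/2<\<rho>" for \<rho>
 proof -
  have \<rho>01: "0<\<rho>" "\<rho><1" using \<rho> r0 by auto
  have s: "1-\<rho>\<^sup>2 \<ge> 0" using \<rho>01 by(simp add: power_le_one)
  note kc=pinch_continuous[OF \<rho>01] and kn=pinch_nonzero[OF \<rho>01]
  define P where "P=(%z. of_real(1-\<rho>\<^sup>2)/pinch_kernel \<rho> z)"
  have Pc: "continuous_on(sphere 0 1) P" unfolding P_def by(intro continuous_intros kc)(use kn in auto)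
  have pc: "continuous_on(sphere 0 1)(\<phi> \<rho>)" by(rule pinch_slice)(use \<rho> in auto)
  have "of_real(1-\<rho>\<^sup>2)* cmean 1(%z. \<phi> \<rho> z/pinch_kernel \<rho> z)-\<phi> 1(- \<i>)
    = cmean 1(%z. P z * \<phi> \<rho> z)+cmean 1(%z. - \<phi> 1(- \<i>)* P z)"
  proof -
   have "of_real(1-\<rho>\<^sup>2)* cmean 1(%z. \<phi> \<rho> z/pinch_kernel \<rho> z)=cmean 1(%z. P z * \<phi> \<rho> z)"
    unfolding cmean_cmult[symmetric] P_def by(simp only: times_divide_eq_left times_divide_eq_right)
   moreover have "cmean 1(%z. - \<phi> 1(- \<i>)* P z) = - \<phi> 1(- \<i>)* 1"
    unfolding cmean_cmult P_def pinch_mean[OF \<rho>01] ..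
   ultimately show ?thesis by simp
  qed
  also have "\<dots>=cmean 1(%z. P z * \<phi> \<rho> z + - \<phi> 1(- \<i>)* P z)"
   by(rule cmean_add[symmetric])(auto intro!: continuous_intros Pc pc)
  finally have eq: "of_real(1-\<rho>\<^sup>2)* cmean 1(%z. \<phi> \<rho> z/pinch_kernel \<rho> z)-\<phi> 1(- \<i>)
    = cmean 1(%z. P z * \<phi> \<rho> z + - \<phi> 1(- \<i>)* P z)" .
  let ?g = "%z. of_real(e/2)* P z + of_real(4 * M *(1-\<rho>\<^sup>2))"
  have "norm(cmean 1(%z. P z * \<phi> \<rho> z + - \<phi> 1(- \<i>)* P z))\<le>Re(cmean 1 ?g)"
  proof(rule cmean_norm_bound)
   fix z :: complex assume z: "norm z=1"
   define D where "D=norm(1 - of_real \<rho> *(\<i> * z))"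
   have D: "D > 0" "norm(1-\<i> * z)\<le>2 * D" using pinch_dist[OF \<rho>01 z] by(auto simp: D_def)
   have P: "P z = of_real((1-\<rho>\<^sup>2)/D\<^sup>2)" unfolding P_def pinch_dist(4)[OF \<rho>01 z] D_def by simp
   have "P z * \<phi> \<rho> z + - \<phi> 1(- \<i>)* P z=P z *(\<phi> \<rho> z-\<phi> 1(- \<i>))" by(simp add: algebra_simps)
   then have "norm(P z * \<phi> \<rho> z + - \<phi> 1(- \<i>)* P z)=(1-\<rho>\<^sup>2)/D\<^sup>2 * norm(\<phi> \<rho> z-\<phi> 1(- \<i>))"
   proof -
    assume eq: "P z * \<phi> \<rho> z + - \<phi> 1(- \<i>)* P z=P z *(\<phi> \<rho> z-\<phi> 1(- \<i>))"
    have "norm(P z)=(1-\<rho>\<^sup>2)/D\<^sup>2" unfolding P norm_of_real using s by simp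
    then show ?thesis unfolding eq norm_mult by(simp only:)
   qed
   also have "\<dots>\<le>(1-\<rho>\<^sup>2)/D\<^sup>2 *(e/2+M *(norm(1-\<i> * z))\<^sup>2)"
    using near[OF _ _ \<rho>(3) z] \<rho> s by(intro mult_left_mono) auto
   also have "\<dots>\<le>(1-\<rho>\<^sup>2)/D\<^sup>2 *(e/2+M *(2 * D)\<^sup>2)"
    using s M0 D by(intro mult_left_mono add_left_mono power_mono) auto
   also have "\<dots>=e/2 *((1-\<rho>\<^sup>2)/D\<^sup>2)+4 * M *(1-\<rho>\<^sup>2)"
    using D(1) by(simp add: field_simps power2_eq_square)
   also have "\<dots>=Re(?g z)" unfolding P by simp
   finally show "norm(P z * \<phi> \<rho> z + - \<phi> 1(- \<i>)* P z)\<le>Re(?g z)" .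
  qed(auto intro!: continuous_intros Pc pc)
  also have "cmean 1 ?g = of_real(e/2)* cmean 1 P + of_real(4 * M *(1-\<rho>\<^sup>2))"
  proof -
   have "cmean 1 ?g=cmean 1(%z. of_real(e/2)* P z)+cmean 1(%z. of_real(4 * M *(1-\<rho>\<^sup>2)))"
    by(rule cmean_add)(auto intro!: continuous_intros Pc)
   also have "cmean 1(%z. of_real(4 * M *(1-\<rho>\<^sup>2))) = of_real(4 * M *(1-\<rho>\<^sup>2))"
    by(simp add: cmean_def)
   finally show ?thesis unfolding cmean_cmult .
  qed
  also have "cmean 1 P=1" unfolding P_def by(rule pinch_mean[OF \<rho>01])
  finally show ?thesis unfolding eq by simp
 qed
 have lim: "((%\<rho>. e/2+4 * M *(1-\<rho>\<^sup>2))\<longlongrightarrow>e/2+4 * M *(1-1\<^sup>2))(at_left(1::real))"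
  by(intro tendsto_intros)
 have "eventually(%\<rho>. e/2+4 * M *(1-\<rho>\<^sup>2)<e)(at_left(1::real))"
  by(rule order_tendstoD(2)[OF lim])(use e in simp)
 moreover have "eventually(%\<rho>. \<rho>\<in>{1-d/2<..<1})(at_left(1::real))"
  by(rule eventually_at_left_real)(use d in simp)
 ultimately show "eventually(%\<rho>. dist(of_real(1-\<rho>\<^sup>2)* cmean 1(%z. \<phi> \<rho> z/pinch_kernel \<rho> z))(\<phi> 1(- \<i>))<e)(at_left 1)"
  using eventually_pinch
 proof eventually_elim
  case(elim \<rho>)
  then show ?case using bound[of \<rho>] by(auto simp: dist_norm)
 qed
qed

text \<open>A simple zero cancels one of the two factors of the kernel; what remains grows more
  slowly than (1 - \<rho>)^(-1/2).\<close>

lemma pinch_limit_simple_zero: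
 "((%\<rho>. of_real(sqrt(1-\<rho>\<^sup>2))* cmean 1(%z. (1-\<i> * z)* \<phi> \<rho> z/pinch_kernel \<rho> z))\<longlongrightarrow>0)(at_left 1)"
proof -
 obtain C where C: "C \<ge> 0" "\<And>\<rho> z. \<rho>\<^sub>0\<le>\<rho>==>\<rho>\<le>1==>norm z=1==>norm(\<phi> \<rho> z)\<le>C"
  by(rule pinch_bounded)(rule that)
 show ?thesis
 proof(rule Lim_null_comparison[OF _ tendsto_quarter_power[of "4 * C/cos(3 * pi/8)"]])
  show "eventually(%\<rho>. norm(of_real(sqrt(1-\<rho>\<^sup>2))* cmean 1(%z. (1-\<i> * z)* \<phi> \<rho> z/pinch_kernel \<rho> z))
    \<le> 4 * C/cos(3 * pi/8)*(1-\<rho>) powr(1/4))(at_left 1)"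
   using eventually_pinch
  proof eventually_elim
   case(elim \<rho>)
   then have \<rho>01: "0<\<rho>" "\<rho><1" using r0 by auto
   have pc: "continuous_on(sphere 0 1)(\<phi> \<rho>)" by(rule pinch_slice)(use elim in auto)
   show ?case unfolding cmean_cmult[symmetric]
   proof(rule cmean_sqrt_kernel_bound[OF \<rho>01])
    show "continuous_on(sphere 0 1)(%z. of_real(sqrt(1-\<rho>\<^sup>2))*((1-\<i> * z)* \<phi> \<rho> z/pinch_kernel \<rho> z))"
     by(intro continuous_intros pc pinch_continuous[OF \<rho>01])(use pinch_nonzero[OF \<rho>01] in auto)
    show "0\<le>4 * C" using C by simp
    fix z :: complex assume z: "norm z=1"
    define D where "D=norm(1 - of_real \<rho> *(\<i> * z))"
    have D: "D > 0" "norm(1-\<i> * z)\<le>2 * D" using pinch_dist[OF \<rho>01 z] by(auto simp: D_def)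
    have s: "sqrt(1-\<rho>\<^sup>2)\<le>2 * sqrt(1-\<rho>)"
    proof -
     have "1-\<rho>\<^sup>2=(1-\<rho>)*(1+\<rho>)" by(simp add: power2_eq_square algebra_simps)
     also have "\<dots>\<le>(1-\<rho>)* 4" using \<rho>01 by(intro mult_left_mono) auto
     finally have "sqrt(1-\<rho>\<^sup>2)\<le>sqrt((1-\<rho>)* 4)" by(rule real_sqrt_le_mono)
     then show ?thesis by(simp only: real_sqrt_mult real_sqrt_four mult.commute)
    qed
    have s0: "0\<le>1-\<rho>\<^sup>2" using \<rho>01 by(simp add: power_le_one)
    have "norm(of_real(sqrt(1-\<rho>\<^sup>2))*((1-\<i> * z)* \<phi> \<rho> z/pinch_kernel \<rho> z))
     = sqrt(1-\<rho>\<^sup>2)*(norm(1-\<i> * z)* norm(\<phi> \<rho> z)/D\<^sup>2)"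
     unfolding pinch_dist(4)[OF \<rho>01 z] D_def[symmetric] norm_mult norm_divide norm_of_real using s0 by simp
    also have "\<dots>\<le>(2 * sqrt(1-\<rho>))*((2 * D)* C/D\<^sup>2)"
     using s D C(2)[of \<rho> z] C(1) z elim \<rho>01 by(intro mult_mono divide_right_mono) auto
    also have "\<dots>=4 * C *(sqrt(1-\<rho>)/D)" using D by(simp add: power2_eq_square field_simps)
    finally show "norm(of_real(sqrt(1-\<rho>\<^sup>2))*((1-\<i> * z)* \<phi> \<rho> z/pinch_kernel \<rho> z))\<le>4 * C *(sqrt(1-\<rho>)/norm(1 - of_real \<rho> *(\<i> * z)))"
     by(simp add: D_def)
   qed
  qed
 qed
qed

text \<open>At \<rho> = 1 the quotient (1 - w)^2/((1 - w)(1 - 1/w)) is -w, so the singularity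
  disappears. For \<rho> < 1 the error is governed by (1 - \<rho>)/|1 - \<rho> w|, which is small in
  the mean.\<close>

lemma pinch_limit_double_zero:
 "((%\<rho>. cmean 1(%z. (1-\<i> * z)\<^sup>2 * \<phi> \<rho> z/pinch_kernel \<rho> z))\<longlongrightarrow>cmean 1(%z. - (\<i> * z)* \<phi> 1 z))(at_left 1)"
proof -
 obtain C where C: "C \<ge> 0" "\<And>\<rho> z. \<rho>\<^sub>0\<le>\<rho>==>\<rho>\<le>1==>norm z=1==>norm(\<phi> \<rho> z)\<le>C"
  by(rule pinch_bounded)(rule that)
 have cont2: "continuous_on({\<rho>\<^sub>0..1} \<times> sphere 0 1)(%(\<rho>, z). - (\<i> * z)* \<phi> \<rho> z)"
  using cont unfolding case_prod_unfold by(intro continuous_intros)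
 have L: "((%\<rho>. cmean 1(%z. - (\<i> * z)* \<phi> \<rho> z))\<longlongrightarrow>cmean 1(%z. - (\<i> * z)* \<phi> 1 z))(at_left 1)"
 proof -
  have "continuous_on {\<rho>\<^sub>0..1} (%\<rho>. cmean 1(%z. - (\<i> * z)* \<phi> \<rho> z))"
   by(rule cmean_continuous_param[OF cont2]) simp
  then show ?thesis using r0 by(auto simp: continuous_on_def at_within_Icc_at_left dest!: bspec[of _ _ 1])
 qed
 have "((%\<rho>. cmean 1(%z. (1-\<i> * z)\<^sup>2 * \<phi> \<rho> z/pinch_kernel \<rho> z)-cmean 1(%z. - (\<i> * z)* \<phi> \<rho> z))\<longlongrightarrow>0)(at_left 1)"
 proof(rule Lim_null_comparison[OF _ tendsto_quarter_power[of "3 * C/cos(3 * pi/8)"]])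
  show "eventually(%\<rho>. norm(cmean 1(%z. (1-\<i> * z)\<^sup>2 * \<phi> \<rho> z/pinch_kernel \<rho> z)-cmean 1(%z. - (\<i> * z)* \<phi> \<rho> z))
    \<le> 3 * C/cos(3 * pi/8)*(1-\<rho>) powr(1/4))(at_left 1)"
   using eventually_pinch
  proof eventually_elim
   case(elim \<rho>)
   then have \<rho>01: "0<\<rho>" "\<rho><1" using r0 by auto
   have pc: "continuous_on(sphere 0 1)(\<phi> \<rho>)" by(rule pinch_slice)(use elim in auto)
   have c1: "continuous_on(sphere 0 1)(%z. (1-\<i> * z)\<^sup>2 * \<phi> \<rho> z/pinch_kernel \<rho> z)"
    by(intro continuous_intros pc pinch_continuous[OF \<rho>01])(use pinch_nonzero[OF \<rho>01] in auto)
   have c2: "continuous_on(sphere 0 1)(%z. \<i> * z * \<phi> \<rho> z)" by(intro continuous_intros pc)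
   have "cmean 1(%z. (1-\<i> * z)\<^sup>2 * \<phi> \<rho> z/pinch_kernel \<rho> z)-cmean 1(%z. - (\<i> * z)* \<phi> \<rho> z)
    = cmean 1(%z. (1-\<i> * z)\<^sup>2 * \<phi> \<rho> z/pinch_kernel \<rho> z+\<i> * z * \<phi> \<rho> z)"
    unfolding cmean_add[OF c1 c2 zero_le_one] using cmean_minus[of 1 "%z. \<i> * z * \<phi> \<rho> z"] by simp
   also have "norm \<dots>\<le>3 * C/cos(3 * pi/8)*(1-\<rho>) powr(1/4)"
   proof(rule cmean_sqrt_kernel_bound[OF \<rho>01])
    show "continuous_on(sphere 0 1)(%z. (1-\<i> * z)\<^sup>2 * \<phi> \<rho> z/pinch_kernel \<rho> z+\<i> * z * \<phi> \<rho> z)"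
     by(rule continuous_on_add[OF c1 c2])
    show "0\<le>3 * C" using C by simp
    fix z :: complex assume z: "norm z=1"
    define w where "w=\<i> * z"
    define a where "a=1 - of_real \<rho> * w"
    define b where "b=1 - of_real \<rho>/w"
    define e1 where "e1 = of_real(1-\<rho>)* w/a"
    define e2 where "e2 = of_real(1-\<rho>)*(1/w)/b"
    have w: "norm w=1" "w~=0" using z by(auto simp: w_def norm_mult)
    have ab: "norm b=norm a" "1-\<rho>\<le>norm a" "norm a > 0"
     using pinch_dist[OF \<rho>01 z] by(auto simp: a_def b_def w_def)
    then have ab0: "a~=0" "b~=0" by auto
    have "a * e1 = of_real(1-\<rho>)* w" "b * e2 = of_real(1-\<rho>)*(1/w)"
     using ab0 by(simp_all add: e1_def e2_def)
    then have "a *(1-e1)=1-w" "b *(1-e2)=1-1/w"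
     by(simp_all add: a_def b_def right_diff_distrib left_diff_distrib diff_divide_distrib)
    moreover have "(1-w)\<^sup>2 = - w *((1-w)*(1-1/w))" using w by(simp add: field_simps power2_eq_square)
    ultimately have "(1-w)\<^sup>2 = - w *((a *(1-e1))*(b *(1-e2)))" by simp
    then have "(1-w)\<^sup>2=(a * b)*(- w *((1-e1)*(1-e2)))" by(simp only: mult_ac)
    then have "(1-w)\<^sup>2/(a * b) = - w *((1-e1)*(1-e2))" using ab0 by simp
    then have X: "(1-w)\<^sup>2/(a * b) = - w *((1-e1)*(1-e2))" .
    have "(1-w)\<^sup>2 * \<phi> \<rho> z/(a * b)+w * \<phi> \<rho> z=(1-w)\<^sup>2/(a * b)* \<phi> \<rho> z+w * \<phi> \<rho> z"
     by(simp only: times_divide_eq_left)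
    also have "\<dots>=w * \<phi> \<rho> z *(e1+e2-e1 * e2)" unfolding X by(simp add: algebra_simps)
    finally have eq: "(1-\<i> * z)\<^sup>2 * \<phi> \<rho> z/pinch_kernel \<rho> z+\<i> * z * \<phi> \<rho> z=w * \<phi> \<rho> z *(e1+e2-e1 * e2)"
     unfolding pinch_kernel_def w_def[symmetric] a_def[symmetric] b_def[symmetric] .
    define x where "x=(1-\<rho>)/norm a"
    have x: "norm e1=x" "norm e2=x" "0\<le>x" "x\<le>1"
     using ab w \<rho>01 by(auto simp: e1_def e2_def x_def norm_divide norm_mult simp del: of_real_diff)
    have "norm(e1+e2-e1 * e2)\<le>norm(e1+e2)+norm(e1 * e2)" by(rule norm_triangle_ineq4)
    also have "\<dots>\<le>norm e1+norm e2+norm(e1 * e2)" by(intro add_right_mono norm_triangle_ineq)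
    also have "\<dots>\<le>3 * x" using x mult_left_le[of x x] by(simp add: norm_mult)
    also have "\<dots>\<le>3 *(sqrt(1-\<rho>)/norm a)"
    proof -
     have "(1-\<rho>)=sqrt(1-\<rho>)* sqrt(1-\<rho>)" using \<rho>01 by simp
     also have "\<dots>\<le>sqrt(1-\<rho>)* 1" using \<rho>01 by(intro mult_left_mono) auto
     finally show ?thesis using ab(3) by(simp add: x_def divide_right_mono)
    qed
    finally have "norm(w * \<phi> \<rho> z *(e1+e2-e1 * e2))\<le>C *(3 *(sqrt(1-\<rho>)/norm a))"
     unfolding norm_mult w mult_1 using C(2)[of \<rho> z] C(1) elim z by(intro mult_mono) auto
    then show "norm((1-\<i> * z)\<^sup>2 * \<phi> \<rho> z/pinch_kernel \<rho> z+\<i> * z * \<phi> \<rho> z)\<le>3 * C *(sqrt(1-\<rho>)/norm(1 - of_real \<rho> *(\<i> * z)))"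
     unfolding eq by(simp add: a_def w_def mult_ac)
   qed
   finally show ?case .
  qed
 qed
 from tendsto_add[OF this L] show ?thesis by simp
qed

end

text \<open>Both functions are continuous along the circle, so agreement off one point suffices;
  this permits division by 1 - w at the pinch point.\<close>

lemma cmean_cong_except:
 assumes f: "continuous_on(sphere 0 1) f" and g: "continuous_on(sphere 0 1) g"
  and eq: "\<And>z. norm z=1==>z~=a==>f z=g z"
 shows "cmean 1 f=cmean 1 g"
proof(rule cmean_cong)
 fix z :: complex assume z: "norm z=1"
 show "f z=g z"
 proof(cases "z=a")
  case True
  have c: "continuous_on UNIV(%x. k(z * cis x))" if "continuous_on(sphere 0 1) k" for k :: "complex => complex"
   by(rule continuous_on_compose2[OF that])(auto intro!: continuous_intros simp: z norm_mult)
  have lim: "((%x. k(z * cis x))\<longlongrightarrow>k z)(at_right 0)" if "continuous_on(sphere 0 1) k" for k :: "complex => complex"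
  proof -
   have "isCont(%x. k(z * cis x)) 0" using c[OF that] by(simp add: continuous_on_eq_continuous_at)
   then show ?thesis by(simp add: isCont_def filterlim_at_split)
  qed
  have "eventually(%x. x\<in>{0<..<1})(at_right(0::real))" by(rule eventually_at_right_real) simp
  then have "eventually(%x. f(z * cis x)=g(z * cis x))(at_right 0)"
  proof eventually_elim
   case(elim x)
   then have "sin x > 0" using pi_gt3 by(intro sin_gt_zero) auto
   then have "cis x~=1" by(auto simp: complex_eq_iff)
   then have "z * cis x~=a" using True z by auto
   then show ?case using z by(intro eq)(auto simp: norm_mult)
  qed
  then have "((%x. f(z * cis x))\<longlongrightarrow>g z)(at_right 0)" using lim[OF g] by(simp add: tendsto_cong)
  then show ?thesis using tendsto_unique[OF _ lim[OF f]] by(simp add: trivial_limit_at_right_real)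
 qed(use eq z in auto)
qed simp

section \<open>Separation of the pinching poles\<close>

context rarefied
begin

abbreviation regdom :: "complex set" where
 "regdom \<equiv> {z. z~=0\<and>norm z * mx<1}"

text \<open>The mirror image of the kernel under z -> 1/z, whose reciprocal concentrates at z = i.
  Since both kernels add up to a constant, they act as a partition of unity.\<close>

definition pinch_dual :: "real => complex => complex" where
 "pinch_dual \<rho> z=(1 - - \<i> * of_real \<rho> * z)*(1-\<i> * of_real \<rho>/z)"

lemma pinch_kernel_altdef: "z~=0==>pinch_kernel \<rho> z=(1 - - \<i> * of_real \<rho>/z)*(1-\<i> * of_real \<rho> * z)"
 by(simp add: pinch_kernel_def divide_inverse mult_ac)

lemma pinch_sum: "z~=0==>pinch_kernel \<rho> z+pinch_dual \<rho> z = of_real(2 *(1+\<rho>\<^sup>2))"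
 unfolding pinch_dual_def by(simp add: pinch_kernel_altdef field_simps power2_eq_square)

lemma pinch_kernel_inverse: "z~=0==>pinch_kernel \<rho> (1/z)=pinch_dual \<rho> z"
 unfolding pinch_dual_def by(simp add: pinch_kernel_altdef)

text \<open>The two pairs of pinching poles are exchanged by the symmetry \<open>z \<mapsto> 1/z\<close> of the integrand, so it
  suffices to treat one of them.\<close>

lemma pairing_pinch:
 assumes bal: "balanced S N 0 t \<nu>"
  and f: "odd_theta(p^r) N(%x. F x * jtheta(x\<^sup>2)(p^r))" (is "odd_theta _ _ ?f")
  and g: "odd_theta(q^r) N(%x. H x * jtheta(x\<^sup>2)(q^r))" (is "odd_theta _ _ ?g")
 shows "of_real(1+\<rho>\<^sup>2)* pairing S N t \<nu> F H
  = (\<Sum>m\<in>{0..<int r}. cmean 1(%z. core S N 0 t \<nu> ?f ?g z m * pinch_dual \<rho> z))"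
proof -
 have kc: "continuous_on(sphere 0 1)(pinch_kernel \<rho>)" and dc: "continuous_on(sphere 0 1)(pinch_dual \<rho>)"
  unfolding pinch_kernel_def[abs_def] pinch_dual_def[abs_def] by(intro continuous_intros; auto)+
 have cc: "continuous_on(sphere 0 1)(%z. core S N 0 t \<nu> ?f ?g z m)" for m
  by(rule core_continuous_circle[OF bal odd_thetaD(1)[OF f] odd_thetaD(1)[OF g]])
 define c where "c=(%m. cmean 1(%z. core S N 0 t \<nu> ?f ?g z m * pinch_kernel \<rho> z))"
 define c' where "c'=(%m. cmean 1(%z. core S N 0 t \<nu> ?f ?g z m * pinch_dual \<rho> z))"
 have per: "c(m+int r)=c m" for m
  unfolding c_def
  by(rule cmean_cong)(use core_period[OF bal circle_ann[OF bal] _ g] f in auto)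
 have reflm: "c' m=c(- \<epsilon>-m)" for m
 proof -
  have "c' m=cmean 1(%z. (%z. core S N 0 t \<nu> ?f ?g z(- \<epsilon>-m)* pinch_kernel \<rho> z)(1/z))"
   unfolding c'_def
  proof(rule cmean_cong)
   fix z :: complex assume "norm z=1"
   then have "z~=0" by auto
   have e: "- \<epsilon>-m = - m-\<epsilon>" by simp
   then show "core S N 0 t \<nu> ?f ?g z m * pinch_dual \<rho> z=(%z. core S N 0 t \<nu> ?f ?g z(- \<epsilon>-m)* pinch_kernel \<rho> z)(1/z)"
    unfolding e by(simp only: core_inverse[OF \<open>z~=0\<close> f g] pinch_kernel_inverse[OF \<open>z~=0\<close>])
  qed simp
  also have "\<dots>=c(- \<epsilon>-m)"
   unfolding c_def using cmean_inverse[of 1 "%z. core S N 0 t \<nu> ?f ?g z(- \<epsilon>-m)* pinch_kernel \<rho> z"] cc kc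
   by(simp add: continuous_on_mult)
  finally show ?thesis .
 qed
 have eq: "(\<Sum>m\<in>{0..<int r}. c' m)=(\<Sum>m\<in>{0..<int r}. c m)"
  unfolding reflm by(rule sum_reflect_periodic[where c=c and K = "- \<epsilon>"])(use r0 per in auto)
 have "of_real(2 *(1+\<rho>\<^sup>2))* pairing S N t \<nu> F H=(\<Sum>m\<in>{0..<int r}. c m+c' m)"
  unfolding pairing_def cint_def sum_distrib_left c_def c'_def
 proof(rule sum.cong[OF refl])
  fix m
  have "of_real(2 *(1+\<rho>\<^sup>2))* cmean 1(%z. core S N 0 t \<nu> ?f ?g z m)
   = cmean 1(%z. core S N 0 t \<nu> ?f ?g z m * pinch_kernel \<rho> z+core S N 0 t \<nu> ?f ?g z m * pinch_dual \<rho> z)"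
   unfolding cmean_cmult[symmetric]
  proof(rule cmean_cong)
   fix z :: complex assume "norm z=1"
   then have "z~=0" by auto
   from pinch_sum[OF this, of \<rho>, symmetric]
   show "of_real(2 *(1+\<rho>\<^sup>2))* core S N 0 t \<nu> ?f ?g z m
    = core S N 0 t \<nu> ?f ?g z m * pinch_kernel \<rho> z+core S N 0 t \<nu> ?f ?g z m * pinch_dual \<rho> z"
    by(simp only:)(simp add: algebra_simps)
  qed simp
  also have "\<dots>=cmean 1(%z. core S N 0 t \<nu> ?f ?g z m * pinch_kernel \<rho> z)+cmean 1(%z. core S N 0 t \<nu> ?f ?g z m * pinch_dual \<rho> z)"
   by(rule cmean_add)(auto intro!: continuous_on_mult cc kc dc)
  finally show "of_real(2 *(1+\<rho>\<^sup>2))* cmean 1(%z. core S N 0 t \<nu> ?f ?g z m)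
   = cmean 1(%z. core S N 0 t \<nu> ?f ?g z m * pinch_kernel \<rho> z)+cmean 1(%z. core S N 0 t \<nu> ?f ?g z m * pinch_dual \<rho> z)" .
 qed
 also have "\<dots>=2 *(\<Sum>m\<in>{0..<int r}. c' m)" by(simp add: sum.distrib eq)
 finally have "2 *(of_real(1+\<rho>\<^sup>2)* pairing S N t \<nu> F H)=2 *(\<Sum>m\<in>{0..<int r}. c' m)"
  by(simp only: of_real_mult of_real_numeral mult.assoc)
 moreover have "2 * x=2 * y==>x=y" for x y :: complex by simp
 ultimately show ?thesis unfolding c'_def[symmetric] by blast
qed

text \<open>Every G is written as h/(1 - z), also where it has no pole; in that case h vanishes at
  1. One family thus serves all discrete arguments.\<close>

lemma G_regularize:
 obtains h where "\<And>m. h m holomorphic_on regdom"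
  "\<And>m z. z\<in>regdom==>z~=1==>G z m=h m z/(1-z)" "h 0 1=res0"
  "\<And>m. \<not> int r dvd m==>h m 1=0"
proof -
 define Q where "Q=(%m h. h holomorphic_on regdom\<and>(\<forall>z\<in>regdom. z~=1 \<longrightarrow> G z m=h z/(1-z))\<and>(m=0 \<longrightarrow> h 1=res0)
   \<and> (\<not> int r dvd m \<longrightarrow> h 1=0))"
 have "\<exists>h. Q m h" for m
 proof(cases "int r dvd m")
  case True
  show ?thesis
  proof(cases "m=0")
   case True
   obtain h where "h holomorphic_on regdom" "\<And>z. z~=0==>norm z * mx<1==>z~=1==>G z 0=h z/(1-z)" "h 1=res0"
    by(rule G_pole_0)(rule that)
   then show ?thesis using True by(intro exI[of _ h])(auto simp: Q_def)
  next
   case False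
   obtain h where "h holomorphic_on regdom\<and>(\<forall>z. z~=0 \<longrightarrow> norm z * mx<1 \<longrightarrow> z~=1 \<longrightarrow> G z m=h z/(1-z))\<and>h 1~=0"
    using G_pole[OF True] by blast
   then show ?thesis using True False by(intro exI[of _ h])(auto simp: Q_def)
  qed
 next
  case False
  then have "dom m=regdom" by(auto simp: dom_def)
  then have "(%z. (1-z)* G z m) holomorphic_on regdom"
   using G_holomorphic[of m] by(intro holomorphic_intros) auto
  then show ?thesis using False by(intro exI[of _ "%z. (1-z)* G z m"])(auto simp: Q_def)
 qed
 then have "\<forall>m. \<exists>h. Q m h" by(rule allI)
 from choice[OF this] obtain h where h: "\<forall>m. Q m(h m)" by(elim exE)
 show ?thesis by(rule that[of h])(use h in \<open>auto simp: Q_def\<close>)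
qed

text \<open>The theta form of the reciprocal of G(w, k) G(1/w, -k) on the unit circle.\<close>

definition circle_factor :: "complex => int => complex" where
 "circle_factor w k=(p * q) powi(k *(k-1) div 2)*(jtheta(w * p powi k)(p^r)* jtheta(q powi k/w)(q^r))"

lemma G_circle_factor:
 assumes w: "norm w=1" "w~=1 \<or> \<not> int r dvd k"
 shows "G w k * G(1/w)(- k)* circle_factor w k=1"
proof -
 have m: "norm w * mx<1" "norm(1/w)* mx<1" using w mx by(auto simp: norm_divide)
 have d: "w\<in>dom k" "1/w\<in>dom(- k)" using w m by(auto simp: dom_def)
 have "G w k~=0" using G_nonzero[OF d(1)] w pq by simp
 moreover have "G(1/w)(- k)~=0" using G_nonzero[OF d(2)] w pq by(simp add: norm_divide)
 ultimately show ?thesis using G_inverse_circle[OF w(1), of k] by(simp add: circle_factor_def field_simps)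
qed

end

context rarefied
begin

text \<open>With the discrete variables chosen in \<open>pinching\<close>, the poles at -i\<rho> and
  -i/\<rho> pinch the circle at -i for m = 0, and those at i\<rho> and i/\<rho> pinch it at i for m
  = -\<epsilon> modulo r.\<close>

definition pinch_param :: "(real => nat => complex) => nat => nat => real => nat => complex" where
 "pinch_param s b c \<rho> a=(if a=b then-\<i> * of_real \<rho> else if a=c then \<i> * of_real \<rho> else s \<rho> a)"

definition core_base :: "nat => (complex => complex) => (complex => complex) => int => complex => complex" where
 "core_base N f g m z=f(zp z m)* g(zq z m)*(p * q) powi(int(N+1)* EE m-m)"

text \<open>What is left of the gamma factors once the dual kernel has cancelled the poles near i
  and, for m = 0, the reciprocal kernel has been split off for those near -i. It remains continuous
  at \<rho> = 1.\<close>

definition pinch_factor :: "nat set => (real => nat => complex) => (nat => int) => (int => complex => complex) => int => real => complex => complex" where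
 "pinch_factor S' s \<nu> hh m \<rho> z=(\<Prod>a\<in>S'. B(s \<rho> a)(\<nu> a) z m)
   *(hh(m+\<epsilon>)(- \<i> * of_real \<rho> * z)* hh(- \<epsilon>-m)(\<i> * of_real \<rho>/z))
   *(if m=0 then hh 0(- \<i> * of_real \<rho>/z)* hh 0(\<i> * of_real \<rho> * z)
    else G(- \<i> * of_real \<rho>/z)(- m)* G(\<i> * of_real \<rho> * z) m)"

lemma core_base_continuous:
 assumes "f holomorphic_on(- {0})" "g holomorphic_on(- {0})"
 shows "continuous_on(sphere 0 1)(core_base N f g m)"
proof -
 have "core_base N f g m holomorphic_on(- {0})"
  unfolding core_base_def[abs_def]
  by(intro holomorphic_intros compose_nonzero_holomorphic[OF assms(1) zp_holomorphic] compose_nonzero_holomorphic[OF assms(2) zq_holomorphic]) auto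
 then show ?thesis by(rule continuous_on_subset[OF holomorphic_on_imp_continuous_on]) auto
qed

end

text \<open>As \<rho> tends to 1 the product \<rho>^2 of the two special parameters tends to 1, so
  the others become balanced for one variable less. The values \<nu> b = 0 and \<nu> c = -\<epsilon>
  give the pair (b, c) the discrete argument 0, so its gamma factor tends to the pole at 1.\<close>

locale pinching=rarefied +
 fixes S' :: "nat set" and n b c :: nat and s :: "real => nat => complex" and \<nu> :: "nat => int"
  and \<rho>\<^sub>0 :: real and hh :: "int => complex => complex"
 assumes fin: "finite S'" and bc: "b \<notin> S'" "c \<notin> S'" "b~=c" and \<nu>bc: "\<nu> b=0" "\<nu> c = - \<epsilon>"
  and \<rho>0: "0<\<rho>\<^sub>0" "\<rho>\<^sub>0<1"
  and s_cont: "\<And>a. a\<in>S'==>continuous_on {\<rho>\<^sub>0..1} (%\<rho>. s \<rho> a)"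
  and s_disc: "\<And>\<rho> a. \<rho>\<^sub>0\<le>\<rho>==>\<rho>\<le>1==>a\<in>S'==>s \<rho> a~=0\<and>norm(s \<rho> a)<1"
  and base: "balanced S' n 0(s 1) \<nu>"
  and bal: "\<And>\<rho>. \<rho>\<^sub>0\<le>\<rho>==>\<rho><1==>balanced(insert b(insert c S'))(Suc n) 0(pinch_param s b c \<rho>) \<nu>"
  and hh_hol: "\<And>m. hh m holomorphic_on regdom"
  and hh_G: "\<And>m z. z\<in>regdom==>z~=1==>G z m=hh m z/(1-z)"
  and hh_0: "hh 0 1=res0" and hh_1: "\<And>m. \<not> int r dvd m==>hh m 1=0"
begin

lemma eventually_rho: "eventually(%\<rho>. \<rho>\<^sub>0\<le>\<rho>\<and>\<rho><1)(at_left 1)"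
 using eventually_at_left_real[OF \<rho>0(2)] by eventually_elim auto

text \<open>The numerators hh are holomorphic across 1, and for 0 < m < r the remaining gamma
  factors have no pole there, so \<rho> = 1 is included.\<close>

lemma pinch_factor_continuous:
 assumes m: "0\<le>m" "m<int r"
 shows "continuous_on({\<rho>\<^sub>0..1} \<times> sphere 0 1)(%(\<rho>, z). pinch_factor S' s \<nu> hh m \<rho> z)"
proof -
 let ?B = "{\<rho>\<^sub>0..1} \<times> sphere(0::complex) 1"
 have cont_G: "continuous_on ?B(%x. G(h x) k)" if "continuous_on ?B h" "\<And>x. x \<in> ?B==>h x\<in>dom k" for h k
 proof -
  have "h ` ?B \<subseteq> dom k" by(rule image_subsetI)(rule that(2))
  then show ?thesis by(rule continuous_on_compose2[OF holomorphic_on_imp_continuous_on[OF G_holomorphic] that(1)])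
 qed
 have cont_h: "continuous_on ?B(%x. hh k(h x))" if "continuous_on ?B h" "\<And>x. x \<in> ?B==>h x\<in>regdom" for h k
 proof -
  have "h ` ?B \<subseteq> regdom" by(rule image_subsetI)(rule that(2))
  then show ?thesis by(rule continuous_on_compose2[OF holomorphic_on_imp_continuous_on[OF hh_hol] that(1)])
 qed
 have cs: "continuous_on ?B(%x. s(fst x) a)" if "a\<in>S'" for a
  by(rule continuous_on_compose2[OF s_cont[OF that]])(auto intro!: continuous_intros)
 have z0: "snd x~=0" if "x \<in> ?B" for x using that by auto
 have lin: "continuous_on ?B(%x. - \<i> * of_real(fst x)* snd x)" "continuous_on ?B(%x. \<i> * of_real(fst x)* snd x)"
  "continuous_on ?B(%x. - \<i> * of_real(fst x)/snd x)" "continuous_on ?B(%x. \<i> * of_real(fst x)/snd x)"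
  using z0 by(auto intro!: continuous_intros)
 have m1: "\<rho> * mx<1" if "\<rho>\<le>1" for \<rho> using mx mult_right_mono[OF that less_imp_le[OF mx(1)]] by linarith
 have reg: "- \<i> * of_real(fst x)* snd x\<in>regdom" "\<i> * of_real(fst x)* snd x\<in>regdom"
  "- \<i> * of_real(fst x)/snd x\<in>regdom" "\<i> * of_real(fst x)/snd x\<in>regdom" if "x \<in> ?B" for x
  using that \<rho>0 m1 by(auto simp: norm_mult norm_divide)
 have dm: "z\<in>dom k" if "z\<in>regdom" "\<not> int r dvd k" for z k using that by(auto simp: dom_def)
 have nd: "\<not> int r dvd m" "\<not> int r dvd-m" if "m~=0" using m that zdvd_not_zless by auto
 have Bc: "continuous_on ?B(%x. B(s(fst x) a)(\<nu> a)(snd x) m)" if a: "a\<in>S'" for a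
  unfolding B_def
  by(intro continuous_on_mult cont_G continuous_on_divide cs[OF a] continuous_intros)
    (use s_disc a in \<open>auto intro!: unit_disc_dom simp: norm_mult norm_divide\<close>)
 show ?thesis
 proof(cases "m=0")
  case True
  show ?thesis unfolding pinch_factor_def case_prod_unfold if_P[OF True]
   by(intro continuous_on_mult continuous_on_prod Bc cont_h lin reg; assumption)
 next
  case False
  show ?thesis unfolding pinch_factor_def case_prod_unfold if_not_P[OF False]
   by(intro continuous_on_mult continuous_on_prod Bc cont_h cont_G lin reg dm nd[OF False]; assumption)
 qed
qed

lemma pinch_product_continuous:
 assumes "continuous_on(sphere 0 1) \<beta>" "0\<le>m" "m<int r"
 shows "continuous_on({\<rho>\<^sub>0..1} \<times> sphere 0 1)(%(\<rho>, z). \<beta> z * pinch_factor S' s \<nu> hh m \<rho> z)"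
proof -
 have "continuous_on({\<rho>\<^sub>0..1} \<times> sphere 0 1)(%x. \<beta> (snd x))"
  by(rule continuous_on_compose2[OF assms(1)])(auto intro!: continuous_intros)
 from continuous_on_mult[OF this pinch_factor_continuous[OF assms(2,3)]]
 show ?thesis by(simp add: case_prod_unfold)
qed

lemma core_pinch:
 assumes \<rho>: "\<rho>\<^sub>0\<le>\<rho>" "\<rho><1" and z: "norm z=1"
 shows "core(insert b(insert c S')) N 0(pinch_param s b c \<rho>) \<nu> f g z m * pinch_dual \<rho> z
  = core_base N f g m z * pinch_factor S' s \<nu> hh m \<rho> z/(if m=0 then pinch_kernel \<rho> z else 1)"
proof -
 let ?t = "pinch_param s b c \<rho>"
 define x1 where "x1 = - \<i> * of_real \<rho> * z"
 define x2 where "x2 = - \<i> * of_real \<rho>/z"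
 define x3 where "x3=\<i> * of_real \<rho> * z"
 define x4 where "x4=\<i> * of_real \<rho>/z"
 have z0: "z~=0" using z by auto
 have nx: "norm x1=\<rho>" "norm x2=\<rho>" "norm x3=\<rho>" "norm x4=\<rho>"
  using \<rho> \<rho>0 z by(auto simp: x1_def x2_def x3_def x4_def norm_mult norm_divide)
 have "\<rho> * mx\<le>1 * mx" using mx \<rho> by(intro mult_right_mono) auto
 then have "\<rho> * mx<1" using mx by linarith
 then have reg: "x\<in>regdom\<and>x~=1" if "norm x=\<rho>" for x using that \<rho> \<rho>0 by auto
 have h: "G x k=hh k x/(1-x)" "1-x~=0" if "norm x=\<rho>" for x k using hh_G[of x k] reg[OF that] by auto
 have P: "(\<Prod>a\<in>insert b(insert c S'). B(?t a)(\<nu> a) z m)=G x1(m+\<epsilon>)* G x2(- m)*(G x3 m * G x4(- \<epsilon>-m)*(\<Prod>a\<in>S'. B(s \<rho> a)(\<nu> a) z m))"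
 proof -
  have "(\<Prod>a\<in>S'. B(?t a)(\<nu> a) z m)=(\<Prod>a\<in>S'. B(s \<rho> a)(\<nu> a) z m)"
   by(rule prod.cong)(use bc in \<open>auto simp: pinch_param_def\<close>)
  moreover have "B(?t b)(\<nu> b) z m=G x1(m+\<epsilon>)* G x2(- m)" "B(?t c)(\<nu> c) z m=G x3 m * G x4(- \<epsilon>-m)"
   using bc by(simp_all add: B_def pinch_param_def \<nu>bc x1_def x2_def x3_def x4_def)
  ultimately show ?thesis using fin bc by simp
 qed
 have d: "pinch_dual \<rho> z=(1-x1)*(1-x4)" unfolding pinch_dual_def x1_def x4_def ..
 have k: "pinch_kernel \<rho> z=(1-x2)*(1-x3)" unfolding pinch_kernel_altdef[OF z0] x2_def x3_def ..
 have e1: "G x1(m+\<epsilon>)*(1-x1)=hh(m+\<epsilon>) x1" "G x4(- \<epsilon>-m)*(1-x4)=hh(- \<epsilon>-m) x4"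
  using h(1)[OF nx(1), of "m+\<epsilon>"] h(1)[OF nx(4), of "- \<epsilon>-m"] h(2)[OF nx(1)] h(2)[OF nx(4)] by simp_all
 have c: "core(insert b(insert c S')) N 0 ?t \<nu> f g z m=core_base N f g m z *(\<Prod>a\<in>insert b(insert c S'). B(?t a)(\<nu> a) z m)"
  by(simp only: core_def core_base_def power_0 mult_1_right)
 have "core(insert b(insert c S')) N 0 ?t \<nu> f g z m * pinch_dual \<rho> z
  = core_base N f g m z *((\<Prod>a\<in>S'. B(s \<rho> a)(\<nu> a) z m)*(G x1(m+\<epsilon>)*(1-x1)*(G x4(- \<epsilon>-m)*(1-x4)))*(G x2(- m)* G x3 m))"
  unfolding c P d by(simp only: mult_ac)
 also have "\<dots>=core_base N f g m z *((\<Prod>a\<in>S'. B(s \<rho> a)(\<nu> a) z m)*(hh(m+\<epsilon>) x1 * hh(- \<epsilon>-m) x4)*(G x2(- m)* G x3 m))"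
  unfolding e1 ..
 also have "\<dots>=core_base N f g m z * pinch_factor S' s \<nu> hh m \<rho> z/(if m=0 then pinch_kernel \<rho> z else 1)"
 proof(cases "m=0")
  case True
  have "G x2(- m)* G x3 m=hh 0 x2 * hh 0 x3/pinch_kernel \<rho> z"
   unfolding k using h(1)[OF nx(2), of 0] h(1)[OF nx(3), of 0] True by simp
  then show ?thesis using True unfolding pinch_factor_def x1_def x2_def x3_def x4_def by simp
 next
  case False
  then show ?thesis unfolding pinch_factor_def x1_def x2_def x3_def x4_def by simp
 qed
 finally show ?thesis .
qed

context
 fixes F H :: "complex => complex"
 assumes F: "even_theta(p^r) n F" and H: "even_theta(q^r) n H"
begin

abbreviation(input) "pbase \<equiv> core_base(Suc n)(%x. F x * jtheta(x\<^sup>2)(p^r))(%x. H x * jtheta(x\<^sup>2)(q^r))"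

lemma pbase_continuous: "continuous_on(sphere 0 1)(pbase m)"
 by(intro core_base_continuous holomorphic_on_mult even_thetaD(1)[OF F] even_thetaD(1)[OF H] jtheta_square_holomorphic pr qr)

lemma pairing_pinch_eq:
 assumes \<rho>: "\<rho>\<^sub>0\<le>\<rho>" "\<rho><1"
 shows "pairing(insert b(insert c S'))(Suc n)(pinch_param s b c \<rho>) \<nu> F H
  = (cmean 1(%z. pbase 0 z * pinch_factor S' s \<nu> hh 0 \<rho> z/pinch_kernel \<rho> z)
   + (\<Sum>m\<in>{1..<int r}. cmean 1(%z. pbase m z * pinch_factor S' s \<nu> hh m \<rho> z))) / of_real(1+\<rho>\<^sup>2)"
proof -
 have "1+\<rho>\<^sup>2~=0" using zero_le_power2[of \<rho>] by linarith
 then have nz: "complex_of_real(1+\<rho>\<^sup>2)~=0" by(simp only: of_real_eq_0_iff simp_thms)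
 have "of_real(1+\<rho>\<^sup>2)* pairing(insert b(insert c S'))(Suc n)(pinch_param s b c \<rho>) \<nu> F H
  = (\<Sum>m\<in>{0..<int r}. cmean 1(%z. pbase m z * pinch_factor S' s \<nu> hh m \<rho> z/(if m=0 then pinch_kernel \<rho> z else 1)))"
  unfolding pairing_pinch[OF bal[OF \<rho>] even_theta_imp_odd_theta[OF pr F] even_theta_imp_odd_theta[OF qr H]]
  by(intro sum.cong refl cmean_cong core_pinch[OF \<rho>]) auto
 also have "{0..<int r}=insert 0 {1..<int r}" using r0 by auto
 also have "(\<Sum>m\<in>insert 0 {1..<int r}. cmean 1(%z. pbase m z * pinch_factor S' s \<nu> hh m \<rho> z/(if m=0 then pinch_kernel \<rho> z else 1)))
   = cmean 1(%z. pbase 0 z * pinch_factor S' s \<nu> hh 0 \<rho> z/pinch_kernel \<rho> z)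
   + (\<Sum>m\<in>{1..<int r}. cmean 1(%z. pbase m z * pinch_factor S' s \<nu> hh m \<rho> z))"
  by(subst sum.insert)(auto intro!: sum.cong)
 finally show ?thesis using nz by(simp only: nonzero_eq_divide_eq[OF nz] mult.commute)
qed

lemma rest_limit: "((%\<rho>. \<Sum>m\<in>{1..<int r}. cmean 1(%z. pbase m z * pinch_factor S' s \<nu> hh m \<rho> z))
  \<longlongrightarrow> (\<Sum>m\<in>{1..<int r}. cmean 1(%z. pbase m z * pinch_factor S' s \<nu> hh m 1 z)))(at_left 1)"
proof(intro tendsto_sum)
 fix m assume m: "m\<in>{1..<int r}"
 show "((%\<rho>. cmean 1(%z. pbase m z * pinch_factor S' s \<nu> hh m \<rho> z))\<longlongrightarrow>cmean 1(%z. pbase m z * pinch_factor S' s \<nu> hh m 1 z))(at_left 1)"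
  by(rule pinch_limit_simple[OF \<rho>0 pinch_product_continuous[OF pbase_continuous]])(use m in auto)
qed

lemma denominator_limit: "((%\<rho>. complex_of_real(1+\<rho>\<^sup>2))\<longlongrightarrow>2)(at_left 1)"
proof -
 have "((%\<rho>. complex_of_real(1+\<rho>\<^sup>2)) \<longlongrightarrow> of_real(1+1\<^sup>2))(at_left 1)" by(intro tendsto_intros)
 then show ?thesis by simp
qed

lemma pairing_limit_pole:
 "((%\<rho>. of_real(1-\<rho>\<^sup>2)* pairing(insert b(insert c S'))(Suc n)(pinch_param s b c \<rho>) \<nu> F H)
  \<longlongrightarrow> pbase 0(- \<i>)* pinch_factor S' s \<nu> hh 0 1(- \<i>)/2)(at_left 1)"
proof -
 have L1: "((%\<rho>. of_real(1-\<rho>\<^sup>2)* cmean 1(%z. pbase 0 z * pinch_factor S' s \<nu> hh 0 \<rho> z/pinch_kernel \<rho> z))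
   \<longlongrightarrow> pbase 0(- \<i>)* pinch_factor S' s \<nu> hh 0 1(- \<i>))(at_left 1)"
  by(rule pinch_limit_pole[OF \<rho>0 pinch_product_continuous[OF pbase_continuous]])(use r0 in auto)
 have L0: "((%\<rho>. complex_of_real(1-\<rho>\<^sup>2)) \<longlongrightarrow> of_real(1-1\<^sup>2))(at_left 1)" by(intro tendsto_intros)
 have "((%\<rho>. (of_real(1-\<rho>\<^sup>2)* cmean 1(%z. pbase 0 z * pinch_factor S' s \<nu> hh 0 \<rho> z/pinch_kernel \<rho> z)
   + of_real(1-\<rho>\<^sup>2)*(\<Sum>m\<in>{1..<int r}. cmean 1(%z. pbase m z * pinch_factor S' s \<nu> hh m \<rho> z))) / of_real(1+\<rho>\<^sup>2))
   \<longlongrightarrow> (pbase 0(- \<i>)* pinch_factor S' s \<nu> hh 0 1(- \<i>) + of_real(1-1\<^sup>2)*(\<Sum>m\<in>{1..<int r}. cmean 1(%z. pbase m z * pinch_factor S' s \<nu> hh m 1 z)))/2)(at_left 1)"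
  by(intro tendsto_divide tendsto_add tendsto_mult[OF L0 rest_limit] L1 denominator_limit) simp
 then have "((%\<rho>. (of_real(1-\<rho>\<^sup>2)* cmean 1(%z. pbase 0 z * pinch_factor S' s \<nu> hh 0 \<rho> z/pinch_kernel \<rho> z)
   + of_real(1-\<rho>\<^sup>2)*(\<Sum>m\<in>{1..<int r}. cmean 1(%z. pbase m z * pinch_factor S' s \<nu> hh m \<rho> z))) / of_real(1+\<rho>\<^sup>2))
   \<longlongrightarrow> pbase 0(- \<i>)* pinch_factor S' s \<nu> hh 0 1(- \<i>)/2)(at_left 1)" by simp
 then show ?thesis
  by(rule Lim_transform_eventually)
    (rule eventually_mono[OF eventually_rho], simp only: pairing_pinch_eq distrib_left times_divide_eq_right)
qed

lemma pairing_limit_simple_zero: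
 assumes \<beta>: "continuous_on(sphere 0 1) \<beta>" "\<And>z. norm z=1==>pbase 0 z=(1-\<i> * z)* \<beta> z"
 shows "((%\<rho>. of_real(sqrt(1-\<rho>\<^sup>2))* pairing(insert b(insert c S'))(Suc n)(pinch_param s b c \<rho>) \<nu> F H)\<longlongrightarrow>0)(at_left 1)"
proof -
 have "((%\<rho>. of_real(sqrt(1-\<rho>\<^sup>2))* cmean 1(%z. (1-\<i> * z)*(\<beta> z * pinch_factor S' s \<nu> hh 0 \<rho> z)/pinch_kernel \<rho> z))
   \<longlongrightarrow> 0)(at_left 1)"
  by(rule pinch_limit_simple_zero[OF \<rho>0 pinch_product_continuous[OF \<beta>(1)]])(use r0 in auto)
 moreover have "cmean 1(%z. (1-\<i> * z)*(\<beta> z * pinch_factor S' s \<nu> hh 0 \<rho> z)/pinch_kernel \<rho> z)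
   = cmean 1(%z. pbase 0 z * pinch_factor S' s \<nu> hh 0 \<rho> z/pinch_kernel \<rho> z)" for \<rho>
  by(rule cmean_cong)(simp_all add: \<beta>(2) mult.assoc)
 ultimately have L1: "((%\<rho>. of_real(sqrt(1-\<rho>\<^sup>2))* cmean 1(%z. pbase 0 z * pinch_factor S' s \<nu> hh 0 \<rho> z/pinch_kernel \<rho> z))
   \<longlongrightarrow> 0)(at_left 1)" by simp
 have L0: "((%\<rho>. complex_of_real(sqrt(1-\<rho>\<^sup>2))) \<longlongrightarrow> of_real(sqrt(1-1\<^sup>2)))(at_left 1)" by(intro tendsto_intros)
 have "((%\<rho>. (of_real(sqrt(1-\<rho>\<^sup>2))* cmean 1(%z. pbase 0 z * pinch_factor S' s \<nu> hh 0 \<rho> z/pinch_kernel \<rho> z)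
   + of_real(sqrt(1-\<rho>\<^sup>2))*(\<Sum>m\<in>{1..<int r}. cmean 1(%z. pbase m z * pinch_factor S' s \<nu> hh m \<rho> z))) / of_real(1+\<rho>\<^sup>2))
   \<longlongrightarrow> (0 + of_real(sqrt(1-1\<^sup>2))*(\<Sum>m\<in>{1..<int r}. cmean 1(%z. pbase m z * pinch_factor S' s \<nu> hh m 1 z)))/2)(at_left 1)"
  by(intro tendsto_divide tendsto_add tendsto_mult[OF L0 rest_limit] L1 denominator_limit) simp
 then have "((%\<rho>. (of_real(sqrt(1-\<rho>\<^sup>2))* cmean 1(%z. pbase 0 z * pinch_factor S' s \<nu> hh 0 \<rho> z/pinch_kernel \<rho> z)
   + of_real(sqrt(1-\<rho>\<^sup>2))*(\<Sum>m\<in>{1..<int r}. cmean 1(%z. pbase m z * pinch_factor S' s \<nu> hh m \<rho> z))) / of_real(1+\<rho>\<^sup>2))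
   \<longlongrightarrow> 0)(at_left 1)" by simp
 then show ?thesis
  by(rule Lim_transform_eventually)
    (rule eventually_mono[OF eventually_rho], simp only: pairing_pinch_eq distrib_left times_divide_eq_right)
qed

lemma pairing_limit_double_zero:
 assumes \<beta>: "continuous_on(sphere 0 1) \<beta>" "\<And>z. norm z=1==>pbase 0 z=(1-\<i> * z)\<^sup>2 * \<beta> z"
 shows "((%\<rho>. pairing(insert b(insert c S'))(Suc n)(pinch_param s b c \<rho>) \<nu> F H)
  \<longlongrightarrow> (cmean 1(%z. - (\<i> * z)*(\<beta> z * pinch_factor S' s \<nu> hh 0 1 z))
    + (\<Sum>m\<in>{1..<int r}. cmean 1(%z. pbase m z * pinch_factor S' s \<nu> hh m 1 z)))/2)(at_left 1)"
proof -
 have "((%\<rho>. cmean 1(%z. (1-\<i> * z)\<^sup>2 *(\<beta> z * pinch_factor S' s \<nu> hh 0 \<rho> z)/pinch_kernel \<rho> z))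
   \<longlongrightarrow> cmean 1(%z. - (\<i> * z)*(\<beta> z * pinch_factor S' s \<nu> hh 0 1 z)))(at_left 1)"
  by(rule pinch_limit_double_zero[OF \<rho>0 pinch_product_continuous[OF \<beta>(1)]])(use r0 in auto)
 moreover have "cmean 1(%z. (1-\<i> * z)\<^sup>2 *(\<beta> z * pinch_factor S' s \<nu> hh 0 \<rho> z)/pinch_kernel \<rho> z)
   = cmean 1(%z. pbase 0 z * pinch_factor S' s \<nu> hh 0 \<rho> z/pinch_kernel \<rho> z)" for \<rho>
  by(rule cmean_cong)(simp_all add: \<beta>(2) mult.assoc)
 ultimately have L1: "((%\<rho>. cmean 1(%z. pbase 0 z * pinch_factor S' s \<nu> hh 0 \<rho> z/pinch_kernel \<rho> z))
   \<longlongrightarrow> cmean 1(%z. - (\<i> * z)*(\<beta> z * pinch_factor S' s \<nu> hh 0 1 z)))(at_left 1)" by simp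
 have "((%\<rho>. (cmean 1(%z. pbase 0 z * pinch_factor S' s \<nu> hh 0 \<rho> z/pinch_kernel \<rho> z)
   + (\<Sum>m\<in>{1..<int r}. cmean 1(%z. pbase m z * pinch_factor S' s \<nu> hh m \<rho> z))) / of_real(1+\<rho>\<^sup>2))
   \<longlongrightarrow> (cmean 1(%z. - (\<i> * z)*(\<beta> z * pinch_factor S' s \<nu> hh 0 1 z))
    + (\<Sum>m\<in>{1..<int r}. cmean 1(%z. pbase m z * pinch_factor S' s \<nu> hh m 1 z)))/2)(at_left 1)"
  by(intro tendsto_divide tendsto_add rest_limit L1 denominator_limit) simp
 then show ?thesis
  by(rule Lim_transform_eventually)
    (rule eventually_mono[OF eventually_rho], simp only: pairing_pinch_eq)
qed

end

end

lemma pinch_quotient: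
 assumes f: "f holomorphic_on(- {0::complex})" "f(- \<i>)=0"
 obtains u where "u holomorphic_on(- {0})" "\<And>z. z~=0==>f z=(1-\<i> * z)* u z"
proof -
 have z: "a = - \<i>" if "1-\<i> * a=0" for a :: complex
 proof -
  have "\<i> * a=1" using that by simp
  then have "\<i> *(\<i> * a)=\<i>" by simp
  then have "- a=\<i>" by(simp add: mult.assoc[symmetric])
  then show ?thesis by(metis minus_minus)
 qed
 have d: "deriv(%z. 1-\<i> * z) a~=0" for a
 proof -
  have "((%z. 1-\<i> * z) has_field_derivative-\<i>)(at a)" by(auto intro!: derivative_eq_intros)
  then show ?thesis by(simp add: DERIV_imp_deriv)
 qed
 obtain u where "u holomorphic_on(- {0})" "\<And>z. z \<in>-{0}==>f z=(1-\<i> * z)* u z"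
 proof(rule holomorphic_quotient[of f "- {0}" "%z. 1-\<i> * z"])
  show "f a=0\<and>deriv(%z. 1-\<i> * z) a~=0" if "1-\<i> * a=0" for a
   using z[OF that] f(2) d by simp
 qed(use f in \<open>auto intro!: holomorphic_intros\<close>)
 then show ?thesis using that by auto
qed

section \<open>The pinch point as a base point for theta functions\<close>

context rarefied
begin

text \<open>The square root (pq)^(\<epsilon>/2) determined by the fixed logarithms.\<close>

definition PQe :: complex where "PQe=exp(of_int \<epsilon> *(lp+lq)/2)"

lemma norm_param_gt:
 assumes bal: "balanced S N 0 t \<nu>" and a: "a\<in>S"
 shows "norm(p * q)<norm(t a)"
proof -
 have t: "norm(t c)<1" if "c\<in>S" for c using bal that by(auto simp: balanced_def)
 have "card S=2 * N+4" "finite S" using bal by(auto simp: balanced_def)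
 then have "card(S-{a})~=0" using a by simp
 then have "S-{a}~={}" by(metis card.empty)
 then obtain b where b: "b\<in>S" "a~=b" by blast
 have "norm(p * q)<norm(t a * t b)" by(rule norm_pair_gt[OF bal a b])
 also have "\<dots>\<le>norm(t a)" using t[OF b(1)] by(simp add: norm_mult mult_left_le)
 finally show ?thesis .
qed

lemma eps_sq: "\<epsilon> * \<epsilon>=\<epsilon>" using eps by auto

lemma zp_zq_mult:
 assumes "z~=0"
 shows "zp z m * zq z m=(p * q) powi m * PQe"
proof -
 have "zp z m * zq z m=exp(of_int(2 * m+\<epsilon>)* lp/2)* exp(of_int(2 * m+\<epsilon>)* lq/2)"
  using assms by(simp add: zp_def zq_def)
 also have "\<dots>=exp(of_int m *(lp+lq) + of_int \<epsilon> *(lp+lq)/2)"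
  unfolding exp_add[symmetric] by(rule arg_cong[of _ _ exp])(simp add: field_simps)
 also have "\<dots>=(p * q) powi m * PQe"
  unfolding PQe_def exp_add by(simp add: lp lq exp_add[symmetric] powi_exp)
 finally show ?thesis .
qed

text \<open>The pinch point z = -i, m = 0 in the variables \<open>zp\<close> and \<open>zq\<close>.
  With these as base points every theta monomial of positive index vanishes at the pinch
  point.\<close>

definition X1 :: complex where "X1=zp(- \<i>) 0"
definition X1' :: complex where "X1'=zq(- \<i>) 0"

lemma X1_nonzero: "X1~=0" "X1'~=0"
 by(simp_all add: X1_def X1'_def)

lemma half_powi: "exp(of_int(2 * m+\<epsilon>)* l/2)* exp(of_int \<epsilon> * l/2)=exp l powi(m+\<epsilon>)"
 "exp(of_int(2 * m+\<epsilon>)* l/2)/exp(of_int \<epsilon> * l/2)=exp l powi m" for l :: complex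
 unfolding powi_exp exp_add[symmetric] exp_diff[symmetric]
 by(rule arg_cong[of _ _ exp], simp add: field_simps)+

lemma X1_forms:
 assumes "z~=0"
 shows "zp z m * X1=(- \<i> * z)* p powi(m+\<epsilon>)" "zp z m/X1=(\<i> * z)* p powi m"
  "zq z m * X1'=q powi(m+\<epsilon>)/(- \<i> * z)" "zq z m/X1'=q powi m/(\<i> * z)"
proof -
 have X: "X1 = - \<i> * exp(of_int \<epsilon> * lp/2)" "X1'=exp(of_int \<epsilon> * lq/2)/(- \<i>)"
  by(simp_all add: X1_def X1'_def zp_def zq_def)
 have i: "1/(- \<i>)=\<i>" by(simp add: divide_inverse)
 show "zp z m * X1=(- \<i> * z)* p powi(m+\<epsilon>)"
  unfolding X zp_def lp half_powi(1)[symmetric] by(simp only: mult_ac)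
 have "zp z m/X1=z/(- \<i>)*(exp(of_int(2 * m+\<epsilon>)* lp/2)/exp(of_int \<epsilon> * lp/2))"
  unfolding X zp_def by(simp only: times_divide_times_eq)
 then show "zp z m/X1=(\<i> * z)* p powi m" unfolding half_powi(2) lp[symmetric] by(simp add: divide_inverse mult_ac)
 have "zq z m * X1'=(exp(of_int(2 * m+\<epsilon>)* lq/2)* exp(of_int \<epsilon> * lq/2))/(z *(- \<i>))"
  unfolding X zq_def by(simp only: times_divide_times_eq)
 then show "zq z m * X1'=q powi(m+\<epsilon>)/(- \<i> * z)" unfolding half_powi(1) lq[symmetric] by(simp only: mult.commute)
 have "X1'=1/(- \<i>)* exp(of_int \<epsilon> * lq/2)" unfolding X(2) times_divide_eq_left mult_1_left ..
 then have X': "X1'=\<i> * exp(of_int \<epsilon> * lq/2)" unfolding i .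
 have "zq z m/X1'=(exp(of_int(2 * m+\<epsilon>)* lq/2)/exp(of_int \<epsilon> * lq/2))/(\<i> * z)"
  unfolding X' zq_def by(simp only: divide_divide_eq_left mult_ac)
 then show "zq z m/X1'=q powi m/(\<i> * z)" unfolding half_powi(2) lq[symmetric] .
qed

lemma X1_squares: "X1\<^sup>2 = - (p powi \<epsilon>)" "X1'\<^sup>2 = - (q powi \<epsilon>)"
 using X1_forms(1)[of "- \<i>" 0] X1_forms(3)[of "- \<i>" 0]
 by(simp_all add: X1_def[symmetric] X1'_def[symmetric] power2_eq_square)

text \<open>Moduli force the exponents to agree, and then the sign is contradictory. Applied to the
  square of the base point, which is -p^\<epsilon> or -q^\<epsilon>, this makes the base point
  admissible.\<close>

lemma neg_powi_ne:
 fixes b :: complex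
 assumes b: "norm b<1" "b~=0"
 shows "- (b powi k)~=(b^n) powi j"
proof
 assume e: "- (b powi k)=(b^n) powi j"
 have bn: "(b^n) powi j=b powi(int n * j)" by(rule power_int_power)
 have n: "norm b powi k=norm b powi(int n * j)" using arg_cong[OF e, of norm] unfolding bn by(simp add: norm_power_int)
 have "k=int n * j"
 proof(rule ccontr)
  assume "k~=int n * j"
  then show False using n b power_int_strict_decreasing[of k "int n * j" "norm b"] power_int_strict_decreasing[of "int n * j" k "norm b"]
   by(cases k "int n * j" rule: linorder_cases) auto
 qed
 then have "- (b powi k)=b powi k" using e bn by simp
 then show False using b by simp
qed

lemma generic_extend:
 assumes b: "norm b<1" "b~=0" and X: "X~=0" "\<And>k::int. X\<^sup>2~=b powi k"
 obtains Y where "generic b X Y"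
proof -
 have "eventually(%l. jtheta(X\<^sup>2 * exp(1 * l)) b~=0\<and>jtheta(1 * exp(- 1 * l)) b~=0)(at 0)"
  using X(1) by(intro eventually_conj eventually_jtheta_nonzero[OF b]) auto
 then obtain l where l: "jtheta(X\<^sup>2 * exp(1 * l)) b~=0" "jtheta(1 * exp(- 1 * l)) b~=0"
  using eventually_happens'[OF at_neq_bot] by blast
 have "theta_prod b X(X * exp l)~=0"
  using l X(1) by(simp add: theta_prod_def power2_eq_square mult_ac exp_minus inverse_eq_divide)
 then show ?thesis using X that[of "X * exp l"] by(simp add: generic_def)
qed

lemma generic_X1:
 obtains Y Y' where "generic(p^r) X1 Y" "generic(q^r) X1' Y'"
proof -
 have q2: "q~=0" "p~=0" using p0 q0 by auto
 have "X1\<^sup>2~=(p^r) powi k" "X1'\<^sup>2~=(q^r) powi k" for k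
  unfolding X1_squares using neg_powi_ne[OF p q2(2)] neg_powi_ne[OF q q2(1)] by auto
 then show ?thesis using generic_extend[OF pr X1_nonzero(1)] generic_extend[OF qr X1_nonzero(2)] that by metis
qed

text \<open>The two theta factors vanishing at the pinch point are, up to powers of pq, the
  reciprocals of the gamma factors of the parameters -i and i. In the minor they cancel, leaving the
  integrand for the remaining parameters.\<close>

lemma theta_pair:
 assumes z: "z~=0"
 shows "theta_prod(p^r)(zp z m) X1 * theta_prod(q^r)(zq z m) X1'
  = circle_factor(- \<i> * z)(m+\<epsilon>)* circle_factor(\<i> * z) m *(p * q) powi(- EE m)/PQe"
proof -
 have e: "(m+\<epsilon>)*(m+\<epsilon>-1) div 2+m *(m-1) div 2=EE m-m" (is "?x + ?y = _")
 proof -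
  have h1: "2 * ?x=(m+\<epsilon>)*(m+\<epsilon>-1)" by(rule dvd_mult_div_cancel[OF dvd_2_consecutive])
  have h2: "2 * ?y=m *(m-1)" by(rule dvd_mult_div_cancel[OF dvd_2_consecutive])
  have "(m+\<epsilon>)*(m+\<epsilon>-1)+m *(m-1)=2 *(EE m-m)+(\<epsilon> * \<epsilon>-\<epsilon>)" by(simp add: EE_def algebra_simps)
  then have "2 *(?x + ?y)=2 *(EE m-m)" unfolding distrib_left h1 h2 eps_sq by(simp only: diff_self add_0_right)
  moreover have "2 * u=2 * v==>u=v" for u v :: int by simp
  ultimately show ?thesis by blast
 qed
 define J where "J=jtheta((- \<i> * z)* p powi(m+\<epsilon>))(p^r)* jtheta((\<i> * z)* p powi m)(p^r)
   *(jtheta(q powi(m+\<epsilon>)/(- \<i> * z))(q^r)* jtheta(q powi m/(\<i> * z))(q^r))"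
 have c: "circle_factor(- \<i> * z)(m+\<epsilon>)* circle_factor(\<i> * z) m=(p * q) powi(EE m-m)* J"
  unfolding circle_factor_def e[symmetric] power_int_add[OF disjI1[OF pq(2)]] J_def by(simp only: mult_ac)
 have "theta_prod(p^r)(zp z m) X1 * theta_prod(q^r)(zq z m) X1'=J/(zp z m * zq z m)"
  unfolding theta_prod_def X1_forms[OF z] J_def by(simp only: times_divide_times_eq)
 also have "\<dots>=J *(p * q) powi(- m)/PQe" unfolding zp_zq_mult[OF z] by(simp add: power_int_minus divide_inverse)
 also have "(p * q) powi(- m)=(p * q) powi(EE m-m)*(p * q) powi(- EE m)"
  unfolding power_int_add[OF disjI1[OF pq(2)], symmetric] by simp
 also have "J *((p * q) powi(EE m-m)*(p * q) powi(- EE m))/PQe=circle_factor(- \<i> * z)(m+\<epsilon>)* circle_factor(\<i> * z) m *(p * q) powi(- EE m)/PQe"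
  unfolding c by(simp only: mult_ac)
 finally show ?thesis .
qed

end

context pinching
begin

text \<open>The inversion formula freed of poles. At w = 1 both sides vanish: through a theta
  function if r divides k, and through hh k 1 = 0 otherwise.\<close>

lemma hh_circle:
 assumes w: "norm w=1"
 shows "hh k w * hh(- k)(1/w)* circle_factor w k=(1-w)*(1-1/w)"
proof(cases "w=1")
 case False
 have w1: "1/w~=1" using False w by(auto simp: divide_eq_eq)
 have reg: "w\<in>regdom" "1/w\<in>regdom" using w mx by(auto simp: norm_divide)
 have "hh k w * hh(- k)(1/w)* circle_factor w k
  = (1-w)*(1-1/w)*(hh k w/(1-w)*(hh(- k)(1/w)/(1-1/w))* circle_factor w k)"
  using False w1 by simp
 also have "hh k w/(1-w)*(hh(- k)(1/w)/(1-1/w))* circle_factor w k=1"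
  using G_circle_factor[OF w, of k] False hh_G[OF reg(1) False, of k] hh_G[OF reg(2) w1, of "- k"] by simp
 finally show ?thesis by simp
next
 case True
 show ?thesis
 proof(cases "int r dvd k")
  case True
  then obtain j where "k=int r * j" by(auto simp: dvd_def)
  then have "p powi k=(p^r) powi j" by(simp add: power_int_mult)
  then have "jtheta(1 * p powi k)(p^r)=0" using pr(2) by(subst jtheta_eq_0_iff[OF pr]) auto
  then show ?thesis using \<open>w=1\<close> by(simp add: circle_factor_def)
 next
  case False
  then show ?thesis using \<open>w=1\<close> hh_1[of k] by simp
 qed
qed

definition cdata :: "(complex => complex) => (complex => complex) => complex => int => complex" where
 "cdata F1 H1=core S' n 0(s 1) \<nu> (%x. F1 x * jtheta(x\<^sup>2)(p^r))(%x. H1 x * jtheta(x\<^sup>2)(q^r))"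

lemma minor_integrand:
 assumes z: "norm z=1" and m: "0\<le>m" "m<int r"
 shows "core_base(Suc n)(%x. (theta_prod(p^r) x X1 * F1 x)* jtheta(x\<^sup>2)(p^r))
    (%x. (theta_prod(q^r) x X1' * H1 x)* jtheta(x\<^sup>2)(q^r)) m z * pinch_factor S' s \<nu> hh m 1 z
  = cdata F1 H1 z m * pinch_dual 1 z/PQe *(if m=0 then(1-\<i> * z)*(1-1/(\<i> * z)) else 1)"
proof -
 have z0: "z~=0" using z by auto
 define Bp where "Bp=(\<Prod>a\<in>S'. B(s 1 a)(\<nu> a) z m)"
 define fg where "fg=F1(zp z m)* jtheta((zp z m)\<^sup>2)(p^r)*(H1(zq z m)* jtheta((zq z m)\<^sup>2)(q^r))"
 have n1: "norm(- \<i> * z)=1" "norm(\<i> * z)=1" using z by(simp_all add: norm_mult)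
 have i1: "1/(- \<i> * z)=\<i>/z" "1/(\<i> * z) = - \<i>/z" using z0 by(simp_all add: divide_inverse)
 have e1: "hh(m+\<epsilon>)(- \<i> * of_real 1 * z)* hh(- \<epsilon>-m)(\<i> * of_real 1/z)* circle_factor(- \<i> * z)(m+\<epsilon>)=pinch_dual 1 z"
  using hh_circle[OF n1(1), of "m+\<epsilon>"] unfolding i1 pinch_dual_def by(simp add: add.commute)
 have e2: "(if m=0 then hh 0(- \<i> * of_real 1/z)* hh 0(\<i> * of_real 1 * z)
    else G(- \<i> * of_real 1/z)(- m)* G(\<i> * of_real 1 * z) m)* circle_factor(\<i> * z) m
   = (if m=0 then(1-\<i> * z)*(1-1/(\<i> * z)) else 1)"
 proof(cases "m=0")
  case True
  then show ?thesis using hh_circle[OF n1(2), of 0] unfolding i1 by(simp add: mult_ac)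
 next
  case False
  then have "\<not> int r dvd m" using m zdvd_not_zless by auto
  then show ?thesis using False G_circle_factor[OF n1(2), of m] unfolding i1 by(simp add: mult_ac)
 qed
 have pw: "(p * q) powi(int(Suc n+1)* EE m-m)=(p * q) powi(int(n+1)* EE m-m)*(p * q) powi EE m"
  unfolding power_int_add[OF disjI1[OF pq(2)], symmetric] by(rule arg_cong[of _ _ "power_int(p * q)"])(simp add: algebra_simps)
 have inv: "(p * q) powi EE m *(p * q) powi(- EE m)=1"
  unfolding power_int_add[OF disjI1[OF pq(2)], symmetric] by simp
 have cd: "cdata F1 H1 z m=fg *(p * q) powi(int(n+1)* EE m-m)* Bp"
  unfolding cdata_def core_def fg_def Bp_def by(simp only: power_0 mult_1_right)
 have "core_base(Suc n)(%x. (theta_prod(p^r) x X1 * F1 x)* jtheta(x\<^sup>2)(p^r))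
    (%x. (theta_prod(q^r) x X1' * H1 x)* jtheta(x\<^sup>2)(q^r)) m z
   = (theta_prod(p^r)(zp z m) X1 * theta_prod(q^r)(zq z m) X1')* fg *((p * q) powi(int(n+1)* EE m-m)*(p * q) powi EE m)"
  unfolding core_base_def fg_def pw by(simp only: mult_ac)
 also have "\<dots>=circle_factor(- \<i> * z)(m+\<epsilon>)* circle_factor(\<i> * z) m/PQe *(fg *(p * q) powi(int(n+1)* EE m-m))*((p * q) powi EE m *(p * q) powi(- EE m))"
  unfolding theta_pair[OF z0] divide_inverse by(simp only: mult_ac)
 finally have cb: "core_base(Suc n)(%x. (theta_prod(p^r) x X1 * F1 x)* jtheta(x\<^sup>2)(p^r))
    (%x. (theta_prod(q^r) x X1' * H1 x)* jtheta(x\<^sup>2)(q^r)) m z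
   = circle_factor(- \<i> * z)(m+\<epsilon>)* circle_factor(\<i> * z) m/PQe *(fg *(p * q) powi(int(n+1)* EE m-m))"
  unfolding inv mult_1_right .
 define U where "U=(if m=0 then hh 0(- \<i> * of_real 1/z)* hh 0(\<i> * of_real 1 * z)
    else G(- \<i> * of_real 1/z)(- m)* G(\<i> * of_real 1 * z) m)"
 define V where "V=hh(m+\<epsilon>)(- \<i> * of_real 1 * z)* hh(- \<epsilon>-m)(\<i> * of_real 1/z)"
 have pf: "pinch_factor S' s \<nu> hh m 1 z=Bp * V * U" unfolding pinch_factor_def Bp_def U_def V_def ..
 show ?thesis
  unfolding cb pf cd unfolding e2[symmetric] e1[symmetric] unfolding U_def[symmetric] V_def[symmetric]
  by(simp only: divide_inverse mult_ac)
qed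

lemma theta_quotients:
 obtains u u' where "u holomorphic_on(- {0})" "\<And>z. z~=0==>theta_prod(p^r)(zp z 0) X1=(1-\<i> * z)* u z"
  "u' holomorphic_on(- {0})" "\<And>z. z~=0==>theta_prod(q^r)(zq z 0) X1'=(1-\<i> * z)* u' z"
proof -
 have h: "(%z. theta_prod(p^r)(zp z 0) X1) holomorphic_on(- {0})" "(%z. theta_prod(q^r)(zq z 0) X1') holomorphic_on(- {0})"
  by(rule compose_nonzero_holomorphic[OF theta_prod_holomorphic[OF pr X1_nonzero(1)] zp_holomorphic]; simp)
    (rule compose_nonzero_holomorphic[OF theta_prod_holomorphic[OF qr X1_nonzero(2)] zq_holomorphic]; simp)
 have z: "theta_prod(p^r)(zp(- \<i>) 0) X1=0" "theta_prod(q^r)(zq(- \<i>) 0) X1'=0"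
  unfolding X1_def[symmetric] X1'_def[symmetric] by(rule theta_prod_self[OF pr X1_nonzero(1)], rule theta_prod_self[OF qr X1_nonzero(2)])
 obtain u where u: "u holomorphic_on(- {0})" "\<And>z. z~=0==>theta_prod(p^r)(zp z 0) X1=(1-\<i> * z)* u z"
  by(rule pinch_quotient[OF h(1) z(1)])(rule that)
 obtain u' where u': "u' holomorphic_on(- {0})" "\<And>z. z~=0==>theta_prod(q^r)(zq z 0) X1'=(1-\<i> * z)* u' z"
  by(rule pinch_quotient[OF h(2) z(2)])(rule that)
 show ?thesis by(rule that[OF u u'])
qed

abbreviation(input) "bigpair F H \<rho> \<equiv> pairing(insert b(insert c S'))(Suc n)(pinch_param s b c \<rho>) \<nu> F H"

lemma circle_cont: "u holomorphic_on(- {0::complex})==>continuous_on(sphere 0 1) u"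
 by(rule continuous_on_subset[OF holomorphic_on_imp_continuous_on]) auto

lemma theta_mult_even:
 assumes "norm d<1" "d~=0" "X~=0" "even_theta d k F1"
 shows "even_theta d(Suc k)(%x. theta_prod d x X * F1 x)"
 using even_theta_mult[OF theta_prod_even[OF assms(1,2,3)] assms(4)] by simp

text \<open>Both functions vanish at the pinch point, so the double-zero limit applies. Its value is
  again a mean against the dual kernel, now at \<rho> = 1, and \<open>pairing_pinch\<close> reads it
  as a pairing of the smaller system.\<close>

lemma minor_limit:
 assumes n: "n=Suc k" and F1: "even_theta(p^r) k F1" and H1: "even_theta(q^r) k H1"
 shows "(bigpair(%x. theta_prod(p^r) x X1 * F1 x)(%x. theta_prod(q^r) x X1' * H1 x)
   \<longlongrightarrow> pairing S' n(s 1) \<nu> F1 H1/PQe)(at_left 1)"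
proof -
 define F where "F=(%x. theta_prod(p^r) x X1 * F1 x)"
 define H where "H=(%x. theta_prod(q^r) x X1' * H1 x)"
 have F: "even_theta(p^r) n F" and H: "even_theta(q^r) n H"
  unfolding F_def H_def n by(rule theta_mult_even[OF pr X1_nonzero(1) F1], rule theta_mult_even[OF qr X1_nonzero(2) H1])
 obtain u u' where u: "u holomorphic_on(- {0})" "\<And>z. z~=0==>theta_prod(p^r)(zp z 0) X1=(1-\<i> * z)* u z"
  and u': "u' holomorphic_on(- {0})" "\<And>z. z~=0==>theta_prod(q^r)(zq z 0) X1'=(1-\<i> * z)* u' z"
  by(rule theta_quotients)(rule that)
 define \<beta> where "\<beta>=(%z. u z * u' z * core_base(Suc n)(%x. F1 x * jtheta(x\<^sup>2)(p^r))(%x. H1 x * jtheta(x\<^sup>2)(q^r)) 0 z)"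
 have \<beta>c: "continuous_on(sphere 0 1) \<beta>"
  unfolding \<beta>_def by(intro continuous_on_mult circle_cont u(1) u'(1) core_base_continuous holomorphic_on_mult
    even_thetaD(1)[OF F1] even_thetaD(1)[OF H1] jtheta_square_holomorphic pr qr)
 let ?b = "core_base(Suc n)(%x. F x * jtheta(x\<^sup>2)(p^r))(%x. H x * jtheta(x\<^sup>2)(q^r))"
 have \<beta>: "?b 0 z=(1-\<i> * z)\<^sup>2 * \<beta> z" if "norm z=1" for z
 proof -
  have "z~=0" using that by auto
  then show ?thesis unfolding core_base_def \<beta>_def F_def H_def by(simp add: u(2) u'(2) power2_eq_square mult_ac)
 qed
 have mi: "?b m z * pinch_factor S' s \<nu> hh m 1 z=cdata F1 H1 z m * pinch_dual 1 z/PQe *(if m=0 then(1-\<i> * z)*(1-1/(\<i> * z)) else 1)"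
  if "norm z=1" "0\<le>m" "m<int r" for z m
  using minor_integrand[OF that, of F1 H1] unfolding F_def H_def .
 have oF: "odd_theta(p^r) n(%x. F1 x * jtheta(x\<^sup>2)(p^r))" and oH: "odd_theta(q^r) n(%x. H1 x * jtheta(x\<^sup>2)(q^r))"
  unfolding n by(rule even_theta_imp_odd_theta[OF pr F1], rule even_theta_imp_odd_theta[OF qr H1])
 have cc: "continuous_on(sphere 0 1)(%z. cdata F1 H1 z m * pinch_dual 1 z)" for m
  unfolding cdata_def pinch_dual_def
  by(intro continuous_on_mult core_continuous_circle[OF base odd_thetaD(1)[OF oF] odd_thetaD(1)[OF oH]] continuous_intros) auto
 have 0: "cmean 1(%z. - (\<i> * z)*(\<beta> z * pinch_factor S' s \<nu> hh 0 1 z))=cmean 1(%z. cdata F1 H1 z 0 * pinch_dual 1 z/PQe)"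
 proof(rule cmean_cong_except)
  have "continuous_on(sphere 0 1)(%z. \<beta> z * pinch_factor S' s \<nu> hh 0 1 z)"
   using pinch_slice[OF \<rho>0 pinch_product_continuous[OF \<beta>c, of 0], of 1] r0 \<rho>0 by simp
  then show "continuous_on(sphere 0 1)(%z. - (\<i> * z)*(\<beta> z * pinch_factor S' s \<nu> hh 0 1 z))"
   by(intro continuous_on_mult[where f = "%z. - (\<i> * z)"])(auto intro!: continuous_intros)
  show "continuous_on(sphere 0 1)(%z. cdata F1 H1 z 0 * pinch_dual 1 z/PQe)"
   using cc[of 0] by(intro continuous_on_divide continuous_on_const)(auto simp: PQe_def)
  fix z :: complex assume z: "norm z=1" "z ~=-\<i>"
  define w where "w=\<i> * z"
  have w0: "w~=0" using z by(auto simp: w_def)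
  have w1: "1-w~=0"
  proof
   assume "1-w=0"
   then have "\<i> *(\<i> * z)=\<i> * 1" by(simp add: w_def)
   then have "- z=\<i>" by(simp add: mult.assoc[symmetric])
   then show False using z(2) by(metis minus_minus)
  qed
  have "(1-w)\<^sup>2 *(\<beta> z * pinch_factor S' s \<nu> hh 0 1 z)=cdata F1 H1 z 0 * pinch_dual 1 z/PQe *((1-w)*(1-1/w))"
   using mi[OF z(1), of 0] r0 unfolding \<beta>[OF z(1)] w_def by(simp add: mult.assoc)
  then have "- w *((1-w)\<^sup>2 *(\<beta> z * pinch_factor S' s \<nu> hh 0 1 z)) = - w *(cdata F1 H1 z 0 * pinch_dual 1 z/PQe *((1-w)*(1-1/w)))"
   by(simp only:)
  also have "\<dots>=(1-w)\<^sup>2 *(cdata F1 H1 z 0 * pinch_dual 1 z/PQe)"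
  proof -
   have "- w *(D *((1-w)*(1-1/w)))=(1-w)\<^sup>2 * D" for D
    using w0 by(simp add: field_simps power2_eq_square)
   then show ?thesis .
  qed
  finally have "(1-w)\<^sup>2 *(- w *(\<beta> z * pinch_factor S' s \<nu> hh 0 1 z))=(1-w)\<^sup>2 *(cdata F1 H1 z 0 * pinch_dual 1 z/PQe)"
   by(simp only: mult.left_commute)
  moreover have "(1-w)\<^sup>2~=0" using w1 by simp
  ultimately show "- (\<i> * z)*(\<beta> z * pinch_factor S' s \<nu> hh 0 1 z)=cdata F1 H1 z 0 * pinch_dual 1 z/PQe"
   unfolding w_def[symmetric] using mult_left_cancel by blast
 qed
 have 1: "(\<Sum>m\<in>{1..<int r}. cmean 1(%z. ?b m z * pinch_factor S' s \<nu> hh m 1 z))=(\<Sum>m\<in>{1..<int r}. cmean 1(%z. cdata F1 H1 z m * pinch_dual 1 z/PQe))"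
  by(intro sum.cong refl cmean_cong)(use mi in auto)
 have "cmean 1(%z. cdata F1 H1 z 0 * pinch_dual 1 z/PQe)+(\<Sum>m\<in>{1..<int r}. cmean 1(%z. cdata F1 H1 z m * pinch_dual 1 z/PQe))
   = (\<Sum>m\<in>insert 0 {1..<int r}. cmean 1(%z. cdata F1 H1 z m * pinch_dual 1 z/PQe))" by simp
 also have "insert 0 {1..<int r}={0..<int r}" using r0 by auto
 also have "(\<Sum>m\<in>{0..<int r}. cmean 1(%z. cdata F1 H1 z m * pinch_dual 1 z/PQe))=(1/PQe)*(\<Sum>m\<in>{0..<int r}. cmean 1(%z. cdata F1 H1 z m * pinch_dual 1 z))"
  unfolding sum_distrib_left cmean_cmult[symmetric] by simp
 also have "(\<Sum>m\<in>{0..<int r}. cmean 1(%z. cdata F1 H1 z m * pinch_dual 1 z))=2 * pairing S' n(s 1) \<nu> F1 H1"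
  using pairing_pinch[OF base oF oH, of 1] unfolding cdata_def by simp
 finally have v: "(cmean 1(%z. - (\<i> * z)*(\<beta> z * pinch_factor S' s \<nu> hh 0 1 z))+(\<Sum>m\<in>{1..<int r}. cmean 1(%z. ?b m z * pinch_factor S' s \<nu> hh m 1 z)))/2
   = pairing S' n(s 1) \<nu> F1 H1/PQe" unfolding 0 1 by simp
 show ?thesis using pairing_limit_double_zero[OF F H \<beta>c \<beta>] unfolding v unfolding F_def H_def .
qed

text \<open>Only one of the two functions vanishes at the pinch point; the entry may grow, but the
  scaling sqrt(1 - \<rho>^2) still sends it to 0.\<close>

lemma row_limit:
 assumes n: "n=Suc k" and F1: "even_theta(p^r) k F1" and H: "even_theta(q^r) n H"
 shows "((%\<rho>. of_real(sqrt(1-\<rho>\<^sup>2))* bigpair(%x. theta_prod(p^r) x X1 * F1 x) H \<rho>)\<longlongrightarrow>0)(at_left 1)"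
proof -
 have F: "even_theta(p^r) n(%x. theta_prod(p^r) x X1 * F1 x)"
  unfolding n by(rule theta_mult_even[OF pr X1_nonzero(1) F1])
 obtain u u' where u: "u holomorphic_on(- {0})" "\<And>z. z~=0==>theta_prod(p^r)(zp z 0) X1=(1-\<i> * z)* u z"
  and u': "u' holomorphic_on(- {0})" "\<And>z. z~=0==>theta_prod(q^r)(zq z 0) X1'=(1-\<i> * z)* u' z"
  by(rule theta_quotients)(rule that)
 define \<beta> where "\<beta>=(%z. u z * core_base(Suc n)(%x. F1 x * jtheta(x\<^sup>2)(p^r))(%x. H x * jtheta(x\<^sup>2)(q^r)) 0 z)"
 have \<beta>c: "continuous_on(sphere 0 1) \<beta>"
  unfolding \<beta>_def by(intro continuous_on_mult circle_cont u(1) core_base_continuous holomorphic_on_mult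
    even_thetaD(1)[OF F1] even_thetaD(1)[OF H] jtheta_square_holomorphic pr qr)
 show ?thesis
 proof(rule pairing_limit_simple_zero[OF F H \<beta>c])
  fix z :: complex assume "norm z=1"
  then have "z~=0" by auto
  then show "core_base(Suc n)(%x. theta_prod(p^r) x X1 * F1 x * jtheta(x\<^sup>2)(p^r))(%x. H x * jtheta(x\<^sup>2)(q^r)) 0 z=(1-\<i> * z)* \<beta> z"
   unfolding core_base_def \<beta>_def by(simp add: u(2) mult_ac)
 qed
qed

lemma column_limit:
 assumes n: "n=Suc k" and F: "even_theta(p^r) n F" and H1: "even_theta(q^r) k H1"
 shows "((%\<rho>. of_real(sqrt(1-\<rho>\<^sup>2))* bigpair F(%x. theta_prod(q^r) x X1' * H1 x) \<rho>)\<longlongrightarrow>0)(at_left 1)"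
proof -
 have H: "even_theta(q^r) n(%x. theta_prod(q^r) x X1' * H1 x)"
  unfolding n by(rule theta_mult_even[OF qr X1_nonzero(2) H1])
 obtain u u' where u: "u holomorphic_on(- {0})" "\<And>z. z~=0==>theta_prod(p^r)(zp z 0) X1=(1-\<i> * z)* u z"
  and u': "u' holomorphic_on(- {0})" "\<And>z. z~=0==>theta_prod(q^r)(zq z 0) X1'=(1-\<i> * z)* u' z"
  by(rule theta_quotients)(rule that)
 define \<beta> where "\<beta>=(%z. u' z * core_base(Suc n)(%x. F x * jtheta(x\<^sup>2)(p^r))(%x. H1 x * jtheta(x\<^sup>2)(q^r)) 0 z)"
 have \<beta>c: "continuous_on(sphere 0 1) \<beta>"
  unfolding \<beta>_def by(intro continuous_on_mult circle_cont u'(1) core_base_continuous holomorphic_on_mult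
    even_thetaD(1)[OF F] even_thetaD(1)[OF H1] jtheta_square_holomorphic pr qr)
 show ?thesis
 proof(rule pairing_limit_simple_zero[OF F H \<beta>c])
  fix z :: complex assume "norm z=1"
  then have "z~=0" by auto
  then show "core_base(Suc n)(%x. F x * jtheta(x\<^sup>2)(p^r))(%x. theta_prod(q^r) x X1' * H1 x * jtheta(x\<^sup>2)(q^r)) 0 z=(1-\<i> * z)* \<beta> z"
   unfolding core_base_def \<beta>_def by(simp add: u'(2) mult_ac)
 qed
qed

definition Bprod :: complex where "Bprod=(\<Prod>a\<in>S'. B(s 1 a)(\<nu> a)(- \<i>) 0)"

text \<open>Neither function vanishes at the pinch point, so the pole survives. There hh at -1 and
  the theta functions of the squared base points multiply to 4 by \<open>hh_circle\<close>; halving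
  gives the constant 2.\<close>

lemma corner_limit:
 assumes F: "even_theta(p^r) n F" and H: "even_theta(q^r) n H"
 shows "((%\<rho>. of_real(1-\<rho>\<^sup>2)* bigpair F H \<rho>)\<longlongrightarrow>2 * res0\<^sup>2 * F X1 * H X1' * Bprod)(at_left 1)"
proof -
 have i: "\<i> * 1/(- \<i>) = - 1" "- \<i> * 1 *(- \<i>) = - 1" "- \<i> * 1/(- \<i>)=1" "\<i> * 1 *(- \<i>)=1" by(simp_all add: divide_inverse)
 have pf: "pinch_factor S' s \<nu> hh 0 1(- \<i>)=Bprod *(hh \<epsilon> (- 1)* hh(- \<epsilon>)(- 1))*(res0 * res0)"
  unfolding pinch_factor_def Bprod_def of_real_1 i hh_0[symmetric] by simp
 have "\<epsilon> *(\<epsilon>-1) div 2=0" using eps by auto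
 then have "circle_factor(- 1) \<epsilon>=jtheta(X1\<^sup>2)(p^r)* jtheta(X1'\<^sup>2)(q^r)"
  unfolding circle_factor_def X1_squares by simp
 then have c: "hh \<epsilon> (- 1)* hh(- \<epsilon>)(- 1)*(jtheta(X1\<^sup>2)(p^r)* jtheta(X1'\<^sup>2)(q^r))=4"
  using hh_circle[of "- 1" \<epsilon>] by simp
 have E0: "EE 0=0" by(simp add: EE_def)
 have cb: "core_base(Suc n)(%x. F x * jtheta(x\<^sup>2)(p^r))(%x. H x * jtheta(x\<^sup>2)(q^r)) 0(- \<i>)
   = F X1 * H X1' *(jtheta(X1\<^sup>2)(p^r)* jtheta(X1'\<^sup>2)(q^r))"
  unfolding core_base_def X1_def[symmetric] X1'_def[symmetric] E0 by(simp add: mult_ac)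
 have "core_base(Suc n)(%x. F x * jtheta(x\<^sup>2)(p^r))(%x. H x * jtheta(x\<^sup>2)(q^r)) 0(- \<i>)* pinch_factor S' s \<nu> hh 0 1(- \<i>)/2
   = F X1 * H X1' * Bprod *(res0 * res0)*(hh \<epsilon> (- 1)* hh(- \<epsilon>)(- 1)*(jtheta(X1\<^sup>2)(p^r)* jtheta(X1'\<^sup>2)(q^r)))/2"
  unfolding pf cb by(simp only: mult_ac)
 also have "\<dots>=2 * res0\<^sup>2 * F X1 * H X1' * Bprod" unfolding c by(simp add: power2_eq_square)
 finally have "core_base(Suc n)(%x. F x * jtheta(x\<^sup>2)(p^r))(%x. H x * jtheta(x\<^sup>2)(q^r)) 0(- \<i>)* pinch_factor S' s \<nu> hh 0 1(- \<i>)/2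
   = 2 * res0\<^sup>2 * F X1 * H X1' * Bprod" .
 from pairing_limit_pole[OF F H, unfolded this] show ?thesis .
qed

end

section \<open>Limit of the determinant and recursion in the number of variables\<close>

lemma det_mat_expand:
 "det(mat N N(%(i, k). R i k))=(\<Sum>\<sigma>\<in>{\<sigma>. \<sigma> permutes {0..<N}}. signof \<sigma> *(\<Prod>i=0..<N. R i(\<sigma> i)))"
 for R :: "nat => nat => complex"
 unfolding det_def by(auto intro!: sum.cong prod.cong dest: permutes_in_image simp: atLeast0LessThan)

lemma det_tendsto:
 fixes M :: "'x => nat => nat => complex"
 assumes "\<And>i k. i<N==>k<N==>((%x. M x i k)\<longlongrightarrow>L i k) A"
 shows "((%x. det(mat N N(%(i, k). M x i k)))\<longlongrightarrow>det(mat N N(%(i, k). L i k))) A"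
 unfolding det_mat_expand
proof(intro tendsto_sum tendsto_mult tendsto_const tendsto_prod)
 fix \<sigma> i assume \<sigma>: "\<sigma>\<in>{\<sigma>. \<sigma> permutes {0..<N}}" "i\<in>{0..<N}"
 then have "\<sigma> i<N" using permutes_in_image[of \<sigma> "{0..<N}" i] by auto
 then show "((%x. M x i(\<sigma> i))\<longlongrightarrow>L i(\<sigma> i)) A" using \<sigma> by(intro assms) auto
qed

lemma det_scale_rows_columns:
 fixes d :: "nat => complex"
 shows "det(mat N N(%(i, k). d i * d k * R i k))=(\<Prod>i=0..<N. d i)\<^sup>2 * det(mat N N(%(i, k). R i k))"
 unfolding det_mat_expand sum_distrib_left
proof(rule sum.cong[OF refl])
 fix \<sigma> assume "\<sigma>\<in>{\<sigma>. \<sigma> permutes {0..<N}}"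
 then have "(\<Prod>i=0..<N. d(\<sigma> i))=(\<Prod>i=0..<N. d i)"
  using prod.permute[of \<sigma> "{0..<N}" d] by(simp add: o_def)
 then show "signof \<sigma> *(\<Prod>i=0..<N. d i * d(\<sigma> i)* R i(\<sigma> i))=(\<Prod>i=0..<N. d i)\<^sup>2 *(signof \<sigma> *(\<Prod>i=0..<N. R i(\<sigma> i)))"
  by(simp add: prod.distrib power2_eq_square)
qed

lemma det_corner:
 fixes L :: "nat => nat => complex"
 assumes "\<And>a. L(Suc a) 0=0"
 shows "det(mat(Suc n)(Suc n)(%(i, k). L i k))=L 0 0 * det(mat n n(%(i, k). L(Suc i)(Suc k)))"
proof -
 define A where "A=mat(Suc n)(Suc n)(%(i, k). L i k)"
 have A: "A\<in>carrier_mat(Suc n)(Suc n)" by(simp add: A_def)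
 have "det A=(\<Sum>i<Suc n. A $$ (i, 0)* cofactor A i 0)"
  by(rule laplace_expansion_column[OF A]) simp
 also have "\<dots>=(\<Sum>i<Suc n. if i=0 then L 0 0 * cofactor A 0 0 else 0)"
 proof(rule sum.cong[OF refl])
  fix i assume "i\<in>{..<Suc n}"
  then show "A $$ (i, 0)* cofactor A i 0=(if i=0 then L 0 0 * cofactor A 0 0 else 0)"
   using assms by(cases i)(auto simp: A_def)
 qed
 also have "\<dots>=L 0 0 * det(mat_delete A 0 0)" by(simp add: cofactor_def)
 also have "mat_delete A 0 0=mat n n(%(i, k). L(Suc i)(Suc k))"
  by(rule eq_matI)(auto simp: mat_delete_def A_def)
 finally show ?thesis unfolding A_def .
qed

lemma theta_mono_Suc: "theta_mono d X Y n(Suc a)=(%x. theta_prod d x X * theta_mono d X Y(n-1) a x)"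
 by(rule ext)(simp add: theta_mono_def)

lemma theta_exponent: "Suc n *(Suc n-1) div 2=n+n *(n-1) div 2"
proof -
 have "Suc n *(Suc n-1)=2 * n+n *(n-1)" by(cases n) auto
 then show ?thesis by simp
qed

context pinching
begin

text \<open>Row 0 and column 0 are each scaled by sqrt(1 - \<rho>^2). In the limit the matrix is
  block diagonal: the corner carries the pole, and the other block is the pairing matrix for n
  variables.\<close>

lemma TT_limit:
 "((%\<rho>. of_real(1-\<rho>\<^sup>2)* TT(insert b(insert c S'))(Suc n)(pinch_param s b c \<rho>) \<nu>)
  \<longlongrightarrow> of_nat(Suc n)*(4 * of_real pi * \<i>)* res0\<^sup>2 * Bprod/PQe^n * TT S' n(s 1) \<nu>)(at_left 1)"
proof -
 obtain Y Y' where Y: "generic(p^r) X1 Y" "generic(q^r) X1' Y'" by(rule generic_X1)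
 let ?S = "insert b(insert c S')"
 define cc where "cc=theta_prod(p^r) X1 Y"
 define cc' where "cc'=theta_prod(q^r) X1' Y'"
 have cc0: "cc~=0" "cc'~=0" using genericD(4) Y by(auto simp: cc_def cc'_def)
 define u where "u=(%d i. theta_mono(p^r) X1 Y d i)"
 define u' where "u'=(%d i. theta_mono(q^r) X1' Y' d i)"
 have ue: "even_theta(p^r) d(u d i)" "even_theta(q^r) d(u' d i)" if "i\<le>d" for d i
  unfolding u_def u'_def by(rule theta_mono_even[OF pr Y(1) that], rule theta_mono_even[OF qr Y(2) that])
 define M where "M=(%\<rho> i k. bigpair(u n i)(u' n k) \<rho>)"
 define d where "d=(%\<rho> (i::nat). if i=0 then complex_of_real(sqrt(1-\<rho>\<^sup>2)) else 1 :: complex)"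
 define E where "E=2 * res0\<^sup>2 * cc^n * cc'^n * Bprod"
 define L where "L=(%i k. if i=0\<and>k=0 then E else if i=0 \<or> k=0 then 0
   else(1/PQe)* pairing S' n(s 1) \<nu> (u(n-1)(i-1))(u'(n-1)(k-1)))"
 have sq: "eventually(%\<rho>. complex_of_real(sqrt(1-\<rho>\<^sup>2))* complex_of_real(sqrt(1-\<rho>\<^sup>2)) = of_real(1-\<rho>\<^sup>2))(at_left 1)"
  using eventually_rho
 proof eventually_elim
  case(elim \<rho>)
  then have "\<rho>\<^sup>2\<le>1" using \<rho>0 by(simp add: power_le_one)
  then show ?case unfolding of_real_mult[symmetric] by simp
 qed
 have ent: "((%\<rho>. d \<rho> i * d \<rho> k * M \<rho> i k)\<longlongrightarrow>L i k)(at_left 1)" if ik: "i<Suc n" "k<Suc n" for i k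
 proof -
  consider "i=0" "k=0" | j where "i=0" "k=Suc j" | a where "i=Suc a" "k=0" | a j where "i=Suc a" "k=Suc j"
   by(cases i; cases k) auto
  then show ?thesis
  proof cases
   case 1
   have "u n 0 X1=cc^n" "u' n 0 X1'=cc'^n" by(simp_all add: u_def u'_def theta_mono_def cc_def cc'_def)
   then have "((%\<rho>. of_real(1-\<rho>\<^sup>2)* M \<rho> 0 0)\<longlongrightarrow>E)(at_left 1)"
    using corner_limit[OF ue(1)[OF le0] ue(2)[OF le0]] unfolding M_def E_def by simp
   moreover have "eventually(%\<rho>. of_real(1-\<rho>\<^sup>2)* M \<rho> 0 0=d \<rho> 0 * d \<rho> 0 * M \<rho> 0 0)(at_left 1)"
    using sq by eventually_elim(simp add: d_def)
   ultimately show ?thesis using 1 by(simp add: L_def Lim_transform_eventually)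
  next
   case(2 j)
   then obtain k' where n: "n=Suc k'" using ik by(cases n) auto
   have "((%\<rho>. of_real(sqrt(1-\<rho>\<^sup>2))* bigpair(u n 0)(%x. theta_prod(q^r) x X1' * u' k' j x) \<rho>)\<longlongrightarrow>0)(at_left 1)"
    by(rule column_limit[OF n ue(1)[OF le0] ue(2)])(use 2 ik n in simp)
   moreover have "(%x. theta_prod(q^r) x X1' * u' k' j x)=u' n(Suc j)" unfolding u'_def theta_mono_Suc n by simp
   ultimately show ?thesis using 2 by(simp add: L_def d_def M_def)
  next
   case(3 a)
   then obtain k' where n: "n=Suc k'" using ik by(cases n) auto
   have "((%\<rho>. of_real(sqrt(1-\<rho>\<^sup>2))* bigpair(%x. theta_prod(p^r) x X1 * u k' a x)(u' n 0) \<rho>)\<longlongrightarrow>0)(at_left 1)"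
    by(rule row_limit[OF n ue(1) ue(2)[OF le0]])(use 3 ik n in simp)
   moreover have "(%x. theta_prod(p^r) x X1 * u k' a x)=u n(Suc a)" unfolding u_def theta_mono_Suc n by simp
   ultimately show ?thesis using 3 by(simp add: L_def d_def M_def)
  next
   case(4 a j)
   then obtain k' where n: "n=Suc k'" using ik by(cases n) auto
   have "(bigpair(%x. theta_prod(p^r) x X1 * u k' a x)(%x. theta_prod(q^r) x X1' * u' k' j x)
     \<longlongrightarrow> pairing S' n(s 1) \<nu> (u k' a)(u' k' j)/PQe)(at_left 1)"
    by(rule minor_limit[OF n ue(1) ue(2)])(use 4 ik n in simp_all)
   moreover have "(%x. theta_prod(p^r) x X1 * u k' a x)=u n(Suc a)" "(%x. theta_prod(q^r) x X1' * u' k' j x)=u' n(Suc j)"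
    unfolding u_def u'_def theta_mono_Suc n by simp_all
   ultimately show ?thesis using 4 n by(simp add: L_def d_def M_def)
  qed
 qed
 have "((%\<rho>. det(mat(Suc n)(Suc n)(%(i, k). d \<rho> i * d \<rho> k * M \<rho> i k)))\<longlongrightarrow>det(mat(Suc n)(Suc n)(%(i, k). L i k)))(at_left 1)"
  by(rule det_tendsto)(rule ent)
 moreover have "det(mat(Suc n)(Suc n)(%(i, k). L i k))=E *((1/PQe)^n * det(pmat S' n(s 1) \<nu> X1 Y X1' Y'))"
 proof -
  have "det(mat(Suc n)(Suc n)(%(i, k). L i k))=L 0 0 * det(mat n n(%(i, k). L(Suc i)(Suc k)))"
   by(rule det_corner)(simp add: L_def)
  also have "L 0 0=E" by(simp add: L_def)
  also have "det(mat n n(%(i, k). L(Suc i)(Suc k)))=(1/PQe)^n * det(mat n n(%(i, k). pairing S' n(s 1) \<nu> (u(n-1) i)(u'(n-1) k)))"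
   unfolding det_scale_mat[symmetric] by(simp add: L_def)
  finally show ?thesis unfolding pmat_def u_def u'_def .
 qed
 ultimately have lim: "((%\<rho>. det(mat(Suc n)(Suc n)(%(i, k). d \<rho> i * d \<rho> k * M \<rho> i k)))\<longlongrightarrow>E *((1/PQe)^n * det(pmat S' n(s 1) \<nu> X1 Y X1' Y')))(at_left 1)"
  by simp
 define K where "K=(%k. (cc * cc')^(k *(k-1) div 2))"
 have K0: "K k~=0" for k using cc0 by(simp add: K_def)
 have KS: "K(Suc n)=cc^n * cc'^n * K n" unfolding K_def theta_exponent by(simp add: power_add power_mult_distrib)
 define \<alpha> where "\<alpha>=(2 * of_real pi * \<i> :: complex)"
 have \<alpha>0: "\<alpha>~=0" by(simp add: \<alpha>_def)
 have ev: "eventually(%\<rho>. fact(Suc n)* \<alpha>^Suc n/K(Suc n)* det(mat(Suc n)(Suc n)(%(i, k). d \<rho> i * d \<rho> k * M \<rho> i k))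
   = of_real(1-\<rho>\<^sup>2)* TT ?S(Suc n)(pinch_param s b c \<rho>) \<nu>)(at_left 1)"
  using eventually_conj[OF eventually_rho sq]
 proof eventually_elim
  case(elim \<rho>)
  have "K(Suc n)* TT ?S(Suc n)(pinch_param s b c \<rho>) \<nu>=fact(Suc n)* \<alpha>^Suc n * det(pmat ?S(Suc n)(pinch_param s b c \<rho>) \<nu> X1 Y X1' Y')"
   unfolding K_def cc_def cc'_def \<alpha>_def by(rule TT_det[OF bal Y])(use elim in auto)
  moreover have "pmat ?S(Suc n)(pinch_param s b c \<rho>) \<nu> X1 Y X1' Y'=mat(Suc n)(Suc n)(%(i, k). M \<rho> i k)"
   unfolding pmat_def M_def u_def u'_def by simp
  ultimately have T: "TT ?S(Suc n)(pinch_param s b c \<rho>) \<nu>=fact(Suc n)* \<alpha>^Suc n * det(mat(Suc n)(Suc n)(%(i, k). M \<rho> i k))/K(Suc n)"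
   using K0 by(simp add: nonzero_eq_divide_eq mult.commute)
  have "(\<Prod>i=0..<Suc n. d \<rho> i)=complex_of_real(sqrt(1-\<rho>\<^sup>2))"
  proof -
   have "(\<Prod>i=0..<Suc n. d \<rho> i)=d \<rho> 0 *(\<Prod>i=0..<n. d \<rho> (Suc i))" by(simp only: prod.atLeast0_lessThan_Suc_shift o_def)
   then show ?thesis by(simp add: d_def)
  qed
  then have "(\<Prod>i=0..<Suc n. d \<rho> i)\<^sup>2 = of_real(1-\<rho>\<^sup>2)" using elim by(simp add: power2_eq_square)
  then show ?case unfolding T det_scale_rows_columns by(simp add: mult_ac)
 qed
 have "((%\<rho>. fact(Suc n)* \<alpha>^Suc n/K(Suc n)* det(mat(Suc n)(Suc n)(%(i, k). d \<rho> i * d \<rho> k * M \<rho> i k)))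
   \<longlongrightarrow> fact(Suc n)* \<alpha>^Suc n/K(Suc n)*(E *((1/PQe)^n * det(pmat S' n(s 1) \<nu> X1 Y X1' Y'))))(at_left 1)"
  by(intro tendsto_mult tendsto_const lim)
 then have lim2: "((%\<rho>. of_real(1-\<rho>\<^sup>2)* TT ?S(Suc n)(pinch_param s b c \<rho>) \<nu>)
   \<longlongrightarrow> fact(Suc n)* \<alpha>^Suc n/K(Suc n)*(E *((1/PQe)^n * det(pmat S' n(s 1) \<nu> X1 Y X1' Y'))))(at_left 1)"
  by(rule Lim_transform_eventually[OF _ ev])
 have Tn: "K n * TT S' n(s 1) \<nu>=fact n * \<alpha>^n * det(pmat S' n(s 1) \<nu> X1 Y X1' Y')"
  unfolding K_def cc_def cc'_def \<alpha>_def by(rule TT_det[OF base Y])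
 have "fact(Suc n)* \<alpha>^Suc n/K(Suc n)*(E *((1/PQe)^n * det(pmat S' n(s 1) \<nu> X1 Y X1' Y')))
   = of_nat(Suc n)* \<alpha>/K(Suc n)*(E *((1/PQe)^n *(fact n * \<alpha>^n * det(pmat S' n(s 1) \<nu> X1 Y X1' Y'))))"
  by(simp add: mult_ac)
 also have "\<dots> = of_nat(Suc n)* \<alpha> *(2 * res0\<^sup>2)* Bprod/PQe^n * TT S' n(s 1) \<nu> *((cc^n * cc'^n * K n)/K(Suc n))"
  unfolding Tn[symmetric] E_def by(simp add: power_one_over divide_inverse power_inverse mult_ac)
 also have "(cc^n * cc'^n * K n)/K(Suc n)=1" unfolding KS[symmetric] using K0 by simp
 also have "of_nat(Suc n)* \<alpha> *(2 * res0\<^sup>2)* Bprod/PQe^n * TT S' n(s 1) \<nu> * 1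
   = of_nat(Suc n)*(4 * of_real pi * \<i>)* res0\<^sup>2 * Bprod/PQe^n * TT S' n(s 1) \<nu>"
  by(simp add: \<alpha>_def)
 finally show ?thesis using lim2 by simp
qed

lemma s_tendsto: "a\<in>S'==>((%\<rho>. s \<rho> a)\<longlongrightarrow>s 1 a)(at_left 1)"
 using s_cont[of a] \<rho>0 by(auto simp: continuous_on_def at_within_Icc_at_left dest!: bspec[of _ _ 1])

text \<open>Only the pair (b, c) approaches a pole, with coefficient res0. The pairs of b and c with
  the other parameters give \<open>Bprod\<close>, the same factor as in the corner of the
  determinant.\<close>

lemma RR_limit:
 "((%\<rho>. of_real(1-\<rho>\<^sup>2)* RR(insert b(insert c S'))(pinch_param s b c \<rho>) \<nu>)
  \<longlongrightarrow> res0 * Bprod * RR S'(s 1) \<nu>)(at_left 1)"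
proof -
 let ?T = "pinch_param s b c"
 have sd: "s 1 a~=0" "norm(s 1 a)<1" if "a\<in>S'" for a using s_disc[of 1 a] \<rho>0 that by auto
 have ev: "eventually(%\<rho>. hh 0(of_real(\<rho>\<^sup>2))*(\<Prod>a\<in>S'. G(- \<i> * of_real \<rho> * s \<rho> a)(\<nu> a+\<epsilon>)* G(\<i> * of_real \<rho> * s \<rho> a)(\<nu> a))* RR S'(s \<rho>) \<nu>
   = of_real(1-\<rho>\<^sup>2)* RR(insert b(insert c S'))(?T \<rho>) \<nu>)(at_left 1)"
  using eventually_rho
 proof eventually_elim
  case(elim \<rho>)
  have r1: "0<\<rho>\<^sup>2" "\<rho>\<^sup>2<1" using elim \<rho>0 by(auto simp: power_less_one_iff abs_square_less_1)
  have "\<rho>\<^sup>2 * mx\<le>1 * mx" using r1 mx by(intro mult_right_mono) auto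
  then have "\<rho>\<^sup>2 * mx<1" using mx by linarith
  then have reg: "of_real(\<rho>\<^sup>2)\<in>regdom" using r1 by(simp add: norm_power)
  have r2: "complex_of_real(\<rho>\<^sup>2)~=1" using r1 of_real_eq_1_iff[of "\<rho>\<^sup>2", where ?'a=complex] by linarith
  then have g0: "of_real(1-\<rho>\<^sup>2)* G(of_real(\<rho>\<^sup>2)) 0=hh 0(of_real(\<rho>\<^sup>2))"
   using hh_G[OF reg r2, of 0] by simp
  have "RR(insert b(insert c S'))(?T \<rho>) \<nu>=G(?T \<rho> b * ?T \<rho> c)(\<nu> b+\<nu> c+\<epsilon>)
    *(\<Prod>a\<in>S'. G(?T \<rho> b * ?T \<rho> a)(\<nu> b+\<nu> a+\<epsilon>)* G(?T \<rho> c * ?T \<rho> a)(\<nu> c+\<nu> a+\<epsilon>))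
    * pairp S'(%a b'. G(?T \<rho> a * ?T \<rho> b')(\<nu> a+\<nu> b'+\<epsilon>))"
   unfolding RR_def by(rule pairp_insert2)(use fin bc in \<open>auto simp: mult.commute add_ac\<close>)
  also have "pairp S'(%a b'. G(?T \<rho> a * ?T \<rho> b')(\<nu> a+\<nu> b'+\<epsilon>))=RR S'(s \<rho>) \<nu>"
   unfolding RR_def by(rule pairp_cong)(use bc in \<open>auto simp: pinch_param_def\<close>)
  also have "(\<Prod>a\<in>S'. G(?T \<rho> b * ?T \<rho> a)(\<nu> b+\<nu> a+\<epsilon>)* G(?T \<rho> c * ?T \<rho> a)(\<nu> c+\<nu> a+\<epsilon>))
    = (\<Prod>a\<in>S'. G(- \<i> * of_real \<rho> * s \<rho> a)(\<nu> a+\<epsilon>)* G(\<i> * of_real \<rho> * s \<rho> a)(\<nu> a))"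
   by(rule prod.cong)(use bc in \<open>auto simp: pinch_param_def \<nu>bc\<close>)
  also have "?T \<rho> b * ?T \<rho> c = of_real(\<rho>\<^sup>2)" using bc by(simp add: pinch_param_def power2_eq_square algebra_simps)
  also have "\<nu> b+\<nu> c+\<epsilon>=0" by(simp add: \<nu>bc)
  finally show ?case unfolding g0[symmetric] by(simp only: mult_ac)
 qed
 have L1: "((%\<rho>. hh 0(of_real(\<rho>\<^sup>2)))\<longlongrightarrow>res0)(at_left 1)"
 proof -
  have "isCont(hh 0) 1"
   using hh_hol[of 0] open_punctured_disc mx by(simp add: holomorphic_on_imp_continuous_on continuous_on_eq_continuous_at[symmetric] holomorphic_on_imp_differentiable_at field_differentiable_imp_continuous_at)
  moreover have "((%\<rho>. complex_of_real(\<rho>\<^sup>2)) \<longlongrightarrow> of_real(1\<^sup>2))(at_left 1)" by(intro tendsto_intros)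
  ultimately show ?thesis using isCont_tendsto_compose[of 1 "hh 0" "%\<rho>. complex_of_real(\<rho>\<^sup>2)" "at_left 1"] by(simp add: hh_0)
 qed
 have GL: "((%\<rho>. G(f \<rho>) k)\<longlongrightarrow>G l k)(at_left 1)" if "(f\<longlongrightarrow>l)(at_left 1)" "l~=0" "norm l<1" for f l k
  by(rule isCont_tendsto_compose[OF G_isCont[OF unit_disc_dom[OF that(2,3)]] that(1)])
 have cr: "((%\<rho>. complex_of_real \<rho>) \<longlongrightarrow> of_real 1)(at_left 1)" by(intro tendsto_intros)
 have L2: "((%\<rho>. \<Prod>a\<in>S'. G(- \<i> * of_real \<rho> * s \<rho> a)(\<nu> a+\<epsilon>)* G(\<i> * of_real \<rho> * s \<rho> a)(\<nu> a))\<longlongrightarrow>Bprod)(at_left 1)"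
 proof -
  have "Bprod=(\<Prod>a\<in>S'. G(- \<i> * of_real 1 * s 1 a)(\<nu> a+\<epsilon>)* G(\<i> * of_real 1 * s 1 a)(\<nu> a))"
   unfolding Bprod_def B_def by(rule prod.cong)(simp_all add: divide_inverse mult.commute)
  moreover have "((%\<rho>. \<Prod>a\<in>S'. G(- \<i> * of_real \<rho> * s \<rho> a)(\<nu> a+\<epsilon>)* G(\<i> * of_real \<rho> * s \<rho> a)(\<nu> a))
    \<longlongrightarrow> (\<Prod>a\<in>S'. G(- \<i> * of_real 1 * s 1 a)(\<nu> a+\<epsilon>)* G(\<i> * of_real 1 * s 1 a)(\<nu> a)))(at_left 1)"
   by(intro tendsto_prod tendsto_mult GL cr s_tendsto tendsto_const)(use sd in \<open>auto simp: norm_mult\<close>)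
  ultimately show ?thesis by simp
 qed
 have L3: "((%\<rho>. RR S'(s \<rho>) \<nu>)\<longlongrightarrow>RR S'(s 1) \<nu>)(at_left 1)"
  unfolding RR_def pairp_def
 proof(intro tendsto_prod GL tendsto_mult s_tendsto)
  fix a b' assume "a\<in>S'" "b'\<in>{b'\<in>S'. a<b'}"
  then show "s 1 a * s 1 b'~=0" "norm(s 1 a * s 1 b')<1" "a\<in>S'" "b'\<in>S'"
   using sd norm_pair_less[OF base, of a b'] by auto
 qed
 show ?thesis by(rule Lim_transform_eventually[OF tendsto_mult[OF tendsto_mult[OF L1 L2] L3] ev])
qed

lemma Bprod_nonzero: "Bprod~=0"
proof -
 have "B(s 1 a)(\<nu> a)(- \<i>) 0~=0" if a: "a\<in>S'" for a
 proof -
  have d: "s 1 a~=0" "norm(s 1 a)<1" "norm(p * q)<norm(s 1 a)"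
   using s_disc[of 1 a] \<rho>0 a norm_param_gt[OF base a] by auto
  then have "G(s 1 a * - \<i>) k~=0" "G(s 1 a / - \<i>) k~=0" for k
   by(intro G_nonzero unit_disc_dom; simp add: norm_mult norm_divide)+
  then show ?thesis unfolding B_def by simp
 qed
 then show ?thesis using fin by(simp add: Bprod_def)
qed

text \<open>The quotient is independent of \<rho>, so it equals the quotient of the two limits; one
  factor res0 and \<open>Bprod\<close> cancel.\<close>

lemma KK_recursion:
 assumes \<rho>: "\<rho>\<^sub>0\<le>\<rho>" "\<rho><1"
 shows "KK(insert b(insert c S'))(Suc n)(pinch_param s b c \<rho>) \<nu>
  = of_nat(Suc n)*(4 * of_real pi * \<i>)* res0/PQe^n * KK S' n(s 1) \<nu>"
proof -
 let ?S = "insert b(insert c S')" and ?T = "pinch_param s b c"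
 define k where "k=KK ?S(Suc n)(?T \<rho>) \<nu>"
 have "eventually(%\<rho>'. k *(of_real(1-\<rho>'\<^sup>2)* RR ?S(?T \<rho>') \<nu>) = of_real(1-\<rho>'\<^sup>2)* TT ?S(Suc n)(?T \<rho>') \<nu>)(at_left 1)"
  using eventually_rho
 proof eventually_elim
  case(elim \<rho>')
  have b': "balanced ?S(Suc n) 0(?T \<rho>') \<nu>" by(rule bal)(use elim in auto)
  have "k=KK ?S(Suc n)(?T \<rho>') \<nu>"
   unfolding k_def by(rule KK_constant[OF bal[OF \<rho>] b']) simp
  then show ?case using RR_nonzero[OF b'] by(simp add: KK_def)
 qed
 from Lim_transform_eventually[OF tendsto_mult[OF tendsto_const RR_limit] this]
 have "k *(res0 * Bprod * RR S'(s 1) \<nu>) = of_nat(Suc n)*(4 * of_real pi * \<i>)* res0\<^sup>2 * Bprod/PQe^n * TT S' n(s 1) \<nu>"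
  using tendsto_unique[OF _ _ TT_limit] by(simp add: trivial_limit_at_left_real)
 then have "(res0 * Bprod)*(k * RR S'(s 1) \<nu>)=(res0 * Bprod)*(of_nat(Suc n)*(4 * of_real pi * \<i>)* res0/PQe^n * TT S' n(s 1) \<nu>)"
  by(simp add: power2_eq_square mult_ac)
 then have "k * RR S'(s 1) \<nu> = of_nat(Suc n)*(4 * of_real pi * \<i>)* res0/PQe^n * TT S' n(s 1) \<nu>"
  by(rule mult_left_cancel[THEN iffD1, rotated])(simp add: res0_nonzero Bprod_nonzero)
 then have "k = of_nat(Suc n)*(4 * of_real pi * \<i>)* res0/PQe^n * TT S' n(s 1) \<nu>/RR S'(s 1) \<nu>"
  by(rule eq_divide_imp[OF RR_nonzero[OF base]])
 then show ?thesis by(simp add: k_def KK_def)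
qed

end

text \<open>Each index occurs in N - 1 of the pairs.\<close>

lemma pair_prod_symmetric_factor:
 "pair_prod N(%j k. f j * f k)=(\<Prod>j\<in>{1..N}. f j^(N-1))" for f :: "nat => complex"
proof(induction N arbitrary: f)
 case 0
 then show ?case by(simp add: pair_prod_def)
next
 case(Suc N)
 have sh: "(\<Prod>j\<in>{1..Suc N}. g j)=g 1 *(\<Prod>j\<in>{1..N}. g(Suc j))" for g :: "nat => complex"
 proof -
  have "(\<Prod>j\<in>{2..Suc N}. g j)=(\<Prod>j\<in>{1..N}. g(Suc j))"
   by(rule prod.reindex_bij_witness[of _ Suc "%j. j-1"]) auto
  moreover have "{1..Suc N}=insert 1 {2..Suc N}" by auto
  ultimately show ?thesis by simp
 qed
 have "pair_prod(Suc N)(%j k. f j * f k)=(\<Prod>k\<in>{1..N}. f 1 * f(Suc k))*(\<Prod>j\<in>{1..N}. f(Suc j)^(N-1))"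
  unfolding pair_prod_Suc using Suc.IH[of "%j. f(Suc j)"] by simp
 also have "\<dots>=f 1^N *(\<Prod>j\<in>{1..N}. f(Suc j)* f(Suc j)^(N-1))"
  by(simp add: prod.distrib mult_ac)
 also have "(\<Prod>j\<in>{1..N}. f(Suc j)* f(Suc j)^(N-1))=(\<Prod>j\<in>{1..N}. f(Suc j)^N)"
 proof(rule prod.cong[OF refl])
  fix j assume "j\<in>{1..N}"
  then have "f(Suc j)^N=f(Suc j)^Suc(N-1)" by simp
  then show "f(Suc j)* f(Suc j)^(N-1)=f(Suc j)^N" by(simp only: power_Suc)
 qed
 finally show ?case unfolding sh by simp
qed

section \<open>Evaluation of the constant and translation to the stated integral\<close>

context rarefied
begin

text \<open>The solution of \<open>KK_recursion\<close> with initial value 1. Multiplied by PQe^(n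
  (n - 1)/2) it is the reciprocal of \<open>kappa\<close>.\<close>

definition KKv :: "nat => complex" where
 "KKv n=fact n *(4 * of_real pi * \<i> * res0)^n/PQe^(n *(n-1) div 2)"

text \<open>Without variables the integral is 1. The six pairs of four parameters fall into three
  complementary couples of product pq, and the reflection formula cancels each couple.\<close>

lemma KK_0:
 assumes bal: "balanced {1..4} 0 0 t \<nu>"
 shows "KK {1..4} 0 t \<nu>=1"
proof -
 obtain X Y where X: "generic(p^r) X Y" using generic_exists[OF pr] .
 obtain X' Y' where X': "generic(q^r) X' Y'" using generic_exists[OF qr] .
 have T: "TT {1..4} 0 t \<nu>=1" using TT_det[OF bal X X'] by(simp add: pmat_def det_def)
 have S: "{1..4}={1, 2, 3, 4::nat}" by auto
 have P: "t 1 * t 2 *(t 3 * t 4)=p * q" using bal unfolding balanced_def S by(simp add: mult.assoc)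
 have N: "\<nu> 1+\<nu> 2+\<nu> 3+\<nu> 4+2 * \<epsilon>=0" using bal unfolding balanced_def S by simp
 have t: "t a~=0" if "a\<in>{1..4}" for a using bal that by(simp add: balanced_def)
 define g where "g=(%a b. G(t a * t b)(\<nu> a+\<nu> b+\<epsilon>))"
 have pr1: "g a b * g c d=1"
  if "a\<in>{1..4}" "b\<in>{1..4}" "a~=b" "t a * t b *(t c * t d)=p * q" "\<nu> a+\<nu> b+\<nu> c+\<nu> d+2 * \<epsilon>=0" for a b c d
 proof -
  have "t c * t d=p * q/(t a * t b)" using that(4)[symmetric] t[OF that(1)] t[OF that(2)] by simp
  moreover have "\<nu> c+\<nu> d+\<epsilon> = - (\<nu> a+\<nu> b+\<epsilon>)" using that(5) by simp
  ultimately show ?thesis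
   using G_reflect_pq[OF norm_pair_gt[OF bal that(1-3)] norm_pair_less[OF bal that(1,2)], of "\<nu> a+\<nu> b+\<epsilon>"]
   unfolding g_def by(simp only:)
 qed
 have "RR {1..4} t \<nu>=g 1 2 * g 3 4 *(g 1 3 * g 2 4)*(g 1 4 * g 2 3)"
 proof -
  have sym: "g a b=g b a" for a b by(simp add: g_def mult.commute add_ac)
  have "RR {1..4} t \<nu>=pairp(insert 1(insert 2 {3, 4})) g" unfolding RR_def g_def S ..
  also have "\<dots>=g 1 2 *(\<Prod>c\<in>{3, 4}. g 1 c * g 2 c)* pairp {3, 4} g"
   by(rule pairp_insert2)(auto intro: sym)
  also have "pairp {3, 4} g=g 3 4"
  proof -
   have "pairp {4} g=1" unfolding pairp_def by(rule prod.neutral)(auto intro!: prod.neutral)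
   moreover have "pairp {3, 4} g=(\<Prod>c\<in>{4}. g 3 c)* pairp {4} g" by(rule pairp_insert)(auto intro: sym)
   ultimately show ?thesis by simp
  qed
  finally show ?thesis by(simp add: mult_ac)
 qed
 also have "g 1 2 * g 3 4=1" by(rule pr1)(use P N in \<open>auto simp: mult_ac\<close>)
 also have "g 1 3 * g 2 4=1" by(rule pr1)(use P N in \<open>auto simp: mult_ac\<close>)
 also have "g 1 4 * g 2 3=1" by(rule pr1)(use P N in \<open>auto simp: mult_ac\<close>)
 finally show ?thesis using T by(simp add: KK_def)
qed

lemma KK_value:
 assumes "balanced {1..2 * n+4} n 0 t \<nu>"
 shows "KK {1..2 * n+4} n t \<nu>=KKv n"
 using assms
proof(induction n arbitrary: t \<nu>)
 case 0
 then show ?case using KK_0 by(simp add: KKv_def)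
next
 case(Suc n)
 define S' where "S'={1..2 * n+4}"
 define b where "b=2 * n+5"
 define c where "c=2 * n+6"
 have S: "{1..2 * Suc n+4}=insert b(insert c S')" by(auto simp: S'_def b_def c_def)
 have fin: "finite S'" "card S'=2 * n+4" by(auto simp: S'_def)
 \<comment> \<open>All parameters of the smaller system are a common root of pq; one of them is
   divided by \<rho>^2 to compensate the product of the two pinching parameters.\<close>
 define e where "e=exp((lp+lq) / of_nat(2 * n+4))"
 have e0: "e~=0" by(simp add: e_def)
 have ep: "e^(2 * n+4)=p * q"
 proof -
  have nz: "(of_nat(2 * n+4) :: complex)~=0" by(metis of_nat_eq_0_iff add_eq_0_iff_both_eq_0 zero_neq_numeral)
  have "e^(2 * n+4)=exp(of_nat(2 * n+4)*((lp+lq) / of_nat(2 * n+4)))" unfolding e_def exp_of_nat_mult ..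
  also have "of_nat(2 * n+4)*((lp+lq) / of_nat(2 * n+4))=lp+lq" unfolding times_divide_eq_right by(rule nonzero_mult_div_cancel_left[OF nz])
  finally show ?thesis by(simp add: exp_add lp lq)
 qed
 have e1: "norm e<1"
 proof(rule ccontr)
  assume "\<not> norm e<1"
  then have "1\<le>norm e^(2 * n+4)" by(intro one_le_power) simp
  then show False using ep pq(1) by(metis norm_power linorder_not_less)
 qed
 \<comment> \<open>The bound |e| < \<rho>0^2 keeps the adjusted parameter e/\<rho>^2 in the unit
   disc for all \<rho> \<ge> \<rho>0.\<close>
 obtain \<rho>0 where \<rho>0: "0<\<rho>0" "\<rho>0<1" "norm e<\<rho>0^2" using exists_power_gt[OF e1] .
 define s where "s=(%\<rho> (a::nat). if a=1 then e / of_real(\<rho>\<^sup>2) else e)"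
 define \<mu> where "\<mu>=(%a::nat. if a=1 then-(int n+2)* \<epsilon> else if a=c then-\<epsilon> else 0)"
 have in1: "1\<in>S'" by(simp add: S'_def)
 have bc: "b \<notin> S'" "c \<notin> S'" "b~=c" "b~=1" "c~=1" by(auto simp: S'_def b_def c_def)
 have ps: "(\<Prod>a\<in>S'. s \<rho> a)=p * q / of_real(\<rho>\<^sup>2)" for \<rho>
 proof -
  have "(\<Prod>a\<in>S'. s \<rho> a)=s \<rho> 1 *(\<Prod>a\<in>S'-{1}. e)"
   unfolding prod.remove[OF fin(1) in1] by(simp add: s_def)
  also have "\<dots>=e * e^(2 * n+3) / of_real(\<rho>\<^sup>2)"
  proof -
   have "card(S'-{1})=2 * n+3" using fin in1 by simp
   then have "(\<Prod>a\<in>S'-{1}. e)=e^(2 * n+3)" by(simp only: prod_constant)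
   then show ?thesis by(simp only: s_def simp_thms if_True times_divide_eq_left)
  qed
  also have "e * e^(2 * n+3)=e^(2 * n+4)"
  proof -
   have "2 * n+4=Suc(2 * n+3)" by simp
   then show ?thesis by(simp only: power_Suc)
  qed
  finally show ?thesis unfolding ep .
 qed
 have s\<mu>: "(\<Sum>a\<in>S'. 2 * \<mu> a+\<epsilon>)=0"
 proof -
  have "(\<Sum>a\<in>S'. \<mu> a)=\<mu> 1+(\<Sum>a\<in>S'-{1}. 0)"
   unfolding sum.remove[OF fin(1) in1] using bc by(intro arg_cong2[of _ _ _ _ "(+)"] sum.cong refl)(auto simp: \<mu>_def)
  then have m: "(\<Sum>a\<in>S'. \<mu> a) = - (int n+2)* \<epsilon>" by(simp add: \<mu>_def)
  have "(\<Sum>a\<in>S'. 2 * \<mu> a+\<epsilon>)=2 *(\<Sum>a\<in>S'. \<mu> a)+int(2 * n+4)* \<epsilon>"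
   by(simp add: sum.distrib sum_distrib_left[symmetric] fin)
  also have "\<dots>=0" unfolding m by(simp add: algebra_simps)
  finally show ?thesis .
 qed
 have sd: "s \<rho> a~=0\<and>norm(s \<rho> a)<1" if "\<rho>0\<le>\<rho>" "\<rho>\<le>1" for \<rho> a
 proof -
  have "\<rho>0\<^sup>2\<le>\<rho>\<^sup>2" using that \<rho>0 by(intro power_mono) auto
  then have "norm e<\<rho>\<^sup>2" using \<rho>0(3) by linarith
  moreover have "\<rho>\<^sup>2 > 0" using that \<rho>0 by simp
  ultimately have "norm(e / of_real(\<rho>\<^sup>2))<1" unfolding norm_divide norm_of_real by(simp add: divide_less_eq)
  then show ?thesis using e0 e1 that \<rho>0 by(auto simp: s_def)
 qed
 have base: "balanced S' n 0(s 1) \<mu>"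
  unfolding balanced_def using fin ps[of 1] s\<mu> sd[of 1] \<rho>0 by auto
 have big: "balanced(insert b(insert c S'))(Suc n) 0(pinch_param s b c \<rho>) \<mu>" if \<rho>: "\<rho>0\<le>\<rho>" "\<rho><1" for \<rho>
 proof -
  have \<rho>p: "\<rho> > 0" using \<rho> \<rho>0 by linarith
  have "(\<Prod>a\<in>S'. pinch_param s b c \<rho> a)=(\<Prod>a\<in>S'. s \<rho> a)"
   by(rule prod.cong)(use bc in \<open>auto simp: pinch_param_def\<close>)
  then have "(\<Prod>a\<in>insert b(insert c S'). pinch_param s b c \<rho> a)=(- \<i> * of_real \<rho>)*((\<i> * of_real \<rho>)*(p * q / of_real(\<rho>\<^sup>2)))"
   using fin bc by(simp add: pinch_param_def ps)
  also have "\<dots>=p * q" using \<rho>p by(simp add: power2_eq_square field_simps)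
  finally have P: "(\<Prod>a\<in>insert b(insert c S'). pinch_param s b c \<rho> a)=p * q" .
  have "(\<Sum>a\<in>insert b(insert c S'). 2 * \<mu> a+\<epsilon>)=(2 * \<mu> b+\<epsilon>)+((2 * \<mu> c+\<epsilon>)+(\<Sum>a\<in>S'. 2 * \<mu> a+\<epsilon>))"
   using fin bc by simp
  also have "\<dots>=0" unfolding s\<mu> using bc by(simp add: \<mu>_def)
  finally have Q: "(\<Sum>a\<in>insert b(insert c S'). 2 * \<mu> a+\<epsilon>)=0" .
  have "pinch_param s b c \<rho> a~=0\<and>norm(pinch_param s b c \<rho> a)<1" for a
   using sd[of \<rho> a] \<rho> \<rho>p by(auto simp: pinch_param_def norm_mult)
  then show ?thesis unfolding balanced_def using P Q fin bc by simp
 qed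
 obtain hh where hh: "\<And>m. hh m holomorphic_on regdom"
  "\<And>m z. z\<in>regdom==>z~=1==>G z m=hh m z/(1-z)" "hh 0 1=res0" "\<And>m. \<not> int r dvd m==>hh m 1=0"
  using G_regularize by blast
 have cs: "continuous_on {\<rho>0..1} (%\<rho>. s \<rho> a)" for a
  unfolding s_def using \<rho>0 by(cases "a=1")(auto intro!: continuous_intros)
 interpret P: pinching r p q lp lq \<epsilon> S' n b c s \<mu> \<rho>0 hh
 proof unfold_locales
  show "\<mu> b=0" "\<mu> c = - \<epsilon>" using bc by(auto simp: \<mu>_def)
 qed(use fin bc \<rho>0 cs sd base big hh in auto)
 have "KK {1..2 * Suc n+4} (Suc n) t \<nu>=KK(insert b(insert c S'))(Suc n)(pinch_param s b c \<rho>0) \<mu>"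
  unfolding S by(rule KK_constant)(use Suc.prems[unfolded S] big[of \<rho>0] \<rho>0 in auto)
 also have "\<dots> = of_nat(Suc n)*(4 * of_real pi * \<i>)* res0/PQe^n * KK S' n(s 1) \<mu>"
  by(rule P.KK_recursion)(use \<rho>0 in auto)
 also have "KK S' n(s 1) \<mu>=KKv n" unfolding S'_def by(rule Suc.IH)(use base in \<open>simp add: S'_def\<close>)
 also have "of_nat(Suc n)*(4 * of_real pi * \<i>)* res0/PQe^n * KKv n=KKv(Suc n)"
  unfolding KKv_def theta_exponent by(simp add: power_add divide_inverse mult_ac)
 finally show ?case .
qed

text \<open>Two inversion formulas, for z w and for z/w. Products and quotients of the variables
  \<open>zp\<close> and \<open>zq\<close> are exactly the theta arguments that arise. Because of the
  value 0 at poles the identity holds on the whole torus.\<close>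

lemma inverse_pm4:
 assumes z: "norm z=1" and w: "norm w=1"
 shows "1/rar_gamma_pm4 r p q z w(2 * m+\<epsilon>)(2 * k+\<epsilon>)=(p * q) powi EE m *(p * q) powi EE k * PQe
   *(theta_prod(p^r)(zp z m)(zp w k)* theta_prod(q^r)(zq z m)(zq w k))"
proof -
 have z0: "z~=0" "w~=0" using z w by auto
 define K where "K=m+k+\<epsilon>"
 define L where "L=m-k"
 have d: "(2 * m+\<epsilon>+(2 * k+\<epsilon>)) div 2=K" "(2 * m+\<epsilon>-(2 * k+\<epsilon>)) div 2=L"
  "(- (2 * m+\<epsilon>)+(2 * k+\<epsilon>)) div 2 = - L" "(- (2 * m+\<epsilon>)-(2 * k+\<epsilon>)) div 2 = - K"
  unfolding K_def L_def by presburger+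
 have "rar_gamma_pm4 r p q z w(2 * m+\<epsilon>)(2 * k+\<epsilon>)
   = G(z * w) K * G(z/w) L *(G(w/z)(- L)* G(1/(z * w))(- K))"
 proof -
  have "(1 * A+1 * A') div 2=(A+A') div 2" "(1 * A + - 1 * A') div 2=(A-A') div 2"
   "(- 1 * A+1 * A') div 2=(- A+A') div 2" "(- 1 * A + - 1 * A') div 2=(- A-A') div 2" for A A' :: int by simp_all
  note e=this[of "2 * m+\<epsilon>" "2 * k+\<epsilon>", unfolded d]
  have f: "(\<Prod>\<sigma>\<in>{1, -1::int}. h \<sigma>)=h 1 * h(- 1)" for h :: "int => complex" by simp
  have pw: "z powi 1 * w powi 1=z * w" "z powi 1 * w powi(- 1)=z/w" "z powi(- 1)* w powi 1=w/z" "z powi(- 1)* w powi(- 1)=1/(z * w)"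
   using z0 by(simp_all add: power_int_minus field_simps)
  show ?thesis unfolding rar_gamma_pm4_def f e pw ..
 qed
 then have "1/rar_gamma_pm4 r p q z w(2 * m+\<epsilon>)(2 * k+\<epsilon>)
   = 1/(G(z * w) K * G(1/(z * w))(- K))*(1/(G(z/w) L * G(1/(z/w))(- L)))"
  by simp
 also have "\<dots>=circle_factor(z * w) K * circle_factor(z/w) L"
  using G_inverse_circle[of "z * w" K] G_inverse_circle[of "z/w" L] z w
  by(simp only: circle_factor_def norm_mult norm_divide)
 finally have A: "1/rar_gamma_pm4 r p q z w(2 * m+\<epsilon>)(2 * k+\<epsilon>)=circle_factor(z * w) K * circle_factor(z/w) L" .
 have ex: "K *(K-1) div 2+L *(L-1) div 2=EE m+EE k-m" (is "?x + ?y = _")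
 proof -
  have h1: "2 * ?x=K *(K-1)" by(rule dvd_mult_div_cancel[OF dvd_2_consecutive])
  have h2: "2 * ?y=L *(L-1)" by(rule dvd_mult_div_cancel[OF dvd_2_consecutive])
  have "K *(K-1)+L *(L-1)=2 *(EE m+EE k-m)+(\<epsilon> * \<epsilon>-\<epsilon>)" by(simp add: EE_def K_def L_def algebra_simps)
  then have "2 *(?x + ?y)=2 *(EE m+EE k-m)" unfolding distrib_left h1 h2 eps_sq by(simp only: diff_self add_0_right)
  moreover have "2 * u=2 * v==>u=v" for u v :: int by simp
  ultimately show ?thesis by blast
 qed
 have x: "exp(of_int(2 * m+\<epsilon>)* l/2)* exp(of_int(2 * k+\<epsilon>)* l/2)=exp l powi K"
  "exp(of_int(2 * m+\<epsilon>)* l/2)/exp(of_int(2 * k+\<epsilon>)* l/2)=exp l powi L" for l :: complex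
  unfolding powi_exp exp_add[symmetric] exp_diff[symmetric] K_def L_def
  by(rule arg_cong[of _ _ exp], simp add: field_simps)+
 have f1: "zp z m * zp w k=z * w * p powi K"
 proof -
  have "zp z m * zp w k=z * w *(exp(of_int(2 * m+\<epsilon>)* lp/2)* exp(of_int(2 * k+\<epsilon>)* lp/2))"
   unfolding zp_def by(simp only: mult_ac)
  then show ?thesis unfolding x(1) lp[symmetric] .
 qed
 have f2: "zp z m/zp w k=z/w * p powi L"
 proof -
  have "zp z m/zp w k=z/w *(exp(of_int(2 * m+\<epsilon>)* lp/2)/exp(of_int(2 * k+\<epsilon>)* lp/2))"
   unfolding zp_def by(simp only: times_divide_times_eq)
  then show ?thesis unfolding x(2) lp[symmetric] .
 qed
 have f3: "zq z m * zq w k=q powi K/(z * w)"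
 proof -
  have "zq z m * zq w k=(exp(of_int(2 * m+\<epsilon>)* lq/2)* exp(of_int(2 * k+\<epsilon>)* lq/2))/(z * w)"
   unfolding zq_def by(simp only: times_divide_times_eq)
  then show ?thesis unfolding x(1) lq[symmetric] .
 qed
 have f4: "zq z m/zq w k=q powi L/(z/w)"
 proof -
  have "zq z m/zq w k=(exp(of_int(2 * m+\<epsilon>)* lq/2)/exp(of_int(2 * k+\<epsilon>)* lq/2))/(z/w)"
  proof -
   have "A/z/(A'/w)=A/A'/(z/w)" for A A' using z0 by(simp add: field_simps)
   then show ?thesis unfolding zq_def .
  qed
  then show ?thesis unfolding x(2) lq[symmetric] .
 qed
 define J where "J=jtheta(z * w * p powi K)(p^r)* jtheta(z/w * p powi L)(p^r)*(jtheta(q powi K/(z * w))(q^r)* jtheta(q powi L/(z/w))(q^r))"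
 have c: "circle_factor(z * w) K * circle_factor(z/w) L=(p * q) powi(EE m+EE k-m)* J"
  unfolding circle_factor_def ex[symmetric] power_int_add[OF disjI1[OF pq(2)]] J_def by(simp only: mult_ac)
 have th: "theta_prod(p^r)(zp z m)(zp w k)* theta_prod(q^r)(zq z m)(zq w k)=J/(zp z m * zq z m)"
  unfolding theta_prod_def f1 f2 f3 f4 J_def by(simp only: times_divide_times_eq)
 have nz: "(p * q) powi m~=0" "PQe~=0" using pq by(auto simp: PQe_def)
 have e: "(p * q) powi EE m *(p * q) powi EE k=(p * q) powi(EE m+EE k-m)*(p * q) powi m"
  unfolding power_int_add[OF disjI1[OF pq(2)], symmetric] by simp
 have "x * J=x * a * b *(J/(a * b))" if "a~=0" "b~=0" for x a b :: complex using that by simp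
 then show ?thesis unfolding A c th zp_zq_mult[OF z0(1)] e using nz by blast
qed

lemma inverse_pm2:
 assumes z: "norm z=1"
 shows "1/rar_gamma_pm2 r p q z(2 * m+\<epsilon>)=(p * q) powi(2 * EE m-m)*(jtheta((zp z m)\<^sup>2)(p^r)* jtheta((zq z m)\<^sup>2)(q^r))"
proof -
 have z0: "z~=0" using z by auto
 define M where "M=2 * m+\<epsilon>"
 have e: "z powi(2 * 1)=z\<^sup>2" "z powi(2 * - 1)=1/z\<^sup>2" by(simp_all add: power_int_minus divide_inverse)
 have f: "(\<Prod>\<sigma>\<in>{1, -1::int}. h \<sigma>)=h 1 * h(- 1)" for h :: "int => complex" by simp
 have "rar_gamma_pm2 r p q z M=G(z\<^sup>2) M * G(1/z\<^sup>2)(- M)"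
  unfolding rar_gamma_pm2_def f e by simp
 then have A: "1/rar_gamma_pm2 r p q z M=(p * q) powi(M *(M-1) div 2)*(jtheta(z\<^sup>2 * p powi M)(p^r)* jtheta(q powi M/z\<^sup>2)(q^r))"
  using G_inverse_circle[of "z\<^sup>2" M] z by(simp add: norm_power)
 have ex: "M *(M-1) div 2=2 * EE m-m"
 proof -
  have h: "2 *(M *(M-1) div 2)=M *(M-1)" by(rule dvd_mult_div_cancel[OF dvd_2_consecutive])
  have "M *(M-1)=2 *(2 * EE m-m)+(\<epsilon> * \<epsilon>-\<epsilon>)" by(simp add: EE_def M_def algebra_simps)
  then have "2 *(M *(M-1) div 2)=2 *(2 * EE m-m)" unfolding h eps_sq by(simp only: diff_self add_0_right)
  moreover have "2 * u=2 * v==>u=v" for u v :: int by simp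
  ultimately show ?thesis by blast
 qed
 have x: "exp(of_int(2 * m+\<epsilon>)* l/2)* exp(of_int(2 * m+\<epsilon>)* l/2)=exp l powi M" for l :: complex
  unfolding powi_exp exp_add[symmetric] M_def by(rule arg_cong[of _ _ exp], simp add: field_simps)
 have f1: "(zp z m)\<^sup>2=z\<^sup>2 * p powi M"
  unfolding lp x[symmetric] by(simp only: zp_def power2_eq_square mult_ac)
 have f2: "(zq z m)\<^sup>2=q powi M/z\<^sup>2"
  unfolding lq x[symmetric] by(simp only: zq_def power2_eq_square times_divide_times_eq)
 show ?thesis unfolding M_def[symmetric] A ex f1 f2 ..
qed

text \<open>Counting powers of pq: the n - 1 pairs containing a variable contribute (n - 1) EE m,
  and the factor in z^2 contributes 2 EE m - m. The sum is the exponent in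
  \<open>core\<close>.\<close>

lemma Delta_I_eq:
 assumes n: "n > 0" and z: "\<And>j. norm(z j)=1"
 shows "Delta_I r n p q \<epsilon> t \<nu> z m *(\<Prod>j\<in>{1..n}. 1/z j)=PQe^(n *(n-1) div 2)* TT_integrand {1..2 * n+4} n t \<nu> m z"
proof -
 define Th where "Th=(%j k. theta_prod(p^r)(zp(z j)(m j))(zp(z k)(m k))* theta_prod(q^r)(zq(z j)(m j))(zq(z k)(m k)))"
 define h where "h=(%j. (p * q) powi EE(m j))"
 define Bp where "Bp=(%j. \<Prod>a\<in>{1..2 * n+4}. B(t a)(\<nu> a)(z j)(m j))"
 define J where "J=(%j. jtheta((zp(z j)(m j))\<^sup>2)(p^r)* jtheta((zq(z j)(m j))\<^sup>2)(q^r))"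
 have "(\<Prod>j\<in>{1..n}. \<Prod>k\<in>{j<..n}. 1/rar_gamma_pm4 r p q(z j)(z k)(2 * m j+\<epsilon>)(2 * m k+\<epsilon>))
   = pair_prod n(%j k. h j * h k * PQe * Th j k)"
  unfolding pair_prod_def h_def Th_def by(intro prod.cong refl inverse_pm4 z)
 also have "\<dots>=(\<Prod>j\<in>{1..n}. h j^(n-1))* PQe^(n *(n-1) div 2)* pair_prod n Th"
  unfolding pair_prod_mult[of n "%j k. h j * h k * PQe"] pair_prod_mult[of n "%j k. h j * h k"] pair_prod_const pair_prod_symmetric_factor ..
 finally have P: "(\<Prod>j\<in>{1..n}. \<Prod>k\<in>{j<..n}. 1/rar_gamma_pm4 r p q(z j)(z k)(2 * m j+\<epsilon>)(2 * m k+\<epsilon>))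
   = (\<Prod>j\<in>{1..n}. h j^(n-1))* PQe^(n *(n-1) div 2)* pair_prod n Th" .
 have Q: "(\<Prod>a\<in>{1..2*n+4}. rar_gamma r p q(t a * z j)(\<nu> a+m j+\<epsilon>)* rar_gamma r p q(t a * inverse(z j))(\<nu> a-m j))
    / rar_gamma_pm2 r p q(z j)(2 * m j+\<epsilon>)=Bp j *((p * q) powi(2 * EE(m j)-m j)* J j)" for j
 proof -
  have b: "(\<Prod>a\<in>{1..2*n+4}. rar_gamma r p q(t a * z j)(\<nu> a+m j+\<epsilon>)* rar_gamma r p q(t a * inverse(z j))(\<nu> a-m j))=Bp j"
   unfolding Bp_def B_def divide_inverse ..
  have "x/y=x *(1/y)" for x y :: complex by simp
  then show ?thesis unfolding J_def inverse_pm2[OF z, symmetric] b by blast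
 qed
 have W: "h j^(n-1)*(Bp j *((p * q) powi(2 * EE(m j)-m j)* J j))=weight {1..2 * n+4} n t \<nu> (z j)(m j)" for j
 proof -
  have "h j^(n-1)=(p * q) powi(int(n-1)* EE(m j))"
   unfolding h_def by(simp only: mult.commute[of "int(n-1)"] power_int_mult power_int_of_nat)
  then have "h j^(n-1)*(p * q) powi(2 * EE(m j)-m j)=(p * q) powi(int(n-1)* EE(m j)+(2 * EE(m j)-m j))"
   by(simp only: power_int_add[OF disjI1[OF pq(2)]])
  also have "int(n-1)* EE(m j)+(2 * EE(m j)-m j)=int(n+1)* EE(m j)-m j"
   using n by(simp add: of_nat_diff algebra_simps)
  finally have e: "h j^(n-1)*(p * q) powi(2 * EE(m j)-m j)=(p * q) powi(int(n+1)* EE(m j)-m j)" .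
  show ?thesis unfolding weight_def core_def e[symmetric] J_def Bp_def by(simp only: power_0 mult_1_right mult_1_left mult_ac)
 qed
 have "Delta_I r n p q \<epsilon> t \<nu> z m *(\<Prod>j\<in>{1..n}. 1/z j)
  = PQe^(n *(n-1) div 2)*(pair_prod n Th *(\<Prod>j\<in>{1..n}. h j^(n-1)*(Bp j *((p * q) powi(2 * EE(m j)-m j)* J j))*(1/z j)))"
  unfolding Delta_I_def P Q unfolding prod.distrib by(simp only: mult_ac)
 also have "\<dots>=PQe^(n *(n-1) div 2)* TT_integrand {1..2 * n+4} n t \<nu> m z"
  unfolding W TT_integrand_def Th_def by simp
 finally show ?thesis .
qed

lemma rarefied_selberg:
 assumes n: "n > 0" and bal: "balanced {1..2 * n+4} n 0 t \<nu>"
 shows "kappa r n p q *(\<Sum>m\<in>{1..n} \<rightarrow>\<^sub>E {0..int r-1}.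
     torus_integral n(%z. Delta_I r n p q \<epsilon> t \<nu> z m *(\<Prod>j\<in>{1..n}. 1/z j)))
  = (\<Prod>a\<in>{1..2*n+4}. \<Prod>b\<in>{a<..2*n+4}. G(t a * t b)(\<nu> a+\<nu> b+\<epsilon>))"
proof -
 define E where "E=PQe^(n *(n-1) div 2)"
 have I: "{0..int r-1}={0..<int r}" by auto
 have "(\<Sum>m\<in>{1..n} \<rightarrow>\<^sub>E {0..int r-1}. torus_integral n(%z. Delta_I r n p q \<epsilon> t \<nu> z m *(\<Prod>j\<in>{1..n}. 1/z j)))
   = E * TT {1..2 * n+4} n t \<nu>"
  unfolding TT_def I sum_distrib_left torus_integral_cmult[symmetric] E_def
  by(intro sum.cong refl torus_integral_cong Delta_I_eq[OF n])
 also have "TT {1..2 * n+4} n t \<nu>=KKv n * RR {1..2 * n+4} t \<nu>"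
  using KK_value[OF bal] RR_nonzero[OF bal] by(simp add: KK_def field_simps)
 also have "RR {1..2 * n+4} t \<nu>=(\<Prod>a\<in>{1..2*n+4}. \<Prod>b\<in>{a<..2*n+4}. G(t a * t b)(\<nu> a+\<nu> b+\<epsilon>))"
  unfolding RR_def pairp_def by(intro prod.cong refl) auto
 finally have S: "(\<Sum>m\<in>{1..n} \<rightarrow>\<^sub>E {0..int r-1}. torus_integral n(%z. Delta_I r n p q \<epsilon> t \<nu> z m *(\<Prod>j\<in>{1..n}. 1/z j)))
   = E *(KKv n *(\<Prod>a\<in>{1..2*n+4}. \<Prod>b\<in>{a<..2*n+4}. G(t a * t b)(\<nu> a+\<nu> b+\<epsilon>)))" .
 have E0: "E~=0" by(simp add: E_def PQe_def)
 have "kappa r n p q=1/((4 * of_real pi * \<i> * res0)^n * fact n)"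
  unfolding kappa_def res0_def by(simp add: power_mult_distrib power_divide field_simps)
 then have "kappa r n p q *(E * KKv n)=1"
  using E0 res0_nonzero unfolding KKv_def E_def[symmetric] by simp
 then have "kappa r n p q *(E *(KKv n * R))=R" for R by(metis mult.assoc mult_1_left)
 then show ?thesis unfolding S .
qed

end

theorem theorem3:
  fixes r n :: nat and t :: "nat \<Rightarrow> complex" and \<nu> :: "nat \<Rightarrow> int"
    and \<epsilon> :: int and p q :: complex
  assumes "r > 0" and "n > 0"
    and "\<And>a. a \<in> {1..2*n+4} \<Longrightarrow> t a \<noteq> 0"
    and "\<And>a. a \<in> {1..2*n+4} \<Longrightarrow> norm (t a) < 1"
    and "\<epsilon> \<in> {0, 1}"
    and "norm p < 1" and "norm q < 1"
    and "(\<Prod>a\<in>{1..2*n+4}. t a) = p * q"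
    and "(\<Sum>a\<in>{1..2*n+4}. \<nu> a) + (int n + 2) * \<epsilon> = 0"
  shows "kappa r n p q *
      (\<Sum>m\<in>{1..n} \<rightarrow>\<^sub>E {0..int r - 1}.
         torus_integral n (\<lambda>z. Delta_I r n p q \<epsilon> t \<nu> z m * (\<Prod>j\<in>{1..n}. 1 / z j)))
    = (\<Prod>a\<in>{1..2*n+4}. \<Prod>b\<in>{a<..2*n+4}.
         rar_gamma r p q (t a * t b) (\<nu> a + \<nu> b + \<epsilon>))"
proof -
 \<comment> \<open>Since no parameter vanishes, the product condition excludes p = 0 and q = 0, and
   logarithms of both exist.\<close>
 have "p * q~=0" unfolding assms(8)[symmetric] using assms(3) by(simp only: prod_zero_iff finite_atLeastAtMost) blast
 then have pq0: "p~=0" "q~=0" by auto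
 interpret rarefied r p q "Ln p" "Ln q" \<epsilon>
  by unfold_locales(use assms pq0 in auto)
 have "(\<Sum>a\<in>{1..2*n+4}. 2 * \<nu> a+\<epsilon>)=2 *(\<Sum>a\<in>{1..2*n+4}. \<nu> a)+int(2 * n+4)* \<epsilon>"
  unfolding sum.distrib sum_distrib_left by simp
 also have "\<dots>=2 *((\<Sum>a\<in>{1..2*n+4}. \<nu> a)+(int n+2)* \<epsilon>)" by(simp add: algebra_simps)
 finally have "(\<Sum>a\<in>{1..2*n+4}. 2 * \<nu> a+\<epsilon>)=0" unfolding assms(9) by simp
 then have "balanced {1..2 * n+4} n 0 t \<nu>"
  unfolding balanced_def using assms(3,4,8) by simp
 then show ?thesis by(rule rarefied_selberg[OF assms(2)])
qed

end
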